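(* Let $p$ be an odd prime and let $S\in\gimel_p$ be in case $\kappa_4$. Then $\mathrm{Aut}(S)'\simeq D_p$. There are no hyperelliptic surfaces in case $\kappa_4$.
   Context: $D_m$ is the dihedral group of order $2m$. $p$ is an odd prime and $\Delta=\{z\in\mathbb{C}:|z|<1\}$. $\gimel_p$ is the set of compact Riemann surfaces $S$ having an automorphism $T_S$ of order $p$ with $S/\langle T_S\rangle\simeq\mathbb{P}^1$ and $|\mathrm{Fix}(T_S)|=4$ (genus $p-1$). $\mathrm{Aut}(S)'=\{f\in\mathrm{Aut}(S): f(\mathrm{Fix}(T_S))=\mathrm{Fix}(T_S)\}$. For $S\in\gimel_p$ there is a Fuchsian group $\Gamma$ of signature $(0;p,p,p,p)$ and a normal subgroup $\Gamma^*$ acting freely on $\Delta$ with $\Delta/\Gamma^*\simeq S$ and $\Gamma/\Gamma^*\simeq\mathbb{Z}/p\mathbb{Z}$ corresponding to $\langle T_S\rangle$. Tilings. For $\alpha,\beta,\gamma>0$ with $\alpha+\beta+\gamma=2\pi/p$, $\Delta(\alpha,\beta,\gamma)$ denotes the tiling of $\Delta$ by copies of a hyperbolic triangle with interior angles $\alpha,\beta,\gamma$ in counterclockwise order, obtained by repeatedly applying half-turns about midpoints of edges; cyclic permutations of the triple give the same tiling. It is a tiling for $\Gamma$ if $\Gamma$ is generated by the rotations through $2\pi/p$ about the vertices of a tile. The canonical tiling of $S$ is the tiling for $\Gamma$ with $0<\alpha\le\pi/p$, $0<\beta,\gamma<\pi/p$ (written $\Delta(\pi/p,\beta,\gamma)$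 with $\beta\ge\gamma$ if an angle equals $\pi/p$). The pair $(i,j)$. Choose a tile of the canonical tiling with vertices $A',B',C'$ in counterclockwise order with angles $\alpha,\beta,\gamma$, and let $x,y,z\in\Gamma$ be the counterclockwise rotations through $2\pi/p$ about $A',B',C'$. Then $y\equiv x^i$, $z\equiv x^j$ modulo $\Gamma^*$ with $i,j\in\{1,\dots,p-1\}$, $p\nmid i+j+1$. With $k=-(i+j+1)$ in $\mathbb{Z}/p\mathbb{Z}$, let ${}^{e}\Lambda^p_{(i,j)}=\{(i,j),(j,k),(k,i),(i^{-1}j,i^{-1}),(i^{-1},i^{-1}k),(i^{-1}k,i^{-1}j),(j^{-1},ij^{-1}),(ij^{-1},j^{-1}k),(j^{-1}k,j^{-1}),(jk^{-1},ik^{-1}),(ik^{-1},k^{-1}),(k^{-1},jk^{-1})\}$. Case $\kappa_4$: $S$ is in $\kappa_4$ if ${}^{e}\Lambda^p_{(i,j)}$ contains a pair (modulo $p$) of the form $(-1,m)$ with $m\in\{2,3,\dots,p-2\}$ and $p\nmid m^2+1$. *)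

theory Defs
  imports
    "HOL-Algebra.Bij"
    "HOL-Algebra.Coset"
    "HOL-Algebra.Multiplicative_Group"
    "HOL-Number_Theory.Modular_Inverse"
    "HOL-Complex_Analysis.Riemann_Mapping"
begin

section \<open>Riemann surfaces\<close>

text \<open>
  A surface is an abstract topology together with a set of charts \<open>(U, \<phi>)\<close>. The record carries
  no axioms; these are imposed by \<open>riemann_surface\<close>.
\<close>

record 'a surface =
  surf_top :: "'a topology"
  atlas :: "('a set \<times> ('a \<Rightarrow> complex)) set"

abbreviation points :: "'a surface \<Rightarrow> 'a set" where
  "points S \<equiv> topspace (surf_top S)"

definition complex_chart :: "'a topology \<Rightarrow> 'a set \<Rightarrow> ('a \<Rightarrow> complex) \<Rightarrow> bool" where
  "complex_chart X U \<phi> \<longleftrightarrow>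
     openin X U \<and> open (\<phi> ` U) \<and>
     homeomorphic_map (subtopology X U) (top_of_set (\<phi> ` U)) \<phi>"

definition riemann_surface :: "'a surface \<Rightarrow> bool" where
  "riemann_surface S \<longleftrightarrow>
     points S \<noteq> {} \<and> connected_space (surf_top S) \<and>
     Hausdorff_space (surf_top S) \<and> second_countable (surf_top S) \<and>
     (\<forall>(U, \<phi>) \<in> atlas S. complex_chart (surf_top S) U \<phi>) \<and>
     (\<Union>(U, \<phi>) \<in> atlas S. U) = points S \<and>
     (\<forall>(U, \<phi>) \<in> atlas S. \<forall>(V, \<psi>) \<in> atlas S.
        (\<psi> \<circ> inv_into U \<phi>) holomorphic_on \<phi> ` (U \<inter> V))"

definition compact_riemann_surface :: "'a surface \<Rightarrow> bool" where
  "compact_riemann_surface S \<longleftrightarrow> riemann_surface S \<and> compact_space (surf_top S)"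

definition holomorphic_map :: "'a surface \<Rightarrow> 'b surface \<Rightarrow> ('a \<Rightarrow> 'b) \<Rightarrow> bool" where
  "holomorphic_map S R f \<longleftrightarrow>
     continuous_map (surf_top S) (surf_top R) f \<and>
     (\<forall>(U, \<phi>) \<in> atlas S. \<forall>(V, \<psi>) \<in> atlas R.
        (\<psi> \<circ> f \<circ> inv_into U \<phi>) holomorphic_on \<phi> ` {x \<in> U. f x \<in> V})"

definition biholomorphic_map :: "'a surface \<Rightarrow> 'b surface \<Rightarrow> ('a \<Rightarrow> 'b) \<Rightarrow> bool" where
  "biholomorphic_map S R f \<longleftrightarrow>
     bij_betw f (points S) (points R) \<and> holomorphic_map S R f \<and>
     holomorphic_map R S (inv_into (points S) f)"

definition biholomorphic :: "'a surface \<Rightarrow> 'b surface \<Rightarrow> bool" where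
  "biholomorphic S R \<longleftrightarrow> (\<exists>f. biholomorphic_map S R f)"

text \<open>Automorphisms are extensional functions, as in \<open>BijGroup\<close>; the product is composition.\<close>

definition Aut :: "'a surface \<Rightarrow> ('a \<Rightarrow> 'a) monoid" where
  "Aut S = (BijGroup (points S))\<lparr>carrier := {f \<in> Bij (points S). biholomorphic_map S S f}\<rparr>"

definition Fix :: "'a surface \<Rightarrow> ('a \<Rightarrow> 'a) \<Rightarrow> 'a set" where
  "Fix S f = {x \<in> points S. f x = x}"

definition riemann_sphere :: "complex option surface" where
  "riemann_sphere =
     \<lparr>surf_top = Alexandroff_compactification euclidean,
      atlas = {(range Some, the), (UNIV - {Some 0}, case_option 0 inverse)}\<rparr>"

definition disc_surface :: "complex surface" where
  "disc_surface = \<lparr>surf_top = top_of_set (ball 0 1), atlas = {(ball 0 1, \<lambda>z. z)}\<rparr>"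


section \<open>Quotients of surfaces by groups of automorphisms\<close>

definition orb :: "('a \<Rightarrow> 'a) set \<Rightarrow> 'a \<Rightarrow> 'a set" where
  "orb G x = (\<lambda>g. g x) ` G"

definition quotient_topology :: "'a topology \<Rightarrow> ('a \<Rightarrow> 'b) \<Rightarrow> 'b topology" where
  "quotient_topology X q =
     topology (\<lambda>V. V \<subseteq> q ` topspace X \<and> openin X {x \<in> topspace X. q x \<in> V})"

lemma openin_quotient_topology:
  "openin (quotient_topology X q) V \<longleftrightarrow>
     V \<subseteq> q ` topspace X \<and> openin X {x \<in> topspace X. q x \<in> V}"
proof -
  have "istopology (\<lambda>V. V \<subseteq> q ` topspace X \<and> openin X {x \<in> topspace X. q x \<in> V})"
    unfolding istopology_def
  proof (rule conjI; intro allI impI conjI)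
    fix U V
    assume U: "U \<subseteq> q ` topspace X \<and> openin X {x \<in> topspace X. q x \<in> U}"
      and V: "V \<subseteq> q ` topspace X \<and> openin X {x \<in> topspace X. q x \<in> V}"
    then show "U \<inter> V \<subseteq> q ` topspace X"
      by blast
    have "{x \<in> topspace X. q x \<in> U \<inter> V} =
        {x \<in> topspace X. q x \<in> U} \<inter> {x \<in> topspace X. q x \<in> V}"
      by auto
    with U V show "openin X {x \<in> topspace X. q x \<in> U \<inter> V}"
      by (simp add: openin_Int)
  next
    fix \<K>
    assume *: "\<forall>K\<in>\<K>. K \<subseteq> q ` topspace X \<and> openin X {x \<in> topspace X. q x \<in> K}"
    then show "\<Union>\<K> \<subseteq> q ` topspace X"
      by blast
    have "{x \<in> topspace X. q x \<in> \<Union>\<K>} = (\<Union>K\<in>\<K>. {x \<in> topspace X. q x \<in> K})"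
      by auto
    then show "openin X {x \<in> topspace X. q x \<in> \<Union>\<K>}"
      using * by (auto intro!: openin_Union)
  qed
  then show ?thesis
    by (simp add: quotient_topology_def topology_inverse')
qed

lemma topspace_quotient_topology: "topspace (quotient_topology X q) = q ` topspace X"
proof
  have "{x \<in> topspace X. q x \<in> q ` topspace X} = topspace X"
    by auto
  then have "openin (quotient_topology X q) (q ` topspace X)"
    by (simp add: openin_quotient_topology)
  then show "q ` topspace X \<subseteq> topspace (quotient_topology X q)"
    by (rule openin_subset)
  show "topspace (quotient_topology X q) \<subseteq> q ` topspace X"
    using openin_topspace[of "quotient_topology X q"] unfolding openin_quotient_topology by (rule conjunct1)
qed

lemma quotient_map_quotient_topology: "quotient_map X (quotient_topology X q) q"
  unfolding quotient_map_def topspace_quotient_topology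
  by (simp add: openin_quotient_topology)

text \<open>
  The orbit space \<open>S/G\<close> with the quotient topology. Its charts are the topological charts
  \<open>(V, \<psi>)\<close> for which \<open>\<psi>\<close> composed with the projection is holomorphic; for \<open>G\<close> acting properly
  discontinuously by automorphisms this is the maximal atlas of the usual quotient Riemann
  surface (also at the branch points).
\<close>

definition quotient_surface :: "'a surface \<Rightarrow> ('a \<Rightarrow> 'a) set \<Rightarrow> 'a set surface" where
  "quotient_surface S G =
     \<lparr>surf_top = quotient_topology (surf_top S) (orb G),
      atlas = {(V, \<psi>).
        complex_chart (quotient_topology (surf_top S) (orb G)) V \<psi> \<and>
        (\<forall>(U, \<phi>) \<in> atlas S.
           (\<psi> \<circ> orb G \<circ> inv_into U \<phi>) holomorphic_on \<phi> ` {x \<in> U. orb G x \<in> V})}\<rparr>"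


section \<open>The surfaces under consideration\<close>

text \<open>
  \<open>gimel_surface p S T\<close>: the surface \<open>S\<close> belongs to the family, with \<open>T\<close> as the distinguished
  automorphism of order \<open>p\<close>.
\<close>

definition gimel_surface :: "nat \<Rightarrow> 'a surface \<Rightarrow> ('a \<Rightarrow> 'a) \<Rightarrow> bool" where
  "gimel_surface p S T \<longleftrightarrow>
     compact_riemann_surface S \<and>
     T \<in> carrier (Aut S) \<and> group.ord (Aut S) T = p \<and>
     biholomorphic (quotient_surface S (generate (Aut S) {T})) riemann_sphere \<and>
     card (Fix S T) = 4"

definition Aut' :: "'a surface \<Rightarrow> ('a \<Rightarrow> 'a) \<Rightarrow> ('a \<Rightarrow> 'a) monoid" where
  "Aut' S T = (Aut S)\<lparr>carrier := {f \<in> carrier (Aut S). f ` Fix S T = Fix S T}\<rparr>"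

text \<open>
  A two-sheeted branched cover of the sphere is the quotient by an involution. The customary
  requirement that the genus be at least 2 is left out: it would only narrow the notion, and
  surfaces in the family above have genus \<open>p - 1 \<ge> 2\<close>.
\<close>

definition hyperelliptic :: "'a surface \<Rightarrow> bool" where
  "hyperelliptic S \<longleftrightarrow>
     compact_riemann_surface S \<and>
     (\<exists>J \<in> carrier (Aut S). group.ord (Aut S) J = 2 \<and>
        biholomorphic (quotient_surface S (generate (Aut S) {J})) riemann_sphere)"

text \<open>
  The dihedral group of order \<open>2m\<close> (\<open>m > 0\<close>) as \<open>\<int>/m \<rtimes> \<int>/2\<close>: \<open>(a, s)\<close> stands for
  \<open>r\<^sup>a\<close> times a reflection if \<open>s\<close> holds.
\<close>

definition dihedral_group :: "nat \<Rightarrow> (int \<times> bool) monoid" where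
  "dihedral_group m =
     \<lparr>carrier = {0..<int m} \<times> UNIV,
      monoid.mult = (\<lambda>(a, s) (b, t). ((if s then a - b else a + b) mod int m, s \<noteq> t)),
      one = (0, False)\<rparr>"


section \<open>Fuchsian groups\<close>

definition fuchsian_group :: "(complex \<Rightarrow> complex) set \<Rightarrow> bool" where
  "fuchsian_group \<Gamma> \<longleftrightarrow>
     subgroup \<Gamma> (Aut disc_surface) \<and>
     (\<forall>K. compact K \<and> K \<subseteq> ball 0 1 \<longrightarrow> finite {g \<in> \<Gamma>. g ` K \<inter> K \<noteq> {}})"

definition point_stabilizer :: "(complex \<Rightarrow> complex) set \<Rightarrow> complex \<Rightarrow> (complex \<Rightarrow> complex) set" where
  "point_stabilizer \<Gamma> z = {g \<in> \<Gamma>. g z = z}"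

text \<open>
  Signature \<open>(0; p, \<dots>, p)\<close> with \<open>r\<close> periods: the orbit space is a topological sphere and there
  are exactly \<open>r\<close> orbits of points with nontrivial stabilizer, each such stabilizer having
  order \<open>p\<close>.
\<close>

definition has_signature_0 :: "(complex \<Rightarrow> complex) set \<Rightarrow> nat \<Rightarrow> nat \<Rightarrow> bool" where
  "has_signature_0 \<Gamma> r p \<longleftrightarrow>
     surf_top (quotient_surface disc_surface \<Gamma>) homeomorphic_space surf_top riemann_sphere \<and>
     finite {orb \<Gamma> z | z. z \<in> ball 0 1 \<and> point_stabilizer \<Gamma> z \<noteq> {\<one>\<^bsub>Aut disc_surface\<^esub>}} \<and>
     card {orb \<Gamma> z | z. z \<in> ball 0 1 \<and> point_stabilizer \<Gamma> z \<noteq> {\<one>\<^bsub>Aut disc_surface\<^esub>}} = r \<and>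
     (\<forall>z \<in> ball 0 1. point_stabilizer \<Gamma> z \<noteq> {\<one>\<^bsub>Aut disc_surface\<^esub>} \<longrightarrow>
        card (point_stabilizer \<Gamma> z) = p)"

definition acts_freely_on_disc :: "(complex \<Rightarrow> complex) set \<Rightarrow> bool" where
  "acts_freely_on_disc \<Gamma> \<longleftrightarrow>
     (\<forall>g \<in> \<Gamma>. \<forall>z \<in> ball 0 1. g z = z \<longrightarrow> g = \<one>\<^bsub>Aut disc_surface\<^esub>)"

text \<open>
  \<open>\<Gamma>s\<close> plays the role of \<open>\<Gamma>\<^sup>*\<close>. The isomorphism \<open>\<theta>\<close> sends the class of \<open>g\<close> to the automorphism
  of \<open>S\<close> induced by \<open>g\<close> through \<open>\<Delta>/\<Gamma>\<^sup>* \<simeq> S\<close>; its target is the group generated by \<open>T\<close>, so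
  \<open>\<Gamma>/\<Gamma>\<^sup>*\<close> is cyclic of the order of \<open>T\<close>.
\<close>

definition uniformized_by ::
  "nat \<Rightarrow> 'a surface \<Rightarrow> ('a \<Rightarrow> 'a) \<Rightarrow> (complex \<Rightarrow> complex) set \<Rightarrow> (complex \<Rightarrow> complex) set \<Rightarrow> bool"
  where
  "uniformized_by p S T \<Gamma> \<Gamma>s \<longleftrightarrow>
     fuchsian_group \<Gamma> \<and> has_signature_0 \<Gamma> 4 p \<and>
     \<Gamma>s \<lhd> (Aut disc_surface)\<lparr>carrier := \<Gamma>\<rparr> \<and> acts_freely_on_disc \<Gamma>s \<and>
     (\<exists>h \<theta>.
        biholomorphic_map (quotient_surface disc_surface \<Gamma>s) S h \<and>
        \<theta> \<in> iso ((Aut disc_surface)\<lparr>carrier := \<Gamma>\<rparr> Mod \<Gamma>s)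
                ((Aut S)\<lparr>carrier := generate (Aut S) {T}\<rparr>) \<and>
        (\<forall>g \<in> \<Gamma>. \<forall>z \<in> ball 0 1.
           \<theta> (\<Gamma>s #>\<^bsub>Aut disc_surface\<^esub> g) (h (orb \<Gamma>s z)) = h (orb \<Gamma>s (g z))))"


section \<open>Hyperbolic triangles and tilings\<close>

text \<open>Poincare metric of curvature \<open>-1\<close> on the unit disc.\<close>

definition hyp_dist :: "complex \<Rightarrow> complex \<Rightarrow> real" where
  "hyp_dist a b = 2 * artanh (norm (Moebius_function 0 a b))"

definition hyp_segment :: "complex \<Rightarrow> complex \<Rightarrow> complex set" where
  "hyp_segment a b = {z \<in> ball 0 1. hyp_dist a z + hyp_dist z b = hyp_dist a b}"

definition hyp_midpoint :: "complex \<Rightarrow> complex \<Rightarrow> complex \<Rightarrow> bool" where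
  "hyp_midpoint a b m \<longleftrightarrow>
     m \<in> ball 0 1 \<and> hyp_dist a m = hyp_dist a b / 2 \<and> hyp_dist m b = hyp_dist a b / 2"

text \<open>Closed solid triangle: the union of the segments from \<open>A\<close> to the points of the opposite side.\<close>

definition hyp_triangle :: "complex \<Rightarrow> complex \<Rightarrow> complex \<Rightarrow> complex set" where
  "hyp_triangle A B C = (\<Union>z \<in> hyp_segment B C. hyp_segment A z)"

text \<open>
  The Moebius map sending \<open>A\<close> to \<open>0\<close> turns the sides at \<open>A\<close> into Euclidean rays from \<open>0\<close>, so the
  angle at \<open>A\<close> and the orientation are read off there. (The Euclidean orientation of \<open>A, B, C\<close>
  need not agree with that of the hyperbolic triangle.)
\<close>

definition hyp_angle :: "complex \<Rightarrow> complex \<Rightarrow> complex \<Rightarrow> real" where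
  "hyp_angle A B C = \<bar>Arg (Moebius_function 0 A C / Moebius_function 0 A B)\<bar>"

definition counterclockwise :: "complex \<Rightarrow> complex \<Rightarrow> complex \<Rightarrow> bool" where
  "counterclockwise A B C \<longleftrightarrow> Im (Moebius_function 0 A C / Moebius_function 0 A B) > 0"

definition ccw_triangle ::
  "complex \<Rightarrow> complex \<Rightarrow> complex \<Rightarrow> real \<Rightarrow> real \<Rightarrow> real \<Rightarrow> bool" where
  "ccw_triangle A B C \<alpha> \<beta> \<gamma> \<longleftrightarrow>
     A \<in> ball 0 1 \<and> B \<in> ball 0 1 \<and> C \<in> ball 0 1 \<and> counterclockwise A B C \<and>
     hyp_angle A B C = \<alpha> \<and> hyp_angle B C A = \<beta> \<and> hyp_angle C A B = \<gamma>"

text \<open>Counterclockwise rotation about \<open>a\<close> through \<open>t\<close>, as an element of \<open>Aut disc_surface\<close>.\<close>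

definition hyp_rotation :: "complex \<Rightarrow> real \<Rightarrow> complex \<Rightarrow> complex" where
  "hyp_rotation a t =
     restrict (\<lambda>z. Moebius_function 0 (- a) (Moebius_function t a z)) (ball 0 1)"

abbreviation half_turn :: "complex \<Rightarrow> complex \<Rightarrow> complex" where
  "half_turn m \<equiv> hyp_rotation m pi"

text \<open>
  Vertex triples of all tiles obtained from the tile \<open>ABC\<close>. Half-turns preserve orientation and
  angles, so every triple lists its vertices in the order of the angles of \<open>ABC\<close>.
\<close>

inductive_set tile_vertices :: "complex \<Rightarrow> complex \<Rightarrow> complex \<Rightarrow> (complex \<times> complex \<times> complex) set"
  for A B C where
  start: "(A, B, C) \<in> tile_vertices A B C"
| turn: "(P, Q, R) \<in> tile_vertices A B C \<Longrightarrow>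
    hyp_midpoint P Q m \<or> hyp_midpoint Q R m \<or> hyp_midpoint R P m \<Longrightarrow>
    (half_turn m P, half_turn m Q, half_turn m R) \<in> tile_vertices A B C"

definition tiles_from :: "complex \<Rightarrow> complex \<Rightarrow> complex \<Rightarrow> complex set set" where
  "tiles_from A B C = (\<lambda>(P, Q, R). hyp_triangle P Q R) ` tile_vertices A B C"

text \<open>\<open>\<T>\<close> is a tiling \<open>\<Delta>(\<alpha>, \<beta>, \<gamma>)\<close>; it is determined by the angles up to \<open>Aut disc_surface\<close>.\<close>

definition is_tiling :: "nat \<Rightarrow> complex set set \<Rightarrow> real \<Rightarrow> real \<Rightarrow> real \<Rightarrow> bool" where
  "is_tiling p \<T> \<alpha> \<beta> \<gamma> \<longleftrightarrow>
     \<alpha> > 0 \<and> \<beta> > 0 \<and> \<gamma> > 0 \<and> \<alpha> + \<beta> + \<gamma> = 2 * pi / real p \<and>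
     (\<exists>A B C. ccw_triangle A B C \<alpha> \<beta> \<gamma> \<and> \<T> = tiles_from A B C)"

definition tiling_for :: "nat \<Rightarrow> complex set set \<Rightarrow> (complex \<Rightarrow> complex) set \<Rightarrow> bool" where
  "tiling_for p \<T> \<Gamma> \<longleftrightarrow>
     (\<exists>P Q R \<alpha> \<beta> \<gamma>. ccw_triangle P Q R \<alpha> \<beta> \<gamma> \<and> hyp_triangle P Q R \<in> \<T> \<and>
        \<Gamma> = generate (Aut disc_surface) ((\<lambda>a. hyp_rotation a (2 * pi / real p)) ` {P, Q, R}))"

definition canonical_tiling ::
  "nat \<Rightarrow> (complex \<Rightarrow> complex) set \<Rightarrow> complex set set \<Rightarrow> real \<Rightarrow> real \<Rightarrow> real \<Rightarrow> bool" where
  "canonical_tiling p \<Gamma> \<T> \<alpha> \<beta> \<gamma> \<longleftrightarrow>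
     is_tiling p \<T> \<alpha> \<beta> \<gamma> \<and> tiling_for p \<T> \<Gamma> \<and>
     0 < \<alpha> \<and> \<alpha> \<le> pi / real p \<and> 0 < \<beta> \<and> \<beta> < pi / real p \<and> 0 < \<gamma> \<and> \<gamma> < pi / real p \<and>
     (\<alpha> = pi / real p \<longrightarrow> \<gamma> \<le> \<beta>)"


section \<open>The pair $(i,j)$ and the case $\kappa_4$\<close>

definition is_pair ::
  "nat \<Rightarrow> 'a surface \<Rightarrow> ('a \<Rightarrow> 'a) \<Rightarrow> nat \<Rightarrow> nat \<Rightarrow> bool" where
  "is_pair p S T i j \<longleftrightarrow>
     (\<exists>\<Gamma> \<Gamma>s \<T> \<alpha> \<beta> \<gamma> A B C.
        uniformized_by p S T \<Gamma> \<Gamma>s \<and> canonical_tiling p \<Gamma> \<T> \<alpha> \<beta> \<gamma> \<and>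
        ccw_triangle A B C \<alpha> \<beta> \<gamma> \<and> hyp_triangle A B C \<in> \<T> \<and>
        (let x = hyp_rotation A (2 * pi / real p);
             y = hyp_rotation B (2 * pi / real p);
             z = hyp_rotation C (2 * pi / real p)
         in x \<in> \<Gamma> \<and> y \<in> \<Gamma> \<and> z \<in> \<Gamma> \<and>
            \<Gamma>s #>\<^bsub>Aut disc_surface\<^esub> y = \<Gamma>s #>\<^bsub>Aut disc_surface\<^esub> (x [^]\<^bsub>Aut disc_surface\<^esub> i) \<and>
            \<Gamma>s #>\<^bsub>Aut disc_surface\<^esub> z = \<Gamma>s #>\<^bsub>Aut disc_surface\<^esub> (x [^]\<^bsub>Aut disc_surface\<^esub> j)) \<and>
        i \<in> {1..p - 1} \<and> j \<in> {1..p - 1} \<and> \<not> p dvd i + j + 1)"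

text \<open>Elements of \<open>\<int>/p\<close> are represented by their residues in \<open>{0..<p}\<close>.\<close>

definition eLambda :: "nat \<Rightarrow> nat \<Rightarrow> nat \<Rightarrow> (int \<times> int) set" where
  "eLambda p i0 j0 =
     (let i = int i0; j = int j0; k = - (i + j + 1);
          i' = modular_inverse (int p) i;
          j' = modular_inverse (int p) j;
          k' = modular_inverse (int p) k
      in (\<lambda>(a, b). (a mod int p, b mod int p)) `
         {(i, j), (j, k), (k, i),
          (i' * j, i'), (i', i' * k), (i' * k, i' * j),
          (j', i * j'), (i * j', j' * k), (j' * k, j'),
          (j * k', i * k'), (i * k', k'), (k', j * k')})"

definition case_kappa4 :: "nat \<Rightarrow> 'a surface \<Rightarrow> ('a \<Rightarrow> 'a) \<Rightarrow> bool" where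
  "case_kappa4 p S T \<longleftrightarrow>
     (\<exists>i j. is_pair p S T i j \<and>
        (\<exists>m \<in> {2..int p - 2}. \<not> int p dvd m\<^sup>2 + 1 \<and> ((- 1) mod int p, m) \<in> eLambda p i j))"

end

theory Submission
  imports Defs "HOL-Complex_Analysis.Complex_Analysis"
begin

text \<open>
  Half a turn \<open>\<sigma>\<close> about the midpoint of a side \<open>AB\<close> of a tile conjugates the rotations about \<open>A\<close> and \<open>B\<close>
  into each other, and the one about \<open>C\<close> into the inverse of their cyclic product, which is the
  rotation about \<open>D = \<sigma> C\<close>. In case \<open>\<kappa>\<^sub>4\<close> the vertices can be labelled so that the rotations about
  \<open>A, B, C, D\<close> induce \<open>t, t\<^sup>-\<^sup>1, t\<^sup>m, t\<^sup>-\<^sup>m\<close> on \<open>S\<close>. Hence \<open>\<sigma>\<close> descends to an involution inverting \<open>t\<close>.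
  An automorphism preserving the fixed points of \<open>t\<close> permutes the exponents \<open>\<plusminus>1, \<plusminus>m\<close> up to a
  common factor, which must be \<open>\<plusminus>1\<close> because \<open>m\<^sup>2\<close> is not \<open>\<plusminus>1\<close>; if it is \<open>1\<close>, the automorphism induces
  on the sphere \<open>S/\<langle>t\<rangle>\<close> a map with four fixed points, so it is a power of \<open>t\<close>.

  A hyperelliptic involution \<open>J\<close> acts as \<open>-1\<close> on holomorphic forms. There are eigenforms of \<open>t\<close> with
  zeros exactly at the images of \<open>A, C, D\<close> and of \<open>B, C, D\<close>, so \<open>J\<close> preserves the fixed points of \<open>t\<close>
  and fixes the image of \<open>A\<close>. It is then a power of \<open>t\<close>, which has odd order.
\<close>

text \<open>Everything is pulled back to the disc: automorphisms of S become elements of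
  \<open>DA\<close> normalizing \<open>\<Gamma>s\<close>, and forms become functions f with f(g z)
  g'(z) = f(z) for g in \<open>\<Gamma>s\<close>. In place of genus, divisors or the theorem of
  Riemann and Roch one tool is used twice: since S is compact, a holomorphic function invariant
  under \<open>\<Gamma>s\<close> is constant. For a quotient of coordinates this gives the rigidity
  of the sphere, for a quotient of forms it shows that the sphere carries none. The forms on S are
  written down as p-th roots.

  Two points shape the preparation. A tile is given as a set of points, and the tile at which the
  pair is read off may differ from the one whose rotations generate the group; so vertices are
  recovered from the set, and all tiles are shown to give the same group. The signature enters by
  counting: it allows four classes of points with nontrivial stabilizer, so those of A, B, C, D,
  told apart by their exponents, are all of them. The range of m makes the exponents distinct and
  also makes the explicit forms vanish over C and D.\<close>

declare mem_ball [simp del] mem_ball_0 [simp del]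

section \<open>Groups of automorphisms\<close>

text \<open>Lets holomorphy be checked near one point at a time, where a chart or a local inverse
  adapted to that point is available.\<close>

lemma holomorphic_on_locally:
  assumes "\<And>y. y \<in> A \<Longrightarrow> \<exists>N. open N \<and> y \<in> N \<and> f holomorphic_on N"
  shows "f holomorphic_on A"
proof -
  obtain N where N: "\<And>y. y \<in> A \<Longrightarrow> open (N y) \<and> y \<in> N y \<and> f holomorphic_on N y"
    using assms by metis
  have "f holomorphic_on (\<Union>y\<in>A. N y)"
    using N by (intro holomorphic_on_UN_open) auto
  then show ?thesis
    by (rule holomorphic_on_subset) (use N in auto)
qed

lemma complex_chart_inj_on: "complex_chart X U \<phi> \<Longrightarrow> inj_on \<phi> U"
  using homeomorphic_imp_injective_map openin_subset
  by (fastforce simp: complex_chart_def inf.absorb2)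

lemma complex_chart_subset: "complex_chart X U \<phi> \<Longrightarrow> U \<subseteq> topspace X"
  by (simp add: complex_chart_def openin_subset)

lemma complex_chart_open_image:
  assumes c: "complex_chart X U \<phi>" and W: "openin X W" "W \<subseteq> U"
  shows "open (\<phi> ` W)"
proof -
  have "open_map (subtopology X U) (top_of_set (\<phi> ` U)) \<phi>"
    using c by (simp add: complex_chart_def homeomorphic_imp_open_map)
  moreover have "openin (subtopology X U) W"
    using W c by (simp add: openin_open_subtopology complex_chart_def)
  ultimately have "openin (top_of_set (\<phi> ` U)) (\<phi> ` W)"
    by (simp add: open_map_def)
  with c show ?thesis
    by (simp add: complex_chart_def openin_open_eq)
qed

text \<open>Kept apart from \<open>riemann_surface\<close>: for the source and the target of a map
  this is what the arguments use, while a surface passed through on the way must also be covered by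
  its charts.\<close>

definition charts_ok :: "'a surface \<Rightarrow> bool" where
  "charts_ok S \<longleftrightarrow> (\<forall>(U, \<phi>) \<in> atlas S. complex_chart (surf_top S) U \<phi>)"

lemma charts_okD: "charts_ok S \<Longrightarrow> (U, \<phi>) \<in> atlas S \<Longrightarrow> complex_chart (surf_top S) U \<phi>"
  by (auto simp: charts_ok_def)

lemma riemann_surface_charts_ok: "riemann_surface S \<Longrightarrow> charts_ok S"
  by (auto simp: riemann_surface_def charts_ok_def)

lemma riemann_surface_cover:
  assumes "riemann_surface S" "x \<in> points S"
  obtains U \<phi> where "(U, \<phi>) \<in> atlas S" "x \<in> U"
proof -
  have "x \<in> (\<Union>(U, \<phi>) \<in> atlas S. U)"
    using assms by (simp add: riemann_surface_def)
  then show thesis using that by blast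
qed

lemma openin_preimage:
  assumes "continuous_map X Y f" "openin X U" "openin Y V"
  shows "openin X {x \<in> U. f x \<in> V}"
proof -
  have "{x \<in> U. f x \<in> V} = U \<inter> {x \<in> topspace X. f x \<in> V}"
    using openin_subset[OF assms(2)] by auto
  then show ?thesis
    using assms by (simp add: openin_Int openin_continuous_map_preimage)
qed

text \<open>Fixed charts of S and Q say nothing about the intermediate point, so a chart of R around
  it is chosen and the composite is split there; this works only near the given point.\<close>

lemma holomorphic_map_compose:
  assumes S: "charts_ok S" and R: "riemann_surface R" and Q: "charts_ok Q"
    and f: "holomorphic_map S R f" and g: "holomorphic_map R Q g"
  shows "holomorphic_map S Q (g \<circ> f)"
  unfolding holomorphic_map_def
proof (intro conjI; clarify?)
  have cf: "continuous_map (surf_top S) (surf_top R) f" and cg: "continuous_map (surf_top R) (surf_top Q) g"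
    using f g by (simp_all add: holomorphic_map_def)
  then show cgf: "continuous_map (surf_top S) (surf_top Q) (g \<circ> f)"
    by (rule continuous_map_compose)
  fix U \<phi> W \<rho>
  assume U: "(U, \<phi>) \<in> atlas S" and W: "(W, \<rho>) \<in> atlas Q"
  note cU = charts_okD[OF S U] and cW = charts_okD[OF Q W]
  have oU: "openin (surf_top S) U" and oW: "openin (surf_top Q) W"
    using cU cW by (auto simp: complex_chart_def)
  show "(\<rho> \<circ> (g \<circ> f) \<circ> inv_into U \<phi>) holomorphic_on \<phi> ` {x \<in> U. (g \<circ> f) x \<in> W}"
  proof (rule holomorphic_on_locally)
    fix y assume "y \<in> \<phi> ` {x \<in> U. (g \<circ> f) x \<in> W}"
    then obtain x where x: "x \<in> U" "g (f x) \<in> W" "y = \<phi> x"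
      by auto
    have "f x \<in> points R"
      using cf x(1) complex_chart_subset[OF cU] by (auto simp: continuous_map_def)
    then obtain V \<psi> where V: "(V, \<psi>) \<in> atlas R" "f x \<in> V"
      using riemann_surface_cover[OF R] by blast
    note cV = charts_okD[OF riemann_surface_charts_ok[OF R] V(1)]
    have oV: "openin (surf_top R) V"
      using cV by (simp add: complex_chart_def)
    define E where "E = {x \<in> {x \<in> U. f x \<in> V}. (g \<circ> f) x \<in> W}"
    have oE: "openin (surf_top S) E"
      unfolding E_def by (intro openin_preimage[OF cgf] openin_preimage[OF cf] oU oV oW)
    have h1: "(\<psi> \<circ> f \<circ> inv_into U \<phi>) holomorphic_on \<phi> ` {x \<in> U. f x \<in> V}"
      using f U V by (auto simp: holomorphic_map_def)
    have h2: "(\<rho> \<circ> g \<circ> inv_into V \<psi>) holomorphic_on \<psi> ` {x \<in> V. g x \<in> W}"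
      using g W V by (auto simp: holomorphic_map_def)
    have iU: "inv_into U \<phi> (\<phi> a) = a" if "a \<in> U" for a
      using complex_chart_inj_on[OF cU] that by simp
    have iV: "inv_into V \<psi> (\<psi> a) = a" if "a \<in> V" for a
      using complex_chart_inj_on[OF cV] that by simp
    have "((\<rho> \<circ> g \<circ> inv_into V \<psi>) \<circ> (\<psi> \<circ> f \<circ> inv_into U \<phi>)) holomorphic_on \<phi> ` E"
      by (rule holomorphic_on_compose_gen[OF holomorphic_on_subset[OF h1] h2])
        (auto simp: E_def iU)
    moreover have "((\<rho> \<circ> g \<circ> inv_into V \<psi>) \<circ> (\<psi> \<circ> f \<circ> inv_into U \<phi>)) z =
        (\<rho> \<circ> (g \<circ> f) \<circ> inv_into U \<phi>) z" if "z \<in> \<phi> ` E" for z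
      using that by (auto simp: E_def iU iV)
    ultimately have "(\<rho> \<circ> (g \<circ> f) \<circ> inv_into U \<phi>) holomorphic_on \<phi> ` E"
      by (rule holomorphic_transform)
    moreover have "open (\<phi> ` E)"
      by (rule complex_chart_open_image[OF cU oE]) (auto simp: E_def)
    moreover have "y \<in> \<phi> ` E"
      using x V by (auto simp: E_def)
    ultimately show "\<exists>N. open N \<and> y \<in> N \<and> (\<rho> \<circ> (g \<circ> f) \<circ> inv_into U \<phi>) holomorphic_on N"
      by (intro exI[of _ "\<phi> ` E"]) simp
  qed
qed

text \<open>Automorphisms are extensional, so inverses and composites occur as restrictions; only
  the values on \<open>points S\<close> may matter.\<close>

lemma holomorphic_map_cong:
  assumes S: "charts_ok S" and f: "holomorphic_map S R f" and eq: "\<And>x. x \<in> points S \<Longrightarrow> f x = g x"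
  shows "holomorphic_map S R g"
  unfolding holomorphic_map_def
proof (intro conjI; clarify?)
  show "continuous_map (surf_top S) (surf_top R) g"
    using f eq continuous_map_eq unfolding holomorphic_map_def by blast
  fix U \<phi> V \<psi>
  assume U: "(U, \<phi>) \<in> atlas S" and V: "(V, \<psi>) \<in> atlas R"
  note cU = charts_okD[OF S U]
  have sU: "U \<subseteq> points S" by (rule complex_chart_subset[OF cU])
  have E: "{x \<in> U. f x \<in> V} = {x \<in> U. g x \<in> V}"
    using sU eq by (auto simp: subset_iff)
  have h: "(\<psi> \<circ> f \<circ> inv_into U \<phi>) holomorphic_on \<phi> ` {x \<in> U. g x \<in> V}"
    using f U V unfolding holomorphic_map_def E[symmetric] by blast
  show "(\<psi> \<circ> g \<circ> inv_into U \<phi>) holomorphic_on \<phi> ` {x \<in> U. g x \<in> V}"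
    by (rule holomorphic_transform[OF h])
      (use sU eq complex_chart_inj_on[OF cU] in \<open>auto simp: subset_iff\<close>)
qed

lemma biholomorphic_map_cong:
  assumes S: "charts_ok S" and R: "charts_ok R"
    and f: "biholomorphic_map S R f" and eq: "\<And>x. x \<in> points S \<Longrightarrow> f x = g x"
  shows "biholomorphic_map S R g"
proof -
  have b: "bij_betw g (points S) (points R)"
    using f eq bij_betw_cong unfolding biholomorphic_map_def by metis
  have "inv_into (points S) f y = inv_into (points S) g y" if "y \<in> points R" for y
  proof -
    have "y \<in> f ` points S"
      using f that by (auto simp: biholomorphic_map_def bij_betw_def)
    then obtain x where x: "x \<in> points S" "y = f x" by blast
    then have "y = g x" using eq by simp
    then have "inv_into (points S) g y = x"
      using b x by (simp add: bij_betw_def inv_into_f_eq)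
    moreover have "inv_into (points S) f y = x"
      using f x by (simp add: biholomorphic_map_def bij_betw_def inv_into_f_eq)
    ultimately show ?thesis by simp
  qed
  then have "holomorphic_map R S (inv_into (points S) g)"
    using f by - (rule holomorphic_map_cong[OF R, of _ "inv_into (points S) f"], auto simp: biholomorphic_map_def)
  moreover have "holomorphic_map S R g"
    using f eq by - (rule holomorphic_map_cong[OF S, of _ f], auto simp: biholomorphic_map_def)
  ultimately show ?thesis
    using b by (simp add: biholomorphic_map_def)
qed

lemma biholomorphic_map_compose:
  assumes S: "riemann_surface S" and R: "riemann_surface R" and Q: "riemann_surface Q"
    and f: "biholomorphic_map S R f" and g: "biholomorphic_map R Q g"
  shows "biholomorphic_map S Q (g \<circ> f)"
  unfolding biholomorphic_map_def
proof (intro conjI)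
  note ok = riemann_surface_charts_ok[OF S] riemann_surface_charts_ok[OF R] riemann_surface_charts_ok[OF Q]
  have bf: "bij_betw f (points S) (points R)" and bg: "bij_betw g (points R) (points Q)"
    using f g by (auto simp: biholomorphic_map_def)
  then show b: "bij_betw (g \<circ> f) (points S) (points Q)"
    by (rule bij_betw_trans)
  show "holomorphic_map S Q (g \<circ> f)"
    using holomorphic_map_compose[OF ok(1) R ok(3)] f g by (simp add: biholomorphic_map_def)
  have "holomorphic_map Q S (inv_into (points S) f \<circ> inv_into (points R) g)"
    using holomorphic_map_compose[OF ok(3) R ok(1)] f g by (simp add: biholomorphic_map_def)
  then show "holomorphic_map Q S (inv_into (points S) (g \<circ> f))"
  proof (rule holomorphic_map_cong[OF ok(3)])
    fix y assume "y \<in> points Q"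
    then obtain x where x: "x \<in> points S" "y = (g \<circ> f) x"
      using b unfolding bij_betw_def by blast
    have "inv_into (points S) (g \<circ> f) y = x"
      unfolding x(2) by (rule inv_into_f_f[OF bij_betw_imp_inj_on[OF b] x(1)])
    moreover have "f x \<in> points R" using bf x(1) by (auto simp: bij_betw_def)
    ultimately show "(inv_into (points S) f \<circ> inv_into (points R) g) y = inv_into (points S) (g \<circ> f) y"
      using bf bg x by (simp add: bij_betw_def)
  qed
qed

lemma biholomorphic_map_inv:
  assumes S: "riemann_surface S" and R: "riemann_surface R" and f: "biholomorphic_map S R f"
  shows "biholomorphic_map R S (inv_into (points S) f)"
  unfolding biholomorphic_map_def
proof (intro conjI)
  have bf: "bij_betw f (points S) (points R)"
    using f by (simp add: biholomorphic_map_def)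
  then show b: "bij_betw (inv_into (points S) f) (points R) (points S)"
    by (rule bij_betw_inv_into)
  show "holomorphic_map R S (inv_into (points S) f)"
    using f by (simp add: biholomorphic_map_def)
  have "f x = inv_into (points R) (inv_into (points S) f) x" if "x \<in> points S" for x
    using that bf b by (metis bij_betw_def bij_betw_inv_into_left f_inv_into_f inv_into_f_f imageI)
  then show "holomorphic_map S R (inv_into (points R) (inv_into (points S) f))"
    using f by - (rule holomorphic_map_cong[OF riemann_surface_charts_ok[OF S], of _ f], auto simp: biholomorphic_map_def)
qed

lemma biholomorphic_map_id:
  assumes "riemann_surface S"
  shows "biholomorphic_map S S (\<lambda>x\<in>points S. x)"
proof -
  note ok = riemann_surface_charts_ok[OF assms]
  have h: "holomorphic_map S S id"
    unfolding holomorphic_map_def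
    using assms by (auto simp: riemann_surface_def o_def Int_def)
  have "id x = inv_into (points S) id x" if "x \<in> points S" for x
    using that by (simp add: inv_into_f_eq)
  then have "holomorphic_map S S (inv_into (points S) id)"
    by (rule holomorphic_map_cong[OF ok h])
  then have "biholomorphic_map S S id"
    using h by (simp add: biholomorphic_map_def bij_betw_def)
  then show ?thesis
    by (rule biholomorphic_map_cong[OF ok ok]) auto
qed

section \<open>The group of automorphisms\<close>

lemma carrier_Aut: "carrier (Aut S) = {f \<in> Bij (points S). biholomorphic_map S S f}"
  by (simp add: Aut_def)

lemma one_Aut: "\<one>\<^bsub>Aut S\<^esub> = (\<lambda>x\<in>points S. x)"
  by (simp add: Aut_def BijGroup_def)

lemma Aut_subgroup:
  assumes "riemann_surface S"
  shows "subgroup (carrier (Aut S)) (BijGroup (points S))"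
proof (rule subgroup.intro)
  note ok = riemann_surface_charts_ok[OF assms]
  show "carrier (Aut S) \<subseteq> carrier (BijGroup (points S))"
    by (auto simp: carrier_Aut BijGroup_def)
  show "\<one>\<^bsub>BijGroup (points S)\<^esub> \<in> carrier (Aut S)"
    using biholomorphic_map_id[OF assms] by (simp add: carrier_Aut BijGroup_def id_Bij)
  fix f assume f: "f \<in> carrier (Aut S)"
  have i: "inv\<^bsub>BijGroup (points S)\<^esub> f = (\<lambda>x\<in>points S. inv_into (points S) f x)"
    using f by (simp add: inv_BijGroup carrier_Aut)
  have "biholomorphic_map S S f" using f by (simp add: carrier_Aut)
  then have "biholomorphic_map S S (inv_into (points S) f)"
    by (rule biholomorphic_map_inv[OF assms assms])
  then have "biholomorphic_map S S (\<lambda>x\<in>points S. inv_into (points S) f x)"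
    by (rule biholomorphic_map_cong[OF ok ok]) simp
  with i show "inv\<^bsub>BijGroup (points S)\<^esub> f \<in> carrier (Aut S)"
    using f by (simp add: carrier_Aut restrict_inv_into_Bij)
  fix g assume g: "g \<in> carrier (Aut S)"
  have "biholomorphic_map S S (f \<circ> g)"
    by (rule biholomorphic_map_compose[OF assms assms assms]) (use f g in \<open>simp_all add: carrier_Aut\<close>)
  then have "biholomorphic_map S S (compose (points S) f g)"
    by (rule biholomorphic_map_cong[OF ok ok]) (simp add: compose_def)
  then show "f \<otimes>\<^bsub>BijGroup (points S)\<^esub> g \<in> carrier (Aut S)"
    using f g by (simp add: carrier_Aut BijGroup_def compose_Bij)
qed

lemma group_Aut:
  assumes "riemann_surface S"
  shows "group (Aut S)"
proof -
  have "group (BijGroup (points S)\<lparr>carrier := carrier (Aut S)\<rparr>)"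
    by (rule subgroup.subgroup_is_group[OF Aut_subgroup[OF assms] group_BijGroup])
  moreover have "BijGroup (points S)\<lparr>carrier := carrier (Aut S)\<rparr> = Aut S"
    by (simp add: Aut_def)
  ultimately show ?thesis by simp
qed

lemma Aut_mult:
  assumes "f \<in> carrier (Aut S)" "g \<in> carrier (Aut S)"
  shows "f \<otimes>\<^bsub>Aut S\<^esub> g = compose (points S) f g"
  using assms by (simp add: Aut_def BijGroup_def)

lemma Aut_mult_apply:
  assumes "f \<in> carrier (Aut S)" "g \<in> carrier (Aut S)" "x \<in> points S"
  shows "(f \<otimes>\<^bsub>Aut S\<^esub> g) x = f (g x)"
  using assms by (simp add: Aut_mult compose_def)

lemma Aut_closed: "f \<in> carrier (Aut S) \<Longrightarrow> x \<in> points S \<Longrightarrow> f x \<in> points S"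
  using Bij_imp_funcset by (auto simp: carrier_Aut)

lemma Aut_inj: "f \<in> carrier (Aut S) \<Longrightarrow> inj_on f (points S)"
  by (simp add: carrier_Aut Bij_def bij_betw_def)

lemma Aut_surj: "f \<in> carrier (Aut S) \<Longrightarrow> f ` points S = points S"
  by (simp add: carrier_Aut Bij_def bij_betw_def)

lemma Aut_eqI:
  assumes "f \<in> carrier (Aut S)" "g \<in> carrier (Aut S)" "\<And>x. x \<in> points S \<Longrightarrow> f x = g x"
  shows "f = g"
  using assms by (intro extensionalityI[of _ "points S"]) (auto simp: carrier_Aut Bij_def)

lemma Aut_inv_apply:
  assumes "riemann_surface S" "f \<in> carrier (Aut S)" "x \<in> points S"
  shows "(inv\<^bsub>Aut S\<^esub> f) (f x) = x" "f ((inv\<^bsub>Aut S\<^esub> f) x) = x"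
proof -
  interpret group "Aut S" by (rule group_Aut[OF assms(1)])
  have i: "inv\<^bsub>Aut S\<^esub> f \<in> carrier (Aut S)" using assms by simp
  have "(inv\<^bsub>Aut S\<^esub> f \<otimes>\<^bsub>Aut S\<^esub> f) x = x" "(f \<otimes>\<^bsub>Aut S\<^esub> inv\<^bsub>Aut S\<^esub> f) x = x"
    using assms by (simp_all add: one_Aut)
  then show "(inv\<^bsub>Aut S\<^esub> f) (f x) = x" "f ((inv\<^bsub>Aut S\<^esub> f) x) = x"
    by (simp_all only: Aut_mult_apply[OF i assms(2,3)] Aut_mult_apply[OF assms(2) i assms(3)])
qed

section \<open>Automorphisms of the disc\<close>

abbreviation disc :: "complex set" where "disc \<equiv> ball 0 1"
abbreviation DA :: "(complex \<Rightarrow> complex) monoid" where "DA \<equiv> Aut disc_surface"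

lemma points_disc [simp]: "points disc_surface = disc"
  by (simp add: disc_surface_def)

lemma riemann_surface_disc: "riemann_surface disc_surface"
proof -
  have "homeomorphic_map (top_of_set disc) (top_of_set disc) (\<lambda>z. z)"
    using homeomorphic_map_id[of "top_of_set disc" "top_of_set disc"] by (simp add: id_def)
  then have c: "complex_chart (top_of_set disc) disc (\<lambda>z. z)"
    by (simp add: complex_chart_def subtopology_subtopology)
  have h: "((\<lambda>z. z) \<circ> inv_into disc (\<lambda>z. z)) holomorphic_on disc"
    by (rule holomorphic_transform[OF holomorphic_on_ident]) (auto simp: inv_into_f_eq inj_on_def)
  have "connected_space (top_of_set disc)"
    using connectedin_iff_connected[of disc] connectedin_def[of euclidean disc] by simp
  moreover have "second_countable (top_of_set disc)"
  proof (rule second_countable_subtopology)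
    obtain B :: "complex set set" where B: "countable B" "\<And>C. C \<in> B \<Longrightarrow> open C"
      "\<And>S. open S \<Longrightarrow> \<exists>U. U \<subseteq> B \<and> S = \<Union>U"
      using univ_second_countable by blast
    have "\<exists>V\<in>B. x \<in> V \<and> V \<subseteq> U" if "open U" "x \<in> U" for U and x :: complex
      using B(3)[OF that(1)] that(2) by blast
    then show "second_countable (euclidean :: complex topology)"
      unfolding second_countable_def using B by (intro exI[of _ B]) auto
  qed
  ultimately show ?thesis
    using c h by (auto simp: riemann_surface_def disc_surface_def Hausdorff_space_subtopology)
qed

interpretation DA: group DA
  by (rule group_Aut[OF riemann_surface_disc])

lemma holomorphic_map_disc:
  assumes "f ` disc \<subseteq> disc"
  shows "holomorphic_map disc_surface disc_surface f \<longleftrightarrow> f holomorphic_on disc"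
proof -
  have E: "{x \<in> disc. f x \<in> disc} = disc" using assms by auto
  have i: "inv_into disc (\<lambda>z. z) z = z" if "z \<in> disc" for z :: complex
    using that by (simp add: inv_into_f_eq inj_on_def)
  have "((\<lambda>z. z) \<circ> f \<circ> inv_into disc (\<lambda>z. z)) holomorphic_on disc \<longleftrightarrow> f holomorphic_on disc"
    by (rule holomorphic_cong) (auto simp: i)
  then show ?thesis
    using assms holomorphic_on_imp_continuous_on[of f disc]
    by (auto simp: holomorphic_map_def disc_surface_def E continuous_map_in_subtopology)
qed

text \<open>An injective holomorphic map has a holomorphic inverse; this supplies the half of
  \<open>biholomorphic_map\<close> that concerns the inverse.\<close>

lemma DA_iff:
  "f \<in> carrier DA \<longleftrightarrow> f \<in> extensional disc \<and> bij_betw f disc disc \<and> f holomorphic_on disc"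
proof
  assume f: "f \<in> carrier DA"
  then have "f \<in> extensional disc" "bij_betw f disc disc" "holomorphic_map disc_surface disc_surface f"
    by (simp_all add: carrier_Aut Bij_def biholomorphic_map_def)
  then show "f \<in> extensional disc \<and> bij_betw f disc disc \<and> f holomorphic_on disc"
    using holomorphic_map_disc[of f] by (simp add: bij_betw_def)
next
  assume f: "f \<in> extensional disc \<and> bij_betw f disc disc \<and> f holomorphic_on disc"
  then obtain g where g: "g holomorphic_on f ` disc" "\<And>z. z \<in> disc \<Longrightarrow> g (f z) = z"
    using holomorphic_has_inverse[of f disc] by (metis bij_betw_def open_ball)
  have im: "f ` disc = disc" using f by (simp add: bij_betw_def)
  have eq: "g z = inv_into disc f z" if "z \<in> disc" for z
  proof -
    have "z \<in> f ` disc" by (simp only: im that)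
    then obtain w where w: "w \<in> disc" "z = f w" by (rule imageE) simp
    have "inv_into disc f z = w"
      unfolding w(2) by (rule inv_into_f_f[OF bij_betw_imp_inj_on w(1)]) (use f in blast)
    then show ?thesis using g(2)[OF w(1)] w(2) by simp
  qed
  have "g holomorphic_on disc" using g(1) by (simp only: im)
  then have "inv_into disc f holomorphic_on disc"
    by (rule holomorphic_transform) (rule eq)
  moreover have "inv_into disc f ` disc \<subseteq> disc"
    using f bij_betw_inv_into[of f disc disc] by (simp add: bij_betw_def)
  ultimately have "holomorphic_map disc_surface disc_surface (inv_into disc f)"
    by (simp add: holomorphic_map_disc)
  moreover have "holomorphic_map disc_surface disc_surface f"
    using f im by (simp add: holomorphic_map_disc)
  ultimately show "f \<in> carrier DA"
    using f by (simp add: carrier_Aut Bij_def biholomorphic_map_def)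
qed

lemma DA_holo: "f \<in> carrier DA \<Longrightarrow> f holomorphic_on disc"
  by (simp add: DA_iff)

lemma DA_closed: "f \<in> carrier DA \<Longrightarrow> z \<in> disc \<Longrightarrow> f z \<in> disc"
  using Aut_closed[of f disc_surface z] by simp

lemma DA_mult: "f \<in> carrier DA \<Longrightarrow> g \<in> carrier DA \<Longrightarrow> z \<in> disc \<Longrightarrow> (f \<otimes>\<^bsub>DA\<^esub> g) z = f (g z)"
  using Aut_mult_apply[of f disc_surface g z] by simp

lemma DA_one: "z \<in> disc \<Longrightarrow> \<one>\<^bsub>DA\<^esub> z = z"
  by (simp add: one_Aut)

lemma DA_eqI: "f \<in> carrier DA \<Longrightarrow> g \<in> carrier DA \<Longrightarrow> (\<And>z. z \<in> disc \<Longrightarrow> f z = g z) \<Longrightarrow> f = g"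
  using Aut_eqI[of f disc_surface g] by simp

lemma DA_inv_apply:
  assumes "f \<in> carrier DA" "z \<in> disc"
  shows "(inv\<^bsub>DA\<^esub> f) (f z) = z" "f ((inv\<^bsub>DA\<^esub> f) z) = z"
  using Aut_inv_apply[OF riemann_surface_disc, of f z] assms by simp_all

lemma DA_inj: "f \<in> carrier DA \<Longrightarrow> inj_on f disc"
  using Aut_inj[of f disc_surface] by simp

lemma DA_I:
  assumes "f holomorphic_on disc" "\<And>z. z \<in> disc \<Longrightarrow> f z \<in> disc"
    and "\<And>z. z \<in> disc \<Longrightarrow> g z \<in> disc" "\<And>z. z \<in> disc \<Longrightarrow> f (g z) = z" "\<And>z. z \<in> disc \<Longrightarrow> g (f z) = z"
  shows "restrict f disc \<in> carrier DA"
proof -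
  have "bij_betw f disc disc"
    by (rule bij_betw_byWitness[of _ g]) (use assms(2-5) in blast)+
  moreover have "restrict f disc holomorphic_on disc"
    by (rule holomorphic_transform[OF assms(1)]) simp
  ultimately show ?thesis
    by (simp add: DA_iff bij_betw_restrict_eq)
qed

section \<open>Moebius maps and hyperbolic rotations\<close>

abbreviation mob :: "complex \<Rightarrow> complex \<Rightarrow> complex" where "mob \<equiv> Moebius_function 0"

lemma disc_iff: "z \<in> disc \<longleftrightarrow> norm z < 1"
  by (simp add: mem_ball_0)

lemma mob_denom_nz: "a \<in> disc \<Longrightarrow> z \<in> disc \<Longrightarrow> 1 - cnj a * z \<noteq> 0"
proof -
  assume "a \<in> disc" "z \<in> disc"
  then have "norm (cnj a * z) < 1"
    using norm_mult_less[of "cnj a" 1 z 1] by (simp add: disc_iff)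
  then show ?thesis by auto
qed

lemma mob_in_disc: "a \<in> disc \<Longrightarrow> z \<in> disc \<Longrightarrow> mob a z \<in> disc"
  by (simp add: disc_iff Moebius_function_norm_lt_1)

lemma uminus_in_disc: "a \<in> disc \<Longrightarrow> - a \<in> disc"
  by (simp add: disc_iff)

lemma unit_mult_in_disc: "norm c = 1 \<Longrightarrow> a \<in> disc \<Longrightarrow> c * a \<in> disc"
  by (simp add: disc_iff norm_mult)

lemma mob_inv1: "a \<in> disc \<Longrightarrow> z \<in> disc \<Longrightarrow> mob (- a) (mob a z) = z"
  by (rule Moebius_function_compose) (auto simp: disc_iff)

lemma mob_inv2: "a \<in> disc \<Longrightarrow> z \<in> disc \<Longrightarrow> mob a (mob (- a) z) = z"
  by (rule Moebius_function_compose) (auto simp: disc_iff)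

lemma mob_inj: "a \<in> disc \<Longrightarrow> z \<in> disc \<Longrightarrow> w \<in> disc \<Longrightarrow> mob a z = mob a w \<Longrightarrow> z = w"
  by (metis mob_inv1)

lemma mob_self [simp]: "mob a a = 0"
  by (rule Moebius_function_eq_zero)

lemma mob_eq_0_iff: "a \<in> disc \<Longrightarrow> z \<in> disc \<Longrightarrow> mob a z = 0 \<longleftrightarrow> z = a"
  by (metis mob_inj mob_self)

lemma mob_minus_zero: "mob (- a) 0 = a"
  by (simp add: Moebius_function_simple)

lemma mob_holo: "a \<in> disc \<Longrightarrow> mob a holomorphic_on disc"
  by (simp add: Moebius_function_holomorphic disc_iff)

lemma norm_mob_commute: "norm (mob a z) = norm (mob z a)"
proof -
  have "norm (1 - cnj a * z) = norm (1 - cnj z * a)"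
    using complex_mod_cnj[of "1 - cnj a * z"] by (simp add: mult.commute)
  then show ?thesis
    by (simp add: Moebius_function_simple norm_divide norm_minus_commute)
qed

lemma holomorphic_on_disc_comp:
  assumes "f holomorphic_on disc" "\<And>z. z \<in> disc \<Longrightarrow> f z \<in> disc" "g holomorphic_on disc"
  shows "(\<lambda>z. g (f z)) holomorphic_on disc"
  using holomorphic_on_compose_gen[OF assms(1,3)] assms(2) by (auto simp: o_def)

text \<open>Moving a and \<open>f a\<close> to 0 turns f into a self-map of the disc fixing 0; the
  Schwarz lemma for it and for its inverse makes it a rotation. All explicit knowledge about
  \<open>DA\<close> comes from this formula.\<close>

lemma DA_eps:
  assumes f: "f \<in> carrier DA" and a: "a \<in> disc"
  obtains \<epsilon> where "norm \<epsilon> = 1" "\<And>z. z \<in> disc \<Longrightarrow> mob (f a) (f z) = \<epsilon> * mob a z"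
proof -
  define g where "g = inv\<^bsub>DA\<^esub> f"
  have g: "g \<in> carrier DA" using f by (simp add: g_def)
  have fa: "f a \<in> disc" using DA_closed[OF f a] .
  have gf: "g (f z) = z" "f (g z) = z" if "z \<in> disc" for z
    using DA_inv_apply[OF f that] by (simp_all add: g_def)
  define h where "h z = mob (f a) (f (mob (- a) z))" for z
  define k where "k z = mob a (g (mob (- f a) z))" for z
  have h_disc: "h z \<in> disc" if "z \<in> disc" for z
    using that a fa f by (simp add: h_def mob_in_disc uminus_in_disc DA_closed)
  have k_disc: "k z \<in> disc" if "z \<in> disc" for z
    using that a fa g by (simp add: k_def mob_in_disc uminus_in_disc DA_closed)
  have "(\<lambda>z. f (mob (- a) z)) holomorphic_on disc"
    by (rule holomorphic_on_disc_comp[OF mob_holo[OF uminus_in_disc[OF a]] mob_in_disc[OF uminus_in_disc[OF a]] DA_holo[OF f]])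
  then have holh: "h holomorphic_on disc"
    unfolding h_def
    by (rule holomorphic_on_disc_comp[OF _ DA_closed[OF f mob_in_disc[OF uminus_in_disc[OF a]]] mob_holo[OF fa]])
  have "(\<lambda>z. g (mob (- f a) z)) holomorphic_on disc"
    by (rule holomorphic_on_disc_comp[OF mob_holo[OF uminus_in_disc[OF fa]] mob_in_disc[OF uminus_in_disc[OF fa]] DA_holo[OF g]])
  then have holk: "k holomorphic_on disc"
    unfolding k_def
    by (rule holomorphic_on_disc_comp[OF _ DA_closed[OF g mob_in_disc[OF uminus_in_disc[OF fa]]] mob_holo[OF a]])
  have h0: "h 0 = 0" and k0: "k 0 = 0"
    using gf(1)[OF a] by (simp_all add: h_def k_def mob_minus_zero)
  have kh: "k (h z) = z" if "z \<in> disc" for z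
    using that a fa f by (simp add: h_def k_def mob_inv1 mob_inv2 gf DA_closed mob_in_disc uminus_in_disc)
  \<comment> \<open>Equality in the Schwarz lemma at one nonzero point suffices, and 1/2 is as good
    as any other.\<close>
  have half: "(1/2::complex) \<in> disc" by (simp add: disc_iff)
  have "norm (h (1/2)) \<le> norm (1/2 :: complex)"
    by (rule Schwarz_Lemma(1)[OF holh h0]) (use h_disc in \<open>auto simp: disc_iff\<close>)
  moreover have "norm (k (h (1/2))) \<le> norm (h (1/2))"
    by (rule Schwarz_Lemma(1)[OF holk k0]) (use k_disc h_disc[OF half] in \<open>auto simp: disc_iff\<close>)
  ultimately have "norm (h (1/2)) = norm (1/2 :: complex)"
    using kh[OF half] by simp
  then have "\<exists>z. norm z < 1 \<and> z \<noteq> 0 \<and> norm (h z) = norm z"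
    by (intro exI[of _ "1/2"]) simp
  then obtain \<epsilon> where e: "\<And>z. norm z < 1 \<Longrightarrow> h z = \<epsilon> * z" "norm \<epsilon> = 1"
    using Schwarz_Lemma(3)[OF holh h0, of 0] h_disc by (auto simp: disc_iff)
  show thesis
  proof (rule that[OF e(2)])
    fix z assume z: "z \<in> disc"
    have "h (mob a z) = \<epsilon> * mob a z"
      using e(1) mob_in_disc[OF a z] by (simp add: disc_iff)
    then show "mob (f a) (f z) = \<epsilon> * mob a z"
      using a z by (simp add: h_def mob_inv1)
  qed
qed

lemma norm_mob_DA:
  "f \<in> carrier DA \<Longrightarrow> a \<in> disc \<Longrightarrow> z \<in> disc \<Longrightarrow> norm (mob (f a) (f z)) = norm (mob a z)"
  by (metis DA_eps mult_1 norm_mult)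

lemma hyp_rotation_apply:
  assumes "z \<in> disc"
  shows "hyp_rotation a t z = mob (- a) (cis t * mob a z)"
  using assms by (simp add: hyp_rotation_def Moebius_function_def cis_conv_exp)

lemma mob_hyp_rotation:
  assumes "a \<in> disc" "z \<in> disc"
  shows "mob a (hyp_rotation a t z) = cis t * mob a z"
  using assms by (simp add: hyp_rotation_apply mob_inv2 mob_in_disc unit_mult_in_disc)

lemma hyp_rotation_in_DA: 
  assumes "a \<in> disc"
  shows "hyp_rotation a t \<in> carrier DA"
proof -
  have c: "cis s * mob a z \<in> disc" if "z \<in> disc" for s z
    using assms that by (simp add: mob_in_disc unit_mult_in_disc)
  have rd: "mob (- a) (cis s * mob a z) \<in> disc" if "z \<in> disc" for s z
    by (rule mob_in_disc[OF uminus_in_disc[OF assms] c[OF that]])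
  have "(\<lambda>z. mob (- a) (cis t * mob a z)) holomorphic_on disc"
    by (rule holomorphic_on_disc_comp[OF _ c mob_holo[OF uminus_in_disc[OF assms]]]) (intro holomorphic_intros mob_holo assms)
  then have "restrict (\<lambda>z. mob (- a) (cis t * mob a z)) disc \<in> carrier DA"
    by (rule DA_I[where g = "\<lambda>z. mob (- a) (cis (- t) * mob a z)"])
      (use assms c rd in \<open>simp_all add: mob_inv1 mob_inv2 cis_mult flip: mult.assoc\<close>)
  moreover have "hyp_rotation a t = restrict (\<lambda>z. mob (- a) (cis t * mob a z)) disc"
    by (rule extensionalityI[of _ disc]) (auto simp: hyp_rotation_apply, simp add: hyp_rotation_def)
  ultimately show ?thesis by simp
qed

lemma hyp_rotation_center: "a \<in> disc \<Longrightarrow> hyp_rotation a t a = a"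
  by (simp add: hyp_rotation_apply mob_minus_zero)

lemma hyp_rotation_eqI:
  assumes "f \<in> carrier DA" "a \<in> disc" "\<And>z. z \<in> disc \<Longrightarrow> mob a (f z) = cis t * mob a z"
  shows "f = hyp_rotation a t"
proof (rule DA_eqI[OF assms(1) hyp_rotation_in_DA[OF assms(2)]])
  fix z assume "z \<in> disc"
  then show "f z = hyp_rotation a t z"
    using assms by - (rule mob_inj[OF assms(2)], simp_all add: DA_closed hyp_rotation_in_DA mob_hyp_rotation)
qed

lemma DA_fixing_is_rotation:
  assumes "f \<in> carrier DA" "a \<in> disc" "f a = a"
  obtains t where "f = hyp_rotation a t"
proof -
  obtain \<epsilon> where e: "norm \<epsilon> = 1" "\<And>z. z \<in> disc \<Longrightarrow> mob (f a) (f z) = \<epsilon> * mob a z"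
    using DA_eps[OF assms(1,2)] by blast
  have "\<epsilon> = cis (Arg \<epsilon>)"
    using e(1) by (metis cis_Arg_unique complex_norm_eq_1_exp mult_1 norm_zero of_real_1 rcis_cmod_Arg rcis_def)
  then show thesis
    using e(2) assms by (intro that[of "Arg \<epsilon>"] hyp_rotation_eqI) auto
qed

lemma hyp_rotation_eq_one:
  assumes "a \<in> disc" "cis t = 1"
  shows "hyp_rotation a t = \<one>\<^bsub>DA\<^esub>"
  by (rule hyp_rotation_eqI[symmetric]) (use assms in \<open>simp_all add: DA_one\<close>)

text \<open>The first fixed point makes f a rotation, the second forces its multiplier to be 1. This
  is how swaps are seen to be involutions and branch points to be isolated.\<close>

lemma DA_two_fixed_points:
  assumes "f \<in> carrier DA" "a \<in> disc" "b \<in> disc" "a \<noteq> b" "f a = a" "f b = b"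
  shows "f = \<one>\<^bsub>DA\<^esub>"
proof -
  obtain t where t: "f = hyp_rotation a t"
    using DA_fixing_is_rotation assms by metis
  have "cis t * mob a b = mob a b"
    using mob_hyp_rotation[of a b t] assms t by simp
  moreover have "mob a b \<noteq> 0" using assms by (simp add: mob_eq_0_iff)
  ultimately show ?thesis
    using t assms by (simp add: hyp_rotation_eq_one)
qed

lemma hyp_rotation_eq_one_iff:
  assumes "a \<in> disc"
  shows "hyp_rotation a t = \<one>\<^bsub>DA\<^esub> \<longleftrightarrow> cis t = 1"
proof
  assume h: "hyp_rotation a t = \<one>\<^bsub>DA\<^esub>"
  obtain b where b: "b \<in> disc" "b \<noteq> a"
  proof (cases "a = 0")
    case True
    show ?thesis by (rule that[of "1/2"]) (auto simp: True disc_iff)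
  next
    case False
    show ?thesis by (rule that[of "0"]) (use False in \<open>auto simp: disc_iff\<close>)
  qed
  then have "mob a b = cis t * mob a b"
    using mob_hyp_rotation[of a b t] assms h by (simp add: DA_one)
  then show "cis t = 1" using b assms by (simp add: mob_eq_0_iff)
qed (use assms hyp_rotation_eq_one in auto)

text \<open>By \<open>DA_eps\<close> the map f is multiplication by a constant between the
  coordinates centred at a and at \<open>f a\<close>, and this commutes with multiplication by
  \<open>cis t\<close>. Hence rotations at points of one orbit are conjugate.\<close>

lemma hyp_rotation_conj:
  assumes f: "f \<in> carrier DA" and a: "a \<in> disc"
  shows "f \<otimes>\<^bsub>DA\<^esub> hyp_rotation a t \<otimes>\<^bsub>DA\<^esub> inv\<^bsub>DA\<^esub> f = hyp_rotation (f a) t"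
proof (rule hyp_rotation_eqI)
  have r: "hyp_rotation a t \<in> carrier DA" using a by (rule hyp_rotation_in_DA)
  show "f \<otimes>\<^bsub>DA\<^esub> hyp_rotation a t \<otimes>\<^bsub>DA\<^esub> inv\<^bsub>DA\<^esub> f \<in> carrier DA" using f r by simp
  show "f a \<in> disc" using DA_closed[OF f a] .
  obtain \<epsilon> where e: "\<And>z. z \<in> disc \<Longrightarrow> mob (f a) (f z) = \<epsilon> * mob a z"
    using DA_eps[OF f a] by blast
  fix z assume z: "z \<in> disc"
  define w where "w = (inv\<^bsub>DA\<^esub> f) z"
  have w: "w \<in> disc" "z = f w"
    using DA_inv_apply[OF f z] DA_closed[of "inv\<^bsub>DA\<^esub> f", OF _ z] f by (simp_all add: w_def)
  have "(f \<otimes>\<^bsub>DA\<^esub> hyp_rotation a t \<otimes>\<^bsub>DA\<^esub> inv\<^bsub>DA\<^esub> f) z = f (hyp_rotation a t w)"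
    using f r z w(1) by (simp add: DA_mult flip: w_def)
  then show "mob (f a) ((f \<otimes>\<^bsub>DA\<^esub> hyp_rotation a t \<otimes>\<^bsub>DA\<^esub> inv\<^bsub>DA\<^esub> f) z) = cis t * mob (f a) z"
    using e w a by (simp add: DA_closed[OF r] mob_hyp_rotation)
qed

text \<open>With a moved to 0 and b to \<open>\<beta>\<close>, the map z |-> (\<open>\<beta>\<close>
  - z) / (1 - cnj \<open>\<beta>\<close> z) exchanges the two. It is the half-turn about the
  midpoint of a and b, obtained without constructing the midpoint.\<close>

lemma swap_exists:
  assumes "a \<in> disc" "b \<in> disc"
  obtains c where "c \<in> carrier DA" "c a = b" "c b = a"
proof -
  define \<beta> where "\<beta> = mob a b"
  have b: "\<beta> \<in> disc" using assms by (simp add: \<beta>_def mob_in_disc)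
  define f where "f z = mob (- a) (- mob \<beta> (mob a z))" for z
  have i: "- mob \<beta> (- v) = mob (- \<beta>) v" for v
    by (simp add: Moebius_function_simple divide_simps)
  have d: "- mob \<beta> (mob a z) \<in> disc" if "z \<in> disc" for z
    using assms b that by (intro uminus_in_disc mob_in_disc)
  have fd: "f z \<in> disc" if "z \<in> disc" for z
    unfolding f_def by (rule mob_in_disc[OF uminus_in_disc[OF assms(1)] d[OF that]])
  have ff: "f (f z) = z" if "z \<in> disc" for z
    using d that assms b by (simp add: f_def mob_inv2 i mob_inv1 mob_in_disc)
  have "(\<lambda>z. - mob \<beta> (mob a z)) holomorphic_on disc"
    by (rule holomorphic_on_minus, rule holomorphic_on_disc_comp[OF mob_holo[OF assms(1)] mob_in_disc[OF assms(1)] mob_holo[OF b]])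
  then have "f holomorphic_on disc"
    unfolding f_def by (rule holomorphic_on_disc_comp[OF _ d mob_holo[OF uminus_in_disc[OF assms(1)]]])
  then have "restrict f disc \<in> carrier DA"
    by (rule DA_I[where g = f]) (use fd ff in auto)
  moreover have "f a = b"
    using assms by (simp add: f_def \<beta>_def Moebius_function_of_zero mob_inv1)
  moreover have "f b = a"
    using assms by (simp add: f_def \<beta>_def mob_minus_zero)
  ultimately show thesis using that[of "restrict f disc"] assms by simp
qed

lemma swap_involution:
  assumes "c \<in> carrier DA" "a \<in> disc" "b \<in> disc" "a \<noteq> b" "c a = b" "c b = a"
  shows "c \<otimes>\<^bsub>DA\<^esub> c = \<one>\<^bsub>DA\<^esub>"
  by (rule DA_two_fixed_points[of _ a b]) (use assms in \<open>simp_all add: DA_mult\<close>)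

lemma swap_apply:
  assumes "c \<in> carrier DA" "a \<in> disc" "b \<in> disc" "a \<noteq> b" "c a = b" "c b = a" "z \<in> disc"
  shows "c (c z) = z"
  using swap_involution[OF assms(1-6)] DA_mult[OF assms(1,1,7)] DA_one[OF assms(7)] by simp

section \<open>Klein model\<close>

text \<open>Passage from the Poincare disc to the projective model of Beltrami and Klein, where
  hyperbolic segments are straight, so that orientation and extreme points become affine
  notions.\<close>

definition klein :: "complex \<Rightarrow> complex" where
  "klein z = 2 * z / of_real (1 + (norm z)\<^sup>2)"

lemma klein_denom: "of_real (1 + (norm z)\<^sup>2) \<noteq> (0::complex)"
  by (metis add_pos_nonneg less_irrefl of_real_eq_0_iff zero_le_power2 zero_less_one)

text \<open>Supplies the constant term in \<open>mob_klein\<close>: applied to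
  \<open>klein a\<close>, the real linear map k + a^2 cnj k occurring there yields 2 a.\<close>

lemma klein_fixed: "klein z + z\<^sup>2 * cnj (klein z) = 2 * z"
proof -
  have "klein z + z\<^sup>2 * cnj (klein z) = 2 * z * (1 + z * cnj z) / of_real (1 + (norm z)\<^sup>2)"
    by (simp add: klein_def power2_eq_square algebra_simps add_divide_distrib)
  also have "1 + z * cnj z = of_real (1 + (norm z)\<^sup>2)"
    by (simp add: complex_norm_square del: of_real_power)
  finally show ?thesis using klein_denom[of z] by simp
qed

text \<open>In the Klein coordinate the map \<open>mob a\<close> is, up to a positive factor, real linear around \<open>a\<close>.\<close>

lemma mob_klein:
  assumes "a \<in> disc" "b \<in> disc"
  obtains r where "r > 0"
    "mob a b = of_real r * ((klein b - klein a) + a\<^sup>2 * cnj (klein b - klein a))"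
proof
  define d where "d = 1 - cnj a * b"
  have d: "d \<noteq> 0" using mob_denom_nz[OF assms] by (simp add: d_def)
  define N where "N = 1 + (norm b)\<^sup>2"
  have N: "N > 0" by (simp add: N_def add_pos_nonneg)
  show "N / (2 * (norm d)\<^sup>2) > 0" using d N by simp
  have kb: "klein b * of_real N = 2 * b" using klein_denom[of b] by (simp add: klein_def N_def)
  have kb': "cnj (klein b) * of_real N = 2 * cnj b"
    using arg_cong[OF kb, of cnj] by simp
  have N': "of_real N = 1 + b * cnj b" by (simp add: N_def complex_norm_square del: of_real_power)
  have "(klein b - klein a) + a\<^sup>2 * cnj (klein b - klein a) = klein b + a\<^sup>2 * cnj (klein b) - 2 * a"
    using klein_fixed[of a] by (simp add: algebra_simps)
  then have "of_real N * ((klein b - klein a) + a\<^sup>2 * cnj (klein b - klein a)) =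
      2 * b + a\<^sup>2 * (2 * cnj b) - 2 * a * of_real N"
    using kb kb' by (simp add: algebra_simps)
  also have "\<dots> = 2 * ((b - a) * cnj d)"
    unfolding N' d_def by (simp add: algebra_simps power2_eq_square)
  finally have "of_real N * ((klein b - klein a) + a\<^sup>2 * cnj (klein b - klein a)) = 2 * ((b - a) * cnj d)" .
  moreover have "mob a b = (b - a) * cnj d / of_real ((norm d)\<^sup>2)"
    using d by (simp add: Moebius_function_simple complex_norm_square del: of_real_power flip: d_def)
  ultimately show "mob a b = of_real (N / (2 * (norm d)\<^sup>2)) *
      ((klein b - klein a) + a\<^sup>2 * cnj (klein b - klein a))"
    by simp
qed

lemma klein_inj:
  assumes "a \<in> disc" "b \<in> disc" "klein a = klein b"
  shows "a = b"
proof -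
  obtain r where "mob a b = of_real r * ((klein b - klein a) + a\<^sup>2 * cnj (klein b - klein a))"
    using mob_klein assms by blast
  then show ?thesis using assms by (simp add: mob_eq_0_iff)
qed

lemma norm_lt_1_power4: "a \<in> disc \<Longrightarrow> (norm a)^4 < 1"
  by (simp add: disc_iff power_less_one_iff)

text \<open>The second term is shorter than the first by the factor |a|^2 < 1, so the two can cancel
  only at 0.\<close>

lemma klein_linear_inj:
  assumes "a \<in> disc" "k + a\<^sup>2 * cnj k = 0"
  shows "k = 0"
proof (rule ccontr)
  assume "k \<noteq> 0"
  have "norm k = norm (a\<^sup>2 * cnj k)"
    using assms(2) by (metis add_eq_0_iff norm_minus_cancel)
  then have "(norm a)\<^sup>2 = 1" using \<open>k \<noteq> 0\<close> by (simp add: norm_mult norm_power)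
  then show False using assms(1) using norm_ge_zero[of a] by (auto simp: disc_iff power2_eq_1_iff)
qed

text \<open>The real linear map k + A^2 cnj k has determinant 1 - |A|^4 > 0, so orientation may be
  read off in Klein coordinates. There it is the sign of an affine determinant, whose cyclic
  symmetry is evident, whereas the definition singles out A.\<close>

lemma counterclockwise_klein:
  assumes "A \<in> disc" "B \<in> disc" "C \<in> disc"
  shows "counterclockwise A B C \<longleftrightarrow> Im ((klein C - klein A) * cnj (klein B - klein A)) > 0"
proof -
  define b where "b = klein B - klein A"
  define c where "c = klein C - klein A"
  obtain r where r: "r > 0" "mob A B = of_real r * (b + A\<^sup>2 * cnj b)"
    using mob_klein[OF assms(1,2)] unfolding b_def by blast
  obtain s where s: "s > 0" "mob A C = of_real s * (c + A\<^sup>2 * cnj c)"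
    using mob_klein[OF assms(1,3)] unfolding c_def by blast
  have i: "Im ((c + A\<^sup>2 * cnj c) * cnj (b + A\<^sup>2 * cnj b)) = (1 - (norm A)^4) * Im (c * cnj b)"
  proof -
    have "(c + A\<^sup>2 * cnj c) * cnj (b + A\<^sup>2 * cnj b) =
        c * cnj b + (A\<^sup>2 * cnj (A\<^sup>2)) * cnj (c * cnj b) + (cnj (A\<^sup>2) * c * b + cnj (cnj (A\<^sup>2) * c * b))"
      by (simp add: algebra_simps)
    moreover have "A\<^sup>2 * cnj (A\<^sup>2) = of_real ((norm A)^4)"
      using complex_norm_square[of "A\<^sup>2"] by (simp add: norm_power flip: power_mult)
    moreover have "Im (u + of_real r * cnj u + (w + cnj w)) = (1 - r) * Im u" for u w and r :: real
      by (simp add: algebra_simps)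
    ultimately show ?thesis by (simp only:)
  qed
  have "0 < 1 - (norm A)^4" using norm_lt_1_power4[OF assms(1)] by simp
  show ?thesis
  proof (cases "mob A B = 0")
    case True
    then have "b + A\<^sup>2 * cnj b = 0" using r by simp
    then have "b = 0" by (rule klein_linear_inj[OF assms(1)])
    then have "(klein C - klein A) * cnj (klein B - klein A) = 0" by (simp add: b_def)
    then show ?thesis using True by (simp only: counterclockwise_def) simp
  next
    case False
    have "mob A C * cnj (mob A B) = of_real (s * r) * ((c + A\<^sup>2 * cnj c) * cnj (b + A\<^sup>2 * cnj b))"
      unfolding r(2) s(2) by (simp add: mult_ac)
    then have eq: "mob A C / mob A B =
        of_real (s * r / (norm (mob A B))\<^sup>2) * ((c + A\<^sup>2 * cnj c) * cnj (b + A\<^sup>2 * cnj b))"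
      by (subst complex_div_cnj) simp
    have im: "Im (of_real x * w) = x * Im w" for x w by simp
    have "Im (mob A C / mob A B) = (s * r / (norm (mob A B))\<^sup>2) * ((1 - (norm A)^4) * Im (c * cnj b))"
      unfolding eq im i ..
    moreover have "s * r / (norm (mob A B))\<^sup>2 > 0" using r s False by simp
    ultimately show ?thesis
      using \<open>0 < 1 - (norm A)^4\<close> zero_less_mult_pos mult_pos_pos
      unfolding counterclockwise_def b_def[symmetric] c_def[symmetric] by metis
  qed
qed

lemma counterclockwise_cyclic:
  assumes "A \<in> disc" "B \<in> disc" "C \<in> disc" "counterclockwise A B C"
  shows "counterclockwise B C A"
proof -
  have "Im ((a - b) * cnj (c - b)) = Im ((c - a) * cnj (b - a))" for a b c
    by (simp add: algebra_simps)
  then show ?thesis using assms by (simp only: counterclockwise_klein)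
qed

lemma counterclockwise_DA:
  assumes "f \<in> carrier DA" "A \<in> disc" "B \<in> disc" "C \<in> disc"
  shows "mob (f A) (f C) / mob (f A) (f B) = mob A C / mob A B"
proof -
  obtain \<epsilon> where "norm \<epsilon> = 1" "\<And>z. z \<in> disc \<Longrightarrow> mob (f A) (f z) = \<epsilon> * mob A z"
    using DA_eps[OF assms(1,2)] by blast
  then show ?thesis using assms by auto
qed

section \<open>Hyperbolic triangles\<close>

text \<open>The addition theorem of tanh with its denominator cleared, obtained by comparing the
  arguments of the logarithms.\<close>

lemma artanh_add_eq_imp:
  fixes s t d :: real
  assumes "0 \<le> s" "s < 1" "0 \<le> t" "t < 1" "0 \<le> d" "d < 1"
    and "artanh s + artanh t = artanh d"
  shows "d * (1 + s * t) = s + t"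
proof -
  have "ln ((1 + s) / (1 - s)) + ln ((1 + t) / (1 - t)) = ln ((1 + d) / (1 - d))"
    using assms(7) by (simp add: artanh_def)
  then have "ln ((1 + s) / (1 - s) * ((1 + t) / (1 - t))) = ln ((1 + d) / (1 - d))"
    using assms by (subst ln_mult_pos) auto
  then have "(1 + s) / (1 - s) * ((1 + t) / (1 - t)) = (1 + d) / (1 - d)"
    using assms by (subst (asm) ln_inj_iff) (auto intro!: mult_pos_pos divide_pos_pos)
  then have "(1 + s) * (1 + t) * (1 - d) = (1 + d) * ((1 - s) * (1 - t))"
    using assms by (simp add: frac_eq_eq)
  then show ?thesis by (simp add: algebra_simps)
qed

text \<open>Equality in the hyperbolic triangle inequality with the middle point at 0. It forces
  \<open>Re (cnj u * v)\<close> to be -|u||v|, hence u and v point in opposite directions.\<close>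

lemma hyp_dist_add_eq_imp:
  assumes "u \<in> disc" "v \<in> disc"
    and "artanh (norm u) + artanh (norm v) = artanh (norm (mob u v))"
  shows "of_real (norm v) * u + of_real (norm u) * v = 0"
proof -
  define s t d where "s = norm u" "t = norm v" "d = norm (mob u v)"
  have st: "0 \<le> s" "s < 1" "0 \<le> t" "t < 1" "0 \<le> d" "d < 1"
    using assms mob_in_disc[OF assms(1,2)] by (auto simp: s_t_d_def disc_iff)
  have eq: "d * (1 + s * t) = s + t"
    using artanh_add_eq_imp[OF st] assms(3) by (simp add: s_t_d_def)
  define k where "k = Re (cnj u * v)"
  have a: "(norm (v - u))\<^sup>2 = s\<^sup>2 + t\<^sup>2 - 2 * k"
    unfolding s_t_d_def k_def cmod_power2 by (simp add: power2_eq_square algebra_simps)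
  have b: "(norm (1 - cnj u * v))\<^sup>2 = 1 + s\<^sup>2 * t\<^sup>2 - 2 * k"
    unfolding s_t_d_def k_def cmod_power2 by (simp add: power2_eq_square algebra_simps)
  have "d * norm (1 - cnj u * v) = norm (v - u)"
    using mob_denom_nz[OF assms(1,2)] by (simp add: s_t_d_def Moebius_function_simple norm_divide)
  then have "d\<^sup>2 * (1 + s\<^sup>2 * t\<^sup>2 - 2 * k) = s\<^sup>2 + t\<^sup>2 - 2 * k"
    by (metis a b power_mult_distrib)
  then have "(d * (1 + s * t))\<^sup>2 * (1 + s\<^sup>2 * t\<^sup>2 - 2 * k) = (1 + s * t)\<^sup>2 * (s\<^sup>2 + t\<^sup>2 - 2 * k)"
    by (simp add: power_mult_distrib)
  \<comment> \<open>After substitution the equation factors; the last two factors are nonzero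
    because s and t are less than 1.\<close>
  then have "2 * (k + s * t) * ((1 - s\<^sup>2) * (1 - t\<^sup>2)) = 0"
    unfolding eq by (simp add: power2_eq_square algebra_simps)
  moreover have "1 - s\<^sup>2 \<noteq> 0" "1 - t\<^sup>2 \<noteq> 0"
    using st by (auto simp: power2_eq_1_iff)
  ultimately have k: "k = - (s * t)" by simp
  have "(norm (of_real y * u + of_real x * v))\<^sup>2 =
      y\<^sup>2 * (norm u)\<^sup>2 + x\<^sup>2 * (norm v)\<^sup>2 + 2 * x * y * Re (cnj u * v)" for x y :: real
    unfolding cmod_power2 by (simp add: power2_eq_square algebra_simps)
  then have "(norm (of_real t * u + of_real s * v))\<^sup>2 = t\<^sup>2 * s\<^sup>2 + s\<^sup>2 * t\<^sup>2 + 2 * s * t * k"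
    by (simp only: s_t_d_def k_def)
  also have "\<dots> = 0" by (simp add: k power2_eq_square)
  finally show ?thesis by (simp add: s_t_d_def)
qed

lemma mob_mob_norm:
  assumes "z \<in> disc" "a \<in> disc" "b \<in> disc"
  shows "norm (mob (mob z a) (mob z b)) = norm (mob a b)"
proof -
  have "restrict (mob z) disc \<in> carrier DA"
    by (rule DA_I[where g = "mob (- z)"]) (use assms mob_holo mob_in_disc mob_inv1 mob_inv2 uminus_in_disc in auto)
  from norm_mob_DA[OF this assms(2,3)] show ?thesis using assms by simp
qed

lemma hyp_dist_split_imp:
  assumes "z \<in> disc" "a \<in> disc" "b \<in> disc" "hyp_dist a z + hyp_dist z b = hyp_dist a b"
  shows "of_real (norm (mob z b)) * mob z a + of_real (norm (mob z a)) * mob z b = 0"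
proof (rule hyp_dist_add_eq_imp)
  show "mob z a \<in> disc" "mob z b \<in> disc" using assms mob_in_disc by auto
  show "artanh (norm (mob z a)) + artanh (norm (mob z b)) = artanh (norm (mob (mob z a) (mob z b)))"
    using assms(4) by (simp add: hyp_dist_def mob_mob_norm[OF assms(1-3)] norm_mob_commute[of a z])
qed

text \<open>Seen from m, the points P and Q have equal modulus by the distances and opposite
  directions by \<open>hyp_dist_split_imp\<close>, so multiplication by -1 exchanges them.\<close>

lemma half_turn_midpoint:
  assumes "P \<in> disc" "Q \<in> disc" "hyp_midpoint P Q m"
  shows "half_turn m P = Q" "half_turn m Q = P"
proof -
  have m: "m \<in> disc" and d: "hyp_dist P m = hyp_dist P Q / 2" "hyp_dist m Q = hyp_dist P Q / 2"
    using assms(3) by (auto simp: hyp_midpoint_def)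
  define u v where "u = mob m P" "v = mob m Q"
  have uv: "norm u < 1" "norm v < 1"
    using assms m mob_in_disc by (auto simp: u_v_def disc_iff[symmetric])
  have "artanh (norm u) = artanh (norm v)"
    using d by (simp add: hyp_dist_def u_v_def norm_mob_commute[of P m])
  then have "ln ((1 + norm u) / (1 - norm u)) = ln ((1 + norm v) / (1 - norm v))"
    by (simp add: artanh_def)
  then have "(1 + norm u) / (1 - norm u) = (1 + norm v) / (1 - norm v)"
    using uv by (subst (asm) ln_inj_iff) (auto intro!: divide_pos_pos add_pos_nonneg)
  then have n: "norm u = norm v" using uv by (simp add: field_simps)
  have "of_real (norm v) * u + of_real (norm u) * v = 0"
    using hyp_dist_split_imp[OF m assms(1,2)] d by (simp add: u_v_def)
  then have "of_real (norm v) * (u + v) = 0"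
    by (simp add: n distrib_left)
  then have "u + v = 0" using n by auto
  then have uv': "mob m Q = - mob m P" "mob m P = - mob m Q"
    by (simp_all add: u_v_def add_eq_0_iff add_eq_0_iff2)
  show "half_turn m P = Q"
    by (rule mob_inj[OF m DA_closed[OF hyp_rotation_in_DA[OF m] assms(1)] assms(2)])
      (simp add: mob_hyp_rotation m assms uv'(1))
  show "half_turn m Q = P"
    by (rule mob_inj[OF m DA_closed[OF hyp_rotation_in_DA[OF m] assms(2)] assms(1)])
      (simp add: mob_hyp_rotation m assms uv'(1))
qed

lemma hyp_dist_self [simp]: "hyp_dist a a = 0"
  by (simp add: hyp_dist_def)

lemma hyp_segment_ends: "a \<in> disc \<Longrightarrow> b \<in> disc \<Longrightarrow> a \<in> hyp_segment a b" "a \<in> disc \<Longrightarrow> b \<in> disc \<Longrightarrow> b \<in> hyp_segment a b"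
  by (simp_all add: hyp_segment_def)

lemma hyp_segment_disc: "z \<in> hyp_segment a b \<Longrightarrow> z \<in> disc"
  by (simp add: hyp_segment_def)

text \<open>Seen from z the end points lie in opposite directions. By \<open>mob_klein\<close> and
  \<open>klein_linear_inj\<close> the same holds for \<open>klein a - klein z\<close> and
  \<open>klein b - klein z\<close>, and the positive factors become the barycentric weights.\<close>

lemma klein_hyp_segment:
  assumes "a \<in> disc" "b \<in> disc" "z \<in> hyp_segment a b"
  shows "klein z \<in> closed_segment (klein a) (klein b)"
proof -
  have z: "z \<in> disc" and h: "hyp_dist a z + hyp_dist z b = hyp_dist a b"
    using assms(3) by (auto simp: hyp_segment_def)
  define s t where "s = norm (mob z a)" "t = norm (mob z b)"
  have eq: "of_real t * mob z a + of_real s * mob z b = 0"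
    using hyp_dist_split_imp[OF z assms(1,2) h] by (simp add: s_t_def)
  show ?thesis
  proof (cases "s = 0 \<or> t = 0")
    case True
    then have "z = a \<or> z = b"
      using z assms mob_eq_0_iff by (auto simp: s_t_def)
    then show ?thesis by auto
  next
    case False
    then have st: "s > 0" "t > 0" by (auto simp: s_t_def)
    obtain r where r: "r > 0" "mob z a = of_real r * ((klein a - klein z) + z\<^sup>2 * cnj (klein a - klein z))"
      using mob_klein[OF z assms(1)] by blast
    obtain q where q: "q > 0" "mob z b = of_real q * ((klein b - klein z) + z\<^sup>2 * cnj (klein b - klein z))"
      using mob_klein[OF z assms(2)] by blast
    define k where "k = of_real (t * r) * (klein a - klein z) + of_real (s * q) * (klein b - klein z)"
    have "k + z\<^sup>2 * cnj k = of_real t * mob z a + of_real s * mob z b"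
      unfolding r(2) q(2) k_def by (simp add: algebra_simps)
    then have "k + z\<^sup>2 * cnj k = 0" using eq by simp
    then have "k = 0" by (rule klein_linear_inj[OF z])
    then have k': "of_real (t * r + s * q) * klein z = of_real (t * r) * klein a + of_real (s * q) * klein b"
      by (simp add: k_def algebra_simps)
    define N where "N = t * r + s * q"
    have N: "N > 0" using st r(1) q(1) by (simp add: N_def add_pos_pos)
    have "of_real N * klein z = of_real (t * r) * klein a + of_real (s * q) * klein b"
      using k' by (simp only: N_def)
    then have "klein z = (of_real (t * r) * klein a + of_real (s * q) * klein b) / of_real N"
      using N by (simp add: nonzero_eq_divide_eq mult.commute)
    then have kz: "klein z = (t * r / N) *\<^sub>R klein a + (s * q / N) *\<^sub>R klein b"
      by (simp add: scaleR_conv_of_real add_divide_distrib)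
    have e: "t * r / N = 1 - s * q / N"
      using N by (simp add: N_def field_simps)
    have "0 \<le> s * q / N" "s * q / N \<le> 1"
      using N st q(1) r(1) by (simp_all add: N_def)
    then show ?thesis
      unfolding in_segment using kz[unfolded e] by blast
  qed
qed

text \<open>The extreme points of a triangle, as a point set, are its vertices; so a tile determines its vertices.\<close>

definition hyp_extreme :: "complex \<Rightarrow> complex set \<Rightarrow> bool" where
  "hyp_extreme v X \<longleftrightarrow> v \<in> X \<and> (\<forall>a\<in>X. \<forall>b\<in>X. v \<in> hyp_segment a b \<longrightarrow> v = a \<or> v = b)"

lemma hyp_triangle_disc: "z \<in> hyp_triangle A B C \<Longrightarrow> z \<in> disc"
  by (auto simp: hyp_triangle_def hyp_segment_disc)

lemma hyp_triangle_vertices: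
  assumes "A \<in> disc" "B \<in> disc" "C \<in> disc"
  shows "A \<in> hyp_triangle A B C" "B \<in> hyp_triangle A B C" "C \<in> hyp_triangle A B C"
  using assms hyp_segment_ends unfolding hyp_triangle_def by blast+

text \<open>A point of the triangle lies on a segment from A to a point of the side BC; extremality
  collapses first this segment and then, if its far end is reached, the side.\<close>

lemma hyp_extreme_imp_vertex:
  assumes "A \<in> disc" "B \<in> disc" "C \<in> disc" "hyp_extreme v (hyp_triangle A B C)"
  shows "v \<in> {A, B, C}"
proof -
  note V = hyp_triangle_vertices[OF assms(1-3)]
  obtain z where z: "z \<in> hyp_segment B C" "v \<in> hyp_segment A z"
    using assms(4) by (auto simp: hyp_extreme_def hyp_triangle_def)
  have "z \<in> hyp_triangle A B C"
    using z(1) hyp_segment_ends(2)[OF assms(1) hyp_segment_disc[OF z(1)]] by (auto simp: hyp_triangle_def)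
  then have "v = A \<or> v = z"
    using assms(4) V z(2) unfolding hyp_extreme_def by blast
  moreover have "v = B \<or> v = C" if "v = z"
    using assms(4) V z(1) that unfolding hyp_extreme_def by blast
  ultimately show ?thesis by blast
qed

lemma klein_hyp_triangle:
  assumes "A \<in> disc" "B \<in> disc" "C \<in> disc" "v \<in> hyp_triangle A B C"
  shows "klein v \<in> convex hull {klein A, klein B, klein C}"
proof -
  let ?H = "convex hull {klein A, klein B, klein C}"
  have v: "klein A \<in> ?H" "klein B \<in> ?H" "klein C \<in> ?H" by (auto intro: hull_inc)
  obtain z where z: "z \<in> hyp_segment B C" "v \<in> hyp_segment A z"
    using assms(4) by (auto simp: hyp_triangle_def)
  have "klein z \<in> ?H"
    by (rule subsetD[OF closed_segment_subset[OF v(2,3) convex_convex_hull] klein_hyp_segment[OF assms(2,3) z(1)]])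
  from closed_segment_subset[OF v(1) this convex_convex_hull] show ?thesis
    by (rule subsetD) (rule klein_hyp_segment[OF assms(1) hyp_segment_disc[OF z(1)] z(2)])
qed

text \<open>Klein coordinates carry the triangle into the Euclidean triangle on the images of the
  vertices. The orientation makes that one non-degenerate, so its corners are extreme points of the
  hull, and this is pulled back.\<close>

lemma vertex_imp_hyp_extreme:
  assumes "A \<in> disc" "B \<in> disc" "C \<in> disc" "counterclockwise A B C" "v \<in> {A, B, C}"
  shows "hyp_extreme v (hyp_triangle A B C)"
  unfolding hyp_extreme_def
proof (intro conjI ballI impI)
  let ?K = "{klein A, klein B, klein C}"
  show v: "v \<in> hyp_triangle A B C"
    using assms(5) hyp_triangle_vertices[OF assms(1-3)] by blast
  fix a b assume ab: "a \<in> hyp_triangle A B C" "b \<in> hyp_triangle A B C" "v \<in> hyp_segment a b"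
  have im: "Im ((klein C - klein A) * cnj (klein B - klein A)) > 0"
    using assms counterclockwise_klein by blast
  have "\<not> collinear ?K"
  proof
    assume "collinear ?K"
    then have "collinear {klein C, klein A, klein B}" by (simp add: insert_commute)
    then have "collinear {0, klein C - klein A, klein B - klein A}"
      by (subst (asm) collinear_3) simp
    then consider "klein C - klein A = 0" | "klein B - klein A = 0" | c where "klein B - klein A = c *\<^sub>R (klein C - klein A)"
      unfolding collinear_lemma by blast
    then show False
    proof cases
      case 3
      have "Im (w * cnj (c *\<^sub>R w)) = 0" for w by (simp add: scaleR_conv_of_real)
      then show False using im unfolding 3 by (metis less_irrefl)
    qed (use im in \<open>metis complex_cnj_zero less_irrefl mult_zero_left mult_zero_right zero_complex.sel(2)\<close>)+
  qed
  then have "\<not> affine_dependent ?K"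
    using collinear_3_eq_affine_dependent by blast
  then have "klein v extreme_point_of (convex hull ?K)"
    using assms(5) extreme_point_of_convex_hull_affine_independent[of ?K] by auto
  moreover have "klein v \<in> closed_segment (klein a) (klein b)"
    using klein_hyp_segment[OF _ _ ab(3)] ab hyp_triangle_disc by blast
  moreover have "klein a \<in> convex hull ?K" "klein b \<in> convex hull ?K"
    using ab klein_hyp_triangle[OF assms(1-3)] by blast+
  ultimately have "klein v = klein a \<or> klein v = klein b"
    by (auto simp: extreme_point_of_def open_segment_def)
  then show "v = a \<or> v = b"
    using klein_inj hyp_triangle_disc v ab by blast
qed

lemma hyp_triangle_eq_imp_vertices_eq:
  assumes "A \<in> disc" "B \<in> disc" "C \<in> disc" "counterclockwise A B C"
    and "P \<in> disc" "Q \<in> disc" "R \<in> disc" "counterclockwise P Q R"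
    and "hyp_triangle A B C = hyp_triangle P Q R"
  shows "{A, B, C} = {P, Q, R}"
proof (rule subset_antisym; rule subsetI)
  fix v assume "v \<in> {A, B, C}"
  from vertex_imp_hyp_extreme[OF assms(1-4) this] show "v \<in> {P, Q, R}"
    unfolding assms(9) by (rule hyp_extreme_imp_vertex[OF assms(5-7)])
next
  fix v assume "v \<in> {P, Q, R}"
  from vertex_imp_hyp_extreme[OF assms(5-8) this] show "v \<in> {A, B, C}"
    unfolding assms(9)[symmetric] by (rule hyp_extreme_imp_vertex[OF assms(1-3)])
qed

section \<open>The rotations at the vertices of a triangle\<close>

text \<open>Only the sum of the angles survives: it is what the product of half-turns depends on,
  and it is unchanged by cyclic relabelling of the vertices.\<close>

definition angle_triangle :: "real \<Rightarrow> complex \<Rightarrow> complex \<Rightarrow> complex \<Rightarrow> bool" where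
  "angle_triangle t A B C \<longleftrightarrow> (\<exists>\<alpha> \<beta> \<gamma>. ccw_triangle A B C \<alpha> \<beta> \<gamma> \<and> \<alpha> + \<beta> + \<gamma> = t)"

lemma angle_triangleD:
  assumes "angle_triangle t A B C"
  shows "A \<in> disc" "B \<in> disc" "C \<in> disc" "counterclockwise A B C"
  using assms by (auto simp: angle_triangle_def ccw_triangle_def)

lemma angle_triangle_distinct:
  assumes "angle_triangle t A B C"
  shows "A \<noteq> B" "B \<noteq> C" "C \<noteq> A"
proof -
  have *: "A \<noteq> B" "C \<noteq> A" if "counterclockwise A B C" for A B C
    using that by (auto simp: counterclockwise_def)
  note D = angle_triangleD[OF assms]
  show "A \<noteq> B" "B \<noteq> C" "C \<noteq> A"
    using *[OF D(4)] *[OF counterclockwise_cyclic[OF D]] by auto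
qed

lemma angle_triangle_cyclic:
  assumes "angle_triangle t A B C"
  shows "angle_triangle t B C A"
proof -
  obtain \<alpha> \<beta> \<gamma> where h: "ccw_triangle A B C \<alpha> \<beta> \<gamma>" "\<alpha> + \<beta> + \<gamma> = t"
    using assms by (auto simp: angle_triangle_def)
  then have "ccw_triangle B C A \<beta> \<gamma> \<alpha>"
    using counterclockwise_cyclic by (auto simp: ccw_triangle_def)
  then show ?thesis unfolding angle_triangle_def using h(2) by (intro exI[of _ \<beta>] exI[of _ \<gamma>] exI[of _ \<alpha>]) simp
qed

lemma angle_triangle_DA:
  assumes f: "f \<in> carrier DA" and "angle_triangle t A B C"
  shows "angle_triangle t (f A) (f B) (f C)"
  using assms(2) DA_closed[OF f] counterclockwise_DA[OF f]
  unfolding angle_triangle_def ccw_triangle_def counterclockwise_def hyp_angle_def by (metis (no_types, lifting))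

text \<open>The positive imaginary part puts the argument between 0 and pi, which removes the
  absolute value in \<open>hyp_angle\<close>.\<close>

lemma ccw_angle:
  assumes "counterclockwise A B C" "hyp_angle A B C = \<alpha>"
  obtains r where "r > 0" "mob A C = of_real r * cis \<alpha> * mob A B" "mob A B \<noteq> 0"
proof -
  define q where "q = mob A C / mob A B"
  have q: "Im q > 0" using assms(1) by (simp add: counterclockwise_def q_def)
  then have nz: "mob A B \<noteq> 0" by (auto simp: q_def)
  have polar: "q = of_real (norm q) * cis (Arg q)"
    using rcis_cmod_Arg[of q] by (simp add: rcis_def)
  then have "Im q = norm q * sin (Arg q)"
    by (metis Im_complex_of_real Im_rcis rcis_cmod_Arg)
  then have "sin (Arg q) > 0" using q by (simp add: zero_less_mult_iff)
  then have "0 < Arg q"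
    using Arg_bounded[of q] sin_gt_zero[of "- Arg q"] by (cases "Arg q = 0") fastforce+
  then have "\<alpha> = Arg q" using assms(2) by (simp add: hyp_angle_def q_def)
  then have "q = of_real (norm q) * cis \<alpha>" using polar by simp
  moreover have "mob A C = q * mob A B" using nz by (simp add: q_def)
  moreover have "norm q > 0" using q by auto
  ultimately show thesis using that[of "norm q"] nz by metis
qed

text \<open>The product carries A to B to C and back to A, so it is a rotation about A. Its
  multiplier is the product of three constants from \<open>DA_eps\<close>, each determined by the
  image of one vertex.\<close>

lemma three_half_turns:
  assumes T: "angle_triangle t A B C"
    and a: "a \<in> carrier DA" "a B = C" "a C = B"
    and b: "b \<in> carrier DA" "b C = A" "b A = C"
    and c: "c \<in> carrier DA" "c A = B" "c B = A"
  shows "b \<otimes>\<^bsub>DA\<^esub> a \<otimes>\<^bsub>DA\<^esub> c = hyp_rotation A t"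
proof -
  note D = angle_triangleD[OF T]
  obtain \<alpha> \<beta> \<gamma> where h: "hyp_angle A B C = \<alpha>" "hyp_angle B C A = \<beta>" "hyp_angle C A B = \<gamma>" and sum: "\<alpha> + \<beta> + \<gamma> = t"
    using T by (auto simp: angle_triangle_def ccw_triangle_def)
  obtain r1 where r1: "r1 > 0" "mob A C = of_real r1 * cis \<alpha> * mob A B" "mob A B \<noteq> 0"
    using ccw_angle[OF D(4) h(1)] .
  obtain r2 where r2: "r2 > 0" "mob B A = of_real r2 * cis \<beta> * mob B C" "mob B C \<noteq> 0"
    using ccw_angle[OF counterclockwise_cyclic[OF D] h(2)] .
  obtain r3 where r3: "r3 > 0" "mob C B = of_real r3 * cis \<gamma> * mob C A" "mob C A \<noteq> 0"
    using ccw_angle[OF counterclockwise_cyclic[OF D(2,3,1) counterclockwise_cyclic[OF D]] h(3)] .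
  obtain ea where ea: "norm ea = 1" "\<And>z. z \<in> disc \<Longrightarrow> mob C (a z) = ea * mob B z"
    using DA_eps[OF a(1) D(2)] unfolding a(2) by blast
  obtain eb where eb: "norm eb = 1" "\<And>z. z \<in> disc \<Longrightarrow> mob A (b z) = eb * mob C z"
    using DA_eps[OF b(1) D(3)] unfolding b(2) by blast
  obtain ec where ec: "norm ec = 1" "\<And>z. z \<in> disc \<Longrightarrow> mob B (c z) = ec * mob A z"
    using DA_eps[OF c(1) D(1)] unfolding c(2) by blast
  have 1: "mob C B = ea * mob B C" using ea(2)[OF D(3)] a by simp
  have 2: "mob A C = eb * mob C A" using eb(2)[OF D(1)] b by simp
  have 3: "mob B A = ec * mob A B" using ec(2)[OF D(2)] c by simp
  \<comment> \<open>Both sides run over the same three vectors; the angles add up to t, and the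
    positive factors must cancel because the multipliers have modulus 1.\<close>
  have "(ea * eb * ec) * (mob B C * mob C A * mob A B) = mob C B * mob A C * mob B A"
    unfolding 1 2 3 by simp
  also have "\<dots> = of_real (r1 * r2 * r3) * (cis \<alpha> * cis \<beta> * cis \<gamma>) * (mob B C * mob C A * mob A B)"
    unfolding r1(2) r2(2) r3(2) by simp
  finally have e: "ea * eb * ec = of_real (r1 * r2 * r3) * cis t"
    using r1 r2 r3 sum by (simp add: cis_mult add.assoc)
  have "norm (ea * eb * ec) = 1" using ea eb ec by (simp add: norm_mult)
  then have "r1 * r2 * r3 = 1" unfolding e using r1 r2 r3 by (simp add: norm_mult abs_mult)
  then have e': "eb * (ea * ec) = cis t" using e by (simp add: mult_ac)
  have ac: "a \<otimes>\<^bsub>DA\<^esub> c \<in> carrier DA" "b \<otimes>\<^bsub>DA\<^esub> a \<in> carrier DA" "b \<otimes>\<^bsub>DA\<^esub> a \<otimes>\<^bsub>DA\<^esub> c \<in> carrier DA"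
    using a b c by simp_all
  show ?thesis
  proof (rule hyp_rotation_eqI[OF ac(3) D(1)])
    fix z assume z: "z \<in> disc"
    have "(b \<otimes>\<^bsub>DA\<^esub> a \<otimes>\<^bsub>DA\<^esub> c) z = b (a (c z))"
      using a(1) b(1) c(1) ac z by (simp add: DA_mult DA_closed)
    then show "mob A ((b \<otimes>\<^bsub>DA\<^esub> a \<otimes>\<^bsub>DA\<^esub> c) z) = cis t * mob A z"
      using ea(2) eb(2) ec(2) z a b c by (simp add: DA_closed flip: e')
  qed
qed

text \<open>With half-turns a, b, c in the sides, the rotations at A, B, C are the words bac, cba,
  acb, and the fourth is the conjugate of acb by c. Its product with the other three cancels letter
  by letter.\<close>

lemma swap_conj_third:
  assumes T: "angle_triangle t A B C"
    and c: "c \<in> carrier DA" "c A = B" "c B = A"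
  shows "hyp_rotation (c C) t =
    inv\<^bsub>DA\<^esub> (hyp_rotation B t \<otimes>\<^bsub>DA\<^esub> hyp_rotation C t \<otimes>\<^bsub>DA\<^esub> hyp_rotation A t)"
proof -
  note D = angle_triangleD[OF T] and N = angle_triangle_distinct[OF T]
  obtain a where a: "a \<in> carrier DA" "a B = C" "a C = B" using swap_exists[OF D(2,3)] by blast
  obtain b where b: "b \<in> carrier DA" "b C = A" "b A = C" using swap_exists[OF D(3,1)] by blast
  have x: "hyp_rotation A t = b \<otimes>\<^bsub>DA\<^esub> a \<otimes>\<^bsub>DA\<^esub> c"
    by (rule three_half_turns[OF T a b c, symmetric])
  have y: "hyp_rotation B t = c \<otimes>\<^bsub>DA\<^esub> b \<otimes>\<^bsub>DA\<^esub> a"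
    by (rule three_half_turns[OF angle_triangle_cyclic[OF T] b c a, symmetric])
  have z: "hyp_rotation C t = a \<otimes>\<^bsub>DA\<^esub> c \<otimes>\<^bsub>DA\<^esub> b"
    by (rule three_half_turns[OF angle_triangle_cyclic[OF angle_triangle_cyclic[OF T]] c a b, symmetric])
  have aa: "a (a w) = w" and bb: "b (b w) = w" and cc: "c (c w) = w" if "w \<in> disc" for w
    using swap_apply a b c D N that by metis+
  have w: "hyp_rotation (c C) t = c \<otimes>\<^bsub>DA\<^esub> hyp_rotation C t \<otimes>\<^bsub>DA\<^esub> inv\<^bsub>DA\<^esub> c"
    by (rule hyp_rotation_conj[OF c(1) D(3), symmetric])
  have "inv\<^bsub>DA\<^esub> c = c"
    using swap_involution[OF c(1) D(1,2) N(1) c(2,3)] c(1) DA.inv_equality by blast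
  then have "hyp_rotation (c C) t \<otimes>\<^bsub>DA\<^esub> (hyp_rotation B t \<otimes>\<^bsub>DA\<^esub> hyp_rotation C t \<otimes>\<^bsub>DA\<^esub> hyp_rotation A t) = \<one>\<^bsub>DA\<^esub>"
    unfolding w unfolding x y z
    using a(1) b(1) c(1) by (intro DA_eqI) (simp_all add: DA_mult DA_closed aa bb cc DA_one)
  then show ?thesis
    using hyp_rotation_in_DA D DA_closed[OF c(1) D(3)] by (metis DA.inv_equality DA.m_closed)
qed

section \<open>Independence of the group from the tile\<close>

definition vertex_group :: "real \<Rightarrow> complex \<Rightarrow> complex \<Rightarrow> complex \<Rightarrow> (complex \<Rightarrow> complex) set" where
  "vertex_group t A B C = generate DA ((\<lambda>a. hyp_rotation a t) ` {A, B, C})"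

lemma vertex_group_cyclic: "vertex_group t B C A = vertex_group t A B C"
  by (simp add: vertex_group_def insert_commute)

lemma vertex_group_subgroup:
  assumes "A \<in> disc" "B \<in> disc" "C \<in> disc"
  shows "subgroup (vertex_group t A B C) DA"
  unfolding vertex_group_def by (rule DA.generate_is_subgroup) (use assms hyp_rotation_in_DA in auto)

text \<open>A and B are exchanged, and by \<open>swap_conj_third\<close> the rotation at the new
  third vertex is a word in the old three.\<close>

lemma vertex_group_swap_subset:
  assumes T: "angle_triangle t A B C" and c: "c \<in> carrier DA" "c A = B" "c B = A"
  shows "vertex_group t (c A) (c B) (c C) \<subseteq> vertex_group t A B C"
proof -
  note D = angle_triangleD[OF T]
  interpret V: subgroup "vertex_group t A B C" DA by (rule vertex_group_subgroup[OF D(1-3)])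
  have m: "hyp_rotation A t \<in> vertex_group t A B C" "hyp_rotation B t \<in> vertex_group t A B C"
    "hyp_rotation C t \<in> vertex_group t A B C"
    unfolding vertex_group_def by (auto intro: generate.incl)
  have "hyp_rotation (c C) t \<in> vertex_group t A B C"
    unfolding swap_conj_third[OF T c] by (intro V.m_inv_closed V.m_closed m)
  then show ?thesis
    unfolding vertex_group_def[of t "c A"]
    by (intro DA.generate_subgroup_incl V.subgroup_axioms) (use m c in auto)
qed

text \<open>The reverse inclusion is the same one for the image triangle, since c is an
  involution.\<close>

lemma vertex_group_swap:
  assumes T: "angle_triangle t A B C" and c: "c \<in> carrier DA" "c A = B" "c B = A"
  shows "vertex_group t (c A) (c B) (c C) = vertex_group t A B C"
proof (rule subset_antisym[OF vertex_group_swap_subset[OF T c]])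
  note D = angle_triangleD[OF T] and N = angle_triangle_distinct[OF T]
  have cc: "c (c w) = w" if "w \<in> disc" for w
    using swap_apply[OF c(1) D(1,2) N(1) c(2,3) that] .
  have "vertex_group t (c (c A)) (c (c B)) (c (c C)) \<subseteq> vertex_group t (c A) (c B) (c C)"
    by (rule vertex_group_swap_subset[OF angle_triangle_DA[OF c(1) T] c(1)]) (use c in auto)
  then show "vertex_group t A B C \<subseteq> vertex_group t (c A) (c B) (c C)"
    by (simp add: cc D)
qed

lemma tile_vertices_vertex_group:
  assumes T: "angle_triangle t A B C" and "(P, Q, R) \<in> tile_vertices A B C"
  shows "angle_triangle t P Q R \<and> vertex_group t P Q R = vertex_group t A B C"
  using assms(2)
proof (induction P Q R)
  case start
  then show ?case using T by simp
next
  case (turn P Q R m)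
  then have T: "angle_triangle t P Q R" and V: "vertex_group t P Q R = vertex_group t A B C" by auto
  note D = angle_triangleD[OF T]
  have m: "m \<in> disc" using turn(2) by (auto simp: hyp_midpoint_def)
  note h = hyp_rotation_in_DA[OF m, of pi]
  have "vertex_group t (half_turn m P) (half_turn m Q) (half_turn m R) = vertex_group t P Q R"
    using turn(2)
  proof (elim disjE)
    assume "hyp_midpoint P Q m"
    then show ?thesis using vertex_group_swap[OF T h] half_turn_midpoint D by blast
  next
    assume "hyp_midpoint Q R m"
    then show ?thesis
      using vertex_group_swap[OF angle_triangle_cyclic[OF T] h] half_turn_midpoint D vertex_group_cyclic by metis
  next
    assume "hyp_midpoint R P m"
    then show ?thesis
      using vertex_group_swap[OF angle_triangle_cyclic[OF angle_triangle_cyclic[OF T]] h] half_turn_midpoint D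
        vertex_group_cyclic by metis
  qed
  then show ?case using angle_triangle_DA[OF h T] V by simp
qed

text \<open>A triangle of the tiling is known only as a point set, so its vertices are those of a
  generated tile up to order; the group does not see the order.\<close>

lemma tile_vertex_group:
  assumes T: "angle_triangle t A B C" and P: "ccw_triangle P Q R \<alpha> \<beta> \<gamma>" "hyp_triangle P Q R \<in> tiles_from A B C"
  shows "vertex_group t P Q R = vertex_group t A B C"
proof -
  obtain P' Q' R' where t: "(P', Q', R') \<in> tile_vertices A B C" "hyp_triangle P Q R = hyp_triangle P' Q' R'"
    using P(2) by (auto simp: tiles_from_def)
  note h = tile_vertices_vertex_group[OF T t(1)]
  then have "{P, Q, R} = {P', Q', R'}"
    using P(1) angle_triangleD[of t P' Q' R'] t(2)
    by (intro hyp_triangle_eq_imp_vertices_eq) (auto simp: ccw_triangle_def)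
  then show ?thesis using h unfolding vertex_group_def by metis
qed

text \<open>The tile whose rotations generate \<open>\<Gamma>\<close> in \<open>tiling_for\<close>
  and the tile ABC at which the pair is read off may differ; both have the vertex group of the tile
  from which the tiling was generated.\<close>

lemma canonical_tiling_vertex_group:
  assumes "canonical_tiling p \<Gamma> \<T> \<alpha> \<beta> \<gamma>" "ccw_triangle A B C \<alpha> \<beta> \<gamma>" "hyp_triangle A B C \<in> \<T>"
  shows "angle_triangle (2 * pi / real p) A B C" "\<Gamma> = vertex_group (2 * pi / real p) A B C"
proof -
  let ?t = "2 * pi / real p"
  have sum: "\<alpha> + \<beta> + \<gamma> = ?t" using assms(1) by (auto simp: canonical_tiling_def is_tiling_def)
  then show "angle_triangle ?t A B C" using assms(2) by (auto simp: angle_triangle_def)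
  obtain A0 B0 C0 where T0: "ccw_triangle A0 B0 C0 \<alpha> \<beta> \<gamma>" "\<T> = tiles_from A0 B0 C0"
    using assms(1) by (auto simp: canonical_tiling_def is_tiling_def)
  then have T: "angle_triangle ?t A0 B0 C0" using sum by (auto simp: angle_triangle_def)
  obtain P Q R a b c where P: "ccw_triangle P Q R a b c" "hyp_triangle P Q R \<in> \<T>" "\<Gamma> = vertex_group ?t P Q R"
    using assms(1) by (auto simp: canonical_tiling_def tiling_for_def vertex_group_def)
  show "\<Gamma> = vertex_group ?t A B C"
    using tile_vertex_group[OF T] P assms(2,3) T0(2) by metis
qed

section \<open>Fuchsian groups\<close>

lemma Aut_orb_eq_iff:
  assumes S: "riemann_surface S" and G: "subgroup G (Aut S)" and x: "x \<in> points S" "y \<in> points S"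
  shows "orb G x = orb G y \<longleftrightarrow> (\<exists>g\<in>G. y = g x)"
proof -
  interpret A: group "Aut S" by (rule group_Aut[OF S])
  interpret G: subgroup G "Aut S" by (rule G)
  show ?thesis
  proof
    have "\<one>\<^bsub>Aut S\<^esub> y \<in> orb G y" unfolding orb_def using G.one_closed by blast
    then have "y \<in> orb G y" using x by (simp add: one_Aut)
    moreover assume "orb G x = orb G y"
    ultimately show "\<exists>g\<in>G. y = g x" by (auto simp: orb_def)
  next
    assume "\<exists>g\<in>G. y = g x"
    then obtain g where g: "g \<in> G" "y = g x" by blast
    have gc: "g \<in> carrier (Aut S)" using G.mem_carrier[OF g(1)] .
    show "orb G x = orb G y"
    proof (rule subset_antisym; rule subsetI)
      fix v assume "v \<in> orb G x"
      then obtain h where h: "h \<in> G" "v = h x" by (auto simp: orb_def)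
      have "(h \<otimes>\<^bsub>Aut S\<^esub> inv\<^bsub>Aut S\<^esub> g) y = v"
        using Aut_inv_apply[OF S gc x(1)] G.mem_carrier[OF h(1)] gc x g h
        by (subst Aut_mult_apply) simp_all
      moreover have "h \<otimes>\<^bsub>Aut S\<^esub> inv\<^bsub>Aut S\<^esub> g \<in> G" using g h by (intro G.m_closed G.m_inv_closed)
      ultimately show "v \<in> orb G y" unfolding orb_def by (metis imageI)
    next
      fix v assume "v \<in> orb G y"
      then obtain h where h: "h \<in> G" "v = h y" by (auto simp: orb_def)
      have "(h \<otimes>\<^bsub>Aut S\<^esub> g) x = v"
        using G.mem_carrier[OF h(1)] gc x g h by (subst Aut_mult_apply) simp_all
      moreover have "h \<otimes>\<^bsub>Aut S\<^esub> g \<in> G" using g h by (intro G.m_closed)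
      ultimately show "v \<in> orb G x" unfolding orb_def by (metis imageI)
    qed
  qed
qed

lemma disc_orb_eq_iff:
  "subgroup G DA \<Longrightarrow> z \<in> disc \<Longrightarrow> w \<in> disc \<Longrightarrow> orb G z = orb G w \<longleftrightarrow> (\<exists>g\<in>G. w = g z)"
  using Aut_orb_eq_iff[OF riemann_surface_disc, of G z w] by simp

lemma fuchsian_group_subgroup: "fuchsian_group G \<Longrightarrow> subgroup G DA"
  by (simp add: fuchsian_group_def)

lemma fuchsian_group_mem: "fuchsian_group G \<Longrightarrow> g \<in> G \<Longrightarrow> g \<in> carrier DA"
  using fuchsian_group_subgroup subgroup.mem_carrier by metis

lemma fuchsian_group_finite:
  "fuchsian_group G \<Longrightarrow> compact K \<Longrightarrow> K \<subseteq> disc \<Longrightarrow> finite {g \<in> G. g ` K \<inter> K \<noteq> {}}"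
  by (simp add: fuchsian_group_def)

lemma fuchsian_group_subset:
  assumes "fuchsian_group G" "subgroup H DA" "H \<subseteq> G"
  shows "fuchsian_group H"
  unfolding fuchsian_group_def
proof (intro conjI allI impI assms(2))
  fix K :: "complex set" assume K: "compact K \<and> K \<subseteq> disc"
  show "finite {g \<in> H. g ` K \<inter> K \<noteq> {}}"
    by (rule finite_subset[OF _ fuchsian_group_finite[OF assms(1)]]) (use K assms(3) in auto)
qed

text \<open>Each g occurs in the finite set belonging to a closed ball that contains 0 and
  \<open>g 0\<close>, and countably many such balls exhaust the disc. Countability later allows a
  pointwise choice of group elements to be made uniform.\<close>

lemma fuchsian_group_countable:
  assumes "fuchsian_group G"
  shows "countable G"
proof -
  define K where "K n = cball (0::complex) (1 - 1 / real (Suc n))" for n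
  have K: "K n \<subseteq> disc" for n
  proof
    fix x assume "x \<in> K n"
    then have "norm x \<le> 1 - 1 / real (Suc n)" by (simp add: K_def)
    moreover have "1 / real (Suc n) > 0" by simp
    ultimately show "x \<in> disc" unfolding disc_iff by linarith
  qed
  have "G \<subseteq> (\<Union>n. {g \<in> G. g ` K n \<inter> K n \<noteq> {}})"
  proof
    fix g assume g: "g \<in> G"
    have "norm (g 0) < 1"
      using DA_closed[OF fuchsian_group_mem[OF assms g], of 0] by (simp add: disc_iff)
    then obtain n where n: "1 / real (Suc n) < 1 - norm (g 0)"
      using nat_approx_posE[of "1 - norm (g 0)"] by auto
    then have "g 0 \<in> K n" "0 \<in> K n" by (auto simp: K_def)
    then have "g ` K n \<inter> K n \<noteq> {}" by blast
    then show "g \<in> (\<Union>n. {g \<in> G. g ` K n \<inter> K n \<noteq> {}})" using g by blast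
  qed
  moreover have "countable (\<Union>n. {g \<in> G. g ` K n \<inter> K n \<noteq> {}})"
  proof (rule countable_UN)
    fix n
    have "compact (K n)" by (simp add: K_def)
    then show "countable {g \<in> G. g ` K n \<inter> K n \<noteq> {}}"
      by (intro countable_finite fuchsian_group_finite[OF assms _ K])
  qed simp
  ultimately show ?thesis by (rule countable_subset)
qed

lemma DA_isCont: "g \<in> carrier DA \<Longrightarrow> z \<in> disc \<Longrightarrow> isCont g z"
  using holomorphic_on_imp_continuous_on[OF DA_holo] continuous_on_interior[of disc g z] by simp

text \<open>Only finitely many elements let a closed ball about z meet its image; for each of them
  that moves z, a smaller radius separates ball and image by continuity.\<close>

lemma fuchsian_group_nbhd:
  assumes G: "fuchsian_group G" and z: "z \<in> disc"
  obtains e where "e > 0" "ball z e \<subseteq> disc"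
    "\<And>g w. g \<in> G \<Longrightarrow> w \<in> ball z e \<Longrightarrow> g w \<in> ball z e \<Longrightarrow> g z = z"
proof -
  define r where "r = (1 - norm z) / 2"
  have r: "r > 0" using z by (simp add: r_def disc_iff)
  have K: "cball z r \<subseteq> disc"
  proof
    fix w assume "w \<in> cball z r"
    then have "norm w \<le> norm z + r"
      using norm_triangle_ineq4[of z "z - w"] by (simp add: dist_norm)
    moreover have "r + r = 1 - norm z" by (simp add: r_def)
    ultimately show "w \<in> disc" using r unfolding disc_iff by linarith
  qed
  define F where "F = {g \<in> G. g ` cball z r \<inter> cball z r \<noteq> {}}"
  have F: "finite F" unfolding F_def by (rule fuchsian_group_finite[OF G _ K]) auto
  have "\<exists>e>0. g z \<noteq> z \<longrightarrow> (\<forall>w\<in>disc. w \<in> ball z e \<longrightarrow> g w \<notin> ball z e)" if "g \<in> F" for g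
  proof (cases "g z = z")
    case False
    have "g \<in> G" using that by (simp add: F_def)
    then have "isCont g z" by (rule DA_isCont[OF fuchsian_group_mem[OF G] z])
    then obtain d where d: "d > 0" "\<And>w. dist w z < d \<Longrightarrow> dist (g w) (g z) < dist (g z) z / 2"
      using False unfolding continuous_at_eps_delta
      by (metis half_gt_zero zero_less_dist_iff)
    have "g w \<notin> ball z (min d (dist (g z) z / 2))" if "w \<in> ball z (min d (dist (g z) z / 2))" for w
    proof
      assume "g w \<in> ball z (min d (dist (g z) z / 2))"
      then have "dist (g w) z < dist (g z) z / 2" by (simp add: mem_ball dist_commute)
      moreover have "dist (g w) (g z) < dist (g z) z / 2"
        using that by (intro d(2)) (simp add: mem_ball dist_commute)
      ultimately show False
        using dist_triangle[of "g z" z "g w"] by (simp add: dist_commute)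
    qed
    then show ?thesis
      using d(1) False by (intro exI[of _ "min d (dist (g z) z / 2)"]) auto
  qed (auto intro!: exI[of _ 1])
  then obtain e where e: "\<And>g. g \<in> F \<Longrightarrow> e g > 0"
    "\<And>g w. g \<in> F \<Longrightarrow> g z \<noteq> z \<Longrightarrow> w \<in> disc \<Longrightarrow> w \<in> ball z (e g) \<Longrightarrow> g w \<notin> ball z (e g)"
    by metis
  define d where "d = Min (insert r (e ` F))"
  have d: "d > 0" "d \<le> r" "\<And>g. g \<in> F \<Longrightarrow> d \<le> e g"
    using F e(1) r by (auto simp: d_def)
  show thesis
  proof (rule that[OF d(1)])
    show sub: "ball z d \<subseteq> disc"
      using K d(2) by (meson ball_subset_cball order_trans subset_ball)
    fix g w assume g: "g \<in> G" "w \<in> ball z d" "g w \<in> ball z d"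
    then have "w \<in> cball z r" "g w \<in> cball z r" using d(2) by (auto simp: mem_ball)
    then have "g w \<in> g ` cball z r \<inter> cball z r" by blast
    then have gF: "g \<in> F" using g(1) unfolding F_def by blast
    have "w \<in> ball z (e g)" "g w \<in> ball z (e g)"
      using g d(3)[OF gF] by (auto simp: mem_ball)
    then show "g z = z" using e(2)[OF gF _ _] sub g(2) by blast
  qed
qed

lemma DA_open_image:
  assumes "g \<in> carrier DA" "open W" "W \<subseteq> disc"
  shows "open (g ` W)"
  by (rule open_mapping_thm3[OF holomorphic_on_subset[OF DA_holo[OF assms(1)] assms(3)] assms(2)
        inj_on_subset[OF DA_inj[OF assms(1)] assms(3)]])

section \<open>Quotients of parametrized surfaces\<close>

text \<open>The properties of a holomorphic covering by the disc that are used for passing to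
  quotients, chosen so that the identity of the disc and the projection to S both have them.\<close>

definition disc_param :: "'a surface \<Rightarrow> (complex \<Rightarrow> 'a) \<Rightarrow> bool" where
  "disc_param S \<pi> \<longleftrightarrow>
     charts_ok S \<and> continuous_map (top_of_set disc) (surf_top S) \<pi> \<and>
     open_map (top_of_set disc) (surf_top S) \<pi> \<and> \<pi> ` disc = points S \<and>
     (\<forall>(U, \<phi>) \<in> atlas S. (\<phi> \<circ> \<pi>) holomorphic_on {z \<in> disc. \<pi> z \<in> U}) \<and>
     (\<forall>z\<in>disc. \<exists>e>0. ball z e \<subseteq> disc \<and> inj_on \<pi> (ball z e))"

lemma disc_paramD:
  assumes "disc_param S \<pi>"
  shows "charts_ok S" "continuous_map (top_of_set disc) (surf_top S) \<pi>"
    "open_map (top_of_set disc) (surf_top S) \<pi>" "\<pi> ` disc = points S"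
    "\<And>U \<phi>. (U, \<phi>) \<in> atlas S \<Longrightarrow> (\<phi> \<circ> \<pi>) holomorphic_on {z \<in> disc. \<pi> z \<in> U}"
    "\<And>z. z \<in> disc \<Longrightarrow> \<exists>e>0. ball z e \<subseteq> disc \<and> inj_on \<pi> (ball z e)"
  using assms unfolding disc_param_def by blast+

lemma disc_param_id: "disc_param disc_surface (\<lambda>z. z)"
proof -
  have "open_map (top_of_set disc) (top_of_set disc) (\<lambda>z. z)"
    by (simp add: open_map_def)
  moreover have "\<exists>e>0. ball z e \<subseteq> disc \<and> inj_on (\<lambda>z. z) (ball z e)" if "z \<in> disc" for z
    using that openE[OF open_ball that] by (auto simp: inj_on_def)
  ultimately show ?thesis
    using riemann_surface_charts_ok[OF riemann_surface_disc]
    by (simp add: disc_param_def) (auto simp: disc_surface_def o_def intro!: holomorphic_intros)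
qed

text \<open>Used twice: for the disc itself and \<open>\<Gamma>s\<close>, which gives S as a
  quotient, and for S and a finite group G, which presents S/G as the quotient of the disc by the
  lifts of G.\<close>

locale disc_quotient =
  fixes S :: "'a surface" and \<pi> :: "complex \<Rightarrow> 'a" and G :: "('a \<Rightarrow> 'a) set" and \<Gamma> :: "(complex \<Rightarrow> complex) set"
  assumes param: "disc_param S \<pi>" and subgroup: "subgroup \<Gamma> DA"
    and orbits: "\<And>z w. z \<in> disc \<Longrightarrow> w \<in> disc \<Longrightarrow> orb G (\<pi> z) = orb G (\<pi> w) \<longleftrightarrow> (\<exists>g\<in>\<Gamma>. w = g z)"
begin

sublocale \<Gamma>: subgroup \<Gamma> DA by (rule subgroup)

abbreviation Q where "Q \<equiv> quotient_topology (surf_top S) (orb G)"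

definition q :: "complex \<Rightarrow> 'a set" where "q z = orb G (\<pi> z)"

lemma q_eq_iff: "z \<in> disc \<Longrightarrow> w \<in> disc \<Longrightarrow> q z = q w \<longleftrightarrow> (\<exists>g\<in>\<Gamma>. w = g z)"
  by (simp add: q_def orbits)

lemma q_DA: "g \<in> \<Gamma> \<Longrightarrow> z \<in> disc \<Longrightarrow> q (g z) = q z"
  using q_eq_iff[of z "g z"] DA_closed[of g z] by auto

lemma \<pi>_points: "z \<in> disc \<Longrightarrow> \<pi> z \<in> points S"
  using disc_paramD(4)[OF param] by auto

lemma q_image: "q ` disc = topspace Q"
  using disc_paramD(4)[OF param] unfolding topspace_quotient_topology q_def by (metis image_image)

lemma q_continuous: "continuous_map (top_of_set disc) Q q"
proof -
  have "continuous_map (top_of_set disc) Q (orb G \<circ> \<pi>)"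
    by (rule continuous_map_compose[OF disc_paramD(2)[OF param]
          quotient_imp_continuous_map[OF quotient_map_quotient_topology]])
  then show ?thesis by (simp add: q_def[abs_def] o_def)
qed

lemma q_open:
  assumes W: "open W" "W \<subseteq> disc"
  shows "openin Q (q ` W)"
  unfolding openin_quotient_topology
proof
  show "q ` W \<subseteq> orb G ` points S" using W \<pi>_points by (auto simp: q_def)
  have "{x \<in> points S. orb G x \<in> q ` W} = \<pi> ` (\<Union>g\<in>\<Gamma>. g ` W)"
  proof (rule subset_antisym; rule subsetI)
    fix x assume "x \<in> {x \<in> points S. orb G x \<in> q ` W}"
    then have x: "x \<in> points S" "orb G x \<in> q ` W" by simp_all
    from x(1) obtain v where v: "v \<in> disc" "x = \<pi> v"
      unfolding disc_paramD(4)[OF param, symmetric] by (rule imageE) simp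
    from x(2) obtain w where w: "w \<in> W" "q v = q w"
      unfolding v(2) q_def by blast
    then obtain g where "g \<in> \<Gamma>" "v = g w"
      using q_eq_iff[of w v] W(2) v by auto
    then show "x \<in> \<pi> ` (\<Union>g\<in>\<Gamma>. g ` W)" using v w by blast
  next
    fix x assume "x \<in> \<pi> ` (\<Union>g\<in>\<Gamma>. g ` W)"
    then obtain g w where g: "g \<in> \<Gamma>" "w \<in> W" "x = \<pi> (g w)" by blast
    then have w: "w \<in> disc" using W(2) by blast
    have "orb G x = q w" using q_DA[OF g(1) w] g(3) by (simp add: q_def)
    moreover have "x \<in> points S" using g \<pi>_points DA_closed[OF \<Gamma>.mem_carrier[OF g(1)] w] by simp
    ultimately show "x \<in> {x \<in> points S. orb G x \<in> q ` W}" using g(2) by blast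
  qed
  moreover have "openin (surf_top S) (\<pi> ` (\<Union>g\<in>\<Gamma>. g ` W))"
  proof -
    have o: "open (\<Union>g\<in>\<Gamma>. g ` W)"
      by (intro open_UN ballI DA_open_image[OF _ W]) (rule \<Gamma>.mem_carrier)
    have "(\<Union>g\<in>\<Gamma>. g ` W) \<subseteq> disc"
      using W(2) DA_closed[OF \<Gamma>.mem_carrier] by blast
    then have "openin (top_of_set disc) (\<Union>g\<in>\<Gamma>. g ` W)"
      using o by (simp add: openin_open_eq)
    then show ?thesis using disc_paramD(3)[OF param] by (simp add: open_map_def)
  qed
  ultimately show "openin (surf_top S) {x \<in> points S. orb G x \<in> q ` W}" by simp
qed

lemma q_open_map: "open_map (top_of_set disc) Q q"
  using q_open unfolding open_map_def by (simp add: openin_open_eq)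

text \<open>A region on which the projection \<open>q\<close> is injective because no element other
  than the identity returns to it; points with nontrivial stabilizer lie in no such region.\<close>

definition free_set :: "complex set \<Rightarrow> bool" where
  "free_set B \<longleftrightarrow> open B \<and> B \<subseteq> disc \<and> (\<forall>g\<in>\<Gamma>. \<forall>z\<in>B. g z \<in> B \<longrightarrow> g = \<one>\<^bsub>DA\<^esub>)"

lemma q_inj_on_free:
  assumes "free_set B"
  shows "inj_on q B"
proof (rule inj_onI)
  fix z w assume zw: "z \<in> B" "w \<in> B" "q z = q w"
  then have d: "z \<in> disc" "w \<in> disc" using assms by (auto simp: free_set_def)
  then obtain g where "g \<in> \<Gamma>" "w = g z" using q_eq_iff zw(3) by blast
  then show "z = w" using assms zw d by (auto simp: free_set_def DA_one)
qed

text \<open>\<open>quotient_surface\<close> admits every topological chart that is holomorphic after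
  the projection, so membership has to be proved for the inverse of \<open>q\<close> on a free set.
  These are the charts used throughout, hence the separate treatment of branch points.\<close>

lemma quotient_chart:
  assumes B: "free_set B"
  shows "(q ` B, inv_into B q) \<in> atlas (quotient_surface S G)"
proof -
  have oB: "open B" and sB: "B \<subseteq> disc" using B by (auto simp: free_set_def)
  define \<psi> where "\<psi> = inv_into B q"
  have psi: "\<psi> (q z) = z" if "z \<in> B" for z
    using q_inj_on_free[OF B] that by (simp add: \<psi>_def)
  have im: "\<psi> ` (q ` B) = B" using psi by force
  have oV: "openin Q (q ` B)" by (rule q_open[OF oB sB])
  have chart: "complex_chart Q (q ` B) \<psi>"
    unfolding complex_chart_def im
  proof (intro conjI oV oB)
    have tV: "topspace (subtopology Q (q ` B)) = q ` B"
      using openin_subset[OF oV] by auto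
    have "homeomorphic_map (top_of_set B) (subtopology Q (q ` B)) q"
    proof (rule bijective_open_imp_homeomorphic_map)
      have "continuous_map (subtopology (top_of_set disc) B) Q q"
        by (rule continuous_map_from_subtopology[OF q_continuous])
      then show "continuous_map (top_of_set B) (subtopology Q (q ` B)) q"
        using sB by (simp add: continuous_map_in_subtopology subtopology_subtopology inf.absorb2)
      show "open_map (top_of_set B) (subtopology Q (q ` B)) q"
        unfolding open_map_def
      proof (intro allI impI)
        fix W assume "openin (top_of_set B) W"
        then have W: "open W" "W \<subseteq> B" using oB by (auto simp: openin_open_eq)
        then have "openin Q (q ` W)" using q_open sB by blast
        then show "openin (subtopology Q (q ` B)) (q ` W)"
          using W(2) openin_subset_topspace_eq by (auto simp: openin_open_subtopology[OF oV])
      qed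
      show "q ` topspace (top_of_set B) = topspace (subtopology Q (q ` B))" using tV by simp
      show "inj_on q (topspace (top_of_set B))" using q_inj_on_free[OF B] by simp
    qed
    then obtain k where k: "homeomorphic_maps (top_of_set B) (subtopology Q (q ` B)) q k"
      unfolding homeomorphic_map_maps by blast
    have "homeomorphic_map (subtopology Q (q ` B)) (top_of_set B) k"
      using k homeomorphic_maps_sym homeomorphic_map_maps by blast
    then show "homeomorphic_map (subtopology Q (q ` B)) (top_of_set B) \<psi>"
    proof (rule homeomorphic_map_eq)
      fix x assume "x \<in> topspace (subtopology Q (q ` B))"
      then obtain z where "z \<in> B" "x = q z" unfolding tV by blast
      then show "k x = \<psi> x" using k psi by (simp add: homeomorphic_maps_def)
    qed
  qed
  have "(\<psi> \<circ> orb G \<circ> inv_into U \<phi>) holomorphic_on \<phi> ` {x \<in> U. orb G x \<in> q ` B}" if U: "(U, \<phi>) \<in> atlas S" for U \<phi>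
  proof (rule holomorphic_on_locally)
    have cU: "complex_chart (surf_top S) U \<phi>" by (rule charts_okD[OF disc_paramD(1)[OF param] U])
    fix y assume "y \<in> \<phi> ` {x \<in> U. orb G x \<in> q ` B}"
    then obtain x b where x: "x \<in> U" "y = \<phi> x" "b \<in> B" "orb G x = q b" by blast
    have "x \<in> points S" using x(1) complex_chart_subset[OF cU] by blast
    then obtain w where w: "w \<in> disc" "x = \<pi> w" using disc_paramD(4)[OF param] by (metis imageE)
    have bd: "b \<in> disc" using x(3) sB by blast
    have "q w = q b" using x(4) w(2) by (simp add: q_def)
    then obtain g where g: "g \<in> \<Gamma>" "b = g w" using q_eq_iff[OF w(1) bd] by blast
    note gc = \<Gamma>.mem_carrier[OF g(1)]
    obtain e where e: "e > 0" "ball w e \<subseteq> disc" "inj_on \<pi> (ball w e)"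
      using disc_paramD(6)[OF param w(1)] by blast
    define D where "D = {z \<in> disc. \<pi> z \<in> U}"
    have "openin (top_of_set disc) D"
      unfolding D_def
      using openin_continuous_map_preimage[OF disc_paramD(2)[OF param], of U] cU by (simp add: complex_chart_def)
    then have oD: "open D" by (simp add: openin_open_eq)
    have "continuous_on (ball w e) g"
      using holomorphic_on_imp_continuous_on[OF DA_holo[OF gc]] e(2) continuous_on_subset by blast
    then have "open (g -` B \<inter> ball w e)"
      by (simp add: continuous_on_open_vimage oB)
    then have oN: "open (D \<inter> (g -` B \<inter> ball w e))" using oD by blast
    define N where "N = D \<inter> (g -` B \<inter> ball w e)"
    have wN: "w \<in> N" using w x g e by (simp add: N_def D_def)
    have hN: "(\<phi> \<circ> \<pi>) holomorphic_on N"
      by (rule holomorphic_on_subset[OF disc_paramD(5)[OF param U]]) (auto simp: N_def D_def)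
    have iN: "inj_on (\<phi> \<circ> \<pi>) N"
    proof (rule comp_inj_on)
      show "inj_on \<pi> N" by (rule inj_on_subset[OF e(3)]) (auto simp: N_def)
      show "inj_on \<phi> (\<pi> ` N)" by (rule inj_on_subset[OF complex_chart_inj_on[OF cU]]) (auto simp: N_def D_def)
    qed
    have oN: "open N" using oN by (simp add: N_def)
    obtain k where k: "k holomorphic_on (\<phi> \<circ> \<pi>) ` N" "\<And>z. z \<in> N \<Longrightarrow> k ((\<phi> \<circ> \<pi>) z) = z"
      using holomorphic_has_inverse[OF hN oN iN] by metis
    \<comment> \<open>Near y the new chart reads g composed with a local inverse k of the
      parametrization; g corrects for the chosen preimage w possibly lying outside B.\<close>
    have "(g \<circ> k) holomorphic_on (\<phi> \<circ> \<pi>) ` N"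
    proof (rule holomorphic_on_compose_gen[OF k(1) DA_holo[OF gc]])
      show "k ` ((\<phi> \<circ> \<pi>) ` N) \<subseteq> disc" using k(2) e(2) by (auto simp: N_def D_def)
    qed
    then have "(\<psi> \<circ> orb G \<circ> inv_into U \<phi>) holomorphic_on (\<phi> \<circ> \<pi>) ` N"
    proof (rule holomorphic_transform)
      fix v assume "v \<in> (\<phi> \<circ> \<pi>) ` N"
      then obtain z where z: "z \<in> N" "v = \<phi> (\<pi> z)" by auto
      have zz: "z \<in> disc" "\<pi> z \<in> U" "g z \<in> B" using z(1) by (auto simp: N_def D_def)
      have "inv_into U \<phi> v = \<pi> z" using complex_chart_inj_on[OF cU] zz z by simp
      then have "(\<psi> \<circ> orb G \<circ> inv_into U \<phi>) v = \<psi> (q z)" by (simp add: q_def)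
      also have "\<dots> = \<psi> (q (g z))" using q_DA[OF g(1) zz(1)] by simp
      also have "\<dots> = g z" by (rule psi[OF zz(3)])
      finally show "(g \<circ> k) v = (\<psi> \<circ> orb G \<circ> inv_into U \<phi>) v" using k(2)[OF z(1)] z(2) by simp
    qed
    moreover have "open ((\<phi> \<circ> \<pi>) ` N)" by (rule open_mapping_thm3[OF hN oN iN])
    moreover have "y \<in> (\<phi> \<circ> \<pi>) ` N" using wN w x by auto
    ultimately show "\<exists>N. open N \<and> y \<in> N \<and> (\<psi> \<circ> orb G \<circ> inv_into U \<phi>) holomorphic_on N"
      by blast
  qed
  with chart show ?thesis
    unfolding quotient_surface_def \<psi>_def by auto
qed

lemma quotient_holomorphic:
  assumes B: "free_set B" and b: "holomorphic_map (quotient_surface S G) R b" and V: "(V, \<rho>) \<in> atlas R"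
  shows "(\<lambda>z. \<rho> (b (q z))) holomorphic_on {z \<in> B. b (q z) \<in> V}"
proof -
  define \<psi> where "\<psi> = inv_into B q"
  have psi: "\<psi> (q z) = z" if "z \<in> B" for z
    using q_inj_on_free[OF B] that by (simp add: \<psi>_def)
  have inj: "inj_on \<psi> (q ` B)" using psi by (auto simp: inj_on_def)
  have "(\<rho> \<circ> b \<circ> inv_into (q ` B) \<psi>) holomorphic_on \<psi> ` {x \<in> q ` B. b x \<in> V}"
    using b V quotient_chart[OF B] unfolding holomorphic_map_def \<psi>_def by blast
  moreover have "\<psi> ` {x \<in> q ` B. b x \<in> V} = {z \<in> B. b (q z) \<in> V}"
    using psi by force
  ultimately have "(\<rho> \<circ> b \<circ> inv_into (q ` B) \<psi>) holomorphic_on {z \<in> B. b (q z) \<in> V}"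
    by simp
  then show ?thesis
  proof (rule holomorphic_transform)
    fix z assume "z \<in> {z \<in> B. b (q z) \<in> V}"
    then have "z \<in> B" by simp
    then have "inv_into (q ` B) \<psi> z = q z"
      using inv_into_f_f[OF inj, of "q z"] psi by auto
    then show "(\<rho> \<circ> b \<circ> inv_into (q ` B) \<psi>) z = \<rho> (b (q z))" by simp
  qed
qed

lemma surf_top_quotient: "surf_top (quotient_surface S G) = Q"
  by (simp add: quotient_surface_def)

lemma composite_continuous:
  assumes "biholomorphic_map (quotient_surface S G) R b"
  shows "continuous_map (top_of_set disc) (surf_top R) (b \<circ> q)"
  by (rule continuous_map_compose[OF q_continuous])
    (use assms in \<open>simp add: biholomorphic_map_def holomorphic_map_def surf_top_quotient\<close>)

lemma composite_image:
  assumes "biholomorphic_map (quotient_surface S G) R b"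
  shows "(b \<circ> q) ` disc = points R"
  using assms unfolding image_comp[symmetric] q_image
  by (simp add: biholomorphic_map_def surf_top_quotient bij_betw_def)

lemma composite_open_map:
  assumes b: "biholomorphic_map (quotient_surface S G) R b"
  shows "open_map (top_of_set disc) (surf_top R) (b \<circ> q)"
proof (rule open_map_compose[OF q_open_map])
  have bij: "bij_betw b (topspace Q) (points R)"
    and c: "continuous_map (surf_top R) Q (inv_into (topspace Q) b)"
    using b by (auto simp: biholomorphic_map_def holomorphic_map_def surf_top_quotient)
  show "open_map Q (surf_top R) b"
    unfolding open_map_def
  proof (intro allI impI)
    fix W assume W: "openin Q W"
    have sW: "W \<subseteq> topspace Q" by (rule openin_subset[OF W])
    have "b ` W = {y \<in> points R. inv_into (topspace Q) b y \<in> W}"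
    proof (rule subset_antisym; rule subsetI)
      fix y assume "y \<in> b ` W"
      then show "y \<in> {y \<in> points R. inv_into (topspace Q) b y \<in> W}"
        using bij sW by (auto simp: bij_betw_def subset_iff)
    next
      fix y assume y: "y \<in> {y \<in> points R. inv_into (topspace Q) b y \<in> W}"
      then have "b (inv_into (topspace Q) b y) = y"
        using bij by (simp add: bij_betw_def f_inv_into_f)
      then show "y \<in> b ` W" using y by (metis (mono_tags, lifting) imageI mem_Collect_eq)
    qed
    then show "openin (surf_top R) (b ` W)"
      using openin_continuous_map_preimage[OF c W] by simp
  qed
qed

lemma composite_eq_iff:
  assumes b: "biholomorphic_map (quotient_surface S G) R b" and z: "z \<in> disc" "w \<in> disc"
  shows "b (q z) = b (q w) \<longleftrightarrow> (\<exists>g\<in>\<Gamma>. w = g z)"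
proof -
  have "inj_on b (topspace Q)"
    using b by (simp add: biholomorphic_map_def surf_top_quotient bij_betw_def)
  then have "b (q z) = b (q w) \<longleftrightarrow> q z = q w"
    using z q_image inj_on_eq_iff by (metis imageI)
  then show ?thesis using q_eq_iff[OF z] by simp
qed

end

section \<open>Lifting automorphisms\<close>

lemma fsigma_ball: "fsigma (ball (c :: complex) r)"
proof -
  have "ball c r = (\<Union>n. cball c (r - 1 / real (Suc n)))"
  proof (rule subset_antisym; rule subsetI)
    fix x assume "x \<in> ball c r"
    then have "0 < r - dist c x" by (simp add: mem_ball)
    then obtain n where "1 / real (Suc n) < r - dist c x" by (rule nat_approx_posE)
    then have "x \<in> cball c (r - 1 / real (Suc n))" by simp
    then show "x \<in> (\<Union>n. cball c (r - 1 / real (Suc n)))" by blast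
  next
    fix x assume "x \<in> (\<Union>n. cball c (r - 1 / real (Suc n)))"
    then obtain n where "dist c x \<le> r - 1 / real (Suc n)" by auto
    moreover have "1 / real (Suc n) > 0" by simp
    ultimately show "x \<in> ball c r" unfolding mem_ball by linarith
  qed
  also have "fsigma \<dots>" by (rule fsigma.intros) simp
  finally show ?thesis .
qed

text \<open>Otherwise every zero set is countable, and countably many of them cannot cover a ball.
  It turns a choice of i that may vary with z into a single choice.\<close>

lemma countable_holomorphic_zero:
  fixes h :: "'i \<Rightarrow> complex \<Rightarrow> complex"
  assumes "countable I" "0 < r"
    and hol: "\<And>i. i \<in> I \<Longrightarrow> h i holomorphic_on ball c r"
    and zero: "\<And>z. z \<in> ball c r \<Longrightarrow> \<exists>i\<in>I. h i z = 0"
  obtains i where "i \<in> I" "\<And>z. z \<in> ball c r \<Longrightarrow> h i z = 0"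
proof (rule ccontr)
  note found = that
  assume no: "\<not> thesis"
  have cnt: "countable {z \<in> ball c r. h i z = 0}" if i: "i \<in> I" for i
  proof (cases "h i constant_on ball c r")
    case True
    then obtain d where c: "\<And>z. z \<in> ball c r \<Longrightarrow> h i z = d" by (auto simp: constant_on_def)
    have "d \<noteq> 0"
    proof
      assume "d = 0"
      with c have "thesis" by (intro found[OF i]) simp
      with no show False ..
    qed
    then have "{z \<in> ball c r. h i z = 0} = {}" using c by auto
    then show ?thesis by (metis countable_empty)
  next
    case False
    then show ?thesis
      by (rule holomorphic_countable_zeros[OF hol[OF i] open_ball connected_ball fsigma_ball])
  qed
  have "countable (\<Union>i\<in>I. {z \<in> ball c r. h i z = 0})"
    by (rule countable_UN[OF assms(1) cnt])
  moreover have "ball c r \<subseteq> (\<Union>i\<in>I. {z \<in> ball c r. h i z = 0})"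
  proof
    fix z assume z: "z \<in> ball c r"
    from zero[OF z] obtain i where "i \<in> I" "h i z = 0" by (rule bexE)
    then show "z \<in> (\<Union>i\<in>I. {z \<in> ball c r. h i z = 0})" using z by blast
  qed
  ultimately have "countable (ball c r)" by (rule countable_subset[rotated])
  moreover have "uncountable (ball c r)" by (rule uncountable_ball[OF assms(2)])
  ultimately show False by contradiction
qed

text \<open>G is countable, so \<open>countable_holomorphic_zero\<close> applies to the differences
  of F and the composites of g with H.\<close>

lemma fuchsian_pointwise:
  assumes G: "fuchsian_group G" and F: "F holomorphic_on disc" "H holomorphic_on disc" "\<And>z. z \<in> disc \<Longrightarrow> H z \<in> disc"
    and ex: "\<And>z. z \<in> disc \<Longrightarrow> \<exists>g\<in>G. F z = g (H z)"
  obtains g where "g \<in> G" "\<And>z. z \<in> disc \<Longrightarrow> F z = g (H z)"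
proof -
  obtain g where "g \<in> G" "\<And>z. z \<in> disc \<Longrightarrow> F z - g (H z) = 0"
  proof (rule countable_holomorphic_zero[of G 1 "\<lambda>g z. F z - g (H z)" 0])
    show "countable G" by (rule fuchsian_group_countable[OF G])
    show "\<exists>g\<in>G. F z - g (H z) = 0" if "z \<in> disc" for z using ex[OF that] by auto
    show "(\<lambda>z. F z - g (H z)) holomorphic_on disc" if "g \<in> G" for g
      by (intro holomorphic_on_diff F(1))
        (rule holomorphic_on_disc_comp[OF F(2,3) DA_holo[OF fuchsian_group_mem[OF G that]]])
  qed auto
  then show thesis using that by simp
qed

lemma holomorphic_map_disc_param:
  assumes P: "disc_param S \<pi>" and f: "holomorphic_map S R f" and V: "(V, \<rho>) \<in> atlas R"
    and R: "charts_ok R" and S: "riemann_surface S"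
  shows "open {z \<in> disc. f (\<pi> z) \<in> V}" "(\<lambda>z. \<rho> (f (\<pi> z))) holomorphic_on {z \<in> disc. f (\<pi> z) \<in> V}"
proof -
  have cfp: "continuous_map (top_of_set disc) (surf_top R) (f \<circ> \<pi>)"
    by (rule continuous_map_compose[OF disc_paramD(2)[OF P]]) (use f in \<open>simp add: holomorphic_map_def\<close>)
  have oV: "openin (surf_top R) V" using charts_okD[OF R V] by (simp add: complex_chart_def)
  have o: "open {z \<in> disc. f (\<pi> z) \<in> V}"
    using openin_continuous_map_preimage[OF cfp oV] by (simp add: openin_open_eq)
  then show "open {z \<in> disc. f (\<pi> z) \<in> V}" .
  show "(\<lambda>z. \<rho> (f (\<pi> z))) holomorphic_on {z \<in> disc. f (\<pi> z) \<in> V}"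
  proof (rule holomorphic_on_locally)
    fix w assume w: "w \<in> {z \<in> disc. f (\<pi> z) \<in> V}"
    then have "\<pi> w \<in> points S" using disc_paramD(4)[OF P] by blast
    then obtain U \<phi> where U: "(U, \<phi>) \<in> atlas S" "\<pi> w \<in> U" by (rule riemann_surface_cover[OF S])
    note cU = charts_okD[OF disc_paramD(1)[OF P] U(1)]
    define N where "N = {z \<in> disc. \<pi> z \<in> U} \<inter> {z \<in> disc. f (\<pi> z) \<in> V}"
    have "open {z \<in> disc. \<pi> z \<in> U}"
      using openin_continuous_map_preimage[OF disc_paramD(2)[OF P], of U] cU by (simp add: complex_chart_def openin_open_eq)
    then have oN: "open N" using o by (simp add: N_def open_Int)
    have h1: "(\<rho> \<circ> f \<circ> inv_into U \<phi>) holomorphic_on \<phi> ` {x \<in> U. f x \<in> V}"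
      using f U V unfolding holomorphic_map_def by blast
    have h2: "(\<phi> \<circ> \<pi>) holomorphic_on N"
      by (rule holomorphic_on_subset[OF disc_paramD(5)[OF P U(1)]]) (auto simp: N_def)
    have "((\<rho> \<circ> f \<circ> inv_into U \<phi>) \<circ> (\<phi> \<circ> \<pi>)) holomorphic_on N"
      by (rule holomorphic_on_compose_gen[OF h2 h1]) (auto simp: N_def)
    then have "(\<lambda>z. \<rho> (f (\<pi> z))) holomorphic_on N"
    proof (rule holomorphic_transform)
      fix z assume "z \<in> N"
      then have "inv_into U \<phi> (\<phi> (\<pi> z)) = \<pi> z"
        by (intro inv_into_f_f[OF complex_chart_inj_on[OF cU]]) (simp add: N_def)
      then show "((\<rho> \<circ> f \<circ> inv_into U \<phi>) \<circ> (\<phi> \<circ> \<pi>)) z = \<rho> (f (\<pi> z))" by simp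
    qed
    moreover have "w \<in> N" using w U by (simp add: N_def)
    ultimately show "\<exists>N. open N \<and> w \<in> N \<and> (\<lambda>z. \<rho> (f (\<pi> z))) holomorphic_on N" using oN by blast
  qed
qed

lemma disc_param_local_inverse:
  assumes P: "disc_param S \<pi>" and S: "riemann_surface S" and w: "w \<in> disc" and O: "open W" "w \<in> W"
    and U: "(U, \<phi>) \<in> atlas S" "\<pi> w \<in> U"
  obtains N k where "open N" "w \<in> N" "N \<subseteq> W" "N \<subseteq> disc" "\<And>z. z \<in> N \<Longrightarrow> \<pi> z \<in> U" "inj_on \<pi> N"
    "open ((\<lambda>z. \<phi> (\<pi> z)) ` N)" "k holomorphic_on (\<lambda>z. \<phi> (\<pi> z)) ` N" "\<And>z. z \<in> N \<Longrightarrow> k (\<phi> (\<pi> z)) = z"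
proof -
  note cU = charts_okD[OF disc_paramD(1)[OF P] U(1)]
  obtain e where e: "e > 0" "ball w e \<subseteq> disc" "inj_on \<pi> (ball w e)"
    using disc_paramD(6)[OF P w] by blast
  define N where "N = {z \<in> disc. \<pi> z \<in> U} \<inter> ball w e \<inter> W"
  have "open {z \<in> disc. \<pi> z \<in> U}"
    using openin_continuous_map_preimage[OF disc_paramD(2)[OF P], of U] cU by (simp add: complex_chart_def openin_open_eq)
  then have oN: "open N" using O by (simp add: N_def open_Int)
  have hN: "(\<phi> \<circ> \<pi>) holomorphic_on N"
    by (rule holomorphic_on_subset[OF disc_paramD(5)[OF P U(1)]]) (auto simp: N_def)
  have ip: "inj_on \<pi> N" by (rule inj_on_subset[OF e(3)]) (auto simp: N_def)
  have iN: "inj_on (\<phi> \<circ> \<pi>) N"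
    by (rule comp_inj_on[OF ip inj_on_subset[OF complex_chart_inj_on[OF cU]]]) (auto simp: N_def)
  obtain k where k: "k holomorphic_on (\<phi> \<circ> \<pi>) ` N" "\<And>z. z \<in> N \<Longrightarrow> k ((\<phi> \<circ> \<pi>) z) = z"
    using holomorphic_has_inverse[OF hN oN iN] by metis
  have eq: "(\<phi> \<circ> \<pi>) ` N = (\<lambda>z. \<phi> (\<pi> z)) ` N" by auto
  show thesis
  proof (rule that[OF oN])
    show "w \<in> N" using w U O e by (simp add: N_def)
    show "open ((\<lambda>z. \<phi> (\<pi> z)) ` N)" using open_mapping_thm3[OF hN oN iN] by (simp add: eq)
    show "k holomorphic_on (\<lambda>z. \<phi> (\<pi> z)) ` N" using k(1) by (simp add: eq)
    show "k (\<phi> (\<pi> z)) = z" if "z \<in> N" for z using k(2)[OF that] by simp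
  qed (use ip in \<open>auto simp: N_def\<close>)
qed

text \<open>Continuity descends because \<open>\<pi>\<close> is open, holomorphy because
  \<open>\<pi>\<close> has local holomorphic inverses.\<close>

lemma holomorphic_map_descend:
  assumes P: "disc_param S \<pi>" and S: "riemann_surface S" and R: "charts_ok R"
    and c: "continuous_map (top_of_set disc) (surf_top R) (\<lambda>z. f (\<pi> z))"
    and h: "\<And>V \<rho>. (V, \<rho>) \<in> atlas R \<Longrightarrow> (\<lambda>z. \<rho> (f (\<pi> z))) holomorphic_on {z \<in> disc. f (\<pi> z) \<in> V}"
  shows "holomorphic_map S R f"
  unfolding holomorphic_map_def
proof (intro conjI; clarify?)
  have pre: "{x \<in> points S. f x \<in> W} = \<pi> ` {z \<in> disc. f (\<pi> z) \<in> W}" for W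
    unfolding disc_paramD(4)[OF P, symmetric] by auto
  show "continuous_map (surf_top S) (surf_top R) f"
    unfolding continuous_map_def
  proof (intro conjI allI impI funcsetI)
    fix x assume "x \<in> points S"
    then obtain z where "z \<in> disc" "x = \<pi> z" using disc_paramD(4)[OF P] by (metis imageE)
    then show "f x \<in> points R" using c by (simp add: continuous_map_def Pi_iff)
  next
    fix W assume "openin (surf_top R) W"
    then have "openin (top_of_set disc) {z \<in> disc. f (\<pi> z) \<in> W}"
      using openin_continuous_map_preimage[OF c] by simp
    then show "openin (surf_top S) {x \<in> points S. f x \<in> W}"
      unfolding pre using disc_paramD(3)[OF P] unfolding open_map_def by blast
  qed
  fix U \<phi> V \<rho>
  assume U: "(U, \<phi>) \<in> atlas S" and V: "(V, \<rho>) \<in> atlas R"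
  note cU = charts_okD[OF disc_paramD(1)[OF P] U]
  have oW: "open {z \<in> disc. f (\<pi> z) \<in> V}"
    using openin_continuous_map_preimage[OF c, of V] charts_okD[OF R V] by (simp add: complex_chart_def openin_open_eq)
  show "(\<rho> \<circ> f \<circ> inv_into U \<phi>) holomorphic_on \<phi> ` {x \<in> U. f x \<in> V}"
  proof (rule holomorphic_on_locally)
    fix y assume "y \<in> \<phi> ` {x \<in> U. f x \<in> V}"
    then obtain x where x: "x \<in> U" "f x \<in> V" "y = \<phi> x" by auto
    have "x \<in> points S" using x(1) complex_chart_subset[OF cU] by blast
    then obtain w where w: "w \<in> disc" "x = \<pi> w" using disc_paramD(4)[OF P] by (metis imageE)
    obtain N k where N: "open N" "w \<in> N" "N \<subseteq> {z \<in> disc. f (\<pi> z) \<in> V}" "N \<subseteq> disc" "\<And>z. z \<in> N \<Longrightarrow> \<pi> z \<in> U" "inj_on \<pi> N"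
      "open ((\<lambda>z. \<phi> (\<pi> z)) ` N)" "k holomorphic_on (\<lambda>z. \<phi> (\<pi> z)) ` N" "\<And>z. z \<in> N \<Longrightarrow> k (\<phi> (\<pi> z)) = z"
      using disc_param_local_inverse[OF P S w(1) oW _ U] w x by (auto simp del: subset_iff)
    have "((\<lambda>z. \<rho> (f (\<pi> z))) \<circ> k) holomorphic_on (\<lambda>z. \<phi> (\<pi> z)) ` N"
      by (rule holomorphic_on_compose_gen[OF N(8) h[OF V]]) (use N(3,9) in auto)
    then have "(\<rho> \<circ> f \<circ> inv_into U \<phi>) holomorphic_on (\<lambda>z. \<phi> (\<pi> z)) ` N"
    proof (rule holomorphic_transform)
      fix v assume "v \<in> (\<lambda>z. \<phi> (\<pi> z)) ` N"
      then obtain z where z: "z \<in> N" "v = \<phi> (\<pi> z)" by auto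
      have "inv_into U \<phi> v = \<pi> z" using complex_chart_inj_on[OF cU] N(5)[OF z(1)] z(2) by simp
      then show "((\<lambda>z. \<rho> (f (\<pi> z))) \<circ> k) v = (\<rho> \<circ> f \<circ> inv_into U \<phi>) v"
        using N(9)[OF z(1)] z(2) by simp
    qed
    moreover have "y \<in> (\<lambda>z. \<phi> (\<pi> z)) ` N" using x w N(2) by auto
    ultimately show "\<exists>N. open N \<and> y \<in> N \<and> (\<rho> \<circ> f \<circ> inv_into U \<phi>) holomorphic_on N"
      using N(7) by blast
  qed
qed

section \<open>Surfaces uniformized by a freely acting Fuchsian group\<close>

locale uniformization =
  fixes S :: "'a surface" and \<pi> :: "complex \<Rightarrow> 'a" and \<Gamma>s :: "(complex \<Rightarrow> complex) set"
  assumes surface: "riemann_surface S" and compact: "compact_space (surf_top S)"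
    and param: "disc_param S \<pi>" and fuchsian: "fuchsian_group \<Gamma>s" and free: "acts_freely_on_disc \<Gamma>s"
    and \<pi>_eq_iff: "\<And>z w. z \<in> disc \<Longrightarrow> w \<in> disc \<Longrightarrow> \<pi> z = \<pi> w \<longleftrightarrow> (\<exists>g\<in>\<Gamma>s. w = g z)"
begin

sublocale \<Gamma>s: subgroup \<Gamma>s DA by (rule fuchsian_group_subgroup[OF fuchsian])
sublocale A: group "Aut S" by (rule group_Aut[OF surface])

lemmas \<Gamma>s_DA = \<Gamma>s.mem_carrier

lemma \<pi>_points: "z \<in> disc \<Longrightarrow> \<pi> z \<in> points S"
  using disc_paramD(4)[OF param] by auto

lemma \<pi>_surj:
  assumes "x \<in> points S"
  obtains z where "z \<in> disc" "x = \<pi> z"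
  using assms disc_paramD(4)[OF param] by (metis imageE)

lemma \<pi>_\<Gamma>s: "g \<in> \<Gamma>s \<Longrightarrow> z \<in> disc \<Longrightarrow> \<pi> (g z) = \<pi> z"
  using \<pi>_eq_iff[of z "g z"] DA_closed[OF \<Gamma>s_DA] by auto

lemma free_fixed: "g \<in> \<Gamma>s \<Longrightarrow> z \<in> disc \<Longrightarrow> g z = z \<Longrightarrow> g = \<one>\<^bsub>DA\<^esub>"
  using free by (auto simp: acts_freely_on_disc_def)

lemma free_ball:
  assumes "z \<in> disc"
  obtains e where "e > 0" "ball z e \<subseteq> disc" "\<And>g w. g \<in> \<Gamma>s \<Longrightarrow> w \<in> ball z e \<Longrightarrow> g w \<in> ball z e \<Longrightarrow> g = \<one>\<^bsub>DA\<^esub>"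
  using fuchsian_group_nbhd[OF fuchsian assms] free_fixed[OF _ assms] by metis

text \<open>Near each point the lift is a local inverse of \<open>\<pi>\<close> applied to f after
  \<open>\<pi>\<close>.\<close>

lemma lift_holomorphic:
  assumes f: "holomorphic_map S S f" and F: "continuous_on disc F" "\<And>z. z \<in> disc \<Longrightarrow> F z \<in> disc"
    and eq: "\<And>z. z \<in> disc \<Longrightarrow> \<pi> (F z) = f (\<pi> z)"
  shows "F holomorphic_on disc"
proof (rule holomorphic_on_locally)
  fix z1 assume z1: "z1 \<in> disc"
  have w: "F z1 \<in> disc" by (rule F(2)[OF z1])
  obtain U \<phi> where U: "(U, \<phi>) \<in> atlas S" "\<pi> (F z1) \<in> U"
    using riemann_surface_cover[OF surface \<pi>_points[OF w]] .
  obtain N k where N: "open N" "F z1 \<in> N" "N \<subseteq> disc" "N \<subseteq> disc" "\<And>z. z \<in> N \<Longrightarrow> \<pi> z \<in> U" "inj_on \<pi> N"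
      "open ((\<lambda>z. \<phi> (\<pi> z)) ` N)" "k holomorphic_on (\<lambda>z. \<phi> (\<pi> z)) ` N" "\<And>z. z \<in> N \<Longrightarrow> k (\<phi> (\<pi> z)) = z"
    by (rule disc_param_local_inverse[OF param surface w open_ball w U]) (rule that; assumption)
  define M where "M = disc \<inter> F -` N"
  have "open M" unfolding M_def using F(1) N(1) by (simp add: continuous_on_open_vimage Int_commute)
  note h = holomorphic_map_disc_param(2)[OF param f U(1) riemann_surface_charts_ok[OF surface] surface]
  have "M \<subseteq> {z \<in> disc. f (\<pi> z) \<in> U}"
  proof
    fix z assume "z \<in> M"
    then have "z \<in> disc" "\<pi> (F z) \<in> U" using N(5) by (auto simp: M_def)
    then show "z \<in> {z \<in> disc. f (\<pi> z) \<in> U}" by (simp add: eq)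
  qed
  then have "(\<lambda>z. \<phi> (f (\<pi> z))) holomorphic_on M" by (rule holomorphic_on_subset[OF h])
  moreover have im: "\<phi> (f (\<pi> z)) = \<phi> (\<pi> (F z)) \<and> F z \<in> N" if "z \<in> M" for z
    using that by (simp add: M_def eq)
  then have "(\<lambda>z. \<phi> (f (\<pi> z))) ` M \<subseteq> (\<lambda>z. \<phi> (\<pi> z)) ` N" by force
  ultimately have "(k \<circ> (\<lambda>z. \<phi> (f (\<pi> z)))) holomorphic_on M"
    by (rule holomorphic_on_compose_gen[OF _ N(8)])
  then have "F holomorphic_on M"
    by (rule holomorphic_transform) (use im N(9) in simp)
  moreover have "z1 \<in> M" using z1 N(2) by (simp add: M_def)
  ultimately show "\<exists>N. open N \<and> z1 \<in> N \<and> F holomorphic_on N" using \<open>open M\<close> by blast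
qed

text \<open>A lift of \<open>f\<close> is a section of the covering of the disc by the fibre product of \<open>f \<circ> \<pi>\<close> and \<open>\<pi>\<close>.\<close>

lemma lift_exists_continuous:
  assumes f: "f \<in> carrier (Aut S)" and z0: "z0 \<in> disc" "w0 \<in> disc" "f (\<pi> z0) = \<pi> w0"
  obtains F where "continuous_on disc F" "\<And>z. z \<in> disc \<Longrightarrow> F z \<in> disc" "\<And>z. z \<in> disc \<Longrightarrow> \<pi> (F z) = f (\<pi> z)" "F z0 = w0"
proof -
  define E where "E = {(z, w). z \<in> disc \<and> w \<in> disc \<and> f (\<pi> z) = \<pi> w}"
  have fc: "continuous_map (surf_top S) (surf_top S) f"
    using f by (simp add: carrier_Aut biholomorphic_map_def holomorphic_map_def)
  have fpc: "continuous_map (top_of_set disc) (surf_top S) (\<lambda>z. f (\<pi> z))"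
    using continuous_map_compose[OF disc_paramD(2)[OF param] fc] by (simp add: o_def)
  have open_pre: "open {z \<in> disc. f (\<pi> z) \<in> \<pi> ` W}" if "open W" "W \<subseteq> disc" for W
  proof -
    have "openin (top_of_set disc) W" using that by (simp add: openin_open_eq)
    then have "openin (surf_top S) (\<pi> ` W)" using disc_paramD(3)[OF param] by (simp add: open_map_def)
    then show ?thesis using openin_continuous_map_preimage[OF fpc] by (simp add: openin_open_eq)
  qed
  have lift_pt: "\<exists>w\<in>disc. f (\<pi> z) = \<pi> w" if "z \<in> disc" for z
    using \<pi>_surj[OF Aut_closed[OF f \<pi>_points[OF that]]] by metis
  have "covering_space E fst disc"
    unfolding covering_space_def
  proof (intro conjI ballI)
    show "continuous_on E fst" by (intro continuous_intros)
    show "fst ` E = disc" using lift_pt by (force simp: E_def)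
    fix x assume x: "x \<in> disc"
    obtain w where w: "w \<in> disc" "f (\<pi> x) = \<pi> w" using lift_pt[OF x] by blast
    obtain e where e: "e > 0" "ball w e \<subseteq> disc" and fr: "\<And>g v. g \<in> \<Gamma>s \<Longrightarrow> v \<in> ball w e \<Longrightarrow> g v \<in> ball w e \<Longrightarrow> g = \<one>\<^bsub>DA\<^esub>"
      using free_ball[OF w(1)] by blast
    define B where "B = ball w e"
    have B: "open B" "B \<subseteq> disc" "w \<in> B" using e by (auto simp: B_def)
    have inj: "inj_on \<pi> B"
    proof (rule inj_onI)
      fix a b assume ab: "a \<in> B" "b \<in> B" "\<pi> a = \<pi> b"
      then have d: "a \<in> disc" "b \<in> disc" using B(2) by auto
      then obtain g where g: "g \<in> \<Gamma>s" "b = g a" using \<pi>_eq_iff[OF d] ab(3) by blast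
      then have "g = \<one>\<^bsub>DA\<^esub>" using fr[OF g(1)] ab(1,2) by (simp add: B_def)
      then show "a = b" using g(2) d by (simp add: DA_one)
    qed
    define T where "T = {z \<in> disc. f (\<pi> z) \<in> \<pi> ` B}"
    have oT: "open T" unfolding T_def by (rule open_pre[OF B(1,2)])
    \<comment> \<open>The branch of the inverse of \<open>\<pi>\<close> with values in B, taken
      after f; the sheets over T are the graphs of g after s, one for each g in
      \<open>\<Gamma>s\<close>.\<close>
    define s where "s z = inv_into B \<pi> (f (\<pi> z))" for z
    have s: "s z \<in> B" "\<pi> (s z) = f (\<pi> z)" if "z \<in> T" for z
      using that inv_into_into[of "f (\<pi> z)" \<pi> B] f_inv_into_f[of "f (\<pi> z)" \<pi> B] by (auto simp: T_def s_def)
    have s_eq: "s z = b" if "z \<in> T" "b \<in> B" "f (\<pi> z) = \<pi> b" for z b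
      using inj that by (simp add: s_def)
    have cs: "continuous_on T s"
      unfolding continuous_on_open_vimage[OF oT]
    proof (intro allI impI)
      fix W :: "complex set" assume "open W"
      have "s -` W \<inter> T = {z \<in> disc. f (\<pi> z) \<in> \<pi> ` (W \<inter> B)}"
      proof (rule subset_antisym; rule subsetI)
        fix z assume "z \<in> s -` W \<inter> T"
        then have "z \<in> T" "s z \<in> W \<inter> B" "f (\<pi> z) = \<pi> (s z)" using s by auto
        then show "z \<in> {z \<in> disc. f (\<pi> z) \<in> \<pi> ` (W \<inter> B)}" by (auto simp: T_def)
      next
        fix z assume "z \<in> {z \<in> disc. f (\<pi> z) \<in> \<pi> ` (W \<inter> B)}"
        then obtain b where b: "z \<in> disc" "b \<in> W" "b \<in> B" "f (\<pi> z) = \<pi> b" by auto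
        then have "z \<in> T" by (auto simp: T_def)
        with s_eq[OF this b(3,4)] b(2) show "z \<in> s -` W \<inter> T" by simp
      qed
      then show "open (s -` W \<inter> T)" using open_pre[of "W \<inter> B"] \<open>open W\<close> B by auto
    qed
    define P where "P g = {(z, v). z \<in> T \<and> v \<in> g ` B \<and> f (\<pi> z) = \<pi> v}" for g
    have gB: "open (g ` B)" "g ` B \<subseteq> disc" if "g \<in> \<Gamma>s" for g
      using DA_open_image[OF \<Gamma>s_DA[OF that] B(1,2)] DA_closed[OF \<Gamma>s_DA[OF that]] B(2) by auto
    have PE: "P g = E \<inter> T \<times> g ` B" if "g \<in> \<Gamma>s" for g
    proof (rule subset_antisym; rule subsetI)
      fix y assume "y \<in> P g"
      then obtain z v where y: "y = (z, v)" "z \<in> T" "v \<in> g ` B" "f (\<pi> z) = \<pi> v"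
        unfolding P_def by blast
      then have "z \<in> disc" "v \<in> disc" using gB(2)[OF that] by (simp add: T_def, blast)
      then show "y \<in> E \<inter> T \<times> g ` B" using y by (simp add: E_def)
    next
      fix y assume "y \<in> E \<inter> T \<times> g ` B"
      then show "y \<in> P g" unfolding P_def E_def by blast
    qed
    have U: "\<Union> (P ` \<Gamma>s) = E \<inter> fst -` T"
    proof (rule subset_antisym; rule subsetI)
      fix y assume "y \<in> \<Union> (P ` \<Gamma>s)"
      then obtain g where g: "g \<in> \<Gamma>s" "y \<in> P g" by blast
      from g(2) have "y \<in> E \<inter> T \<times> g ` B" unfolding PE[OF g(1)] .
      then show "y \<in> E \<inter> fst -` T" by auto
    next
      fix y assume "y \<in> E \<inter> fst -` T"
      then obtain z v where y: "y = (z, v)" "z \<in> T" "v \<in> disc" "f (\<pi> z) = \<pi> v"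
        by (auto simp: E_def)
      have sd: "s z \<in> disc" using s(1)[OF y(2)] B(2) by blast
      have "\<pi> (s z) = \<pi> v" using s(2)[OF y(2)] y(4) by simp
      then obtain g where g: "g \<in> \<Gamma>s" "v = g (s z)" using \<pi>_eq_iff[OF sd y(3)] by blast
      have "v \<in> g ` B" unfolding g(2) by (rule imageI[OF s(1)[OF y(2)]])
      then have "y \<in> P g" using y(1,2,4) by (simp add: P_def)
      then show "y \<in> \<Union> (P ` \<Gamma>s)" using g(1) by blast
    qed
    have "f (\<pi> x) \<in> \<pi> ` B" unfolding w(2) using B(3) by (rule imageI)
    then have xT: "x \<in> T" using x by (simp add: T_def)
    have "T \<subseteq> disc" unfolding T_def by (rule Collect_restrict)
    then have opT: "openin (top_of_set disc) T"
      by (rule open_subset[OF _ oT])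
      have oP: "openin (top_of_set E) (P g)" if "g \<in> \<Gamma>s" for g
        unfolding PE[OF that] by (rule openin_open_Int) (rule open_Times[OF oT gB(1)[OF that]])
      have dP: "pairwise disjnt (P ` \<Gamma>s)"
      proof (rule pairwiseI)
        fix u v assume uv: "u \<in> P ` \<Gamma>s" "v \<in> P ` \<Gamma>s" "u \<noteq> v"
        then obtain g h where gh: "g \<in> \<Gamma>s" "h \<in> \<Gamma>s" "u = P g" "v = P h" by blast
        have False if y: "y \<in> u" "y \<in> v" for y
        proof -
          obtain b c where bc: "b \<in> B" "c \<in> B" "g b = h c"
            using y unfolding gh P_def by auto
          have bd: "b \<in> disc" and cd: "c \<in> disc" using bc B(2) by auto
          have i: "inv\<^bsub>DA\<^esub> h \<otimes>\<^bsub>DA\<^esub> g \<in> \<Gamma>s" using gh by (intro \<Gamma>s.m_closed \<Gamma>s.m_inv_closed)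
          have "(inv\<^bsub>DA\<^esub> h \<otimes>\<^bsub>DA\<^esub> g) b = c"
            using DA_inv_apply(1)[OF \<Gamma>s_DA[OF gh(2)] cd] bc(3) \<Gamma>s_DA[OF gh(1)] \<Gamma>s_DA[OF gh(2)] bd
            by (simp add: DA_mult)
          then have "inv\<^bsub>DA\<^esub> h \<otimes>\<^bsub>DA\<^esub> g = \<one>\<^bsub>DA\<^esub>" using fr[OF i] bc by (simp add: B_def)
          moreover have "h \<otimes>\<^bsub>DA\<^esub> (inv\<^bsub>DA\<^esub> h \<otimes>\<^bsub>DA\<^esub> g) = g"
            using \<Gamma>s_DA[OF gh(1)] \<Gamma>s_DA[OF gh(2)] by (simp add: DA.m_assoc[symmetric])
          ultimately have "g = h" using \<Gamma>s_DA[OF gh(2)] by simp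
          then show False using uv(3) gh by simp
        qed
        then show "disjnt u v" unfolding disjnt_iff by metis
      qed
      have hP: "\<exists>q. homeomorphism (P g) T fst q" if g: "g \<in> \<Gamma>s" for g
      proof -
        have "homeomorphism (P g) T fst (\<lambda>z. (z, g (s z)))"
          unfolding homeomorphism_def
        proof (intro conjI ballI)
          have sd: "s z \<in> disc" if "z \<in> T" for z using s(1)[OF that] B(2) by blast
          have m: "(z, g (s z)) \<in> P g" if "z \<in> T" for z
            unfolding P_def using that s[OF that] \<pi>_\<Gamma>s[OF g sd[OF that]] by simp
          show "fst (z, g (s z)) = z" for z by simp
          show inv: "(fst y, g (s (fst y))) = y" if yP: "y \<in> P g" for y
          proof -
            obtain z b where y: "y = (z, g b)" "z \<in> T" "b \<in> B" "f (\<pi> z) = \<pi> (g b)"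
              using yP unfolding P_def by auto
            have "b \<in> disc" using y(3) B(2) by blast
            then have "f (\<pi> z) = \<pi> b" using y(4) \<pi>_\<Gamma>s[OF g] by simp
            then have "s z = b" by (rule s_eq[OF y(2,3)])
            then show ?thesis using y(1) by simp
          qed
          show "fst ` P g = T" 
          proof (rule subset_antisym; rule subsetI)
            fix z assume "z \<in> fst ` P g" then show "z \<in> T" unfolding P_def by auto
          next
            fix z assume "z \<in> T" from m[OF this] show "z \<in> fst ` P g" by (rule rev_image_eqI) simp
          qed
          show "(\<lambda>z. (z, g (s z))) ` T = P g"
          proof (rule subset_antisym; rule subsetI)
            fix y assume "y \<in> (\<lambda>z. (z, g (s z))) ` T"
            then obtain z where z: "z \<in> T" "y = (z, g (s z))" by (rule imageE) simp
            then show "y \<in> P g" using m[OF z(1)] by simp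
          next
            fix y assume y: "y \<in> P g"
            then have "fst y \<in> T" unfolding P_def by auto
            then show "y \<in> (\<lambda>z. (z, g (s z))) ` T"
              by (rule rev_image_eqI) (rule inv[OF y, symmetric])
          qed
          show "continuous_on (P g) fst" by (intro continuous_intros)
          have "continuous_on T (g \<circ> s)"
            by (rule continuous_on_compose[OF cs continuous_on_subset[OF holomorphic_on_imp_continuous_on[OF DA_holo[OF \<Gamma>s_DA[OF g]]]]])
              (use sd in auto)
          then show "continuous_on T (\<lambda>z. (z, g (s z)))"
            by (intro continuous_on_Pair continuous_on_id) (simp add: o_def)
        qed
        then show ?thesis by blast
      qed
    show "\<exists>T. x \<in> T \<and> openin (top_of_set disc) T \<and>
        (\<exists>v. \<Union> v = E \<inter> fst -` T \<and> (\<forall>u\<in>v. openin (top_of_set E) u) \<and> pairwise disjnt v \<and>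
          (\<forall>u\<in>v. \<exists>q. homeomorphism u T fst q))"
      by (rule exI[of _ T], intro conjI xT opT, rule exI[of _ "P ` \<Gamma>s"], intro conjI ballI U dP) (use oP hP in blast)+
  qed
  moreover have "(z0, w0) \<in> E" using z0 by (simp add: E_def)
  moreover have "simply_connected disc" by (simp add: convex_imp_simply_connected)
  moreover have "locally path_connected disc" by (rule open_imp_locally_path_connected) simp
  moreover have "continuous_on disc (\<lambda>z. z)" "(\<lambda>z. z) \<in> disc \<rightarrow> disc" "z0 = fst (z0, w0)" by simp_all
  ultimately obtain h where h: "continuous_on disc h" "h \<in> disc \<rightarrow> E" "h z0 = (z0, w0)" "\<And>y. y \<in> disc \<Longrightarrow> fst (h y) = y"
    using covering_space_lift_strong[of E fst disc "(z0, w0)" z0 disc "\<lambda>z. z"] z0(1) by metis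
  show thesis
  proof (rule that)
    show "continuous_on disc (\<lambda>z. snd (h z))" by (intro continuous_intros h(1))
    show "snd (h z0) = w0" using h(3) by simp
    fix z assume z: "z \<in> disc"
    have "h z \<in> E" using h(2) z by blast
    then show "snd (h z) \<in> disc" "\<pi> (snd (h z)) = f (\<pi> z)"
      using h(4)[OF z] by (auto simp: E_def split: prod.splits)
  qed
qed

text \<open>A relation and not a function, since the lifts of one automorphism form a coset of
  \<open>\<Gamma>s\<close>.\<close>

definition covers :: "(complex \<Rightarrow> complex) \<Rightarrow> ('a \<Rightarrow> 'a) \<Rightarrow> bool" where
  "covers F f \<longleftrightarrow> F \<in> carrier DA \<and> f \<in> carrier (Aut S) \<and> (\<forall>z\<in>disc. \<pi> (F z) = f (\<pi> z))"

lemma coversD: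
  assumes "covers F f"
  shows "F \<in> carrier DA" "f \<in> carrier (Aut S)" "\<And>z. z \<in> disc \<Longrightarrow> \<pi> (F z) = f (\<pi> z)"
  using assms by (auto simp: covers_def)

lemma covers_mult:
  assumes "covers F f" "covers H h"
  shows "covers (F \<otimes>\<^bsub>DA\<^esub> H) (f \<otimes>\<^bsub>Aut S\<^esub> h)"
  unfolding covers_def
  using coversD[OF assms(1)] coversD[OF assms(2)] DA_closed[OF coversD(1)[OF assms(2)]]
  by (simp add: DA_mult Aut_mult_apply \<pi>_points)

lemma covers_inv:
  assumes "covers F f"
  shows "covers (inv\<^bsub>DA\<^esub> F) (inv\<^bsub>Aut S\<^esub> f)"
  unfolding covers_def
proof (intro conjI ballI)
  note c = coversD[OF assms]
  show "inv\<^bsub>DA\<^esub> F \<in> carrier DA" "inv\<^bsub>Aut S\<^esub> f \<in> carrier (Aut S)" using c by simp_all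
  fix z assume z: "z \<in> disc"
  define w where "w = (inv\<^bsub>DA\<^esub> F) z"
  have w: "w \<in> disc" "F w = z"
    using DA_inv_apply[OF c(1) z] DA_closed[of "inv\<^bsub>DA\<^esub> F" z] c(1) z by (simp_all add: w_def)
  have "(inv\<^bsub>Aut S\<^esub> f) (\<pi> z) = (inv\<^bsub>Aut S\<^esub> f) (f (\<pi> w))" using c(3)[OF w(1)] w(2) by simp
  also have "\<dots> = \<pi> w" by (rule Aut_inv_apply(1)[OF surface c(2) \<pi>_points[OF w(1)]])
  finally show "\<pi> ((inv\<^bsub>DA\<^esub> F) z) = (inv\<^bsub>Aut S\<^esub> f) (\<pi> z)" by (simp add: w_def)
qed

lemma covers_unique:
  assumes "covers F f" "covers F h"
  shows "f = h"
proof (rule Aut_eqI[OF coversD(2)[OF assms(1)] coversD(2)[OF assms(2)]])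
  fix x assume "x \<in> points S"
  then obtain z where "z \<in> disc" "x = \<pi> z" by (rule \<pi>_surj)
  then show "f x = h x" using coversD(3)[OF assms(1)] coversD(3)[OF assms(2)] by metis
qed

lemma covers_one: "g \<in> \<Gamma>s \<Longrightarrow> covers g \<one>\<^bsub>Aut S\<^esub>"
  unfolding covers_def using \<Gamma>s_DA[of g] \<pi>_\<Gamma>s[of g] \<pi>_points A.one_closed
  by (intro conjI ballI) (simp_all add: one_Aut)

text \<open>At each point F agrees with some element of \<open>\<Gamma>s\<close>;
  \<open>fuchsian_pointwise\<close> makes it one element for the whole disc.\<close>

lemma covers_one_imp:
  assumes "covers F \<one>\<^bsub>Aut S\<^esub>"
  shows "F \<in> \<Gamma>s"
proof -
  note c = coversD[OF assms]
  have ex: "\<exists>g\<in>\<Gamma>s. F z = g z" if z: "z \<in> disc" for z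
  proof -
    have "\<pi> z = \<pi> (F z)" using c(3)[OF z] \<pi>_points[OF z] by (simp add: one_Aut)
    then show ?thesis using \<pi>_eq_iff[OF z DA_closed[OF c(1) z]] by blast
  qed
  obtain g where g: "g \<in> \<Gamma>s" "\<And>z. z \<in> disc \<Longrightarrow> F z = g z"
    by (rule fuchsian_pointwise[OF fuchsian DA_holo[OF c(1)] holomorphic_on_ident _ ex]) auto
  have "F = g" by (rule DA_eqI[OF c(1) \<Gamma>s_DA[OF g(1)] g(2)])
  then show ?thesis using g(1) by simp
qed

lemma covers_same:
  assumes "covers F f" "covers H f"
  obtains g where "g \<in> \<Gamma>s" "F = g \<otimes>\<^bsub>DA\<^esub> H"
proof -
  have "covers (F \<otimes>\<^bsub>DA\<^esub> inv\<^bsub>DA\<^esub> H) \<one>\<^bsub>Aut S\<^esub>"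
    using covers_mult[OF assms(1) covers_inv[OF assms(2)]] coversD(2)[OF assms(1)] by simp
  then have "F \<otimes>\<^bsub>DA\<^esub> inv\<^bsub>DA\<^esub> H \<in> \<Gamma>s" by (rule covers_one_imp)
  moreover have "F = (F \<otimes>\<^bsub>DA\<^esub> inv\<^bsub>DA\<^esub> H) \<otimes>\<^bsub>DA\<^esub> H"
    using coversD(1)[OF assms(1)] coversD(1)[OF assms(2)] by (simp add: DA.m_assoc)
  ultimately show thesis by (rule that)
qed

text \<open>Continuous lifts of f and of its inverse are taken with matching base points, so that
  both composites lift the identity and fix a point; then they are the identity because
  \<open>\<Gamma>s\<close> acts freely.\<close>

lemma lift_exists:
  assumes f: "f \<in> carrier (Aut S)"
  obtains F where "covers F f"
proof -
  define fi where "fi = inv\<^bsub>Aut S\<^esub> f"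
  have fi: "fi \<in> carrier (Aut S)" using f by (simp add: fi_def)
  have z0: "(0::complex) \<in> disc" by (simp add: disc_iff)
  obtain w0 where w0: "w0 \<in> disc" "f (\<pi> 0) = \<pi> w0"
    using \<pi>_surj[OF Aut_closed[OF f \<pi>_points[OF z0]]] by metis
  have w0': "fi (\<pi> w0) = \<pi> 0"
    using Aut_inv_apply(1)[OF surface f \<pi>_points[OF z0]] w0(2) by (simp add: fi_def)
  obtain F where F: "continuous_on disc F" "\<And>z. z \<in> disc \<Longrightarrow> F z \<in> disc" "\<And>z. z \<in> disc \<Longrightarrow> \<pi> (F z) = f (\<pi> z)" "F 0 = w0"
    using lift_exists_continuous[OF f z0 w0] by blast
  obtain H where H: "continuous_on disc H" "\<And>z. z \<in> disc \<Longrightarrow> H z \<in> disc" "\<And>z. z \<in> disc \<Longrightarrow> \<pi> (H z) = fi (\<pi> z)" "H w0 = 0"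
    using lift_exists_continuous[OF fi w0(1) z0 w0'] by blast
  have hF: "F holomorphic_on disc"
    by (rule lift_holomorphic[OF _ F(1-3)]) (use f in \<open>simp_all add: carrier_Aut biholomorphic_map_def\<close>)
  have hH: "H holomorphic_on disc"
    by (rule lift_holomorphic[OF _ H(1-3)]) (use fi in \<open>simp_all add: carrier_Aut biholomorphic_map_def\<close>)
  have id: "K z = z" if K: "K holomorphic_on disc" "\<And>z. z \<in> disc \<Longrightarrow> K z \<in> disc" "\<And>z. z \<in> disc \<Longrightarrow> \<pi> (K z) = \<pi> z"
    and v: "v \<in> disc" "K v = v" and z: "z \<in> disc" for K v z
  proof -
    have ex: "\<exists>g\<in>\<Gamma>s. K z = g z" if z: "z \<in> disc" for z
      using \<pi>_eq_iff[OF z K(2)[OF z]] K(3)[OF z] by metis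
    obtain g where g: "g \<in> \<Gamma>s" "\<And>z. z \<in> disc \<Longrightarrow> K z = g z"
      by (rule fuchsian_pointwise[OF fuchsian K(1) holomorphic_on_ident _ ex]) auto
    have "g v = v" using g(2)[OF v(1)] v(2) by simp
    then have "g = \<one>\<^bsub>DA\<^esub>" by (rule free_fixed[OF g(1) v(1)])
    then show "K z = z" using g(2)[OF z] z by (simp add: DA_one)
  qed
  have HF: "H (F z) = z" if z: "z \<in> disc" for z
  proof (rule id[where K = "\<lambda>z. H (F z)", OF _ _ _ z0 _ z])
    show "(\<lambda>z. H (F z)) holomorphic_on disc" by (rule holomorphic_on_disc_comp[OF hF F(2) hH])
    show "H (F z) \<in> disc" if "z \<in> disc" for z by (intro H(2) F(2) that)
    show "\<pi> (H (F z)) = \<pi> z" if "z \<in> disc" for z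
      using H(3)[OF F(2)[OF that]] F(3)[OF that] Aut_inv_apply(1)[OF surface f \<pi>_points[OF that]] by (simp add: fi_def)
    show "H (F 0) = 0" using F(4) H(4) by simp
  qed
  have FH: "F (H z) = z" if z: "z \<in> disc" for z
  proof (rule id[where K = "\<lambda>z. F (H z)", OF _ _ _ w0(1) _ z])
    show "(\<lambda>z. F (H z)) holomorphic_on disc" by (rule holomorphic_on_disc_comp[OF hH H(2) hF])
    show "F (H z) \<in> disc" if "z \<in> disc" for z by (intro H(2) F(2) that)
    show "\<pi> (F (H z)) = \<pi> z" if "z \<in> disc" for z
      using F(3)[OF H(2)[OF that]] H(3)[OF that] Aut_inv_apply(2)[OF surface f \<pi>_points[OF that]] by (simp add: fi_def)
    show "F (H w0) = w0" using F(4) H(4) by simp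
  qed
  have "restrict F disc \<in> carrier DA" by (rule DA_I[OF hF F(2) H(2) FH HF])
  then have "covers (restrict F disc) f" using f F(3) by (simp add: covers_def)
  then show thesis by (rule that)
qed

text \<open>The value at \<open>\<pi> z\<close> is defined through an arbitrary preimage. The first
  condition makes it independent of the choice, the second does the same for the inverse of F, which
  yields the inverse automorphism.\<close>

lemma descend:
  assumes F: "F \<in> carrier DA"
    and n1: "\<And>g. g \<in> \<Gamma>s \<Longrightarrow> F \<otimes>\<^bsub>DA\<^esub> g \<otimes>\<^bsub>DA\<^esub> inv\<^bsub>DA\<^esub> F \<in> \<Gamma>s"
    and n2: "\<And>g. g \<in> \<Gamma>s \<Longrightarrow> inv\<^bsub>DA\<^esub> F \<otimes>\<^bsub>DA\<^esub> g \<otimes>\<^bsub>DA\<^esub> F \<in> \<Gamma>s"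
  obtains f where "covers F f"
proof -
  have iF: "inv\<^bsub>DA\<^esub> F \<in> carrier DA" using F by simp
  define D where "D K x = \<pi> (K (SOME z. z \<in> disc \<and> x = \<pi> z))" for K :: "complex \<Rightarrow> complex" and x
  have D: "D K (\<pi> z) = \<pi> (K z)" if K: "K \<in> carrier DA" and n: "\<And>g. g \<in> \<Gamma>s \<Longrightarrow> K \<otimes>\<^bsub>DA\<^esub> g \<otimes>\<^bsub>DA\<^esub> inv\<^bsub>DA\<^esub> K \<in> \<Gamma>s"
    and z: "z \<in> disc" for K z
  proof -
    define w where "w = (SOME w. w \<in> disc \<and> \<pi> z = \<pi> w)"
    have w: "w \<in> disc" "\<pi> z = \<pi> w" using someI[of "\<lambda>w. w \<in> disc \<and> \<pi> z = \<pi> w" z] z by (auto simp: w_def)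
    obtain g where g: "g \<in> \<Gamma>s" "w = g z" using \<pi>_eq_iff[OF z w(1)] w(2) by blast
    have "K w = (K \<otimes>\<^bsub>DA\<^esub> g \<otimes>\<^bsub>DA\<^esub> inv\<^bsub>DA\<^esub> K) (K z)"
      using K \<Gamma>s_DA[OF g(1)] z g(2) DA_closed[OF K z] by (simp add: DA_mult DA_inv_apply)
    then have "\<pi> (K w) = \<pi> (K z)" using \<pi>_\<Gamma>s[OF n[OF g(1)] DA_closed[OF K z]] by simp
    then show ?thesis by (simp add: D_def flip: w_def)
  qed
  have D1: "D F (\<pi> z) = \<pi> (F z)" if "z \<in> disc" for z by (rule D[OF F n1 that])
  have D2: "D (inv\<^bsub>DA\<^esub> F) (\<pi> z) = \<pi> ((inv\<^bsub>DA\<^esub> F) z)" if "z \<in> disc" for z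
    by (rule D[OF iF _ that]) (use n2 F in simp)
  have hol: "holomorphic_map S S k" if K: "K \<in> carrier DA" and k: "\<And>z. z \<in> disc \<Longrightarrow> k (\<pi> z) = \<pi> (K z)" for k K
  proof (rule holomorphic_map_descend[OF param surface riemann_surface_charts_ok[OF surface]])
    have cK: "continuous_map (top_of_set disc) (top_of_set disc) K"
      using holomorphic_on_imp_continuous_on[OF DA_holo[OF K]] DA_closed[OF K] by (auto simp: continuous_map_in_subtopology)
    have "continuous_map (top_of_set disc) (surf_top S) (\<pi> \<circ> K)"
      by (rule continuous_map_compose[OF cK disc_paramD(2)[OF param]])
    then show "continuous_map (top_of_set disc) (surf_top S) (\<lambda>z. k (\<pi> z))"
      by (rule continuous_map_eq) (simp add: k)
    fix V \<rho> assume V: "(V, \<rho>) \<in> atlas S"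
    have "((\<rho> \<circ> \<pi>) \<circ> K) holomorphic_on {z \<in> disc. k (\<pi> z) \<in> V}"
      by (rule holomorphic_on_compose_gen[OF holomorphic_on_subset[OF DA_holo[OF K]] disc_paramD(5)[OF param V]])
        (use DA_closed[OF K] k in auto)
    then show "(\<lambda>z. \<rho> (k (\<pi> z))) holomorphic_on {z \<in> disc. k (\<pi> z) \<in> V}"
      by (rule holomorphic_transform) (simp add: k)
  qed
  define f where "f = restrict (D F) (points S)"
  have fz: "f (\<pi> z) = \<pi> (F z)" if "z \<in> disc" for z using D1[OF that] \<pi>_points[OF that] by (simp add: f_def)
  define h where "h = D (inv\<^bsub>DA\<^esub> F)"
  have hz: "h (\<pi> z) = \<pi> ((inv\<^bsub>DA\<^esub> F) z)" if "z \<in> disc" for z using D2[OF that] by (simp add: h_def)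
  have hf: "h (f x) = x \<and> f (h x) = x \<and> f x \<in> points S \<and> h x \<in> points S" if "x \<in> points S" for x
  proof -
    obtain z where z: "z \<in> disc" "x = \<pi> z" using \<pi>_surj[OF \<open>x \<in> points S\<close>] .
    then show ?thesis
      using DA_closed[OF F z(1)] DA_closed[OF iF z(1)] DA_inv_apply[OF F z(1)] by (simp add: fz hz \<pi>_points)
  qed
  have bij: "bij_betw f (points S) (points S)"
    by (rule bij_betw_byWitness[of _ h]) (use hf in auto)
  have "holomorphic_map S S h" by (rule hol[OF iF hz])
  then have "holomorphic_map S S (inv_into (points S) f)"
  proof (rule holomorphic_map_cong[OF riemann_surface_charts_ok[OF surface]])
    fix x assume x: "x \<in> points S"
    have "inv_into (points S) f x = h x"
      by (rule inv_into_f_eq[OF bij_betw_imp_inj_on[OF bij]]) (use hf[OF x] in auto)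
    then show "h x = inv_into (points S) f x" ..
  qed
  then have "f \<in> carrier (Aut S)"
    using bij hol[OF F fz] by (simp add: carrier_Aut Bij_def biholomorphic_map_def) (simp add: f_def)
  then have "covers F f" using F fz by (simp add: covers_def)
  then show thesis by (rule that)
qed

end

text \<open>The covering map is h after the passage to orbits. A free action makes every point of
  the disc the centre of a free ball, so holomorphy in all charts of S follows from
  \<open>quotient_holomorphic\<close>.\<close>

lemma uniformized_by_uniformization:
  assumes S: "compact_riemann_surface S" and u: "uniformized_by p S T \<Gamma> \<Gamma>s"
  obtains \<pi> \<theta> where "uniformization S \<pi> \<Gamma>s"
    "\<theta> \<in> iso (DA\<lparr>carrier := \<Gamma>\<rparr> Mod \<Gamma>s) ((Aut S)\<lparr>carrier := generate (Aut S) {T}\<rparr>)"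
    "\<And>g z. g \<in> \<Gamma> \<Longrightarrow> z \<in> disc \<Longrightarrow> \<theta> (\<Gamma>s #>\<^bsub>DA\<^esub> g) (\<pi> z) = \<pi> (g z)"
proof -
  have \<Gamma>: "fuchsian_group \<Gamma>" and n: "\<Gamma>s \<lhd> DA\<lparr>carrier := \<Gamma>\<rparr>" and fr: "acts_freely_on_disc \<Gamma>s"
    using u by (auto simp: uniformized_by_def)
  obtain h \<theta> where h: "biholomorphic_map (quotient_surface disc_surface \<Gamma>s) S h"
    and t: "\<theta> \<in> iso (DA\<lparr>carrier := \<Gamma>\<rparr> Mod \<Gamma>s) ((Aut S)\<lparr>carrier := generate (Aut S) {T}\<rparr>)"
    and th: "\<forall>g \<in> \<Gamma>. \<forall>z \<in> disc. \<theta> (\<Gamma>s #>\<^bsub>DA\<^esub> g) (h (orb \<Gamma>s z)) = h (orb \<Gamma>s (g z))"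
    using u unfolding uniformized_by_def by blast
  have rs: "riemann_surface S" and cs: "compact_space (surf_top S)"
    using S by (auto simp: compact_riemann_surface_def)
  have "subgroup \<Gamma>s (DA\<lparr>carrier := \<Gamma>\<rparr>)" using n by (simp add: normal_def)
  then have sub: "subgroup \<Gamma>s DA"
    by (rule DA.incl_subgroup[OF fuchsian_group_subgroup[OF \<Gamma>]])
  have "\<Gamma>s \<subseteq> \<Gamma>" using subgroup.subset[OF \<open>subgroup \<Gamma>s (DA\<lparr>carrier := \<Gamma>\<rparr>)\<close>] by simp
  then have fu: "fuchsian_group \<Gamma>s" by (rule fuchsian_group_subset[OF \<Gamma> sub])
  interpret Q: disc_quotient disc_surface "\<lambda>z. z" \<Gamma>s \<Gamma>s
  proof (rule disc_quotient.intro)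
    show "disc_param disc_surface (\<lambda>z. z)" by (rule disc_param_id)
    show "orb \<Gamma>s z = orb \<Gamma>s w \<longleftrightarrow> (\<exists>g\<in>\<Gamma>s. w = g z)" if "z \<in> disc" "w \<in> disc" for z w
      by (rule disc_orb_eq_iff[OF sub that])
  qed (rule sub)
  define \<pi> where "\<pi> z = h (orb \<Gamma>s z)" for z
  have \<pi>q: "\<pi> = h \<circ> Q.q" by (auto simp: \<pi>_def Q.q_def)
  have free: "\<exists>e>0. Q.free_set (ball z e)" if z: "z \<in> disc" for z
  proof -
    obtain e where e: "e > 0" "ball z e \<subseteq> disc" "\<And>g w. g \<in> \<Gamma>s \<Longrightarrow> w \<in> ball z e \<Longrightarrow> g w \<in> ball z e \<Longrightarrow> g z = z"
      using fuchsian_group_nbhd[OF fu z] by blast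
    have "g = \<one>\<^bsub>DA\<^esub>" if "g \<in> \<Gamma>s" "w \<in> ball z e" "g w \<in> ball z e" for g w
      using e(3)[OF that] that(1) z fr by (auto simp: acts_freely_on_disc_def)
    then show ?thesis using e by (intro exI[of _ e]) (auto simp: Q.free_set_def)
  qed
  have peq: "\<pi> z = \<pi> w \<longleftrightarrow> (\<exists>g\<in>\<Gamma>s. w = g z)" if "z \<in> disc" "w \<in> disc" for z w
    using Q.composite_eq_iff[OF h that] by (simp add: \<pi>q)
  have "disc_param S \<pi>"
    unfolding disc_param_def
  proof (intro conjI ballI)
    show "charts_ok S" by (rule riemann_surface_charts_ok[OF rs])
    show "continuous_map (top_of_set disc) (surf_top S) \<pi>" unfolding \<pi>q by (rule Q.composite_continuous[OF h])
    show "open_map (top_of_set disc) (surf_top S) \<pi>" unfolding \<pi>q by (rule Q.composite_open_map[OF h])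
    show "\<pi> ` disc = points S" unfolding \<pi>q by (rule Q.composite_image[OF h])
    show "case x of (U, \<phi>) \<Rightarrow> (\<phi> \<circ> \<pi>) holomorphic_on {z \<in> disc. \<pi> z \<in> U}" if "x \<in> atlas S" for x
    proof -
      obtain U \<phi> where x1: "x = (U, \<phi>)" by (cases x)
      with that have x: "x = (U, \<phi>)" "(U, \<phi>) \<in> atlas S" by auto
      have "(\<phi> \<circ> \<pi>) holomorphic_on {z \<in> disc. \<pi> z \<in> U}"
      proof (rule holomorphic_on_locally)
        fix w assume w: "w \<in> {z \<in> disc. \<pi> z \<in> U}"
        then obtain e where e: "e > 0" "Q.free_set (ball w e)" using free by blast
        have hm: "holomorphic_map (quotient_surface disc_surface \<Gamma>s) S h" using h by (simp add: biholomorphic_map_def)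
        have "(\<lambda>z. \<phi> (h (Q.q z))) holomorphic_on {z \<in> ball w e. h (Q.q z) \<in> U}"
          by (rule Q.quotient_holomorphic[OF e(2) hm x(2)])
        then have "(\<phi> \<circ> \<pi>) holomorphic_on {z \<in> ball w e. \<pi> z \<in> U}" by (simp add: \<pi>q o_def)
        moreover have "open {z \<in> ball w e. \<pi> z \<in> U}"
        proof -
          have "openin (surf_top S) U" using charts_okD[OF \<open>charts_ok S\<close> x(2)] by (simp add: complex_chart_def)
          then have "openin (top_of_set disc) {z \<in> ball w e. \<pi> z \<in> U}"
            using e(2) by (intro openin_preimage[OF \<open>continuous_map _ _ \<pi>\<close>]) (auto simp: openin_open_eq Q.free_set_def)
          then show ?thesis by (simp add: openin_open_eq)
        qed
        moreover have "w \<in> {z \<in> ball w e. \<pi> z \<in> U}" using w e(1) by simp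
        ultimately show "\<exists>N. open N \<and> w \<in> N \<and> (\<phi> \<circ> \<pi>) holomorphic_on N" by blast
      qed
      then show ?thesis by (simp add: x(1))
    qed
    show "\<exists>e>0. ball z e \<subseteq> disc \<and> inj_on \<pi> (ball z e)" if z: "z \<in> disc" for z
    proof -
      obtain e where e: "e > 0" "Q.free_set (ball z e)" using free[OF z] by blast
      have sub: "ball z e \<subseteq> disc" using e(2) by (simp add: Q.free_set_def)
      have "inj_on \<pi> (ball z e)"
      proof (rule inj_onI)
        fix a b assume ab: "a \<in> ball z e" "b \<in> ball z e" "\<pi> a = \<pi> b"
        then obtain g where g: "g \<in> \<Gamma>s" "b = g a" using peq[of a b] sub by blast
        then have "g = \<one>\<^bsub>DA\<^esub>" using e(2) ab by (auto simp: Q.free_set_def)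
        then show "a = b" using g(2) ab(1) sub by (auto simp: DA_one)
      qed
      then show ?thesis using e(1) sub by blast
    qed
  qed
  then have "uniformization S \<pi> \<Gamma>s"
    using rs cs fu fr peq by unfold_locales auto
  then show thesis
    by (rule that[OF _ t]) (use th in \<open>simp add: \<pi>_def\<close>)
qed

section \<open>Orbits and stabilizers of Fuchsian groups\<close>

definition stab :: "(complex \<Rightarrow> complex) set \<Rightarrow> complex \<Rightarrow> (complex \<Rightarrow> complex) set" where
  "stab G z = {g \<in> G. g z = z}"

lemma mem_orb: "w \<in> orb G z \<longleftrightarrow> (\<exists>g\<in>G. w = g z)"
  by (auto simp: orb_def)

lemma fuchsian_orb_subset: "fuchsian_group G \<Longrightarrow> A \<in> disc \<Longrightarrow> orb G A \<subseteq> disc"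
  using DA_closed[OF fuchsian_group_mem] by (auto simp: orb_def)

lemma fuchsian_orb_refl:
  assumes "fuchsian_group G" "A \<in> disc"
  shows "A \<in> orb G A"
proof -
  have "\<one>\<^bsub>DA\<^esub> \<in> G" using subgroup.one_closed[OF fuchsian_group_subgroup[OF assms(1)]] .
  moreover have "A = \<one>\<^bsub>DA\<^esub> A" using assms(2) by (simp add: DA_one)
  ultimately show ?thesis unfolding mem_orb by blast
qed

lemma fuchsian_orb_closed:
  assumes G: "fuchsian_group G" and A: "A \<in> disc" and g: "g \<in> G" and z: "z \<in> disc"
  shows "g z \<in> orb G A \<longleftrightarrow> z \<in> orb G A"
proof -
  interpret G: subgroup G DA by (rule fuchsian_group_subgroup[OF G])
  note gc = G.mem_carrier[OF g]
  show ?thesis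
  proof
    assume "g z \<in> orb G A"
    then obtain h where h: "h \<in> G" "g z = h A" by (auto simp: mem_orb)
    have "z = (inv\<^bsub>DA\<^esub> g \<otimes>\<^bsub>DA\<^esub> h) A"
      using DA_inv_apply(1)[OF gc z] h(2) gc G.mem_carrier[OF h(1)] A by (simp add: DA_mult)
    moreover have "inv\<^bsub>DA\<^esub> g \<otimes>\<^bsub>DA\<^esub> h \<in> G" using g h by (intro G.m_closed G.m_inv_closed)
    ultimately show "z \<in> orb G A" unfolding mem_orb by blast
  next
    assume "z \<in> orb G A"
    then obtain h where h: "h \<in> G" "z = h A" by (auto simp: mem_orb)
    have "g z = (g \<otimes>\<^bsub>DA\<^esub> h) A"
      using h(2) gc G.mem_carrier[OF h(1)] A by (simp add: DA_mult)
    moreover have "g \<otimes>\<^bsub>DA\<^esub> h \<in> G" using g h by (intro G.m_closed)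
    ultimately show "g z \<in> orb G A" unfolding mem_orb by blast
  qed
qed

lemma compact_subset_disc_cball:
  assumes "z \<in> disc"
  obtains r where "r > 0" "cball z r \<subseteq> disc"
  using open_contains_cball[of disc] assms by auto

lemma fuchsian_orb_finite:
  assumes G: "fuchsian_group G" and A: "A \<in> disc" and K: "compact K" "K \<subseteq> disc"
  shows "finite (orb G A \<inter> K)"
proof -
  have "finite {g \<in> G. g ` insert A K \<inter> insert A K \<noteq> {}}"
    by (rule fuchsian_group_finite[OF G]) (use A K in auto)
  then have "finite ((\<lambda>g. g A) ` {g \<in> G. g ` insert A K \<inter> insert A K \<noteq> {}})" by simp
  moreover have "orb G A \<inter> K \<subseteq> (\<lambda>g. g A) ` {g \<in> G. g ` insert A K \<inter> insert A K \<noteq> {}}"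
  proof
    fix z assume "z \<in> orb G A \<inter> K"
    then obtain g where g: "g \<in> G" "z = g A" "g A \<in> K" by (auto simp: mem_orb)
    then have "g A \<in> g ` insert A K \<inter> insert A K" by blast
    then show "z \<in> (\<lambda>g. g A) ` {g \<in> G. g ` insert A K \<inter> insert A K \<noteq> {}}" using g(1,2) by blast
  qed
  ultimately show ?thesis by (rule finite_subset[rotated])
qed

lemma fuchsian_stab_finite:
  assumes "fuchsian_group G" "z \<in> disc"
  shows "finite (stab G z)"
proof -
  have "finite {g \<in> G. g ` {z} \<inter> {z} \<noteq> {}}"
    by (rule fuchsian_group_finite[OF assms(1)]) (use assms in auto)
  then show ?thesis by (rule finite_subset[rotated]) (auto simp: stab_def)
qed

text \<open>A set closed and discrete in the disc; z itself may belong to D. Orbits and branch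
  points have this property, and it is stable under unions, so poles and branch points can be
  removed together.\<close>

definition no_accum :: "complex set \<Rightarrow> bool" where
  "no_accum D \<longleftrightarrow> (\<forall>z\<in>disc. \<exists>e>0. ball z e \<subseteq> disc \<and> ball z e \<inter> D \<subseteq> {z})"

lemma no_accumE:
  assumes "no_accum D" "z \<in> disc"
  obtains e where "e > 0" "ball z e \<subseteq> disc" "ball z e \<inter> D \<subseteq> {z}"
  using assms unfolding no_accum_def by blast

lemma no_accum_Un:
  assumes "no_accum D" "no_accum E"
  shows "no_accum (D \<union> E)"
  unfolding no_accum_def
proof
  fix z assume z: "z \<in> disc"
  obtain d where d: "d > 0" "ball z d \<subseteq> disc" "ball z d \<inter> D \<subseteq> {z}" by (rule no_accumE[OF assms(1) z])
  obtain e where e: "e > 0" "ball z e \<subseteq> disc" "ball z e \<inter> E \<subseteq> {z}" by (rule no_accumE[OF assms(2) z])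
  have "ball z (min d e) \<subseteq> ball z d" "ball z (min d e) \<subseteq> ball z e" by (auto simp: mem_ball)
  then have "ball z (min d e) \<subseteq> disc \<and> ball z (min d e) \<inter> (D \<union> E) \<subseteq> {z}" using d e by blast
  then show "\<exists>e>0. ball z e \<subseteq> disc \<and> ball z e \<inter> (D \<union> E) \<subseteq> {z}"
    using d(1) e(1) by (intro exI[of _ "min d e"]) simp
qed

lemma no_accum_orb:
  assumes "fuchsian_group G" "A \<in> disc"
  shows "no_accum (orb G A)"
  unfolding no_accum_def
proof
  fix z assume z: "z \<in> disc"
  obtain r where r: "r > 0" "cball z r \<subseteq> disc" by (rule compact_subset_disc_cball[OF z])
  have "finite (orb G A \<inter> cball z r)" by (rule fuchsian_orb_finite[OF assms compact_cball r(2)])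
  then obtain d where d: "d > 0" "\<And>x. x \<in> orb G A \<inter> cball z r \<Longrightarrow> x \<noteq> z \<Longrightarrow> d \<le> dist z x"
    using finite_set_avoid[of "orb G A \<inter> cball z r" z] by blast
  have "ball z (min d r) \<inter> orb G A \<subseteq> {z}"
  proof
    fix x assume x: "x \<in> ball z (min d r) \<inter> orb G A"
    then have "x \<in> orb G A \<inter> cball z r" "dist z x < d" by (auto simp: mem_ball)
    then show "x \<in> {z}" using d(2)[of x] by force
  qed
  moreover have "ball z (min d r) \<subseteq> disc" using r(2) by (force simp: mem_ball)
  ultimately show "\<exists>e>0. ball z e \<subseteq> disc \<and> ball z e \<inter> orb G A \<subseteq> {z}"
    using d(1) r(1) by (intro exI[of _ "min d r"]) simp
qed

definition branch_points :: "(complex \<Rightarrow> complex) set \<Rightarrow> complex set" where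
  "branch_points G = {z \<in> disc. stab G z \<noteq> {\<one>\<^bsub>DA\<^esub>}}"

lemma fuchsian_one_stab:
  assumes "fuchsian_group G" "z \<in> disc"
  shows "\<one>\<^bsub>DA\<^esub> \<in> stab G z"
  using subgroup.one_closed[OF fuchsian_group_subgroup[OF assms(1)]] assms(2) by (simp add: stab_def DA_one)

text \<open>Near z every element with a fixed point also fixes z, and a nontrivial element has at
  most one fixed point.\<close>

lemma no_accum_branch_points:
  assumes G: "fuchsian_group G"
  shows "no_accum (branch_points G)"
  unfolding no_accum_def
proof
  fix z assume z: "z \<in> disc"
  obtain e where e: "e > 0" "ball z e \<subseteq> disc" "\<And>g w. g \<in> G \<Longrightarrow> w \<in> ball z e \<Longrightarrow> g w \<in> ball z e \<Longrightarrow> g z = z"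
    using fuchsian_group_nbhd[OF G z] by blast
  have "ball z e \<inter> branch_points G \<subseteq> {z}"
  proof
    fix w assume w: "w \<in> ball z e \<inter> branch_points G"
    then have wd: "w \<in> disc" and "stab G w \<noteq> {\<one>\<^bsub>DA\<^esub>}" by (auto simp: branch_points_def)
    then obtain g where g: "g \<in> G" "g w = w" "g \<noteq> \<one>\<^bsub>DA\<^esub>"
      using fuchsian_one_stab[OF G wd] by (auto simp: stab_def)
    have "g z = z" by (rule e(3)[OF g(1), of w]) (use w g in auto)
    then show "w \<in> {z}"
      using DA_two_fixed_points[OF fuchsian_group_mem[OF G g(1)] wd z] g(2,3) by auto
  qed
  then show "\<exists>e>0. ball z e \<subseteq> disc \<and> ball z e \<inter> branch_points G \<subseteq> {z}" using e by blast
qed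

lemma open_diff_isolated:
  assumes "no_accum D"
  shows "open (disc - D)"
  unfolding open_contains_ball
proof
  fix z assume z: "z \<in> disc - D"
  then obtain e where "e > 0" "ball z e \<subseteq> disc" "ball z e \<inter> D \<subseteq> {z}" using no_accumE[OF assms] by blast
  then show "\<exists>e>0. ball z e \<subseteq> disc - D" using z by blast
qed

lemma eventually_not_isolated:
  assumes "no_accum D" "z \<in> disc"
  shows "eventually (\<lambda>w. w \<in> disc - D) (at z)"
proof -
  obtain e where "e > 0" "ball z e \<subseteq> disc" "ball z e \<inter> D \<subseteq> {z}" using no_accumE[OF assms] .
  then show ?thesis unfolding eventually_at
    by (intro exI[of _ e]) (auto simp: mem_ball dist_commute subset_iff)
qed

text \<open>The removable singularity theorem at each point of D.\<close>

lemma holomorphic_extend_isolated: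
  assumes iso: "no_accum D" and h: "f holomorphic_on disc - D"
    and lim: "\<And>z. z \<in> D \<inter> disc \<Longrightarrow> (f \<longlongrightarrow> f z) (at z)"
  shows "f holomorphic_on disc"
proof (rule holomorphic_on_locally)
  fix z assume z: "z \<in> disc"
  obtain e where e: "e > 0" "ball z e \<subseteq> disc" "ball z e \<inter> D \<subseteq> {z}" by (rule no_accumE[OF iso z])
  have hp: "f holomorphic_on ball z e - {z}"
    by (rule holomorphic_on_subset[OF h]) (use e in blast)
  have "(f \<longlongrightarrow> f z) (at z)"
  proof (cases "z \<in> D")
    case True
    then show ?thesis using lim z by blast
  next
    case False
    then have "z \<in> disc - D" using z by blast
    then have "isCont f z"
      using continuous_on_interior[OF holomorphic_on_imp_continuous_on[OF h]] open_diff_isolated[OF iso]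
      by (simp add: interior_open)
    then show ?thesis by (simp add: isCont_def)
  qed
  then have "f holomorphic_on ball z e"
    by (intro no_isolated_singularity'[OF _ hp]) (auto intro: tendsto_within_subset)
  then show "\<exists>N. open N \<and> z \<in> N \<and> f holomorphic_on N" using e(1) by (intro exI[of _ "ball z e"]) simp
qed

section \<open>The sphere as a quotient\<close>

text \<open>A coordinate on the sphere obtained as quotient by \<open>\<Gamma>\<close>, with the
  orbit of A at infinity. Having the pole at an orbit of choice lets a fixed point of a map or a
  zero of a form be put there.\<close>

locale hauptmodul =
  fixes \<Gamma> :: "(complex \<Rightarrow> complex) set" and A :: complex and \<tau> :: "complex \<Rightarrow> complex"
  assumes fuchsian': "fuchsian_group \<Gamma>" and A: "A \<in> disc"
    and \<tau>_holo: "\<tau> holomorphic_on disc - orb \<Gamma> A"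
    and \<tau>_pole: "\<And>z. z \<in> orb \<Gamma> A \<Longrightarrow> is_pole \<tau> z"
    and \<tau>_eq_iff: "\<And>z w. z \<in> disc - orb \<Gamma> A \<Longrightarrow> w \<in> disc - orb \<Gamma> A \<Longrightarrow> \<tau> z = \<tau> w \<longleftrightarrow> (\<exists>g\<in>\<Gamma>. w = g z)"

section \<open>Finite groups of automorphisms with quotient the sphere\<close>

locale sphere_quotient = uniformization S \<pi> \<Gamma>s
  for S :: "'a surface" and \<pi> \<Gamma>s +
  fixes G :: "('a \<Rightarrow> 'a) set"
  assumes G_sub: "subgroup G (Aut S)" and G_fin: "finite G"
    and G_sphere: "biholomorphic (quotient_surface S G) riemann_sphere"
begin

text \<open>The group of all lifts of G, an extension of G by \<open>\<Gamma>s\<close>; S/G is the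
  quotient of the disc by it.\<close>

definition \<Gamma>G :: "(complex \<Rightarrow> complex) set" where
  "\<Gamma>G = {F. \<exists>f\<in>G. covers F f}"

lemma \<Gamma>G_subgroup: "subgroup \<Gamma>G DA"
proof (rule subgroup.intro)
  interpret G: subgroup G "Aut S" by (rule G_sub)
  show "\<Gamma>G \<subseteq> carrier DA" by (auto simp: \<Gamma>G_def dest: coversD)
  show "x \<otimes>\<^bsub>DA\<^esub> y \<in> \<Gamma>G" if xy: "x \<in> \<Gamma>G" "y \<in> \<Gamma>G" for x y
  proof -
    obtain f h where "f \<in> G" "covers x f" "h \<in> G" "covers y h" using xy by (auto simp: \<Gamma>G_def)
    then show ?thesis unfolding \<Gamma>G_def using covers_mult G.m_closed by blast
  qed
  show "\<one>\<^bsub>DA\<^esub> \<in> \<Gamma>G" unfolding \<Gamma>G_def using covers_one[OF \<Gamma>s.one_closed] G.one_closed by blast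
  show "inv\<^bsub>DA\<^esub> x \<in> \<Gamma>G" if "x \<in> \<Gamma>G" for x
    using that covers_inv G.m_inv_closed unfolding \<Gamma>G_def by blast
qed

text \<open>All lifts of one f differ by \<open>\<Gamma>s\<close> from a fixed lift F, and a lift
  that lets K meet its image yields an element of \<open>\<Gamma>s\<close> doing so for the union of
  K and its image under F. Finiteness of G finishes.\<close>

lemma \<Gamma>G_fuchsian: "fuchsian_group \<Gamma>G"
  unfolding fuchsian_group_def
proof (intro conjI \<Gamma>G_subgroup allI impI)
  fix K :: "complex set" assume K: "compact K \<and> K \<subseteq> disc"
  have fin: "finite {g. covers g f \<and> g ` K \<inter> K \<noteq> {}}" if f: "f \<in> G" for f
  proof -
    obtain F where F: "covers F f" by (rule lift_exists[OF subgroup.mem_carrier[OF G_sub f]])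
    note Fc = coversD(1)[OF F]
    have FK: "F ` K \<subseteq> disc" using DA_closed[OF Fc] K by blast
    have "compact (F ` K)"
      by (rule compact_continuous_image[OF continuous_on_subset[OF holomorphic_on_imp_continuous_on[OF DA_holo[OF Fc]]]])
        (use K in auto)
    then have "finite {g \<in> \<Gamma>s. g ` (K \<union> F ` K) \<inter> (K \<union> F ` K) \<noteq> {}}"
      by (intro fuchsian_group_finite[OF fuchsian] compact_Un) (use K FK in auto)
    then have "finite ((\<lambda>g. g \<otimes>\<^bsub>DA\<^esub> F) ` {g \<in> \<Gamma>s. g ` (K \<union> F ` K) \<inter> (K \<union> F ` K) \<noteq> {}})" by simp
    moreover have "{g. covers g f \<and> g ` K \<inter> K \<noteq> {}} \<subseteq>
        (\<lambda>g. g \<otimes>\<^bsub>DA\<^esub> F) ` {g \<in> \<Gamma>s. g ` (K \<union> F ` K) \<inter> (K \<union> F ` K) \<noteq> {}}"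
    proof
      fix g assume "g \<in> {g. covers g f \<and> g ` K \<inter> K \<noteq> {}}"
      then obtain k where g: "covers g f" "k \<in> K" "g k \<in> K" by auto
      obtain h where h: "h \<in> \<Gamma>s" "g = h \<otimes>\<^bsub>DA\<^esub> F" using covers_same[OF g(1) F] by blast
      have "h (F k) = g k" using h Fc \<Gamma>s_DA[OF h(1)] g(2) K by (auto simp: DA_mult)
      have "h (F k) \<in> h ` (K \<union> F ` K)" by (rule imageI) (use g(2) in blast)
      with \<open>h (F k) = g k\<close> have "g k \<in> h ` (K \<union> F ` K) \<inter> (K \<union> F ` K)" using g(3) by simp
      then show "g \<in> (\<lambda>g. g \<otimes>\<^bsub>DA\<^esub> F) ` {g \<in> \<Gamma>s. g ` (K \<union> F ` K) \<inter> (K \<union> F ` K) \<noteq> {}}"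
        using h by blast
    qed
    ultimately show ?thesis by (rule finite_subset[rotated])
  qed
  have "{g \<in> \<Gamma>G. g ` K \<inter> K \<noteq> {}} \<subseteq> (\<Union>f\<in>G. {g. covers g f \<and> g ` K \<inter> K \<noteq> {}})"
    by (auto simp: \<Gamma>G_def)
  then show "finite {g \<in> \<Gamma>G. g ` K \<inter> K \<noteq> {}}"
    by (rule finite_subset) (rule finite_UN_I[OF G_fin fin])
qed

lemma \<Gamma>s_subset_\<Gamma>G: "\<Gamma>s \<subseteq> \<Gamma>G"
  unfolding \<Gamma>G_def using covers_one subgroup.one_closed[OF G_sub] by blast

lemma orbits_G:
  assumes z: "z \<in> disc" "w \<in> disc"
  shows "orb G (\<pi> z) = orb G (\<pi> w) \<longleftrightarrow> (\<exists>g\<in>\<Gamma>G. w = g z)"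
  unfolding Aut_orb_eq_iff[OF surface G_sub \<pi>_points[OF z(1)] \<pi>_points[OF z(2)]]
proof
  assume "\<exists>f\<in>G. \<pi> w = f (\<pi> z)"
  then obtain f where f: "f \<in> G" "\<pi> w = f (\<pi> z)" by blast
  obtain F where F: "covers F f" by (rule lift_exists[OF subgroup.mem_carrier[OF G_sub f(1)]])
  have Fz: "F z \<in> disc" by (rule DA_closed[OF coversD(1)[OF F] z(1)])
  have "\<pi> (F z) = \<pi> w" using coversD(3)[OF F z(1)] f(2) by simp
  then obtain g where g: "g \<in> \<Gamma>s" "w = g (F z)" using \<pi>_eq_iff[OF Fz z(2)] by blast
  have FG: "F \<in> \<Gamma>G" using F f(1) by (auto simp: \<Gamma>G_def)
  have "g \<otimes>\<^bsub>DA\<^esub> F \<in> \<Gamma>G" using subgroup.m_closed[OF \<Gamma>G_subgroup _ FG] g(1) \<Gamma>s_subset_\<Gamma>G by blast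
  moreover have "w = (g \<otimes>\<^bsub>DA\<^esub> F) z" using g \<Gamma>s_DA[OF g(1)] coversD(1)[OF F] z(1) by (simp add: DA_mult)
  ultimately show "\<exists>g\<in>\<Gamma>G. w = g z" by blast
next
  assume "\<exists>g\<in>\<Gamma>G. w = g z"
  then obtain g f where g: "f \<in> G" "covers g f" "w = g z" by (auto simp: \<Gamma>G_def)
  then show "\<exists>f\<in>G. \<pi> w = f (\<pi> z)" using coversD(3)[OF g(2) z(1)] by blast
qed

sublocale DQ: disc_quotient S \<pi> G \<Gamma>G
  by (rule disc_quotient.intro[OF param \<Gamma>G_subgroup orbits_G])

text \<open>Holomorphy is asserted on free sets, where charts of the quotient are at hand.
  Continuity into the compactified plane carries the remaining information across branch
  points.\<close>

lemma sphere_map: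
  obtains P where "continuous_map (top_of_set disc) (Alexandroff_compactification euclidean) P"
    "\<And>z w. z \<in> disc \<Longrightarrow> w \<in> disc \<Longrightarrow> P z = P w \<longleftrightarrow> (\<exists>g\<in>\<Gamma>G. w = g z)"
    "\<And>B. DQ.free_set B \<Longrightarrow> (\<lambda>z. the (P z)) holomorphic_on {z \<in> B. P z \<in> range Some}"
proof -
  obtain b where b: "biholomorphic_map (quotient_surface S G) riemann_sphere b"
    using G_sphere by (auto simp: biholomorphic_def)
  show thesis
  proof (rule that[of "b \<circ> DQ.q"])
    show "continuous_map (top_of_set disc) (Alexandroff_compactification euclidean) (b \<circ> DQ.q)"
      using DQ.composite_continuous[OF b] by (simp add: riemann_sphere_def)
    show "(b \<circ> DQ.q) z = (b \<circ> DQ.q) w \<longleftrightarrow> (\<exists>g\<in>\<Gamma>G. w = g z)" if "z \<in> disc" "w \<in> disc" for z w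
      using DQ.composite_eq_iff[OF b that] by simp
    fix B assume B: "DQ.free_set B"
    have "holomorphic_map (quotient_surface S G) riemann_sphere b" using b by (simp add: biholomorphic_map_def)
    moreover have "(range Some, the) \<in> atlas riemann_sphere" by (simp add: riemann_sphere_def)
    ultimately show "(\<lambda>z. the ((b \<circ> DQ.q) z)) holomorphic_on {z \<in> B. (b \<circ> DQ.q) z \<in> range Some}"
      using DQ.quotient_holomorphic[OF B] by simp
  qed
qed

lemma free_set_ball:
  assumes z: "z \<in> disc" "z \<notin> branch_points \<Gamma>G"
  obtains e where "e > 0" "DQ.free_set (ball z e)"
proof -
  obtain e where e: "e > 0" "ball z e \<subseteq> disc" "\<And>g w. g \<in> \<Gamma>G \<Longrightarrow> w \<in> ball z e \<Longrightarrow> g w \<in> ball z e \<Longrightarrow> g z = z"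
    using fuchsian_group_nbhd[OF \<Gamma>G_fuchsian z(1)] by blast
  have s: "stab \<Gamma>G z = {\<one>\<^bsub>DA\<^esub>}" using z by (simp add: branch_points_def)
  have "g = \<one>\<^bsub>DA\<^esub>" if "g \<in> \<Gamma>G" "w \<in> ball z e" "g w \<in> ball z e" for g w
  proof -
    have "g \<in> stab \<Gamma>G z" using e(3)[OF that] that(1) by (simp add: stab_def)
    then show ?thesis by (simp add: s)
  qed
  then have "DQ.free_set (ball z e)" using e(2) by (simp add: DQ.free_set_def)
  then show thesis by (rule that[OF e(1)])
qed

text \<open>Branch points are isolated and the map to the sphere is continuous there, so they are
  removable singularities of the finite coordinate. If the orbit of A is not already at infinity, c
  |-> 1/(c - a) puts it there.\<close>

lemma hauptmodul_exists:
  assumes A: "A \<in> disc"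
  obtains \<tau> where "hauptmodul \<Gamma>G A \<tau>"
proof -
  obtain P where Pc: "continuous_map (top_of_set disc) (Alexandroff_compactification euclidean) P"
    and Pe: "\<And>z w. z \<in> disc \<Longrightarrow> w \<in> disc \<Longrightarrow> P z = P w \<longleftrightarrow> (\<exists>g\<in>\<Gamma>G. w = g z)"
    and Ph: "\<And>B. DQ.free_set B \<Longrightarrow> (\<lambda>z. the (P z)) holomorphic_on {z \<in> B. P z \<in> range Some}"
    using sphere_map by blast
  have orb_P: "w \<in> orb \<Gamma>G z \<longleftrightarrow> P w = P z" if "z \<in> disc" "w \<in> disc" for z w
    using Pe[OF that] by (auto simp: mem_orb)
  have pre: "open {z \<in> disc. P z \<in> V}" if "openin (Alexandroff_compactification euclidean) V" for V
    using openin_continuous_map_preimage[OF Pc that] by (simp add: openin_open_eq)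
  have preS: "open {z \<in> disc. P z \<in> Some ` U}" if "open U" for U
    by (rule pre) (simp add: openin_Alexandroff_compactification_image_Some that)
  define \<tau>0 where "\<tau>0 z = the (P z)" for z
  define N where "N = {z \<in> disc. P z \<in> range Some}"
  have oN: "open N" unfolding N_def by (rule preS) simp
  have N_iff: "z \<in> N \<longleftrightarrow> z \<in> disc \<and> P z \<noteq> None" for z
    by (cases "P z") (auto simp: N_def)
  have PN: "P z = Some (\<tau>0 z)" if "z \<in> N" for z using that by (simp add: N_iff \<tau>0_def)
  have c0: "continuous_on N \<tau>0"
    unfolding continuous_on_open_vimage[OF oN]
  proof (intro allI impI)
    fix U :: "complex set" assume "open U"
    have "\<tau>0 -` U \<inter> N = {z \<in> disc. P z \<in> Some ` U}"
      using PN by (auto simp: N_iff \<tau>0_def)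
    then show "open (\<tau>0 -` U \<inter> N)" using preS[OF \<open>open U\<close>] by simp
  qed
  have h0: "\<tau>0 holomorphic_on N"
  proof (rule holomorphic_on_locally)
    fix z assume z: "z \<in> N"
    then have zd: "z \<in> disc" by (simp add: N_iff)
    obtain d where d: "d > 0" "ball z d \<subseteq> disc" "ball z d \<inter> branch_points \<Gamma>G \<subseteq> {z}"
      by (rule no_accumE[OF no_accum_branch_points[OF \<Gamma>G_fuchsian] zd])
    obtain e where e: "e > 0" "ball z e \<subseteq> N" using openE[OF oN z] by blast
    define B where "B = ball z (min d e)"
    have B: "B \<subseteq> N" "B \<inter> branch_points \<Gamma>G \<subseteq> {z}" "z \<in> B"
      using d e by (auto simp: B_def mem_ball subset_iff)
    have "\<tau>0 holomorphic_on B - {z}"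
    proof (rule holomorphic_on_locally)
      fix w assume w: "w \<in> B - {z}"
      then have wd: "w \<in> disc" "w \<notin> branch_points \<Gamma>G" using B N_iff by blast+
      obtain r where r: "r > 0" "DQ.free_set (ball w r)" by (rule free_set_ball[OF wd])
      have "\<tau>0 holomorphic_on {z \<in> ball w r. P z \<in> range Some}"
        using Ph[OF r(2)] unfolding \<tau>0_def[abs_def] .
      moreover have "{z \<in> ball w r. P z \<in> range Some} = ball w r \<inter> N"
        using r(2) by (auto simp: N_def DQ.free_set_def)
      ultimately have "\<tau>0 holomorphic_on ball w r \<inter> N" by simp
      moreover have "open (ball w r \<inter> N)" using oN by blast
      moreover have "w \<in> ball w r \<inter> N" using r(1) w B(1) by auto
      ultimately show "\<exists>M. open M \<and> w \<in> M \<and> \<tau>0 holomorphic_on M" by blast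
    qed
    then have "\<tau>0 holomorphic_on B"
      by (intro no_isolated_singularity[OF continuous_on_subset[OF c0 B(1)]]) (auto simp: B_def)
    then show "\<exists>M. open M \<and> z \<in> M \<and> \<tau>0 holomorphic_on M"
      using B(3) by (intro exI[of _ B]) (simp add: B_def)
  qed
  have evN: "eventually (\<lambda>w. w \<in> N) (at z)" if z: "z \<in> disc" for z
  proof (cases "P z = None")
    case True
    have "eventually (\<lambda>w. w \<in> disc - orb \<Gamma>G z) (at z)"
      by (rule eventually_not_isolated[OF no_accum_orb[OF \<Gamma>G_fuchsian z] z])
    then show ?thesis
      by (rule eventually_mono) (use orb_P[OF z] True in \<open>auto simp: N_iff\<close>)
  next
    case False
    then have "z \<in> N" using z by (simp add: N_iff)
    then show ?thesis using eventually_at_in_open'[OF oN] by blast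
  qed
  \<comment> \<open>Complements of closed balls together with infinity are neighbourhoods of
    infinity in the compactification.\<close>
  have pole0: "filterlim \<tau>0 at_infinity (at z)" if z: "z \<in> disc" "P z = None" for z
    unfolding filterlim_at_infinity[OF order_refl]
  proof (intro allI impI)
    fix R :: real assume "0 < R"
    define V where "V = insert None (Some ` (UNIV - cball (0::complex) R))"
    have "openin (Alexandroff_compactification euclidean) V"
      unfolding openin_Alexandroff_compactification V_def by (intro disjI2 exI[of _ "cball 0 R"]) auto
    then have o: "open {z \<in> disc. P z \<in> V}" by (rule pre)
    have "z \<in> {z \<in> disc. P z \<in> V}" using z by (simp add: V_def)
    then have "eventually (\<lambda>w. w \<in> {z \<in> disc. P z \<in> V}) (at z)"
      using eventually_at_in_open'[OF o] by blast
    with evN[OF z(1)] show "eventually (\<lambda>w. R \<le> norm (\<tau>0 w)) (at z)"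
    proof eventually_elim
      case (elim w)
      then have "Some (\<tau>0 w) \<in> V" using PN by simp
      then show ?case by (auto simp: V_def)
    qed
  qed
  show thesis
  proof (cases "P A")
    case None
    have orbA: "z \<in> orb \<Gamma>G A \<longleftrightarrow> P z = None" if "z \<in> disc" for z using orb_P[OF A that] None by simp
    have NA: "disc - orb \<Gamma>G A = N" using orbA by (auto simp: N_iff)
    have "hauptmodul \<Gamma>G A \<tau>0"
    proof (rule hauptmodul.intro[OF \<Gamma>G_fuchsian A])
      show "\<tau>0 holomorphic_on disc - orb \<Gamma>G A" using h0 by (simp add: NA)
      show "is_pole \<tau>0 z" if "z \<in> orb \<Gamma>G A" for z
      proof -
        have "z \<in> disc" using that fuchsian_orb_subset[OF \<Gamma>G_fuchsian A] by blast
        then show ?thesis unfolding is_pole_def using that orbA by (intro pole0) auto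
      qed
      show "\<tau>0 z = \<tau>0 w \<longleftrightarrow> (\<exists>g\<in>\<Gamma>G. w = g z)" if "z \<in> disc - orb \<Gamma>G A" "w \<in> disc - orb \<Gamma>G A" for z w
      proof -
        have "z \<in> N" "w \<in> N" using that NA by auto
        then show ?thesis using Pe[of z w] PN by (simp add: N_iff)
      qed
    qed
    then show thesis by (rule that)
  next
    case (Some a)
    have orbA: "z \<in> orb \<Gamma>G A \<longleftrightarrow> P z = Some a" if "z \<in> disc" for z using orb_P[OF A that] Some by simp
    \<comment> \<open>The value 0 over infinity is the limit of 1/(c - a) there, so the new
      coordinate is holomorphic at these points and still injective modulo the group.\<close>
    define \<tau> where "\<tau> z = (case P z of None \<Rightarrow> 0 | Some c \<Rightarrow> inverse (c - a))" for z
    have tN: "\<tau> z = inverse (\<tau>0 z - a)" if "z \<in> N" for z using PN[OF that] by (simp add: \<tau>_def)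
    have "hauptmodul \<Gamma>G A \<tau>"
    proof (rule hauptmodul.intro[OF \<Gamma>G_fuchsian A])
      have hM: "\<tau> holomorphic_on N - orb \<Gamma>G A"
      proof (rule holomorphic_transform)
        show "(\<lambda>z. inverse (\<tau>0 z - a)) holomorphic_on N - orb \<Gamma>G A"
        proof (intro holomorphic_intros holomorphic_on_subset[OF h0])
          fix z assume "z \<in> N - orb \<Gamma>G A"
          then show "\<tau>0 z - a \<noteq> 0" using orbA[of z] PN[of z] by (auto simp: N_iff)
        qed auto
      qed (simp add: tN)
      show "\<tau> holomorphic_on disc - orb \<Gamma>G A"
      proof (rule holomorphic_on_locally)
        fix z assume z: "z \<in> disc - orb \<Gamma>G A"
        then have zd: "z \<in> disc" by simp
        have oD: "open (disc - orb \<Gamma>G A)" by (rule open_diff_isolated[OF no_accum_orb[OF \<Gamma>G_fuchsian A]])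
        show "\<exists>M. open M \<and> z \<in> M \<and> \<tau> holomorphic_on M"
        proof (cases "P z = None")
          case True
          obtain d where d: "d > 0" "ball z d \<subseteq> disc" "ball z d \<inter> orb \<Gamma>G z \<subseteq> {z}"
            by (rule no_accumE[OF no_accum_orb[OF \<Gamma>G_fuchsian zd] zd])
          obtain e where e: "e > 0" "ball z e \<subseteq> disc - orb \<Gamma>G A" using openE[OF oD z] by blast
          define B where "B = ball z (min d e)"
          have Bd: "B \<subseteq> ball z d" "B \<subseteq> ball z e" "z \<in> B" using d(1) e(1) by (auto simp: B_def mem_ball)
          have "B - {z} \<subseteq> N - orb \<Gamma>G A"
          proof
            fix w assume w: "w \<in> B - {z}"
            then have "w \<in> disc" "w \<notin> orb \<Gamma>G A" "w \<notin> orb \<Gamma>G z" using Bd d e by blast+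
            then show "w \<in> N - orb \<Gamma>G A" using orb_P[OF zd] True by (simp add: N_iff)
          qed
          then have hB: "\<tau> holomorphic_on B - {z}" by (rule holomorphic_on_subset[OF hM])
          have "filterlim (\<lambda>w. \<tau>0 w - a) at_infinity (at z)"
            using tendsto_add_filterlim_at_infinity'[OF pole0[OF zd True] tendsto_const[of "- a"]] by simp
          then have "((\<lambda>w. inverse (\<tau>0 w - a)) \<longlongrightarrow> 0) (at z)"
            by (rule filterlim_compose[OF tendsto_inverse_0])
          then have "(\<tau> \<longlongrightarrow> 0) (at z)"
            by (rule Lim_transform_eventually) (rule eventually_mono[OF evN[OF zd]], simp add: tN)
          then have "(\<tau> \<longlongrightarrow> \<tau> z) (at z)" using True by (simp add: \<tau>_def)
          then have "\<tau> holomorphic_on B"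
            by (intro no_isolated_singularity'[OF _ hB]) (auto simp: B_def intro: tendsto_within_subset)
          then show ?thesis using Bd(3) by (intro exI[of _ B]) (simp add: B_def)
        next
          case False
          then have "z \<in> N - orb \<Gamma>G A" using z by (simp add: N_iff)
          moreover have "N - orb \<Gamma>G A = N \<inter> (disc - orb \<Gamma>G A)" by (auto simp: N_iff)
          then have "open (N - orb \<Gamma>G A)" using oN oD by auto
          ultimately show ?thesis using hM by blast
        qed
      qed
      show "is_pole \<tau> z" if "z \<in> orb \<Gamma>G A" for z
      proof -
        have zd: "z \<in> disc" using that fuchsian_orb_subset[OF \<Gamma>G_fuchsian A] by blast
        then have Pz: "P z = Some a" using orbA that by simp
        then have zN: "z \<in> N" using zd by (simp add: N_iff)
        have "isCont \<tau>0 z" using continuous_on_interior[OF c0] zN oN by (simp add: interior_open)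
        then have "(\<tau>0 \<longlongrightarrow> a) (at z)" using PN[OF zN] Pz by (simp add: isCont_def)
        then have "((\<lambda>w. \<tau>0 w - a) \<longlongrightarrow> 0) (at z)" using tendsto_diff[OF _ tendsto_const[of a]] by force
        moreover have "eventually (\<lambda>w. w \<in> N \<and> w \<in> disc - orb \<Gamma>G A) (at z)"
          by (rule eventually_conj[OF evN[OF zd] eventually_not_isolated[OF no_accum_orb[OF \<Gamma>G_fuchsian A] zd]])
        then have ev: "eventually (\<lambda>w. w \<in> N \<and> \<tau>0 w - a \<noteq> 0) (at z)"
        proof (rule eventually_mono)
          fix w assume w: "w \<in> N \<and> w \<in> disc - orb \<Gamma>G A"
          then show "w \<in> N \<and> \<tau>0 w - a \<noteq> 0" using orbA[of w] PN[of w] by auto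
        qed
        ultimately have "filterlim (\<lambda>w. \<tau>0 w - a) (at 0) (at z)"
          unfolding filterlim_at by (auto elim: eventually_mono)
        then have "filterlim (\<lambda>w. inverse (\<tau>0 w - a)) at_infinity (at z)"
          by (rule filterlim_compose[OF filterlim_inverse_at_infinity])
        moreover have "eventually (\<lambda>w. inverse (\<tau>0 w - a) = \<tau> w) (at z)"
          by (rule eventually_mono[OF ev]) (simp add: tN)
        ultimately show ?thesis unfolding is_pole_def by (rule filterlim_mono_eventually[OF _ order_refl order_refl])
      qed
      show "\<tau> z = \<tau> w \<longleftrightarrow> (\<exists>g\<in>\<Gamma>G. w = g z)" if zw: "z \<in> disc - orb \<Gamma>G A" "w \<in> disc - orb \<Gamma>G A" for z w
      proof -
        have na: "P z \<noteq> Some a" "P w \<noteq> Some a" using zw orbA by auto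
        have "\<tau> z = \<tau> w \<longleftrightarrow> P z = P w"
          using na by (cases "P z"; cases "P w") (auto simp: \<tau>_def)
        then show ?thesis using Pe[of z w] zw by simp
      qed
    qed
    then show thesis by (rule that)
  qed
qed

end

section \<open>Orders of meromorphic functions\<close>

text \<open>Order as a local factorization, negative at poles. The value at z is left open, and a
  function vanishing near z has no order at all.\<close>

definition has_ord :: "(complex \<Rightarrow> complex) \<Rightarrow> complex \<Rightarrow> int \<Rightarrow> bool" where
  "has_ord f z k \<longleftrightarrow> (\<exists>h r. r > 0 \<and> h holomorphic_on ball z r \<and> (\<forall>w\<in>ball z r. h w \<noteq> 0) \<and>
     (\<forall>w\<in>ball z r - {z}. f w = h w * (w - z) powi k))"

lemma has_ordE:
  assumes "has_ord f z k" "e > 0"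
  obtains h r where "r > 0" "r \<le> e" "h holomorphic_on ball z r" "\<And>w. w \<in> ball z r \<Longrightarrow> h w \<noteq> 0"
    "\<And>w. w \<in> ball z r \<Longrightarrow> w \<noteq> z \<Longrightarrow> f w = h w * (w - z) powi k"
proof -
  obtain h r where h: "r > 0" "h holomorphic_on ball z r" "\<And>w. w \<in> ball z r \<Longrightarrow> h w \<noteq> 0"
    "\<And>w. w \<in> ball z r - {z} \<Longrightarrow> f w = h w * (w - z) powi k"
    using assms(1) unfolding has_ord_def by blast
  have s: "ball z (min r e) \<subseteq> ball z r" by (auto simp: mem_ball)
  show thesis
    by (rule that[of "min r e" h]) (use h assms(2) s in \<open>auto intro: holomorphic_on_subset\<close>)
qed

lemma has_ordI:
  assumes "open N" "z \<in> N" "h holomorphic_on N" "\<And>w. w \<in> N \<Longrightarrow> h w \<noteq> 0"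
    "\<And>w. w \<in> N \<Longrightarrow> w \<noteq> z \<Longrightarrow> f w = h w * (w - z) powi k"
  shows "has_ord f z k"
proof -
  obtain r where r: "r > 0" "ball z r \<subseteq> N" using openE[OF assms(1,2)] by blast
  show ?thesis unfolding has_ord_def
    by (intro exI[of _ h] exI[of _ r]) (use r assms in \<open>auto intro: holomorphic_on_subset\<close>)
qed

lemma has_ord_cong:
  assumes "has_ord f z k" "eventually (\<lambda>w. f w = g w) (at z)"
  shows "has_ord g z k"
proof -
  obtain e where e: "e > 0" "\<And>w. w \<noteq> z \<Longrightarrow> dist w z < e \<Longrightarrow> f w = g w"
    using assms(2) unfolding eventually_at by blast
  obtain h r where h: "r > 0" "r \<le> e" "h holomorphic_on ball z r" "\<And>w. w \<in> ball z r \<Longrightarrow> h w \<noteq> 0"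
    "\<And>w. w \<in> ball z r \<Longrightarrow> w \<noteq> z \<Longrightarrow> f w = h w * (w - z) powi k"
    by (rule has_ordE[OF assms(1) e(1)]) (rule that, assumption+)
  show ?thesis
  proof (rule has_ordI[of "ball z r" z h])
    fix w assume w: "w \<in> ball z r" "w \<noteq> z"
    then have "f w = g w" using h(2) by (intro e(2)) (auto simp: mem_ball dist_commute)
    then show "g w = h w * (w - z) powi k" using h(5)[OF w] by simp
  qed (use h in auto)
qed

lemma has_ord_analytic:
  assumes "open N" "z \<in> N" "f holomorphic_on N" "f z \<noteq> 0"
  shows "has_ord f z 0"
proof -
  have "continuous_on N f" by (rule holomorphic_on_imp_continuous_on[OF assms(3)])
  then have "open (f -` (- {0}) \<inter> N)" using continuous_on_open_vimage[OF assms(1)] by blast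
  then show ?thesis
    by (rule has_ordI[of _ _ f]) (use assms in \<open>auto intro: holomorphic_on_subset\<close>)
qed

lemma has_ord_mult:
  assumes "has_ord f z k" "has_ord g z l"
  shows "has_ord (\<lambda>w. f w * g w) z (k + l)"
proof -
  obtain h r where h: "r > 0" "r \<le> 1" "h holomorphic_on ball z r" "\<And>w. w \<in> ball z r \<Longrightarrow> h w \<noteq> 0"
    "\<And>w. w \<in> ball z r \<Longrightarrow> w \<noteq> z \<Longrightarrow> f w = h w * (w - z) powi k"
    by (rule has_ordE[OF assms(1) zero_less_one]) (rule that, assumption+)
  obtain j s where j: "s > 0" "s \<le> r" "j holomorphic_on ball z s" "\<And>w. w \<in> ball z s \<Longrightarrow> j w \<noteq> 0"
    "\<And>w. w \<in> ball z s \<Longrightarrow> w \<noteq> z \<Longrightarrow> g w = j w * (w - z) powi l"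
    by (rule has_ordE[OF assms(2) h(1)]) (rule that, assumption+)
  have s: "ball z s \<subseteq> ball z r" using j(2) by (auto simp: mem_ball)
  show ?thesis
  proof (rule has_ordI[of "ball z s" z "\<lambda>w. h w * j w"])
    show "(\<lambda>w. h w * j w) holomorphic_on ball z s"
      by (intro holomorphic_intros j(3) holomorphic_on_subset[OF h(3) s])
    show "h w * j w \<noteq> 0" if "w \<in> ball z s" for w using h(4)[of w] j(4)[OF that] s that by auto
    fix w assume w: "w \<in> ball z s" "w \<noteq> z"
    then have "f w = h w * (w - z) powi k" "g w = j w * (w - z) powi l" using h(5)[of w] j(5)[of w] s by auto
    moreover have "(w - z) powi (k + l) = (w - z) powi k * (w - z) powi l" using w by (simp add: power_int_add)
    ultimately show "f w * g w = h w * j w * (w - z) powi (k + l)" by (simp only: mult_ac)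
  qed (use j in auto)
qed

lemma has_ord_inverse:
  assumes "has_ord f z k"
  shows "has_ord (\<lambda>w. inverse (f w)) z (- k)"
proof -
  obtain h r where h: "r > 0" "r \<le> 1" "h holomorphic_on ball z r" "\<And>w. w \<in> ball z r \<Longrightarrow> h w \<noteq> 0"
    "\<And>w. w \<in> ball z r \<Longrightarrow> w \<noteq> z \<Longrightarrow> f w = h w * (w - z) powi k"
    by (rule has_ordE[OF assms(1) zero_less_one]) (rule that, assumption+)
  show ?thesis
  proof (rule has_ordI[of "ball z r" z "\<lambda>w. inverse (h w)"])
    show "(\<lambda>w. inverse (h w)) holomorphic_on ball z r" by (intro holomorphic_intros h(3,4))
  qed (use h in \<open>auto simp: power_int_minus\<close>)
qed

lemma has_ord_divide:
  assumes "has_ord f z k" "has_ord g z l"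
  shows "has_ord (\<lambda>w. f w / g w) z (k - l)"
  using has_ord_mult[OF assms(1) has_ord_inverse[OF assms(2)]] by (simp add: divide_inverse)

lemma has_ord_power:
  assumes "has_ord f z k"
  shows "has_ord (\<lambda>w. f w ^ n) z (int n * k)"
proof (induction n)
  case 0
  show ?case using has_ord_analytic[of UNIV z "\<lambda>_. 1"] by simp
next
  case (Suc n)
  show ?case using has_ord_mult[OF assms Suc] by (simp add: algebra_simps)
qed

lemma has_ord_nonzero:
  assumes "has_ord f z k"
  shows "eventually (\<lambda>w. f w \<noteq> 0) (at z)"
proof -
  obtain h r where h: "r > 0" "r \<le> 1" "h holomorphic_on ball z r" "\<And>w. w \<in> ball z r \<Longrightarrow> h w \<noteq> 0"
    "\<And>w. w \<in> ball z r \<Longrightarrow> w \<noteq> z \<Longrightarrow> f w = h w * (w - z) powi k"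
    by (rule has_ordE[OF assms(1) zero_less_one]) (rule that, assumption+)
  have "f w \<noteq> 0" if "w \<noteq> z" "dist w z < r" for w
    using h(4,5)[of w] that by (simp add: mem_ball dist_commute)
  then show ?thesis unfolding eventually_at using h(1) by blast
qed

lemma has_ord_tendsto:
  assumes "has_ord f z k" "k \<ge> 0"
  obtains c where "(f \<longlongrightarrow> c) (at z)" "c = 0 \<longleftrightarrow> k > 0"
proof -
  obtain h r where h: "r > 0" "r \<le> 1" "h holomorphic_on ball z r" "\<And>w. w \<in> ball z r \<Longrightarrow> h w \<noteq> 0"
    "\<And>w. w \<in> ball z r \<Longrightarrow> w \<noteq> z \<Longrightarrow> f w = h w * (w - z) powi k"
    by (rule has_ordE[OF assms(1) zero_less_one]) (rule that, assumption+)
  have "isCont h z"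
    using continuous_on_interior[OF holomorphic_on_imp_continuous_on[OF h(3)]] h(1) by simp
  then have "(h \<longlongrightarrow> h z) (at z)" by (simp add: isCont_def)
  moreover have "((\<lambda>w. (w - z) ^ nat k) \<longlongrightarrow> (z - z) ^ nat k) (at z)" by (intro tendsto_intros)
  ultimately have "((\<lambda>w. h w * (w - z) ^ nat k) \<longlongrightarrow> h z * (z - z) ^ nat k) (at z)" by (rule tendsto_mult)
  then have "(f \<longlongrightarrow> h z * (z - z) ^ nat k) (at z)"
  proof (rule Lim_transform_eventually)
    have "h w * (w - z) ^ nat k = f w" if "w \<noteq> z" "dist w z < r" for w
      using h(5)[of w] that assms(2) by (simp add: mem_ball dist_commute power_int_def)
    then show "eventually (\<lambda>w. h w * (w - z) ^ nat k = f w) (at z)"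
      unfolding eventually_at using h(1) by blast
  qed
  moreover have "h z * (z - z) ^ nat k = 0 \<longleftrightarrow> k > 0"
    using h(1) h(4)[of z] by (cases "nat k") (auto simp: mem_ball)
  ultimately show thesis by (rule that)
qed

lemma has_ord_isCont:
  assumes "has_ord f z k" "k \<ge> 0" "isCont f z"
  shows "f z = 0 \<longleftrightarrow> k > 0"
proof -
  obtain c where c: "(f \<longlongrightarrow> c) (at z)" "c = 0 \<longleftrightarrow> k > 0" by (rule has_ord_tendsto[OF assms(1,2)])
  have "(f \<longlongrightarrow> f z) (at z)" using assms(3) by (simp add: isCont_def)
  then have "c = f z" using tendsto_unique[OF _ c(1)] by simp
  then show ?thesis using c(2) by simp
qed

lemma has_ord_unique:
  assumes "has_ord f z k" "has_ord f z l"
  shows "k = l"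
proof -
  have *: "\<not> k < l" if f: "has_ord f z k" "has_ord f z l" for k l
  proof
    assume "k < l"
    have "has_ord (\<lambda>w. f w / f w) z (l - k)" by (rule has_ord_divide[OF f(2,1)])
    then obtain c where c: "((\<lambda>w. f w / f w) \<longlongrightarrow> c) (at z)" "c = 0 \<longleftrightarrow> l - k > 0"
      using has_ord_tendsto[of "\<lambda>w. f w / f w" z "l - k"] \<open>k < l\<close> by auto
    have "((\<lambda>w. f w / f w) \<longlongrightarrow> 1) (at z)"
      by (rule tendsto_eventually) (rule eventually_mono[OF has_ord_nonzero[OF f(1)]], simp)
    then have "c = 1" using tendsto_unique[OF _ c(1)] by simp
    then show False using c(2) \<open>k < l\<close> by simp
  qed
  show ?thesis using *[OF assms] *[OF assms(2,1)] by simp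
qed

lemma has_ord_zero:
  assumes "f holomorphic_on S" "open S" "connected S" "z \<in> S" "w \<in> S" "f w \<noteq> 0"
  obtains k :: nat where "has_ord f z (int k)" "k > 0 \<longleftrightarrow> f z = 0"
proof -
  define n where "n = zorder f z"
  define g where "g = zor_poly f z"
  have "(if f z = 0 then n > 0 else n = 0) \<and> (\<exists>r. r > 0 \<and> cball z r \<subseteq> S \<and> g holomorphic_on cball z r
    \<and> (\<forall>w\<in>cball z r. f w = g w * (w - z) ^ nat n \<and> g w \<noteq> 0))"
    unfolding n_def g_def by (rule zorder_exist_zero[OF assms(1-4)]) (use assms in blast)
  then obtain r where n: "if f z = 0 then n > 0 else n = 0" and r: "r > 0" "g holomorphic_on cball z r"
    "\<And>w. w \<in> cball z r \<Longrightarrow> f w = g w * (w - z) ^ nat n \<and> g w \<noteq> 0" by blast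
  have "has_ord f z (int (nat n))"
  proof (rule has_ordI[of "ball z r" z g])
    show "g holomorphic_on ball z r" by (rule holomorphic_on_subset[OF r(2)]) auto
    show "f w = g w * (w - z) powi int (nat n)" if "w \<in> ball z r" for w
      unfolding power_int_of_nat using r(3)[of w] that by (simp add: mem_ball)
  qed (use r in \<open>auto simp: mem_ball\<close>)
  moreover have "nat n > 0 \<longleftrightarrow> f z = 0" using n by (auto split: if_splits)
  ultimately show thesis by (rule that)
qed

text \<open>Differentiating h(w) (w - z)^k leaves (w - z)^(k - 1) times a factor whose value at z is
  k h(z), which is nonzero.\<close>

lemma has_ord_deriv:
  assumes "has_ord f z k" "k \<noteq> 0"
  shows "has_ord (deriv f) z (k - 1)"
proof -
  obtain h r where h: "r > 0" "r \<le> 1" "h holomorphic_on ball z r" "\<And>w. w \<in> ball z r \<Longrightarrow> h w \<noteq> 0"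
    "\<And>w. w \<in> ball z r \<Longrightarrow> w \<noteq> z \<Longrightarrow> f w = h w * (w - z) powi k"
    by (rule has_ordE[OF assms(1) zero_less_one]) (rule that, assumption+)
  define j where "j w = deriv h w * (w - z) + of_int k * h w" for w
  have hj: "j holomorphic_on ball z r" unfolding j_def
    by (intro holomorphic_intros h(3)) auto
  have jz: "j z \<noteq> 0" using assms(2) h(1) h(4)[of z] by (simp add: j_def)
  have "has_ord (\<lambda>w. j w * (w - z) powi (k - 1)) z (0 + (k - 1))"
  proof (rule has_ord_mult)
    show "has_ord j z 0" by (rule has_ord_analytic[OF open_ball _ hj jz]) (use h(1) in simp)
    show "has_ord (\<lambda>w. (w - z) powi (k - 1)) z (k - 1)"
      by (rule has_ordI[of UNIV z "\<lambda>_. 1"]) auto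
  qed
  then have "has_ord (\<lambda>w. j w * (w - z) powi (k - 1)) z (k - 1)" by simp
  then show ?thesis
  proof (rule has_ord_cong)
    have "j w * (w - z) powi (k - 1) = deriv f w" if w: "w \<noteq> z" "dist w z < r" for w
    proof -
      have wb: "w \<in> ball z r - {z}" using w by (simp add: mem_ball dist_commute)
      have "(h has_field_derivative deriv h w) (at w)"
        using holomorphic_derivI[OF h(3) open_ball] wb by blast
      moreover have "((\<lambda>w. (w - z) powi k) has_field_derivative (of_int k * (w - z) powi (k - 1))) (at w)"
        using w(1) by (auto intro!: derivative_eq_intros)
      ultimately have "((\<lambda>w. h w * (w - z) powi k) has_field_derivative
          (h w * (of_int k * (w - z) powi (k - 1)) + deriv h w * (w - z) powi k)) (at w)"
        by (rule DERIV_mult'[THEN DERIV_cong]) (simp add: mult_ac)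
      then have "(f has_field_derivative
          (h w * (of_int k * (w - z) powi (k - 1)) + deriv h w * (w - z) powi k)) (at w)"
        by (rule has_field_derivative_transform_within_open[of _ _ _ "ball z r - {z}"])
          (use wb h(5) in auto)
      then have "deriv f w = h w * (of_int k * (w - z) powi (k - 1)) + deriv h w * (w - z) powi k"
        by (rule DERIV_imp_deriv)
      moreover have "(w - z) powi k = (w - z) * (w - z) powi (k - 1)"
        using power_int_add_1[of "w - z" "k - 1"] w(1) by (simp add: mult.commute)
      ultimately show ?thesis by (simp add: j_def algebra_simps)
    qed
    then show "eventually (\<lambda>w. j w * (w - z) powi (k - 1) = deriv f w) (at z)"
      unfolding eventually_at using h(1) by blast
  qed
qed

text \<open>The leading coefficient of \<open>f \<circ> E\<close> at a fixed point of \<open>E\<close> differs from that of \<open>f\<close> by a power of the multiplier.\<close>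

lemma has_ord_compose_ratio:
  assumes f: "has_ord f z k" and E: "(E has_field_derivative \<zeta>) (at z)" "E z = z" "\<zeta> \<noteq> 0"
    and inj: "eventually (\<lambda>w. E w \<noteq> z) (at z)"
  shows "((\<lambda>w. f (E w) / f w) \<longlongrightarrow> \<zeta> powi k) (at z)"
proof -
  obtain h r where h: "r > 0" "r \<le> 1" "h holomorphic_on ball z r" "\<And>w. w \<in> ball z r \<Longrightarrow> h w \<noteq> 0"
    "\<And>w. w \<in> ball z r \<Longrightarrow> w \<noteq> z \<Longrightarrow> f w = h w * (w - z) powi k"
    by (rule has_ordE[OF f zero_less_one]) (rule that, assumption+)
  have ch: "isCont h z"
    using continuous_on_interior[OF holomorphic_on_imp_continuous_on[OF h(3)]] h(1) by simp
  have cE: "isCont E z" by (rule DERIV_isCont[OF E(1)])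
  have lE: "(E \<longlongrightarrow> z) (at z)" using cE E(2) by (simp add: isCont_def)
  have "((\<lambda>w. (E w - E z) / (w - z)) \<longlongrightarrow> \<zeta>) (at z)"
    using E(1) by (simp add: has_field_derivative_iff)
  then have q: "((\<lambda>w. (E w - z) / (w - z)) \<longlongrightarrow> \<zeta>) (at z)" by (simp add: E(2))
  have hz: "h z \<noteq> 0" using h(1) h(4)[of z] by simp
  have "((\<lambda>w. h (E w)) \<longlongrightarrow> h z) (at z)"
    by (rule isCont_tendsto_compose[OF ch lE])
  moreover have "(h \<longlongrightarrow> h z) (at z)" using ch by (simp add: isCont_def)
  ultimately have "((\<lambda>w. h (E w) / h w) \<longlongrightarrow> h z / h z) (at z)" using hz by (rule tendsto_divide)
  then have "((\<lambda>w. h (E w) / h w * ((E w - z) / (w - z)) powi k) \<longlongrightarrow> h z / h z * \<zeta> powi k) (at z)"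
    by (rule tendsto_mult[OF _ tendsto_power_int[OF q E(3)]])
  then have "((\<lambda>w. h (E w) / h w * ((E w - z) / (w - z)) powi k) \<longlongrightarrow> \<zeta> powi k) (at z)"
    using hz by simp
  then show ?thesis
  proof (rule Lim_transform_eventually)
    have "eventually (\<lambda>w. E w \<in> ball z r) (at z)"
      using lE h(1) by (intro topological_tendstoD) auto
    moreover have "eventually (\<lambda>w. w \<in> ball z r) (at z)" using h(1) by (intro eventually_at_in_open') auto
    moreover have "eventually (\<lambda>w. w \<noteq> z) (at z)" by (simp add: eventually_at_filter)
    ultimately show "eventually (\<lambda>w. h (E w) / h w * ((E w - z) / (w - z)) powi k = f (E w) / f w) (at z)"
      using inj
    proof eventually_elim
      case (elim w)
      then have "f (E w) = h (E w) * (E w - z) powi k" "f w = h w * (w - z) powi k" using h(5) by auto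
      then show ?case by (simp add: power_int_divide_distrib)
    qed
  qed
qed

text \<open>Near a zero of order \<open>k\<close> every small value is attained \<open>k\<close> times.\<close>

lemma has_ord_le_card:
  assumes ord: "has_ord f z0 (int k)" and e: "e > 0" and f0: "f z0 = 0" and "k > 0"
    and H: "finite H" and eq: "\<And>z w. z \<in> ball z0 e \<Longrightarrow> w \<in> ball z0 e \<Longrightarrow> f z = f w \<Longrightarrow> \<exists>g\<in>H. w = g z"
  shows "k \<le> card H"
proof -
  obtain h r where h: "r > 0" "r \<le> e" "h holomorphic_on ball z0 r" "\<And>w. w \<in> ball z0 r \<Longrightarrow> h w \<noteq> 0"
    "\<And>w. w \<in> ball z0 r \<Longrightarrow> w \<noteq> z0 \<Longrightarrow> f w = h w * (w - z0) powi (int k)"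
    by (rule has_ordE[OF ord e]) (rule that, assumption+)
  have z0: "z0 \<in> ball z0 r" using h(1) by simp
  obtain L where L: "L holomorphic_on ball z0 r" "\<And>w. w \<in> ball z0 r \<Longrightarrow> exp (L w) = h w"
    using holomorphic_logarithm_exists[OF convex_ball open_ball h(3) h(4) z0] by metis
  \<comment> \<open>A k-th root of f with a simple zero at z0, hence a local coordinate in which f
    is the k-th power.\<close>
  define j where "j w = (w - z0) * exp (L w / of_nat k)" for w
  have hj: "j holomorphic_on ball z0 r" unfolding j_def
    by (intro holomorphic_intros L(1)) (use \<open>k > 0\<close> in auto)
  have jk: "j w ^ k = f w" if w: "w \<in> ball z0 r" for w
  proof (cases "w = z0")
    case True
    then show ?thesis using f0 \<open>k > 0\<close> by (simp add: j_def)
  next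
    case False
    have "exp (L w / of_nat k) ^ k = h w"
      using L(2)[OF w] \<open>k > 0\<close> by (simp flip: exp_of_nat_mult)
    then show ?thesis using h(5)[OF w False] by (simp add: j_def power_mult_distrib mult.commute)
  qed
  define K where "K w = exp (L w / of_nat k)" for w
  have hK: "K holomorphic_on ball z0 r" unfolding K_def
    by (intro holomorphic_intros L(1)) (use \<open>k > 0\<close> in auto)
  have "((\<lambda>w. (w - z0) * K w) has_field_derivative (z0 - z0) * deriv K z0 + 1 * K z0) (at z0)"
    by (rule DERIV_mult'[THEN DERIV_cong])
      (use holomorphic_derivI[OF hK open_ball z0] in \<open>auto intro!: derivative_eq_intros\<close>)
  then have "deriv j z0 = K z0" unfolding j_def[abs_def] K_def by (simp add: DERIV_imp_deriv)
  then have "deriv j z0 \<noteq> 0" by (simp add: K_def)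
  then obtain s where s: "s > 0" "ball z0 s \<subseteq> ball z0 r" "inj_on j (ball z0 s)"
    using has_complex_derivative_locally_injective[OF hj z0 open_ball] by blast
  have "open (j ` ball z0 s)"
    by (rule open_mapping_thm3[OF holomorphic_on_subset[OF hj s(2)] open_ball s(3)])
  moreover have "0 \<in> j ` ball z0 s" by (rule image_eqI[of _ _ z0]) (use s(1) in \<open>auto simp: j_def\<close>)
  ultimately obtain d where d: "d > 0" "ball 0 d \<subseteq> j ` ball z0 s" using openE by blast
  \<comment> \<open>A value whose k-th roots all have modulus d/2 and so lie in the ball of radius d
    covered by j.\<close>
  define c where "c = (of_real (d / 2) :: complex) ^ k"
  have c: "c \<noteq> 0" using d(1) by (simp add: c_def)
  define R where "R = {z::complex. z ^ k = c}"
  have cardR: "card R = k" unfolding R_def by (rule card_nth_roots[OF c \<open>k > 0\<close>])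
  have RB: "R \<subseteq> j ` ball z0 s"
  proof
    fix z assume "z \<in> R"
    then have "z ^ k = c" by (simp add: R_def)
    then have "norm z ^ k = norm c" by (simp flip: norm_power)
    also have "norm c = (d / 2) ^ k" using d(1) by (simp add: c_def norm_power norm_divide)
    finally have "norm z ^ k = (d / 2) ^ k" .
    then have "norm z = d / 2"
      using power_eq_iff_eq_base[OF \<open>k > 0\<close>, of "norm z" "d / 2"] d(1) by simp
    then show "z \<in> j ` ball z0 s" using d by (intro subsetD[OF d(2)]) (simp add: mem_ball_0)
  qed
  define W where "W = {w \<in> ball z0 s. j w \<in> R}"
  have jW: "j ` W = R" using RB by (auto simp: W_def)
  have "inj_on j W" by (rule inj_on_subset[OF s(3)]) (auto simp: W_def)
  then have cardW: "card W = k" using card_image[of j W] jW cardR by simp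
  then obtain w0 where w0: "w0 \<in> W" using \<open>k > 0\<close> by fastforce
  have Wr: "w \<in> ball z0 r" "w \<in> ball z0 e" if "w \<in> W" for w
    using that s(2) h(2) by (auto simp: W_def mem_ball)
  have fW: "f w = c" if "w \<in> W" for w
    using jk[OF Wr(1)[OF that]] that by (simp add: W_def R_def)
  have "W \<subseteq> (\<lambda>g. g w0) ` H"
  proof
    fix w assume w: "w \<in> W"
    have "f w0 = f w" using fW[OF w] fW[OF w0] by simp
    then obtain g where "g \<in> H" "w = g w0" using eq[OF Wr(2)[OF w0] Wr(2)[OF w]] by blast
    then show "w \<in> (\<lambda>g. g w0) ` H" by blast
  qed
  then have "card W \<le> card ((\<lambda>g. g w0) ` H)" using H by (intro card_mono) auto
  also have "\<dots> \<le> card H" by (rule card_image_le[OF H])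
  finally show ?thesis using cardW by simp
qed

text \<open>The values at the removed points are the limits, which is stated separately so that they
  can be read off later.\<close>

lemma has_ord_extend:
  assumes iso: "no_accum D" and f: "f holomorphic_on disc - D"
    and lim: "\<And>z. z \<in> D \<inter> disc \<Longrightarrow> \<exists>c. (f \<longlongrightarrow> c) (at z)"
  obtains F where "F holomorphic_on disc" "\<And>z. z \<in> disc - D \<Longrightarrow> F z = f z"
    "\<And>z. z \<in> disc \<Longrightarrow> eventually (\<lambda>w. F w = f w) (at z)" "\<And>z c. z \<in> D \<inter> disc \<Longrightarrow> (f \<longlongrightarrow> c) (at z) \<Longrightarrow> F z = c"
proof -
  define F where "F z = (if z \<in> D then Lim (at z) f else f z)" for z
  have eqF: "F z = f z" if "z \<in> disc - D" for z using that by (simp add: F_def)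
  have FD: "F z = c" if "z \<in> D \<inter> disc" "(f \<longlongrightarrow> c) (at z)" for z c
    using that tendsto_Lim[OF _ that(2)] by (simp add: F_def)
  have ev: "eventually (\<lambda>w. F w = f w) (at z)" if "z \<in> disc" for z
    by (rule eventually_mono[OF eventually_not_isolated[OF iso that]]) (rule eqF)
  have "F holomorphic_on disc"
  proof (rule holomorphic_extend_isolated[OF iso])
    show "F holomorphic_on disc - D" by (rule holomorphic_transform[OF f]) (simp add: eqF)
    fix z assume z: "z \<in> D \<inter> disc"
    obtain c where c: "(f \<longlongrightarrow> c) (at z)" using lim[OF z] by blast
    have "(F \<longlongrightarrow> c) (at z)"
      by (rule Lim_transform_eventually[OF c]) (rule eventually_mono[OF ev], use z in auto)
    then show "(F \<longlongrightarrow> F z) (at z)" using FD[OF z c] by simp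
  qed
  then show thesis using eqF ev FD by (rule that)
qed

section \<open>Derivatives of disc automorphisms\<close>

lemma DA_has_field_derivative:
  assumes "g \<in> carrier DA" "z \<in> disc"
  shows "(g has_field_derivative deriv g z) (at z)" "deriv g z \<noteq> 0"
  using holomorphic_derivI[OF DA_holo[OF assms(1)] open_ball assms(2)]
    holomorphic_injective_imp_regular[OF DA_holo[OF assms(1)] open_ball DA_inj[OF assms(1)] assms(2)] by auto

lemma DA_deriv_mult:
  assumes "g \<in> carrier DA" "h \<in> carrier DA" "z \<in> disc"
  shows "deriv (g \<otimes>\<^bsub>DA\<^esub> h) z = deriv g (h z) * deriv h z"
proof -
  have "((g \<circ> h) has_field_derivative deriv g (h z) * deriv h z) (at z)"
    by (rule DERIV_chain[OF DA_has_field_derivative(1)[OF assms(1) DA_closed[OF assms(2,3)]] DA_has_field_derivative(1)[OF assms(2,3)]])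
  then have "((g \<otimes>\<^bsub>DA\<^esub> h) has_field_derivative deriv g (h z) * deriv h z) (at z)"
    by (rule has_field_derivative_transform_within_open[OF _ open_ball assms(3)]) (use assms in \<open>simp add: DA_mult\<close>)
  then show ?thesis by (rule DERIV_imp_deriv)
qed

lemma DA_deriv_one:
  assumes "z \<in> disc"
  shows "deriv \<one>\<^bsub>DA\<^esub> z = 1"
proof -
  have "((\<lambda>z. z) has_field_derivative 1) (at z)" by (rule DERIV_ident)
  then have "(\<one>\<^bsub>DA\<^esub> has_field_derivative 1) (at z)"
    by (rule has_field_derivative_transform_within_open[OF _ open_ball assms]) (simp add: DA_one)
  then show ?thesis by (rule DERIV_imp_deriv)
qed

lemma DA_eventually_neq:
  assumes "g \<in> carrier DA" "z \<in> disc"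
  shows "eventually (\<lambda>w. w \<in> disc \<and> w \<noteq> z \<and> g w \<noteq> g z) (at z)"
proof -
  have "eventually (\<lambda>w. w \<in> disc) (at z)" by (rule eventually_at_in_open'[OF open_ball assms(2)])
  moreover have "eventually (\<lambda>w. w \<noteq> z) (at z)" by (simp add: eventually_at_filter)
  ultimately show ?thesis
    by eventually_elim (use inj_onD[OF DA_inj[OF assms(1)]] assms(2) in blast)
qed

lemma deriv_hyp_rotation:
  assumes "a \<in> disc"
  shows "deriv (hyp_rotation a t) a = cis t"
proof -
  define m where "m = 1 - cnj a * a"
  have m: "m \<noteq> 0" using mob_denom_nz[OF assms assms] by (simp add: m_def)
  have d1: "(mob a has_field_derivative inverse m) (at a)"
  proof -
    have "((\<lambda>z. (z - a) / (1 - cnj a * z)) has_field_derivative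
        (1 * (1 - cnj a * a) - (a - a) * (- cnj a)) / ((1 - cnj a * a) * (1 - cnj a * a))) (at a)"
      using m by (auto simp: m_def intro!: derivative_eq_intros)
    moreover have "(\<lambda>z. (z - a) / (1 - cnj a * z)) = mob a" by (auto simp: Moebius_function_simple)
    ultimately show ?thesis using m by (simp add: m_def divide_simps)
  qed
  have d2: "(mob (- a) has_field_derivative m) (at 0)"
  proof -
    have "((\<lambda>z. (z + a) / (1 + cnj a * z)) has_field_derivative
        (1 * (1 + cnj a * 0) - (0 + a) * cnj a) / ((1 + cnj a * 0) * (1 + cnj a * 0))) (at 0)"
      by (auto intro!: derivative_eq_intros)
    moreover have "(\<lambda>z. (z + a) / (1 + cnj a * z)) = mob (- a)" by (auto simp: Moebius_function_simple)
    ultimately show ?thesis by (simp add: m_def mult.commute)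
  qed
  have "((\<lambda>z. cis t * mob a z) has_field_derivative cis t * inverse m) (at a)"
    by (rule DERIV_cmult[OF d1])
  moreover have "(mob (- a) has_field_derivative m) (at (cis t * mob a a))" using d2 by simp
  ultimately have "((\<lambda>z. mob (- a) (cis t * mob a z)) has_field_derivative m * (cis t * inverse m)) (at a)"
    by (rule DERIV_chain2[rotated])
  then have "((\<lambda>z. mob (- a) (cis t * mob a z)) has_field_derivative cis t) (at a)"
    by (rule DERIV_cong) (use m in simp)
  then have "(hyp_rotation a t has_field_derivative cis t) (at a)"
    by (rule has_field_derivative_transform_within_open[OF _ open_ball assms]) (simp add: hyp_rotation_apply)
  then show ?thesis by (rule DERIV_imp_deriv)
qed

section \<open>Orders of a Hauptmodul\<close>

context hauptmodul
begin

sublocale \<Gamma>: subgroup \<Gamma> DA by (rule fuchsian_group_subgroup[OF fuchsian'])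

lemma orb_disc: "z \<in> orb \<Gamma> A \<Longrightarrow> z \<in> disc"
  using fuchsian_orb_subset[OF fuchsian' A] by blast

lemma orb_closed: "g \<in> \<Gamma> \<Longrightarrow> z \<in> disc \<Longrightarrow> g z \<in> orb \<Gamma> A \<longleftrightarrow> z \<in> orb \<Gamma> A"
  by (rule fuchsian_orb_closed[OF fuchsian' A])

lemma no_accum_orbA: "no_accum (orb \<Gamma> A)"
  by (rule no_accum_orb[OF fuchsian' A])

lemma open_domain: "open (disc - orb \<Gamma> A)"
  by (rule open_diff_isolated[OF no_accum_orbA])

lemma \<tau>_inv:
  assumes "g \<in> \<Gamma>" "z \<in> disc - orb \<Gamma> A"
  shows "\<tau> (g z) = \<tau> z"
proof -
  have "g z \<in> disc - orb \<Gamma> A"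
    using assms orb_closed[OF assms(1)] DA_closed[OF \<Gamma>.mem_carrier[OF assms(1)]] by blast
  then show ?thesis using \<tau>_eq_iff[OF assms(2)] assms(1) by metis
qed

text \<open>Prepares the bound on the multiplicity of \<open>\<tau>\<close> at z0 by the order of
  the stabilizer: an element of \<open>\<Gamma>\<close> relating two nearby points must fix z0, by
  \<open>fuchsian_group_nbhd\<close>.\<close>

lemma stab_nbhd:
  assumes z: "z0 \<in> disc"
  obtains e where "e > 0" "ball z0 e \<subseteq> disc" "ball z0 e \<inter> orb \<Gamma> A \<subseteq> {z0}"
    "\<And>z w. z \<in> ball z0 e - orb \<Gamma> A \<Longrightarrow> w \<in> ball z0 e - orb \<Gamma> A \<Longrightarrow> \<tau> z = \<tau> w \<Longrightarrow> \<exists>g\<in>stab \<Gamma> z0. w = g z"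
proof -
  obtain d where d: "d > 0" "ball z0 d \<subseteq> disc" "\<And>g w. g \<in> \<Gamma> \<Longrightarrow> w \<in> ball z0 d \<Longrightarrow> g w \<in> ball z0 d \<Longrightarrow> g z0 = z0"
    using fuchsian_group_nbhd[OF fuchsian' z] by blast
  obtain e where e: "e > 0" "ball z0 e \<subseteq> disc" "ball z0 e \<inter> orb \<Gamma> A \<subseteq> {z0}"
    by (rule no_accumE[OF no_accum_orbA z])
  have s: "ball z0 (min d e) \<subseteq> ball z0 d" "ball z0 (min d e) \<subseteq> ball z0 e" by (auto simp: mem_ball)
  show thesis
  proof (rule that[of "min d e"])
    show "0 < min d e" using d e by simp
    show "ball z0 (min d e) \<subseteq> disc" "ball z0 (min d e) \<inter> orb \<Gamma> A \<subseteq> {z0}" using s e by auto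
    fix z w assume zw: "z \<in> ball z0 (min d e) - orb \<Gamma> A" "w \<in> ball z0 (min d e) - orb \<Gamma> A" "\<tau> z = \<tau> w"
    have "z \<in> disc - orb \<Gamma> A" "w \<in> disc - orb \<Gamma> A" using zw s e by auto
    then obtain g where g: "g \<in> \<Gamma>" "w = g z" using \<tau>_eq_iff zw(3) by blast
    have "g z0 = z0" by (rule d(3)[OF g(1), of z]) (use zw s g in auto)
    then show "\<exists>g\<in>stab \<Gamma> z0. w = g z" using g by (auto simp: stab_def)
  qed
qed

text \<open>A local uniformizer of the sphere, pulled back to the disc; its value at a pole of \<open>\<tau>\<close> is 0.\<close>

lemma local_coordinate:
  assumes z0: "z0 \<in> disc" and e: "e > 0" "ball z0 e \<subseteq> disc" "ball z0 e \<inter> orb \<Gamma> A \<subseteq> {z0}"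
    "\<And>z w. z \<in> ball z0 e - orb \<Gamma> A \<Longrightarrow> w \<in> ball z0 e - orb \<Gamma> A \<Longrightarrow> \<tau> z = \<tau> w \<Longrightarrow> \<exists>g\<in>stab \<Gamma> z0. w = g z"
    and f: "f holomorphic_on ball z0 e" "f z0 = 0"
    and ff: "\<And>z w. z \<in> ball z0 e \<Longrightarrow> w \<in> ball z0 e \<Longrightarrow> f z = f w \<Longrightarrow>
      z = z0 \<and> w = z0 \<or> z \<notin> orb \<Gamma> A \<and> w \<notin> orb \<Gamma> A \<and> \<tau> z = \<tau> w"
  obtains k :: nat where "k > 0" "has_ord f z0 (int k)" "k \<le> card (stab \<Gamma> z0)"
proof -
  have fin: "finite (stab \<Gamma> z0)" by (rule fuchsian_stab_finite[OF fuchsian' z0])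
  have eqs: "\<exists>g\<in>stab \<Gamma> z0. w = g z" if "z \<in> ball z0 e" "w \<in> ball z0 e" "f z = f w" for z w
    using ff[OF that]
  proof
    assume "z = z0 \<and> w = z0"
    then show ?thesis using fuchsian_one_stab[OF fuchsian' z0] z0 by (intro bexI[of _ "\<one>\<^bsub>DA\<^esub>"]) (auto simp: DA_one)
  next
    assume "z \<notin> orb \<Gamma> A \<and> w \<notin> orb \<Gamma> A \<and> \<tau> z = \<tau> w"
    then show ?thesis using e(4)[of z w] that by blast
  qed
  \<comment> \<open>Were f zero on the ball, all its points would be images of z0 under the finite
    stabilizer.\<close>
  have "\<exists>w\<in>ball z0 e. f w \<noteq> 0"
  proof (rule ccontr)
    assume "\<not> ?thesis"
    then have z: "f w = f z0" if "w \<in> ball z0 e" for w using that f(2) by auto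
    have zb: "z0 \<in> ball z0 e" using e(1) by simp
    have "ball z0 e \<subseteq> (\<lambda>g. g z0) ` stab \<Gamma> z0"
    proof
      fix w assume "w \<in> ball z0 e"
      from eqs[OF zb this z[OF this, symmetric]] show "w \<in> (\<lambda>g. g z0) ` stab \<Gamma> z0" by blast
    qed
    then have "finite (ball z0 e)" using fin finite_subset by blast
    then show False using uncountable_ball[OF e(1), of z0] countable_finite by blast
  qed
  then obtain w where w: "w \<in> ball z0 e" "f w \<noteq> 0" by blast
  have z0b: "z0 \<in> ball z0 e" using e(1) by simp
  obtain k where k: "has_ord f z0 (int k)" "k > 0 \<longleftrightarrow> f z0 = 0"
    by (rule has_ord_zero[OF f(1) open_ball connected_ball z0b w])
  have kp: "k > 0" using k(2) f(2) by simp
  have "k \<le> card (stab \<Gamma> z0)"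
    by (rule has_ord_le_card[OF k(1) e(1) f(2) kp fin eqs])
  then show thesis by (rule that[OF kp k(1)])
qed

text \<open>Near z0 a fibre lies in an orbit of the stabilizer, so the multiplicity cannot exceed
  its order. Equality at the vertices follows later from divisibility by p.\<close>

lemma ord_regular:
  assumes z0: "z0 \<in> disc - orb \<Gamma> A"
  obtains k :: nat where "k > 0" "has_ord (\<lambda>w. \<tau> w - \<tau> z0) z0 (int k)" "k \<le> card (stab \<Gamma> z0)"
proof -
  have z0d: "z0 \<in> disc" using z0 by simp
  obtain e where e: "e > 0" "ball z0 e \<subseteq> disc" "ball z0 e \<inter> orb \<Gamma> A \<subseteq> {z0}"
    "\<And>z w. z \<in> ball z0 e - orb \<Gamma> A \<Longrightarrow> w \<in> ball z0 e - orb \<Gamma> A \<Longrightarrow> \<tau> z = \<tau> w \<Longrightarrow> \<exists>g\<in>stab \<Gamma> z0. w = g z"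
    using stab_nbhd[OF z0d] by blast
  have n: "w \<notin> orb \<Gamma> A" if "w \<in> ball z0 e" for w using e(3) z0 that by blast
  have h: "(\<lambda>w. \<tau> w - \<tau> z0) holomorphic_on ball z0 e"
    by (intro holomorphic_intros holomorphic_on_subset[OF \<tau>_holo]) (use e(2) n in auto)
  obtain k :: nat where "k > 0" "has_ord (\<lambda>w. \<tau> w - \<tau> z0) z0 (int k)" "k \<le> card (stab \<Gamma> z0)"
    by (rule local_coordinate[OF z0d e h]) (use n in auto)
  then show thesis by (rule that)
qed

lemma ord_pole:
  assumes z0: "z0 \<in> orb \<Gamma> A"
  obtains k :: nat where "k > 0" "has_ord \<tau> z0 (- int k)" "k \<le> card (stab \<Gamma> z0)"
proof -
  have z0d: "z0 \<in> disc" by (rule orb_disc[OF z0])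
  obtain e where e: "e > 0" "ball z0 e \<subseteq> disc" "ball z0 e \<inter> orb \<Gamma> A \<subseteq> {z0}"
    "\<And>z w. z \<in> ball z0 e - orb \<Gamma> A \<Longrightarrow> w \<in> ball z0 e - orb \<Gamma> A \<Longrightarrow> \<tau> z = \<tau> w \<Longrightarrow> \<exists>g\<in>stab \<Gamma> z0. w = g z"
    using stab_nbhd[OF z0d] by blast
  have "eventually (\<lambda>w. \<tau> w \<noteq> 0) (at z0)"
    using \<tau>_pole[OF z0] unfolding is_pole_def by (rule filterlim_at_infinity_imp_eventually_ne)
  then obtain d where d: "d > 0" "\<And>w. w \<noteq> z0 \<Longrightarrow> dist w z0 < d \<Longrightarrow> \<tau> w \<noteq> 0"
    unfolding eventually_at by blast
  define r where "r = min d e"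
  have r: "r > 0" "ball z0 r \<subseteq> ball z0 e" using d(1) e(1) by (auto simp: r_def mem_ball)
  have nz: "\<tau> w \<noteq> 0" if "w \<in> ball z0 r - {z0}" for w
    using that by (intro d(2)) (auto simp: r_def mem_ball dist_commute)
  have n: "w \<notin> orb \<Gamma> A" if "w \<in> ball z0 r - {z0}" for w using e(3) r(2) that by blast
  \<comment> \<open>The reciprocal of \<open>\<tau>\<close> with its removable singularity filled in
    serves as the coordinate at infinity.\<close>
  define f where "f w = (if w = z0 then 0 else inverse (\<tau> w))" for w
  have h: "f holomorphic_on ball z0 r"
    unfolding f_def
  proof (rule is_pole_inverse_holomorphic[OF open_ball _ \<tau>_pole[OF z0]])
    show "\<tau> holomorphic_on ball z0 r - {z0}"
      by (rule holomorphic_on_subset[OF \<tau>_holo]) (use r(2) e(2) n in blast)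
    show "\<forall>x\<in>ball z0 r - {z0}. \<tau> x \<noteq> 0" using nz by blast
  qed
  obtain k :: nat where k: "k > 0" "has_ord f z0 (int k)" "k \<le> card (stab \<Gamma> z0)"
  proof (rule local_coordinate[OF z0d r(1) _ _ _ h])
    show "ball z0 r \<subseteq> disc" "ball z0 r \<inter> orb \<Gamma> A \<subseteq> {z0}" using r e by auto
    show "\<exists>g\<in>stab \<Gamma> z0. w = g z" if "z \<in> ball z0 r - orb \<Gamma> A" "w \<in> ball z0 r - orb \<Gamma> A" "\<tau> z = \<tau> w" for z w
      by (rule e(4)) (use that r in auto)
    show "f z0 = 0" by (simp add: f_def)
    fix z w assume zw: "z \<in> ball z0 r" "w \<in> ball z0 r" "f z = f w"
    show "z = z0 \<and> w = z0 \<or> z \<notin> orb \<Gamma> A \<and> w \<notin> orb \<Gamma> A \<and> \<tau> z = \<tau> w"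
      using zw(3) n[of z] n[of w] nz[of z] nz[of w] zw(1,2) by (auto simp: f_def split: if_splits)
  qed
  have "has_ord (\<lambda>w. inverse (f w)) z0 (- int k)" by (rule has_ord_inverse[OF k(2)])
  then have "has_ord \<tau> z0 (- int k)"
    by (rule has_ord_cong) (auto simp: f_def eventually_at_filter)
  then show thesis by (rule that[OF k(1) _ k(3)])
qed

text \<open>For an invariant function the ratio f(g w) / f(w) is 1, while its limit at the fixed
  point is the k-th power of the multiplier of g.\<close>

lemma rotation_power_ord:
  assumes z0: "z0 \<in> disc" and g: "g \<in> stab \<Gamma> z0" and f: "has_ord f z0 k"
    and inv: "\<And>w. w \<in> disc - orb \<Gamma> A \<Longrightarrow> f (g w) = f w"
  shows "deriv g z0 powi k = 1"
proof -
  have gc: "g \<in> carrier DA" and gz: "g z0 = z0" using g \<Gamma>.mem_carrier by (auto simp: stab_def)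
  have ne: "eventually (\<lambda>w. g w \<noteq> z0) (at z0)"
    by (rule eventually_mono[OF DA_eventually_neq[OF gc z0]]) (simp add: gz)
  have "((\<lambda>w. f (g w) / f w) \<longlongrightarrow> deriv g z0 powi k) (at z0)"
    by (rule has_ord_compose_ratio[OF f DA_has_field_derivative(1)[OF gc z0] gz DA_has_field_derivative(2)[OF gc z0] ne])
  moreover have "((\<lambda>w. f (g w) / f w) \<longlongrightarrow> 1) (at z0)"
  proof (rule tendsto_eventually)
    show "eventually (\<lambda>w. f (g w) / f w = 1) (at z0)"
      using has_ord_nonzero[OF f] eventually_not_isolated[OF no_accum_orbA z0]
      by eventually_elim (simp add: inv)
  qed
  ultimately show ?thesis using tendsto_unique[of "at z0"] by simp
qed

end

section \<open>Invariant functions and forms\<close>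

lemma has_ord_pole_diff:
  assumes "has_ord f z (- int k)" "k > 0"
  shows "has_ord (\<lambda>w. f w - b) z (- int k)"
proof -
  obtain h r where h: "r > 0" "r \<le> 1" "h holomorphic_on ball z r" "\<And>w. w \<in> ball z r \<Longrightarrow> h w \<noteq> 0"
    "\<And>w. w \<in> ball z r \<Longrightarrow> w \<noteq> z \<Longrightarrow> f w = h w * (w - z) powi (- int k)"
    by (rule has_ordE[OF assms(1) zero_less_one]) (rule that, assumption+)
  define j where "j w = h w - b * (w - z) ^ k" for w
  have hj: "j holomorphic_on ball z r" unfolding j_def by (intro holomorphic_intros h(3))
  have jz: "j z \<noteq> 0" using h(1) h(4)[of z] assms(2) by (simp add: j_def zero_power)
  have "has_ord (\<lambda>w. j w * (w - z) powi (- int k)) z (0 + (- int k))"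
  proof (rule has_ord_mult)
    show "has_ord j z 0" by (rule has_ord_analytic[OF open_ball _ hj jz]) (use h(1) in simp)
    show "has_ord (\<lambda>w. (w - z) powi (- int k)) z (- int k)"
      by (rule has_ordI[of UNIV z "\<lambda>_. 1"]) auto
  qed
  then have "has_ord (\<lambda>w. j w * (w - z) powi (- int k)) z (- int k)" by simp
  then show ?thesis
  proof (rule has_ord_cong)
    have "j w * (w - z) powi (- int k) = f w - b" if w: "w \<noteq> z" "dist w z < r" for w
    proof -
      have "f w = h w * (w - z) powi (- int k)" using h(5)[of w] w by (simp add: mem_ball dist_commute)
      moreover have "(w - z) ^ k * (w - z) powi (- int k) = 1" using w(1) by (simp add: power_int_minus)
      ultimately show ?thesis by (simp add: j_def left_diff_distrib mult.assoc)
    qed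
    then show "eventually (\<lambda>w. j w * (w - z) powi (- int k) = f w - b) (at z)"
      unfolding eventually_at using h(1) by blast
  qed
qed

lemma holo_isCont:
  assumes "f holomorphic_on disc" "z \<in> disc"
  shows "isCont f z"
  using continuous_on_interior[OF holomorphic_on_imp_continuous_on[OF assms(1)]] assms(2) by simp

lemma zero_off_isolated:
  assumes "no_accum D" "f holomorphic_on disc" "\<And>z. z \<in> disc - D \<Longrightarrow> f z = 0" "z \<in> disc"
  shows "f z = 0"
proof -
  have "(f \<longlongrightarrow> f z) (at z)" using holo_isCont[OF assms(2,4)] by (simp add: isCont_def)
  moreover have "(f \<longlongrightarrow> 0) (at z)"
    by (rule tendsto_eventually) (rule eventually_mono[OF eventually_not_isolated[OF assms(1,4)]], rule assms(3))
  ultimately show ?thesis using tendsto_unique[of "at z"] by simp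
qed

lemma DA_deriv_holo:
  assumes "g \<in> carrier DA"
  shows "deriv g holomorphic_on disc"
  by (rule holomorphic_deriv[OF DA_holo[OF assms] open_ball])

section \<open>Invariant functions on a compact quotient\<close>

context uniformization
begin

text \<open>The images of growing balls form an increasing open cover of the compact surface, so one
  of them is everything.\<close>

lemma compact_fundamental_domain:
  obtains r where "r < 1" "\<And>z. z \<in> disc \<Longrightarrow> \<exists>w\<in>cball 0 r. \<exists>g\<in>\<Gamma>s. z = g w"
proof -
  define B where "B n = ball (0::complex) (1 - 1 / real (Suc n))" for n
  have Bd: "B n \<subseteq> disc" for n unfolding B_def by (rule subset_ball) simp
  have Bm: "B m \<subseteq> B n" if "m \<le> n" for m n
    unfolding B_def by (rule subset_ball) (use that in \<open>simp add: frac_le\<close>)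
  have "\<forall>U\<in>range (\<lambda>n. \<pi> ` B n). openin (surf_top S) U"
  proof
    fix U assume "U \<in> range (\<lambda>n. \<pi> ` B n)"
    then obtain n where U: "U = \<pi> ` B n" by blast
    have "openin (top_of_set disc) (B n)" by (rule open_subset[OF Bd]) (simp add: B_def)
    then show "openin (surf_top S) U" using disc_paramD(3)[OF param] U by (simp add: open_map_def)
  qed
  moreover have "points S \<subseteq> \<Union> (range (\<lambda>n. \<pi> ` B n))"
  proof
    fix x assume "x \<in> points S"
    then obtain z where z: "z \<in> disc" "x = \<pi> z" using \<pi>_surj by blast
    have "0 < 1 - norm z" using z(1) by (simp add: disc_iff)
    then obtain n where "1 / real (Suc n) < 1 - norm z" by (rule nat_approx_posE)
    then have "z \<in> B n" by (simp add: B_def mem_ball_0)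
    then show "x \<in> \<Union> (range (\<lambda>n. \<pi> ` B n))" using z(2) by blast
  qed
  ultimately obtain F where F: "finite F" "F \<subseteq> range (\<lambda>n. \<pi> ` B n)" "points S \<subseteq> \<Union> F"
    using compact unfolding compact_space_alt by meson
  obtain I where I: "finite I" "F = (\<lambda>n. \<pi> ` B n) ` I"
    using finite_subset_image[OF F(1,2)] by blast
  define N where "N = Max (insert 0 I)"
  have IN: "n \<le> N" if "n \<in> I" for n unfolding N_def using I(1) that by simp
  show thesis
  proof (rule that[of "1 - 1 / real (Suc N)"])
    show "1 - 1 / real (Suc N) < 1" by simp
    fix z assume z: "z \<in> disc"
    have "\<pi> z \<in> \<Union> F" using F(3) \<pi>_points[OF z] by blast
    then obtain n where n: "n \<in> I" "\<pi> z \<in> \<pi> ` B n" using I(2) by blast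
    then obtain w where w: "w \<in> B n" "\<pi> z = \<pi> w" by blast
    then have wN: "w \<in> B N" using Bm[OF IN[OF n(1)]] by blast
    then have wd: "w \<in> disc" using Bd by blast
    obtain g where "g \<in> \<Gamma>s" "z = g w" using \<pi>_eq_iff[OF wd z] w(2) by metis
    moreover have "w \<in> cball 0 (1 - 1 / real (Suc N))" using wN by (simp add: B_def mem_ball_0)
    ultimately show "\<exists>w\<in>cball 0 (1 - 1 / real (Suc N)). \<exists>g\<in>\<Gamma>s. z = g w" by blast
  qed
qed

text \<open>By \<open>compact_fundamental_domain\<close> the modulus of f attains its maximum over
  the whole disc at a point of a compact ball, and the maximum principle applies.\<close>

lemma invariant_constant:
  assumes f: "f holomorphic_on disc" and inv: "\<And>g z. g \<in> \<Gamma>s \<Longrightarrow> z \<in> disc \<Longrightarrow> f (g z) = f z"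
  obtains c where "\<And>z. z \<in> disc \<Longrightarrow> f z = c"
proof -
  obtain r where r: "r < 1" "\<And>z. z \<in> disc \<Longrightarrow> \<exists>w\<in>cball 0 r. \<exists>g\<in>\<Gamma>s. z = g w"
    using compact_fundamental_domain by blast
  have sub: "cball 0 r \<subseteq> disc" using r(1) by (auto simp: disc_iff)
  have "(0::complex) \<in> disc" by (simp add: disc_iff)
  from r(2)[OF this] have ne: "cball (0::complex) r \<noteq> {}" by blast
  have "continuous_on (cball 0 r) (\<lambda>z. norm (f z))"
    by (intro continuous_on_norm continuous_on_subset[OF holomorphic_on_imp_continuous_on[OF f] sub])
  then obtain \<xi> where xi: "\<xi> \<in> cball 0 r" "\<And>w. w \<in> cball 0 r \<Longrightarrow> norm (f w) \<le> norm (f \<xi>)"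
    using continuous_attains_sup[OF compact_cball ne] by blast
  have "norm (f z) \<le> norm (f \<xi>)" if z: "z \<in> disc" for z
  proof -
    obtain w g where w: "w \<in> cball 0 r" "g \<in> \<Gamma>s" "z = g w" using r(2)[OF z] by blast
    have "f z = f w" unfolding w(3) by (rule inv[OF w(2)]) (use w(1) sub in blast)
    then show ?thesis using xi(2)[OF w(1)] by simp
  qed
  then have "f constant_on disc"
    by (intro maximum_modulus_principle[OF f open_ball connected_ball open_ball order_refl]) (use xi(1) sub in blast)+
  then show thesis using that unfolding constant_on_def by blast
qed

text \<open>The second conclusion determines the constant: once the limit at a single removed point
  is known, so is the function.\<close>

lemma invariant_constant_isolated:
  assumes iso: "no_accum D" and f: "f holomorphic_on disc - D"
    and lim: "\<And>z. z \<in> D \<inter> disc \<Longrightarrow> \<exists>c. (f \<longlongrightarrow> c) (at z)"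
    and inv: "\<forall>g\<in>\<Gamma>s. \<forall>z\<in>disc - D. g z \<in> disc - D \<and> f (g z) = f z"
  obtains c where "\<And>z. z \<in> disc - D \<Longrightarrow> f z = c" "\<And>z l. z \<in> D \<inter> disc \<Longrightarrow> (f \<longlongrightarrow> l) (at z) \<Longrightarrow> l = c"
proof -
  obtain F where F: "F holomorphic_on disc" "\<And>z. z \<in> disc - D \<Longrightarrow> F z = f z"
    "\<And>z. z \<in> disc \<Longrightarrow> eventually (\<lambda>w. F w = f w) (at z)" "\<And>z c. z \<in> D \<inter> disc \<Longrightarrow> (f \<longlongrightarrow> c) (at z) \<Longrightarrow> F z = c"
    using has_ord_extend[OF iso f lim] by blast
  obtain c where c: "\<And>z. z \<in> disc \<Longrightarrow> F z = c"
  proof (rule invariant_constant[OF F(1)])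
    fix g z assume g: "g \<in> \<Gamma>s" and z: "z \<in> disc"
    have h: "(\<lambda>z. F (g z) - F z) holomorphic_on disc"
      by (intro holomorphic_on_diff F(1)) (rule holomorphic_on_disc_comp[OF DA_holo[OF \<Gamma>s_DA[OF g]] DA_closed[OF \<Gamma>s_DA[OF g]] F(1)])
    have "F (g z) - F z = 0"
      by (rule zero_off_isolated[OF iso h _ z]) (use inv g F(2) in auto)
    then show "F (g z) = F z" by simp
  qed auto
  show thesis
  proof (rule that[of c])
    show "f z = c" if "z \<in> disc - D" for z using F(2)[OF that] c[of z] that by simp
    show "l = c" if "z \<in> D \<inter> disc" "(f \<longlongrightarrow> l) (at z)" for z l using F(4)[OF that] c[of z] that(1) by simp
  qed
qed

text \<open>An automorphism of the sphere with three fixed points is the identity: with two of the fixed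
  points at \<open>b\<close> and \<open>\<infinity>\<close>, the quotient \<open>(\<tau> \<circ> F - b) / (\<tau> - b)\<close> has no zeros or poles.\<close>

lemma normalizer_fixing_orbits:
  assumes H: "hauptmodul \<Gamma> A \<tau>" and sub: "\<Gamma>s \<subseteq> \<Gamma>" and F: "F \<in> carrier DA"
    and n1: "\<And>g. g \<in> \<Gamma> \<Longrightarrow> F \<otimes>\<^bsub>DA\<^esub> g \<otimes>\<^bsub>DA\<^esub> inv\<^bsub>DA\<^esub> F \<in> \<Gamma>"
    and n2: "\<And>g. g \<in> \<Gamma> \<Longrightarrow> inv\<^bsub>DA\<^esub> F \<otimes>\<^bsub>DA\<^esub> g \<otimes>\<^bsub>DA\<^esub> F \<in> \<Gamma>"
    and B: "B \<in> disc" and C: "C \<in> disc"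
    and FA: "F A \<in> orb \<Gamma> A" and FB: "F B \<in> orb \<Gamma> B" and FC: "F C \<in> orb \<Gamma> C"
    and dist: "B \<notin> orb \<Gamma> A" "C \<notin> orb \<Gamma> A" "C \<notin> orb \<Gamma> B"
  shows "F \<in> \<Gamma>"
proof -
  interpret H: hauptmodul \<Gamma> A \<tau> by (rule H)
  note fu = H.fuchsian'
  have iF: "inv\<^bsub>DA\<^esub> F \<in> carrier DA" using F by simp
  have Fg: "F (g z) = (F \<otimes>\<^bsub>DA\<^esub> g \<otimes>\<^bsub>DA\<^esub> inv\<^bsub>DA\<^esub> F) (F z)" if g: "g \<in> carrier DA" and z: "z \<in> disc" for g z
    using DA_inv_apply(1)[OF F z] F g iF z DA_closed[OF F z] by (simp add: DA_mult)
  have F_orb: "F z \<in> orb \<Gamma> X" if X: "X \<in> disc" "F X \<in> orb \<Gamma> X" and z: "z \<in> orb \<Gamma> X" for X z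
  proof -
    obtain g where g: "g \<in> \<Gamma>" "z = g X" using z by (auto simp: mem_orb)
    have "F z = (F \<otimes>\<^bsub>DA\<^esub> g \<otimes>\<^bsub>DA\<^esub> inv\<^bsub>DA\<^esub> F) (F X)" unfolding g(2) by (rule Fg[OF H.\<Gamma>.mem_carrier[OF g(1)] X(1)])
    then show ?thesis using fuchsian_orb_closed[OF fu X(1) n1[OF g(1)] DA_closed[OF F X(1)]] X(2) by simp
  qed
  have F_orb_imp: "z \<in> orb \<Gamma> X" if X: "X \<in> disc" "F X \<in> orb \<Gamma> X" and z: "z \<in> disc" "F z \<in> orb \<Gamma> X" for X z
  proof -
    have Fz: "F z \<in> disc" "F X \<in> disc" using DA_closed[OF F] z X by auto
    have "orb \<Gamma> (F X) = orb \<Gamma> X"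
      using disc_orb_eq_iff[OF H.\<Gamma>.subgroup_axioms X(1) Fz(2)] X(2) by (auto simp: mem_orb)
    then have "F z \<in> orb \<Gamma> (F X)" using z(2) by simp
    then obtain g where g: "g \<in> \<Gamma>" "F z = g (F X)" unfolding mem_orb by blast
    note gc = H.\<Gamma>.mem_carrier[OF g(1)]
    have "z = (inv\<^bsub>DA\<^esub> F) (F z)" using DA_inv_apply(1)[OF F z(1)] by simp
    also have "\<dots> = (inv\<^bsub>DA\<^esub> F \<otimes>\<^bsub>DA\<^esub> g \<otimes>\<^bsub>DA\<^esub> F) X"
      using F gc iF X(1) Fz g(2) by (simp add: DA_mult)
    finally show ?thesis using n2[OF g(1)] by (auto simp: mem_orb)
  qed
  define b where "b = \<tau> B"
  define D where "D = orb \<Gamma> A \<union> orb \<Gamma> B"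
  have isoD: "no_accum D" unfolding D_def
    by (intro no_accum_Un no_accum_orb[OF fu] H.A B)
  have Dd: "D \<subseteq> disc" unfolding D_def using fuchsian_orb_subset[OF fu] H.A B by auto
  have \<tau>B: "\<tau> z = b \<longleftrightarrow> z \<in> orb \<Gamma> B" if "z \<in> disc - orb \<Gamma> A" for z
    using H.\<tau>_eq_iff[of B z] that dist(1) B by (auto simp: b_def mem_orb)
  have FD: "F z \<in> disc - D" if "z \<in> disc - D" for z
    using that DA_closed[OF F] F_orb_imp[OF H.A FA, of z] F_orb_imp[OF B FB, of z] by (auto simp: D_def)
  define R where "R z = (\<tau> (F z) - b) / (\<tau> z - b)" for z
  have hR: "R holomorphic_on disc - D"
  proof -
    have "(\<tau> \<circ> F) holomorphic_on disc - D"
      by (rule holomorphic_on_compose_gen[OF holomorphic_on_subset[OF DA_holo[OF F]] H.\<tau>_holo])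
        (use FD D_def in auto)
    then have "(\<lambda>z. \<tau> (F z)) holomorphic_on disc - D" by (simp add: o_def)
    moreover have "\<tau> holomorphic_on disc - D" by (rule holomorphic_on_subset[OF H.\<tau>_holo]) (auto simp: D_def)
    moreover have "\<tau> z - b \<noteq> 0" if "z \<in> disc - D" for z using \<tau>B[of z] that by (auto simp: D_def)
    ultimately show ?thesis unfolding R_def by (intro holomorphic_intros)
  qed
  have lim: "\<exists>c. (R \<longlongrightarrow> c) (at z)" if z: "z \<in> D \<inter> disc" for z
  proof -
    have zd: "z \<in> disc" using z by blast
    obtain X where X: "X \<in> disc" "F X \<in> orb \<Gamma> X" "z \<in> orb \<Gamma> X"
      using z FA FB H.A B by (auto simp: D_def)
    have "F z \<in> orb \<Gamma> X" by (rule F_orb[OF X])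
    moreover have "orb \<Gamma> z = orb \<Gamma> X"
      using disc_orb_eq_iff[OF H.\<Gamma>.subgroup_axioms X(1) zd] X(3) by (auto simp: mem_orb)
    ultimately have "F z \<in> orb \<Gamma> z" by simp
    then obtain g where g: "g \<in> \<Gamma>" "F z = g z" unfolding mem_orb by blast
    note gc = H.\<Gamma>.mem_carrier[OF g(1)]
    have ig: "inv\<^bsub>DA\<^esub> g \<in> \<Gamma>" using g(1) by (rule H.\<Gamma>.m_inv_closed)
    \<comment> \<open>F preserves the orbit of z, so correcting it by g gives a map that fixes z. As
      \<open>\<tau>\<close> does not see g, the limit of R is a power of the multiplier of this
      map.\<close>
    define E where "E = inv\<^bsub>DA\<^esub> g \<otimes>\<^bsub>DA\<^esub> F"
    have Ec: "E \<in> carrier DA" using gc F by (simp add: E_def)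
    have Ew: "E w = (inv\<^bsub>DA\<^esub> g) (F w)" if "w \<in> disc" for w using that gc F by (simp add: E_def DA_mult)
    have Ez: "E z = z" using Ew[OF zd] g(2) DA_inv_apply(1)[OF gc zd] by simp
    obtain k where k: "has_ord (\<lambda>w. \<tau> w - b) z k"
    proof (cases "z \<in> orb \<Gamma> A")
      case True
      obtain k :: nat where "k > 0" "has_ord \<tau> z (- int k)" using H.ord_pole[OF True] by blast
      then show thesis using has_ord_pole_diff that by blast
    next
      case False
      then have zz: "z \<in> disc - orb \<Gamma> A" "z \<in> orb \<Gamma> B" using z by (auto simp: D_def)
      then have "\<tau> z = b" using \<tau>B by blast
      then show thesis using H.ord_regular[OF zz(1)] that by metis
    qed
    have ne: "eventually (\<lambda>w. E w \<noteq> z) (at z)"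
      by (rule eventually_mono[OF DA_eventually_neq[OF Ec zd]]) (simp add: Ez)
    have "((\<lambda>w. (\<tau> (E w) - b) / (\<tau> w - b)) \<longlongrightarrow> deriv E z powi k) (at z)"
      by (rule has_ord_compose_ratio[OF k DA_has_field_derivative(1)[OF Ec zd] Ez DA_has_field_derivative(2)[OF Ec zd] ne])
    then have "(R \<longlongrightarrow> deriv E z powi k) (at z)"
    proof (rule Lim_transform_eventually)
      show "eventually (\<lambda>w. (\<tau> (E w) - b) / (\<tau> w - b) = R w) (at z)"
      proof (rule eventually_mono[OF eventually_not_isolated[OF isoD zd]])
        fix w assume w: "w \<in> disc - D"
        have "\<tau> (E w) = \<tau> (F w)" using H.\<tau>_inv[OF ig, of "F w"] FD[OF w] w by (simp add: Ew D_def)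
        then show "(\<tau> (E w) - b) / (\<tau> w - b) = R w" by (simp add: R_def)
      qed
    qed
    then show ?thesis by blast
  qed
  have inv: "g z \<in> disc - D \<and> R (g z) = R z" if g: "g \<in> \<Gamma>s" and z: "z \<in> disc - D" for g z
  proof -
    have gG: "g \<in> \<Gamma>" using g sub by blast
    note gc = H.\<Gamma>.mem_carrier[OF gG]
    have zd: "z \<in> disc" using z by blast
    have 1: "g z \<in> disc - D"
      using z DA_closed[OF gc zd] fuchsian_orb_closed[OF fu H.A gG zd] fuchsian_orb_closed[OF fu B gG zd] by (auto simp: D_def)
    have 2: "\<tau> (g z) = \<tau> z" by (rule H.\<tau>_inv[OF gG]) (use z in \<open>auto simp: D_def\<close>)
    have "\<tau> (F (g z)) = \<tau> (F z)" unfolding Fg[OF gc zd]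
      by (rule H.\<tau>_inv[OF n1[OF gG]]) (use FD[OF z] in \<open>auto simp: D_def\<close>)
    then show ?thesis using 1 2 by (simp add: R_def)
  qed
  have inv': "\<forall>g\<in>\<Gamma>s. \<forall>z\<in>disc - D. g z \<in> disc - D \<and> R (g z) = R z" by (intro ballI inv)
  obtain c where c: "\<And>z. z \<in> disc - D \<Longrightarrow> R z = c"
    by (rule invariant_constant_isolated[OF isoD hR lim inv']) (assumption, rule that, assumption+)
  have CD: "C \<in> disc - D" using C dist by (auto simp: D_def)
  \<comment> \<open>The third fixed orbit determines the constant: R takes the value 1 at C.\<close>
  have "\<tau> (F C) = \<tau> C"
  proof -
    obtain g where "g \<in> \<Gamma>" "F C = g C" using FC by (auto simp: mem_orb)
    then show ?thesis using H.\<tau>_inv[of g C] CD by (simp add: D_def)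
  qed
  moreover have "\<tau> C \<noteq> b" using \<tau>B[of C] CD by (auto simp: D_def)
  ultimately have "c = 1" using c[OF CD] by (simp add: R_def)
  have ex: "\<exists>g\<in>\<Gamma>. F z = g z" if zd: "z \<in> disc" for z
  proof (cases "z \<in> D")
    case True
    then obtain X where X: "X \<in> disc" "F X \<in> orb \<Gamma> X" "z \<in> orb \<Gamma> X"
      using FA FB H.A B by (auto simp: D_def)
    have "orb \<Gamma> z = orb \<Gamma> X"
      using disc_orb_eq_iff[OF H.\<Gamma>.subgroup_axioms X(1) zd] X(3) by (auto simp: mem_orb)
    then have "F z \<in> orb \<Gamma> z" using F_orb[OF X] by simp
    then show ?thesis unfolding mem_orb by blast
  next
    case False
    then have z: "z \<in> disc - D" using zd by blast
    have "\<tau> z - b \<noteq> 0" using \<tau>B[of z] z by (auto simp: D_def)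
    then have "\<tau> z = \<tau> (F z)" using c[OF z] \<open>c = 1\<close> by (simp add: R_def)
    then show ?thesis using H.\<tau>_eq_iff[of z "F z"] z FD[OF z] by (simp add: D_def)
  qed
  obtain g where g: "g \<in> \<Gamma>" "\<And>z. z \<in> disc \<Longrightarrow> F z = g z"
    by (rule fuchsian_pointwise[OF fu DA_holo[OF F] holomorphic_on_ident _ ex]) auto
  have "F = g" by (rule DA_eqI[OF F H.\<Gamma>.mem_carrier[OF g(1)] g(2)])
  then show ?thesis using g(1) by simp
qed

end

section \<open>The differential of a Hauptmodul\<close>

context hauptmodul
begin

text \<open>The chain rule for \<open>\<tau>\<close> after g. The differential of
  \<open>\<tau>\<close> is thus an invariant form, the reference against which other forms are
  measured.\<close>

lemma deriv_\<tau>_equivariant: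
  assumes "g \<in> \<Gamma>" "z \<in> disc - orb \<Gamma> A"
  shows "deriv \<tau> (g z) * deriv g z = deriv \<tau> z"
proof -
  note gc = \<Gamma>.mem_carrier[OF assms(1)]
  have gz: "g z \<in> disc - orb \<Gamma> A"
    using assms orb_closed[OF assms(1)] DA_closed[OF gc] by blast
  have "((\<tau> \<circ> g) has_field_derivative deriv \<tau> (g z) * deriv g z) (at z)"
    by (rule DERIV_chain[OF holomorphic_derivI[OF \<tau>_holo open_domain gz] DA_has_field_derivative(1)[OF gc]]) (use assms in simp)
  then have "(\<tau> has_field_derivative deriv \<tau> (g z) * deriv g z) (at z)"
    by (rule has_field_derivative_transform_within_open[OF _ open_domain assms(2)]) (simp add: \<tau>_inv[OF assms(1)])
  then show ?thesis by (simp add: DERIV_imp_deriv)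
qed

lemma has_ord_deriv_regular:
  assumes z: "z \<in> disc - orb \<Gamma> A" and k: "has_ord (\<lambda>w. \<tau> w - \<tau> z) z (int k)" "k > 0"
  shows "has_ord (deriv \<tau>) z (int k - 1)"
proof -
  have "has_ord (deriv (\<lambda>w. \<tau> w - \<tau> z)) z (int k - 1)"
    by (rule has_ord_deriv[OF k(1)]) (use k(2) in simp)
  then show ?thesis
  proof (rule has_ord_cong)
    have "z \<in> disc" using z by simp
    show "eventually (\<lambda>w. deriv (\<lambda>w. \<tau> w - \<tau> z) w = deriv \<tau> w) (at z)"
    proof (rule eventually_mono[OF eventually_not_isolated[OF no_accum_orbA \<open>z \<in> disc\<close>]])
      fix w assume w: "w \<in> disc - orb \<Gamma> A"
      have "((\<lambda>w. \<tau> w - \<tau> z) has_field_derivative deriv \<tau> w - 0) (at w)"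
        by (intro DERIV_diff DERIV_const holomorphic_derivI[OF \<tau>_holo open_domain w])
      then show "deriv (\<lambda>w. \<tau> w - \<tau> z) w = deriv \<tau> w" by (simp add: DERIV_imp_deriv)
    qed
  qed
qed

text \<open>A trivial stabilizer bounds the multiplicity by 1, and the derivative has order one
  less.\<close>

lemma deriv_\<tau>_nonzero:
  assumes z: "z \<in> disc - orb \<Gamma> A" "z \<notin> branch_points \<Gamma>"
  shows "deriv \<tau> z \<noteq> 0"
proof -
  have "stab \<Gamma> z = {\<one>\<^bsub>DA\<^esub>}" using z by (simp add: branch_points_def)
  then have "card (stab \<Gamma> z) = 1" by simp
  then obtain k :: nat where k: "k > 0" "has_ord (\<lambda>w. \<tau> w - \<tau> z) z (int k)" "k \<le> 1"
    using ord_regular[OF z(1)] by metis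
  then have "k = 1" by simp
  then have "has_ord (deriv \<tau>) z 0" using has_ord_deriv_regular[OF z(1) k(2,1)] by simp
  moreover have "isCont (deriv \<tau>) z"
    using continuous_on_interior[OF holomorphic_on_imp_continuous_on[OF holomorphic_deriv[OF \<tau>_holo open_domain]]]
      z(1) open_domain by (simp add: interior_open)
  ultimately show ?thesis using has_ord_isCont[of "deriv \<tau>" z 0] by simp
qed

lemma no_accum_branch: "no_accum (branch_points \<Gamma>)"
  by (rule no_accum_branch_points[OF fuchsian'])

lemma branch_points_closed:
  assumes g: "g \<in> \<Gamma>" and z: "z \<in> disc"
  shows "g z \<in> branch_points \<Gamma> \<longleftrightarrow> z \<in> branch_points \<Gamma>"
proof -
  have *: "g z \<in> branch_points \<Gamma>" if g: "g \<in> \<Gamma>" and z: "z \<in> branch_points \<Gamma>" for g z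
  proof -
    note gc = \<Gamma>.mem_carrier[OF g]
    have zd: "z \<in> disc" using z by (simp add: branch_points_def)
    obtain h where h: "h \<in> \<Gamma>" "h z = z" "h \<noteq> \<one>\<^bsub>DA\<^esub>"
      using z fuchsian_one_stab[OF fuchsian' zd] by (auto simp: branch_points_def stab_def)
    note hc = \<Gamma>.mem_carrier[OF h(1)]
    define k where "k = g \<otimes>\<^bsub>DA\<^esub> h \<otimes>\<^bsub>DA\<^esub> inv\<^bsub>DA\<^esub> g"
    have "k \<in> \<Gamma>" unfolding k_def using g h(1) by (intro \<Gamma>.m_closed \<Gamma>.m_inv_closed)
    moreover have "k (g z) = g z"
      using gc hc zd DA_closed[OF gc zd] h(2) by (simp add: k_def DA_mult DA_inv_apply)
    moreover have "k \<noteq> \<one>\<^bsub>DA\<^esub>"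
    proof
      assume "k = \<one>\<^bsub>DA\<^esub>"
      have "h = inv\<^bsub>DA\<^esub> g \<otimes>\<^bsub>DA\<^esub> k \<otimes>\<^bsub>DA\<^esub> g"
        using gc hc by (simp add: k_def DA.m_assoc DA.inv_solve_left)
      then show False using h(3) gc \<open>k = \<one>\<^bsub>DA\<^esub>\<close> by simp
    qed
    ultimately have "k \<in> stab \<Gamma> (g z)" "k \<noteq> \<one>\<^bsub>DA\<^esub>" by (auto simp: stab_def)
    then show ?thesis using DA_closed[OF gc zd] by (auto simp: branch_points_def)
  qed
  show ?thesis
  proof
    assume "g z \<in> branch_points \<Gamma>"
    from *[OF \<Gamma>.m_inv_closed[OF g] this] show "z \<in> branch_points \<Gamma>"
      using DA_inv_apply(1)[OF \<Gamma>.mem_carrier[OF g] z] by simp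
  qed (rule *[OF g])
qed

end

section \<open>Forms and involutions with quotient the sphere\<close>

context uniformization
begin

text \<open>There are no holomorphic forms on the sphere, so an involution with quotient the sphere acts on forms as \<open>-1\<close>.\<close>

lemma involution_negates_forms:
  assumes J: "J \<in> carrier (Aut S)" "J \<otimes>\<^bsub>Aut S\<^esub> J = \<one>\<^bsub>Aut S\<^esub>"
    and sph: "biholomorphic (quotient_surface S {\<one>\<^bsub>Aut S\<^esub>, J}) riemann_sphere"
    and K: "covers K J" and f: "f holomorphic_on disc"
    and w2: "\<And>g z. g \<in> \<Gamma>s \<Longrightarrow> z \<in> disc \<Longrightarrow> f (g z) * deriv g z = f z"
    and z: "z \<in> disc"
  shows "f (K z) * deriv K z = - f z"
proof (rule ccontr)
  assume neg: "f (K z) * deriv K z \<noteq> - f z"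
  note Kc = coversD(1)[OF K]
  interpret Q: sphere_quotient S \<pi> \<Gamma>s "{\<one>\<^bsub>Aut S\<^esub>, J}"
  proof (rule sphere_quotient.intro)
    show "uniformization S \<pi> \<Gamma>s" by unfold_locales
    show "sphere_quotient_axioms S {\<one>\<^bsub>Aut S\<^esub>, J}"
    proof (rule sphere_quotient_axioms.intro)
      have "inv\<^bsub>Aut S\<^esub> J = J" by (rule A.inv_equality[OF J(2) J(1) J(1)])
      then show "subgroup {\<one>\<^bsub>Aut S\<^esub>, J} (Aut S)"
        by (intro subgroup.intro) (use J in auto)
    qed (use sph in auto)
  qed
  have mem: "g \<in> Q.\<Gamma>G \<longleftrightarrow> g \<in> \<Gamma>s \<or> covers g J" for g
    using covers_one covers_one_imp by (auto simp: Q.\<Gamma>G_def)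
  \<comment> \<open>The form plus its pullback by J is invariant under all lifts of the group, hence
    a form on the sphere; it is shown to vanish.\<close>
  define \<eta> where "\<eta> w = f w + f (K w) * deriv K w" for w
  have h\<eta>: "\<eta> holomorphic_on disc" unfolding \<eta>_def
    by (intro holomorphic_intros f DA_deriv_holo[OF Kc] holomorphic_on_disc_comp[OF DA_holo[OF Kc] DA_closed[OF Kc] f])
  have sl: "f (g (h w)) * deriv g (h w) * deriv h w = f ((g \<otimes>\<^bsub>DA\<^esub> h) w) * deriv (g \<otimes>\<^bsub>DA\<^esub> h) w"
    if "g \<in> carrier DA" "h \<in> carrier DA" "w \<in> disc" for g h w
    using that by (simp add: DA_deriv_mult DA_mult)
  have J_slash: "f (g w) * deriv g w = f (K w) * deriv K w" if g: "covers g J" and w: "w \<in> disc" for g w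
  proof -
    obtain h where h: "h \<in> \<Gamma>s" "g = h \<otimes>\<^bsub>DA\<^esub> K" using covers_same[OF g K] by blast
    have "f (g w) * deriv g w = f (h (K w)) * deriv h (K w) * deriv K w"
      unfolding h(2) by (rule sl[OF \<Gamma>s_DA[OF h(1)] Kc w, symmetric])
    then show ?thesis using w2[OF h(1) DA_closed[OF Kc w]] by simp
  qed
  have \<eta>_w2: "\<eta> (g w) * deriv g w = \<eta> w" if g: "g \<in> Q.\<Gamma>G" and w: "w \<in> disc" for g w
  proof -
    have gc: "g \<in> carrier DA" by (rule fuchsian_group_mem[OF Q.\<Gamma>G_fuchsian g])
    have e: "\<eta> (g w) * deriv g w = f (g w) * deriv g w + f ((K \<otimes>\<^bsub>DA\<^esub> g) w) * deriv (K \<otimes>\<^bsub>DA\<^esub> g) w"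
      using sl[OF Kc gc w] by (simp add: \<eta>_def distrib_right)
    from g consider "g \<in> \<Gamma>s" | "covers g J" using mem by blast
    then show ?thesis
    proof cases
      case 1
      have "covers (K \<otimes>\<^bsub>DA\<^esub> g) J" using covers_mult[OF K covers_one[OF 1]] J(1) by simp
      then show ?thesis using e w2[OF 1 w] J_slash[OF _ w] by (simp add: \<eta>_def)
    next
      case 2
      have "covers (K \<otimes>\<^bsub>DA\<^esub> g) \<one>\<^bsub>Aut S\<^esub>" using covers_mult[OF K 2] J(2) by simp
      then have "K \<otimes>\<^bsub>DA\<^esub> g \<in> \<Gamma>s" by (rule covers_one_imp)
      then show ?thesis using e w2[OF _ w] J_slash[OF 2 w] by (simp add: \<eta>_def)
    qed
  qed
  have z0: "(0::complex) \<in> disc" by (simp add: disc_iff)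
  obtain \<tau> where "hauptmodul Q.\<Gamma>G 0 \<tau>" using Q.hauptmodul_exists[OF z0] by blast
  then interpret H: hauptmodul Q.\<Gamma>G 0 \<tau> .
  \<comment> \<open>Since \<open>\<Gamma>s\<close> acts freely, a stabilizer embeds into the set
    consisting of the identity and J.\<close>
  have stab2: "card (stab Q.\<Gamma>G w) \<le> 2" if w: "w \<in> disc" for w
  proof -
    define \<Phi> where "\<Phi> g = (SOME j. j \<in> {\<one>\<^bsub>Aut S\<^esub>, J} \<and> covers g j)" for g
    have \<Phi>: "\<Phi> g \<in> {\<one>\<^bsub>Aut S\<^esub>, J} \<and> covers g (\<Phi> g)" if g: "g \<in> Q.\<Gamma>G" for g
    proof -
      obtain j where "j \<in> {\<one>\<^bsub>Aut S\<^esub>, J} \<and> covers g j" using g unfolding Q.\<Gamma>G_def by blast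
      then show ?thesis unfolding \<Phi>_def by (rule someI[of "\<lambda>j. j \<in> {\<one>\<^bsub>Aut S\<^esub>, J} \<and> covers g j"])
    qed
    have "inj_on \<Phi> (stab Q.\<Gamma>G w)"
    proof (rule inj_onI)
      fix g h assume gh: "g \<in> stab Q.\<Gamma>G w" "h \<in> stab Q.\<Gamma>G w" "\<Phi> g = \<Phi> h"
      then have G: "g \<in> Q.\<Gamma>G" "h \<in> Q.\<Gamma>G" "g w = w" "h w = w" by (auto simp: stab_def)
      have "covers g (\<Phi> h)" using \<Phi>[OF G(1)] gh(3) by simp
      then obtain k where k: "k \<in> \<Gamma>s" "g = k \<otimes>\<^bsub>DA\<^esub> h" using covers_same \<Phi>[OF G(2)] by blast
      have hc: "h \<in> carrier DA" by (rule fuchsian_group_mem[OF Q.\<Gamma>G_fuchsian G(2)])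
      have "k w = w" using G(3,4) k(2) DA_mult[OF \<Gamma>s_DA[OF k(1)] hc w] by simp
      then have "k = \<one>\<^bsub>DA\<^esub>" by (rule free_fixed[OF k(1) w])
      then show "g = h" using k(2) hc by simp
    qed
    moreover have "\<Phi> ` stab Q.\<Gamma>G w \<subseteq> {\<one>\<^bsub>Aut S\<^esub>, J}" using \<Phi> by (auto simp: stab_def)
    ultimately have "card (stab Q.\<Gamma>G w) \<le> card {\<one>\<^bsub>Aut S\<^esub>, J}" by (intro card_inj_on_le) auto
    also have "\<dots> \<le> 2" by (simp add: card_insert_if)
    finally show ?thesis .
  qed
  \<comment> \<open>A nontrivial rotation fixing w multiplies the value at w by its multiplier,
    which is not 1.\<close>
  have branch0: "\<eta> w = 0" if w: "w \<in> branch_points Q.\<Gamma>G" for w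
  proof -
    have wd: "w \<in> disc" using w by (simp add: branch_points_def)
    obtain g where g: "g \<in> Q.\<Gamma>G" "g w = w" "g \<noteq> \<one>\<^bsub>DA\<^esub>"
      using w fuchsian_one_stab[OF Q.\<Gamma>G_fuchsian wd] by (auto simp: branch_points_def stab_def)
    have gc: "g \<in> carrier DA" by (rule fuchsian_group_mem[OF Q.\<Gamma>G_fuchsian g(1)])
    obtain t where t: "g = hyp_rotation w t" using DA_fixing_is_rotation[OF gc wd g(2)] by blast
    have "cis t \<noteq> 1" using g(3) t hyp_rotation_eq_one[OF wd] by blast
    moreover have "\<eta> w * cis t = \<eta> w" using \<eta>_w2[OF g(1) wd] g(2) deriv_hyp_rotation[OF wd, of t] t by simp
    ultimately show ?thesis by simp
  qed
  define D where "D = orb Q.\<Gamma>G 0 \<union> branch_points Q.\<Gamma>G"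
  have isoD: "no_accum D" unfolding D_def by (rule no_accum_Un[OF H.no_accum_orbA H.no_accum_branch])
  \<comment> \<open>The quotient of two invariant forms is an invariant function.\<close>
  define R where "R w = \<eta> w / deriv \<tau> w" for w
  have hR: "R holomorphic_on disc - D" unfolding R_def
  proof (rule holomorphic_on_divide)
    show "\<eta> holomorphic_on disc - D" by (rule holomorphic_on_subset[OF h\<eta>]) auto
    show "deriv \<tau> holomorphic_on disc - D"
      by (rule holomorphic_on_subset[OF holomorphic_deriv[OF H.\<tau>_holo H.open_domain]]) (auto simp: D_def)
    show "deriv \<tau> w \<noteq> 0" if "w \<in> disc - D" for w by (rule H.deriv_\<tau>_nonzero) (use that in \<open>auto simp: D_def\<close>)
  qed
  have \<eta>z: "\<eta> z \<noteq> 0" using neg by (simp add: \<eta>_def add_eq_0_iff)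
  \<comment> \<open>At a pole of \<open>\<tau>\<close> of order k its differential has a pole of
    order k + 1, so R tends to 0; this fixes the constant.\<close>
  have pole_lim: "(R \<longlongrightarrow> 0) (at w)" if w: "w \<in> orb Q.\<Gamma>G 0" for w
  proof -
    obtain k :: nat where k: "k > 0" "has_ord \<tau> w (- int k)" using H.ord_pole[OF w] by blast
    have "has_ord (deriv \<tau>) w (- int k - 1)" by (rule has_ord_deriv[OF k(2)]) (use k(1) in simp)
    then have o: "has_ord (\<lambda>w. inverse (deriv \<tau> w)) w (- (- int k - 1))" by (rule has_ord_inverse)
    obtain c where c: "((\<lambda>w. inverse (deriv \<tau> w)) \<longlongrightarrow> c) (at w)" "c = 0 \<longleftrightarrow> - (- int k - 1) > 0"
      by (rule has_ord_tendsto[OF o]) auto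
    have "(\<eta> \<longlongrightarrow> \<eta> w) (at w)" using holo_isCont[OF h\<eta> H.orb_disc[OF w]] by (simp add: isCont_def)
    then have "((\<lambda>v. \<eta> v * inverse (deriv \<tau> v)) \<longlongrightarrow> \<eta> w * c) (at w)" by (rule tendsto_mult[OF _ c(1)])
    moreover have "c = 0" using c(2) by simp
    ultimately show ?thesis by (simp add: R_def[abs_def] divide_inverse)
  qed
  have lim: "\<exists>c. (R \<longlongrightarrow> c) (at w)" if w: "w \<in> D \<inter> disc" for w
  proof (cases "w \<in> orb Q.\<Gamma>G 0")
    case True
    then show ?thesis using pole_lim by blast
  next
    case False
    then have wr: "w \<in> disc - orb Q.\<Gamma>G 0" and wb: "w \<in> branch_points Q.\<Gamma>G" and wd: "w \<in> disc" using w by (auto simp: D_def)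
    obtain k :: nat where k: "k > 0" "has_ord (\<lambda>v. \<tau> v - \<tau> w) w (int k)" "k \<le> card (stab Q.\<Gamma>G w)"
      using H.ord_regular[OF wr] by blast
    have k2: "k \<le> 2" using k(3) stab2[OF wd] by simp
    have o: "has_ord (deriv \<tau>) w (int k - 1)" by (rule H.has_ord_deriv_regular[OF wr k(2,1)])
    obtain m :: nat where m: "has_ord \<eta> w (int m)" "m > 0 \<longleftrightarrow> \<eta> w = 0"
      using has_ord_zero[OF h\<eta> open_ball connected_ball wd z \<eta>z] by blast
    \<comment> \<open>Multiplicity at most 2 means that the differential has at most a simple zero,
      which the zero of the invariant form cancels.\<close>
    have "m > 0" using m(2) branch0[OF wb] by simp
    have "has_ord R w (int m - (int k - 1))" unfolding R_def[abs_def] by (rule has_ord_divide[OF m(1) o])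
    moreover have "int m - (int k - 1) \<ge> 0" using \<open>m > 0\<close> k2 by simp
    ultimately show ?thesis using has_ord_tendsto by blast
  qed
  have inv: "g w \<in> disc - D \<and> R (g w) = R w" if g: "g \<in> \<Gamma>s" and w: "w \<in> disc - D" for g w
  proof -
    have gG: "g \<in> Q.\<Gamma>G" using g mem by blast
    have wd: "w \<in> disc" using w by blast
    have gc: "g \<in> carrier DA" by (rule \<Gamma>s_DA[OF g])
    have "g w \<in> disc - D"
      using w DA_closed[OF gc wd] H.orb_closed[OF gG wd] H.branch_points_closed[OF gG wd] by (auto simp: D_def)
    moreover have "R (g w) = R w"
    proof -
      have d: "deriv \<tau> (g w) * deriv g w = deriv \<tau> w"
        by (rule H.deriv_\<tau>_equivariant[OF gG]) (use w in \<open>auto simp: D_def\<close>)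
      have "R w = (\<eta> (g w) * deriv g w) / (deriv \<tau> (g w) * deriv g w)" unfolding d \<eta>_w2[OF gG wd] R_def ..
      then show ?thesis using DA_has_field_derivative(2)[OF gc wd] by (simp add: R_def)
    qed
    ultimately show ?thesis ..
  qed
  have inv': "\<forall>g\<in>\<Gamma>s. \<forall>z\<in>disc - D. g z \<in> disc - D \<and> R (g z) = R z" by (intro ballI inv)
  obtain c where c: "\<And>w. w \<in> disc - D \<Longrightarrow> R w = c" "\<And>w l. w \<in> D \<inter> disc \<Longrightarrow> (R \<longlongrightarrow> l) (at w) \<Longrightarrow> l = c"
    by (rule invariant_constant_isolated[OF isoD hR lim inv']) (assumption, rule that, assumption+)
  have orb0: "0 \<in> orb Q.\<Gamma>G 0" by (rule fuchsian_orb_refl[OF Q.\<Gamma>G_fuchsian z0])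
  then have "0 = c" by (intro c(2)[OF _ pole_lim[OF orb0]]) (use z0 in \<open>auto simp: D_def\<close>)
  have "\<eta> w = 0" if w: "w \<in> disc - D" for w
  proof -
    have "deriv \<tau> w \<noteq> 0" by (rule H.deriv_\<tau>_nonzero) (use w in \<open>auto simp: D_def\<close>)
    then show ?thesis using c(1)[OF w] \<open>0 = c\<close> by (simp add: R_def)
  qed
  then have "\<eta> z = 0" by (rule zero_off_isolated[OF isoD h\<eta> _ z])
  then show False using \<eta>z by simp
qed

end

section \<open>Roots of holomorphic functions on the disc\<close>

lemma cis_powi_eq_one:
  assumes "p > 0"
  shows "cis (2 * pi / real p) powi k = 1 \<longleftrightarrow> int p dvd k"
proof -
  have "cis t = 1 \<longleftrightarrow> (\<exists>n::int. t = of_int (2 * n) * pi)" for t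
    unfolding cis_conv_exp exp_eq_1 by simp
  then have "cis (2 * pi / real p) powi k = 1 \<longleftrightarrow> (\<exists>n::int. of_int k * (2 * pi / real p) = of_int (2 * n) * pi)"
    unfolding cis_power_int by blast
  also have "\<dots> \<longleftrightarrow> (\<exists>n::int. (of_int k :: real) = of_int (n * int p))"
    using assms by (intro iff_exI) (simp add: field_simps)
  also have "\<dots> \<longleftrightarrow> (\<exists>n::int. k = n * int p)" by (simp only: of_int_eq_iff)
  also have "\<dots> \<longleftrightarrow> int p dvd k" by (auto simp: dvd_def mult.commute)
  finally show ?thesis .
qed

lemma cis_powi_eq_iff:
  assumes "p > 0"
  shows "cis (2 * pi / real p) powi k = cis (2 * pi / real p) powi l \<longleftrightarrow> int p dvd k - l"
proof -
  define x where "x = cis (2 * pi / real p)"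
  have nz: "x \<noteq> 0" by (simp add: x_def)
  have d: "x powi (k - l) = x powi k / x powi l" by (rule power_int_diff) (rule disjI1[OF nz])
  have z: "x powi l \<noteq> 0" by (rule power_int_not_zero) (rule disjI1[OF nz])
  have "x powi k = x powi l \<longleftrightarrow> x powi (k - l) = 1" unfolding d by (simp only: divide_eq_1_iff z simp_thms)
  then show ?thesis unfolding x_def cis_powi_eq_one[OF assms] .
qed

lemma no_accum_finite:
  assumes D: "no_accum D" and K: "compact K" "K \<subseteq> disc"
  shows "finite (D \<inter> K)"
proof -
  define e where "e z = (SOME e. e > 0 \<and> ball z e \<inter> D \<subseteq> {z})" for z
  have e: "e z > 0 \<and> ball z (e z) \<inter> D \<subseteq> {z}" if z: "z \<in> disc" for z
  proof -
    obtain d where "d > 0" "ball z d \<inter> D \<subseteq> {z}" by (rule no_accumE[OF D z]) (rule that)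
    then have "d > 0 \<and> ball z d \<inter> D \<subseteq> {z}" ..
    then show ?thesis unfolding e_def by (rule someI[of "\<lambda>e. e > 0 \<and> ball z e \<inter> D \<subseteq> {z}"])
  qed
  have cover: "K \<subseteq> (\<Union>z\<in>K. ball z (e z))"
  proof
    fix z assume z: "z \<in> K"
    then have "z \<in> ball z (e z)" using e[of z] K(2) by (simp add: subset_iff)
    then show "z \<in> (\<Union>z\<in>K. ball z (e z))" using z by blast
  qed
  obtain F where F: "F \<subseteq> K" "finite F" "K \<subseteq> (\<Union>z\<in>F. ball z (e z))"
    by (rule compactE_image[OF K(1) _ cover]) auto
  have "D \<inter> K \<subseteq> F"
  proof
    fix x assume x: "x \<in> D \<inter> K"
    then obtain z where z: "z \<in> F" "x \<in> ball z (e z)" using F(3) by blast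
    have "ball z (e z) \<inter> D \<subseteq> {z}" using e[of z] z(1) F(1) K(2) by blast
    then show "x \<in> F" using x z by blast
  qed
  then show ?thesis using F(2) by (rule finite_subset)
qed

lemma has_ord_shift:
  "has_ord (\<lambda>w. (w - z) powi k) z k"
  by (rule has_ordI[of UNIV z "\<lambda>_. 1"]) auto

text \<open>Induction on the zeros: a power of w - d with exponent divisible by p has an evident
  p-th root and is divided out. Without zeros, a logarithm exists on the convex set.\<close>

lemma root_finite_zeros:
  assumes U: "open U" "convex U" "U \<noteq> {}" and p: "p > 0" and "finite S"
    and "G holomorphic_on U" "\<And>z. z \<in> U - S \<Longrightarrow> G z \<noteq> 0"
    and "\<And>z. z \<in> S \<inter> U \<Longrightarrow> has_ord G z (int p * int (n z))"
  shows "\<exists>f. f holomorphic_on U \<and> (\<forall>z\<in>U. f z ^ p = G z)"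
  using assms(5-)
proof (induction S arbitrary: G)
  case empty
  obtain u where u: "u \<in> U" using U(3) by blast
  have nz: "G z \<noteq> 0" if "z \<in> U" for z using empty.prems(2) that by simp
  obtain g where g: "g holomorphic_on U" "\<And>x. x \<in> U \<Longrightarrow> exp (g x) = G x"
    using holomorphic_logarithm_exists[OF U(2,1) empty.prems(1) nz u] by blast
  have "exp (g x / of_nat p) ^ p = G x" if "x \<in> U" for x
    using g(2)[OF that] p by (simp add: exp_of_nat_mult[symmetric])
  moreover have "(\<lambda>x. exp (g x / of_nat p)) holomorphic_on U" by (intro holomorphic_intros g(1)) (use p in auto)
  ultimately show ?case by (intro exI[of _ "\<lambda>x. exp (g x / of_nat p)"]) simp
next
  case (insert d S)
  show ?case
  proof (cases "d \<in> U")
    case False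
    show ?thesis
      by (rule insert.IH) (use insert.prems False in auto)
  next
    case True
    define H where "H w = G w / (w - d) powi (int p * int (n d))" for w
    have ordG: "has_ord G d (int p * int (n d))" using insert.prems(3) True by simp
    have ordH: "has_ord H d (int p * int (n d) - int p * int (n d))" unfolding H_def[abs_def]
      by (rule has_ord_divide[OF ordG has_ord_shift])
    then have ordH: "has_ord H d 0" by simp
    \<comment> \<open>The second fact says that c is nonzero, so filling it in at d leaves a
      holomorphic function with one zero fewer.\<close>
    obtain c where c: "(H \<longlongrightarrow> c) (at d)" "c = 0 \<longleftrightarrow> (0::int) > 0"
      using has_ord_tendsto[OF ordH order_refl] by blast
    define K where "K w = (if w = d then c else H w)" for w
    have KH: "eventually (\<lambda>w. H w = K w) (at d)" by (simp add: K_def eventually_at_filter)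
    have Kd: "(K \<longlongrightarrow> K d) (at d)" using Lim_transform_eventually[OF c(1) KH] unfolding K_def[of d] by simp
    have hK0: "K holomorphic_on U - {d}"
    proof (rule holomorphic_transform)
      show "H holomorphic_on U - {d}" unfolding H_def[abs_def]
        by (intro holomorphic_intros holomorphic_on_subset[OF insert.prems(1)]) auto
    qed (simp add: K_def)
    have hK: "K holomorphic_on U"
    proof (rule no_isolated_singularity'[OF _ hK0 U(1)])
      show "(K \<longlongrightarrow> K z) (at z within U)" if "z \<in> {d}" for z
        using Lim_at_imp_Lim_at_within[OF Kd] that by simp
    qed simp
    have GK: "G w = (w - d) ^ (p * n d) * K w" if w: "w \<in> U" "w \<noteq> d" for w
      using w by (simp add: K_def H_def power_int_def nat_mult_distrib)
    have "\<exists>f. f holomorphic_on U \<and> (\<forall>z\<in>U. f z ^ p = K z)"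
    proof (rule insert.IH[OF hK])
      show "K z \<noteq> 0" if "z \<in> U - S" for z
        using that insert.prems(2)[of z] GK[of z] c(2) by (cases "z = d") (auto simp: K_def)
      fix z assume z: "z \<in> S \<inter> U"
      then have zd: "z \<noteq> d" using insert.hyps by blast
      have "has_ord (\<lambda>w. (w - d) powi (int p * int (n d))) z 0"
        by (rule has_ord_analytic[of "- {d}"]) (use zd in \<open>auto intro!: holomorphic_intros\<close>)
      then have "has_ord H z (int p * int (n z) - 0)" unfolding H_def[abs_def]
        by (rule has_ord_divide[rotated]) (use insert.prems(3)[of z] z in simp)
      then have "has_ord H z (int p * int (n z))" by simp
      then show "has_ord K z (int p * int (n z))"
      proof (rule has_ord_cong)
        have "eventually (\<lambda>w. w \<in> - {d}) (at z)" by (rule eventually_at_in_open') (use zd in auto)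
        then show "eventually (\<lambda>w. H w = K w) (at z)" by eventually_elim (simp add: K_def)
      qed
    qed
    then obtain f where f: "f holomorphic_on U" "\<And>z. z \<in> U \<Longrightarrow> f z ^ p = K z" by blast
    have hf: "(\<lambda>z. (z - d) ^ n d * f z) holomorphic_on U" by (intro holomorphic_intros f(1))
    have eq: "((z - d) ^ n d * f z) ^ p = G z" if z: "z \<in> U" "z \<noteq> d" for z
      using GK[OF z] f(2)[OF z(1)] by (simp add: power_mult_distrib power_mult[symmetric] mult.commute)
    have "((z - d) ^ n d * f z) ^ p = G z" if z: "z \<in> U" for z
    proof (cases "z = d")
      case True
      have o: "open U" "z \<in> U" by (fact U(1), fact z)
      have ct: "isCont h z" if "h holomorphic_on U" for h
        using continuous_on_interior[OF holomorphic_on_imp_continuous_on[OF that]] o by (simp add: interior_open)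
      have "((\<lambda>z. ((z - d) ^ n d * f z) ^ p) \<longlongrightarrow> ((z - d) ^ n d * f z) ^ p) (at z)"
        using ct[OF holomorphic_on_power[OF hf]] by (simp add: isCont_def)
      moreover have "(G \<longlongrightarrow> G z) (at z)" using ct[OF insert.prems(1)] by (simp add: isCont_def)
      then have "((\<lambda>z. ((z - d) ^ n d * f z) ^ p) \<longlongrightarrow> G z) (at z)"
      proof (rule Lim_transform_eventually)
        have "eventually (\<lambda>w. w \<in> U \<and> w \<noteq> z) (at z)"
          using eventually_at_in_open'[OF o] by (simp add: eventually_at_filter)
        then show "eventually (\<lambda>w. G w = ((w - d) ^ n d * f w) ^ p) (at z)"
          by eventually_elim (use True eq in auto)
      qed
      ultimately show ?thesis by (rule tendsto_unique[rotated]) simp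
    next
      case False
      then show ?thesis by (rule eq[OF z])
    qed
    then show ?thesis using hf by blast
  qed
qed

lemma root_of_unity_factor:
  assumes "x ^ p = y ^ p" "p > 0"
  obtains w :: complex where "w ^ p = 1" "x = w * y"
proof (cases "y = 0")
  case True
  then show ?thesis using assms that[of 1] by (simp add: power_0_left)
next
  case False
  show ?thesis
    by (rule that[of "x / y"]) (use False assms in \<open>simp_all add: power_divide\<close>)
qed

lemma roots_of_unity_countable: "p > 0 \<Longrightarrow> countable {w::complex. w ^ p = 1}"
  by (intro countable_finite finite_roots_unity) simp

text \<open>Pointwise the ratio is one of finitely many roots of unity;
  \<open>countable_holomorphic_zero\<close> selects one for the whole ball.\<close>

lemma root_of_unity_multiple:
  assumes r: "0 < r" and p: "p > 0" and "f holomorphic_on ball c r" "g holomorphic_on ball c r"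
    and eq: "\<And>z. z \<in> ball c r \<Longrightarrow> f z ^ p = g z ^ p"
  obtains w :: complex where "w ^ p = 1" "\<And>z. z \<in> ball c r \<Longrightarrow> f z = w * g z"
proof -
  obtain w :: complex where w: "w \<in> {w. w ^ p = 1}" "\<And>z. z \<in> ball c r \<Longrightarrow> f z - w * g z = 0"
  proof (rule countable_holomorphic_zero[OF roots_of_unity_countable[OF p] r, of "\<lambda>w z. f z - w * g z" c])
    show "(\<lambda>z. f z - w * g z) holomorphic_on ball c r" for w by (intro holomorphic_intros assms)
    fix z assume z: "z \<in> ball c r"
    obtain w where "w ^ p = 1" "f z = w * g z" by (rule root_of_unity_factor[OF eq[OF z] p])
    then show "\<exists>w\<in>{w. w ^ p = 1}. f z - w * g z = 0" by auto
  qed auto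
  show thesis by (rule that[of w]) (use w in auto)
qed

text \<open>The zeros may accumulate at the boundary circle, so roots are taken on smaller
  concentric balls. Prescribing the value c at a point b outside D makes them unique, and they fit
  together.\<close>

lemma holomorphic_root_disc:
  assumes p: "p > 0" and D: "no_accum D" and G: "G holomorphic_on disc"
    and nz: "\<And>z. z \<in> disc - D \<Longrightarrow> G z \<noteq> 0"
    and ord: "\<And>z. z \<in> D \<inter> disc \<Longrightarrow> has_ord G z (int p * int (n z))"
  obtains f where "f holomorphic_on disc" "\<And>z. z \<in> disc \<Longrightarrow> f z ^ p = G z"
    "\<And>z. z \<in> D \<inter> disc \<Longrightarrow> has_ord f z (int (n z))"
proof -
  have z0: "(0::complex) \<in> disc" by (simp add: disc_iff)
  have "\<exists>b. b \<in> disc - D"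
    using eventually_happens[OF eventually_not_isolated[OF D z0]] by simp
  then obtain b where b: "b \<in> disc" "b \<notin> D" by blast
  have Gb: "G b \<noteq> 0" using nz b by blast
  have nb: "norm b < 1" using b(1) by (simp add: disc_iff)
  have ex: "\<exists>f. f holomorphic_on ball 0 r \<and> (\<forall>z\<in>ball 0 r. f z ^ p = G z)" if r: "0 < r" "r < 1" for r
  proof -
    have sub: "cball 0 r \<subseteq> disc" "ball 0 r \<subseteq> disc" using r by (auto simp: disc_iff mem_ball)
    show ?thesis
    proof (rule root_finite_zeros[of _ p "D \<inter> cball 0 r" _ n])
      show "finite (D \<inter> cball 0 r)" by (rule no_accum_finite[OF D compact_cball sub(1)])
      show "G holomorphic_on ball 0 r" by (rule holomorphic_on_subset[OF G sub(2)])
      show "G z \<noteq> 0" if "z \<in> ball 0 r - D \<inter> cball 0 r" for z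
        by (rule nz) (use that sub(2) in \<open>auto simp: mem_ball\<close>)
      show "has_ord G z (int p * int (n z))" if "z \<in> D \<inter> cball 0 r \<inter> ball 0 r" for z
        by (rule ord) (use that sub(2) in auto)
    qed (use r p in auto)
  qed
  obtain c where c: "c ^ p = G b"
  proof -
    define r where "r = (1 + norm b) / 2"
    have r: "0 < r" "r < 1" "norm b < r" using nb add_pos_nonneg[of 1 "norm b"] by (simp_all add: r_def)
    obtain f where "\<And>z. z \<in> ball 0 r \<Longrightarrow> f z ^ p = G z" using ex[OF r(1,2)] by blast
    then have "f b ^ p = G b" using r(3) by (simp add: mem_ball_0)
    then show thesis by (rule that)
  qed
  have cnz: "c \<noteq> 0" using c Gb p by (auto simp: power_0_left)
  have ex': "\<exists>f. f holomorphic_on ball 0 r \<and> (\<forall>z\<in>ball 0 r. f z ^ p = G z) \<and> f b = c"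
    if r: "norm b < r" "r < 1" for r
  proof -
    have r0: "0 < r" using r(1) norm_ge_zero[of b] by linarith
    obtain f where f: "f holomorphic_on ball 0 r" "\<And>z. z \<in> ball 0 r \<Longrightarrow> f z ^ p = G z"
      using ex[OF r0 r(2)] by blast
    have bb: "b \<in> ball 0 r" using r by (simp add: mem_ball_0)
    have "c ^ p = f b ^ p" using c f(2)[OF bb] by simp
    then obtain w where w: "w ^ p = 1" "c = w * f b" using p by (rule root_of_unity_factor)
    have "(\<lambda>z. w * f z) holomorphic_on ball 0 r" by (intro holomorphic_intros f(1))
    moreover have "\<forall>z\<in>ball 0 r. (w * f z) ^ p = G z" using f(2) w(1) by (simp add: power_mult_distrib)
    ultimately show ?thesis using w(2) by (intro exI[of _ "\<lambda>z. w * f z"]) simp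
  qed
  define F where "F r = (SOME f. f holomorphic_on ball 0 r \<and> (\<forall>z\<in>ball 0 r. f z ^ p = G z) \<and> f b = c)" for r
  have F: "F r holomorphic_on ball 0 r \<and> (\<forall>z\<in>ball 0 r. F r z ^ p = G z) \<and> F r b = c"
    if "norm b < r" "r < 1" for r
    unfolding F_def by (rule someI_ex[OF ex'[OF that]])
  have agree_le: "F s z = F r z" if r: "norm b < r" "r \<le> s" "s < 1" and z: "z \<in> ball 0 r" for r s z
  proof -
    have r0: "0 < r" using r(1) norm_ge_zero[of b] by linarith
    have sub: "ball 0 r \<subseteq> ball (0::complex) s" using r(2) by (auto simp: mem_ball)
    have Fs: "F s holomorphic_on ball 0 s \<and> (\<forall>z\<in>ball 0 s. F s z ^ p = G z) \<and> F s b = c" by (rule F) (use r in auto)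
    have Fr: "F r holomorphic_on ball 0 r \<and> (\<forall>z\<in>ball 0 r. F r z ^ p = G z) \<and> F r b = c" by (rule F) (use r in auto)
    obtain w where w: "w ^ p = 1" "\<And>z. z \<in> ball 0 r \<Longrightarrow> F s z = w * F r z"
    proof (rule root_of_unity_multiple[OF r0 p])
      show "F s holomorphic_on ball 0 r" using Fs sub holomorphic_on_subset by blast
      show "F r holomorphic_on ball 0 r" using Fr by blast
      show "F s z ^ p = F r z ^ p" if "z \<in> ball 0 r" for z using Fs Fr sub that by auto
    qed auto
    have "c = w * c" using w(2)[of b] Fs Fr r(1) by (simp add: mem_ball_0)
    then show ?thesis using w(2)[OF z] cnz by simp
  qed
  have agree: "F s z = F r z" if "norm b < r" "r < 1" "norm b < s" "s < 1" "z \<in> ball 0 r" "z \<in> ball 0 s" for r s z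
    using agree_le[of r s z] agree_le[of s r z] that by (cases "r \<le> s") auto
  \<comment> \<open>A radius less than 1 whose ball contains both z and the base point b.\<close>
  define \<rho> where "\<rho> z = (1 + max (norm z) (norm b)) / 2" for z :: complex
  have \<rho>: "norm b < \<rho> z" "\<rho> z < 1" "z \<in> ball 0 (\<rho> z)" if "z \<in> disc" for z
    using that nb by (auto simp: \<rho>_def disc_iff mem_ball_0)
  define f where "f z = F (\<rho> z) z" for z
  have fF: "f w = F (\<rho> z) w" if "z \<in> disc" "w \<in> disc" "w \<in> ball 0 (\<rho> z)" for z w
    unfolding f_def by (rule agree) (use \<rho>[OF that(1)] \<rho>[OF that(2)] that in auto)
  have sub: "ball 0 (\<rho> z) \<subseteq> disc" if "z \<in> disc" for z using \<rho>(2)[OF that] by (auto simp: mem_ball)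
  have hf: "f holomorphic_on disc"
  proof (rule holomorphic_on_locally)
    fix z assume z: "z \<in> disc"
    have "f holomorphic_on ball 0 (\<rho> z)"
    proof (rule holomorphic_transform)
      show "F (\<rho> z) holomorphic_on ball 0 (\<rho> z)" using F[OF \<rho>(1,2)[OF z]] by blast
      show "F (\<rho> z) w = f w" if w: "w \<in> ball 0 (\<rho> z)" for w
        by (rule fF[symmetric]) (use z w sub[OF z] in auto)
    qed
    then show "\<exists>N. open N \<and> z \<in> N \<and> f holomorphic_on N"
      using \<rho>(3)[OF z] by (intro exI[of _ "ball 0 (\<rho> z)"]) simp
  qed
  have root: "f z ^ p = G z" if z: "z \<in> disc" for z
    using F[OF \<rho>(1,2)[OF z]] \<rho>(3)[OF z] by (simp add: f_def)
  have fb: "f b \<noteq> 0" using root[OF b(1)] Gb p by (auto simp: power_0_left)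
  have "has_ord f z (int (n z))" if z: "z \<in> D \<inter> disc" for z
  proof -
    have zd: "z \<in> disc" using z by blast
    obtain m where m: "has_ord f z (int m)"
      using has_ord_zero[OF hf open_ball connected_ball zd b(1) fb] by blast
    have "has_ord (\<lambda>w. f w ^ p) z (int p * int m)" by (rule has_ord_power[OF m])
    then have "has_ord G z (int p * int m)"
    proof (rule has_ord_cong)
      show "eventually (\<lambda>w. f w ^ p = G w) (at z)"
        using eventually_at_in_open'[OF open_ball zd] by eventually_elim (rule root)
    qed
    from has_ord_unique[OF this ord[OF z]] have "m = n z" using p by simp
    then show ?thesis using m by simp
  qed
  then show thesis using that hf root by blast
qed

section \<open>Forms with prescribed zeros\<close>

lemma has_ord_prod:
  assumes "finite X" "\<And>x. x \<in> X \<Longrightarrow> has_ord (f x) z (k x)"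
  shows "has_ord (\<lambda>w. \<Prod>x\<in>X. f x w) z (\<Sum>x\<in>X. k x)"
  using assms
proof (induction X)
  case empty
  then show ?case by (simp add: has_ord_analytic[OF open_UNIV])
next
  case (insert x X)
  have "has_ord (\<lambda>w. f x w * (\<Prod>x\<in>X. f x w)) z (k x + (\<Sum>x\<in>X. k x))"
    by (rule has_ord_mult) (use insert in auto)
  then show ?case using insert.hyps by simp
qed

context hauptmodul
begin

text \<open>The rotation has a multiplier of exact order p, so \<open>rotation_power_ord\<close>
  leaves only exponents divisible by p.\<close>

lemma rotation_order_divides:
  assumes p: "p > 0" and z: "z \<in> disc" and rot: "hyp_rotation z (2 * pi / real p) \<in> \<Gamma>"
    and f: "has_ord f z k" and inv: "\<And>w g. g \<in> \<Gamma> \<Longrightarrow> w \<in> disc - orb \<Gamma> A \<Longrightarrow> f (g w) = f w"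
  shows "int p dvd k"
proof -
  have "hyp_rotation z (2 * pi / real p) \<in> stab \<Gamma> z" using rot hyp_rotation_center[OF z] by (simp add: stab_def)
  from rotation_power_ord[OF z this f inv[OF rot]] have "cis (2 * pi / real p) powi k = 1"
    by (simp add: deriv_hyp_rotation[OF z])
  then show ?thesis using cis_powi_eq_one[OF p] by blast
qed

text \<open>The multiplicity is positive, at most p and divisible by p.\<close>

lemma ord_full_regular:
  assumes p: "p > 0" and z: "z \<in> disc - orb \<Gamma> A" and c: "card (stab \<Gamma> z) = p"
    and rot: "hyp_rotation z (2 * pi / real p) \<in> \<Gamma>"
  shows "has_ord (\<lambda>w. \<tau> w - \<tau> z) z (int p)"
proof -
  have zd: "z \<in> disc" using z by blast
  obtain k :: nat where k: "k > 0" "has_ord (\<lambda>w. \<tau> w - \<tau> z) z (int k)" "k \<le> card (stab \<Gamma> z)"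
    by (rule ord_regular[OF z])
  have "int p dvd int k" by (rule rotation_order_divides[OF p zd rot k(2)]) (simp add: \<tau>_inv)
  then have "k = p" using k(1,3) c by (simp add: dvd_imp_le le_antisym)
  then show ?thesis using k(2) by simp
qed

lemma ord_full_pole:
  assumes p: "p > 0" and z: "z \<in> orb \<Gamma> A" and c: "card (stab \<Gamma> z) = p"
    and rot: "hyp_rotation z (2 * pi / real p) \<in> \<Gamma>"
  shows "has_ord \<tau> z (- int p)"
proof -
  obtain k :: nat where k: "k > 0" "has_ord \<tau> z (- int k)" "k \<le> card (stab \<Gamma> z)"
    by (rule ord_pole[OF z])
  have "int p dvd - int k" by (rule rotation_order_divides[OF p orb_disc[OF z] rot k(2)]) (simp add: \<tau>_inv)
  then have "int p dvd int k" by simp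
  then have "k = p" using k(1,3) c by (simp add: dvd_imp_le le_antisym)
  then show ?thesis using k(2) by simp
qed

lemma orbits_disjoint:
  assumes "x \<in> disc" "y \<in> disc" "z \<in> orb \<Gamma> x" "z \<in> orb \<Gamma> y"
  shows "y \<in> orb \<Gamma> x"
proof -
  obtain g where g: "g \<in> \<Gamma>" "z = g y" using assms(4) unfolding mem_orb by blast
  show ?thesis using fuchsian_orb_closed[OF fuchsian' assms(1) g(1) assms(2)] assms(3) g(2) by simp
qed

text \<open>The \<open>p\<close>-th root of \<open>\<tau>'\<^sup>p / \<Prod>\<^sub>x (\<tau> - \<tau> x)\<^sup>e\<^sup>x\<close>, the form usually written \<open>dx / y\<close> on the curve
  \<open>y\<^sup>p = \<Prod>\<^sub>x (X - \<tau> x)\<^sup>e\<^sup>x\<close>.\<close>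

lemma form_exists:
  fixes e :: "complex \<Rightarrow> nat"
  assumes p: "p > 0" and X: "finite X" "X \<subseteq> disc"
    and XA: "\<And>x. x \<in> X \<Longrightarrow> x \<notin> orb \<Gamma> A"
    and XX: "\<And>x y. x \<in> X \<Longrightarrow> y \<in> X \<Longrightarrow> y \<in> orb \<Gamma> x \<Longrightarrow> y = x"
    and br: "branch_points \<Gamma> = orb \<Gamma> A \<union> (\<Union>x\<in>X. orb \<Gamma> x)"
    and st: "\<And>z. z \<in> branch_points \<Gamma> \<Longrightarrow> card (stab \<Gamma> z) = p \<and> hyp_rotation z (2 * pi / real p) \<in> \<Gamma>"
    and e: "\<And>x. x \<in> X \<Longrightarrow> e x < p" and sum_e: "p + 1 \<le> sum e X"
  obtains f where "f holomorphic_on disc"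
    "\<And>z. z \<in> disc \<Longrightarrow> f z = 0 \<longleftrightarrow> (z \<in> orb \<Gamma> A \<and> p + 1 < sum e X) \<or> (\<exists>x\<in>X. z \<in> orb \<Gamma> x \<and> e x + 1 < p)"
    "\<And>x z. x \<in> X \<Longrightarrow> z \<in> disc \<Longrightarrow>
       f (hyp_rotation x (2 * pi / real p) z) * deriv (hyp_rotation x (2 * pi / real p)) z
         = cis (2 * pi / real p) powi (- int (e x)) * f z"
proof -
  define D where "D = branch_points \<Gamma>"
  have AD: "orb \<Gamma> A \<subseteq> D" using br by (auto simp: D_def)
  have Dd: "D \<subseteq> disc" by (auto simp: D_def branch_points_def)
  have isoD: "no_accum D" unfolding D_def by (rule no_accum_branch)
  have D_closed: "g z \<in> disc - D" if "g \<in> \<Gamma>" "z \<in> disc - D" for g z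
    using branch_points_closed[OF that(1), of z] DA_closed[OF \<Gamma>.mem_carrier[OF that(1)]] that(2) by (auto simp: D_def)
  have xd: "x \<in> disc - orb \<Gamma> A" if "x \<in> X" for x using that X(2) XA by blast
  have \<tau>x: "\<tau> z = \<tau> x \<longleftrightarrow> z \<in> orb \<Gamma> x" if "x \<in> X" "z \<in> disc - orb \<Gamma> A" for x z
    using \<tau>_eq_iff[OF xd[OF that(1)] that(2)] by (auto simp: mem_orb)
  define x_of where "x_of z = (THE x. x \<in> X \<and> z \<in> orb \<Gamma> x)" for z
  have x_of: "x_of z = x" if "x \<in> X" "z \<in> orb \<Gamma> x" for x z
    unfolding x_of_def
  proof (rule the_equality)
    fix y assume y: "y \<in> X \<and> z \<in> orb \<Gamma> y"
    have "y \<in> orb \<Gamma> x" by (rule orbits_disjoint[of x y z]) (use that y X(2) in auto)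
    then show "y = x" using XX that y by blast
  qed (use that in blast)
  \<comment> \<open>The orders of the root: over x the p-th power has order p (p - 1) - p e(x), at
    infinity it has order -p (p + 1) plus p times the sum of all e. The bounds on e keep the
    subtractions of natural numbers exact.\<close>
  define N where "N z = (if z \<in> orb \<Gamma> A then sum e X - p - 1 else p - 1 - e (x_of z))" for z
  define Q where "Q w = (\<Prod>x\<in>X. (\<tau> w - \<tau> x) ^ e x)" for w
  define G0 where "G0 w = deriv \<tau> w ^ p / Q w" for w
  have Q_nz: "Q z \<noteq> 0" if z: "z \<in> disc - D" for z
  proof -
    have "\<tau> z - \<tau> x \<noteq> 0" if "x \<in> X" for x
      using \<tau>x[OF that, of z] z AD br that by (auto simp: D_def)
    then show ?thesis using X(1) by (auto simp: Q_def)
  qed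
  have d_nz: "deriv \<tau> z \<noteq> 0" if "z \<in> disc - D" for z
    by (rule deriv_\<tau>_nonzero) (use that AD in \<open>auto simp: D_def\<close>)
  have hG0: "G0 holomorphic_on disc - D"
  proof -
    have s: "disc - D \<subseteq> disc - orb \<Gamma> A" using AD by blast
    have "deriv \<tau> holomorphic_on disc - D"
      by (rule holomorphic_on_subset[OF holomorphic_deriv[OF \<tau>_holo open_domain] s])
    moreover have "Q holomorphic_on disc - D" unfolding Q_def[abs_def]
      by (intro holomorphic_intros holomorphic_on_subset[OF \<tau>_holo s])
    ultimately show ?thesis unfolding G0_def[abs_def]
      by (intro holomorphic_on_divide holomorphic_on_power) (use Q_nz in auto)
  qed
  have ordG0: "has_ord G0 z (int p * int (N z))" if z: "z \<in> D" for z
  proof (cases "z \<in> orb \<Gamma> A")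
    case True
    have t: "has_ord \<tau> z (- int p)" using st[of z] z by (intro ord_full_pole[OF p True]) (auto simp: D_def)
    have d: "has_ord (deriv \<tau>) z (- int p - 1)" by (rule has_ord_deriv[OF t]) (use p in simp)
    have q: "has_ord Q z (\<Sum>x\<in>X. int (e x) * (- int p))" unfolding Q_def[abs_def]
      by (intro has_ord_prod X(1) has_ord_power has_ord_pole_diff t p)
    have "has_ord G0 z (int p * (- int p - 1) - (\<Sum>x\<in>X. int (e x) * (- int p)))" unfolding G0_def[abs_def]
      by (rule has_ord_divide[OF has_ord_power[OF d] q])
    moreover have "int p * (- int p - 1) - (\<Sum>x\<in>X. int (e x) * (- int p)) = int p * int (N z)"
    proof -
      have 1: "(\<Sum>x\<in>X. int (e x) * (- int p)) = - int p * int (sum e X)"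
      by (simp add: sum_distrib_right[symmetric] sum_negf)
      have 2: "int (N z) = int (sum e X) - int p - 1" using True sum_e by (simp add: N_def of_nat_diff)
      show ?thesis unfolding 1 2 by (simp only: algebra_simps)
    qed
    ultimately show ?thesis by simp
  next
    case False
    then have zr: "z \<in> disc - orb \<Gamma> A" using z Dd by blast
    obtain x where x: "x \<in> X" "z \<in> orb \<Gamma> x" using z False br by (auto simp: D_def)
    have t: "has_ord (\<lambda>w. \<tau> w - \<tau> z) z (int p)" using st[of z] z by (intro ord_full_regular[OF p zr]) (auto simp: D_def)
    have d: "has_ord (deriv \<tau>) z (int p - 1)" by (rule has_ord_deriv_regular[OF zr t p])
    have fac: "has_ord (\<lambda>w. \<tau> w - \<tau> y) z (if y = x then int p else 0)" if y: "y \<in> X" for y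
    proof (cases "y = x")
      case True
      then show ?thesis using t \<tau>x[OF x(1) zr] x(2) by simp
    next
      case False
      have "z \<notin> orb \<Gamma> y" using x_of[OF x] x_of[OF y, of z] False by auto
      then have "\<tau> z - \<tau> y \<noteq> 0" using \<tau>x[OF y zr] by simp
      then have "has_ord (\<lambda>w. \<tau> w - \<tau> y) z 0"
        by (intro has_ord_analytic[OF open_domain zr] holomorphic_intros \<tau>_holo)
      then show ?thesis using False by simp
    qed
    have q: "has_ord Q z (\<Sum>y\<in>X. int (e y) * (if y = x then int p else 0))" unfolding Q_def[abs_def]
      by (intro has_ord_prod X(1) has_ord_power fac)
    have "has_ord G0 z (int p * (int p - 1) - (\<Sum>y\<in>X. int (e y) * (if y = x then int p else 0)))" unfolding G0_def[abs_def]
      by (rule has_ord_divide[OF has_ord_power[OF d] q])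
    moreover have "int p * (int p - 1) - (\<Sum>y\<in>X. int (e y) * (if y = x then int p else 0)) = int p * int (N z)"
    proof -
      have 1: "(\<Sum>y\<in>X. int (e y) * (if y = x then int p else 0)) = int (e x) * int p"
      using X(1) x(1) by (simp add: if_distrib[of "(*) _"] sum.delta' cong: if_cong)
      have 2: "int (N z) = int p - 1 - int (e x)" using False x_of[OF x] e[OF x(1)] by (simp add: N_def of_nat_diff)
      show ?thesis unfolding 1 2 by (simp only: algebra_simps)
    qed
    ultimately show ?thesis by simp
  qed
  have lim: "\<exists>c. (G0 \<longlongrightarrow> c) (at z)" if z: "z \<in> D \<inter> disc" for z
  proof -
    have "has_ord G0 z (int p * int (N z))" by (rule ordG0) (use z in blast)
    then show ?thesis by (rule has_ord_tendsto) auto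
  qed
  obtain G where G: "G holomorphic_on disc" "\<And>z. z \<in> disc - D \<Longrightarrow> G z = G0 z"
    "\<And>z. z \<in> disc \<Longrightarrow> eventually (\<lambda>w. G w = G0 w) (at z)"
    by (rule has_ord_extend[OF isoD hG0 lim]) (assumption, rule that, assumption+)
  have G_nz: "G z \<noteq> 0" if "z \<in> disc - D" for z
    using G(2)[OF that] Q_nz[OF that] d_nz[OF that] by (simp add: G0_def)
  have ordG: "has_ord G z (int p * int (N z))" if z: "z \<in> D \<inter> disc" for z
  proof (rule has_ord_cong[OF ordG0])
    show "eventually (\<lambda>w. G0 w = G w) (at z)" using G(3)[of z] z by (simp add: eq_commute)
  qed (use z in blast)
  obtain f where f: "f holomorphic_on disc" "\<And>z. z \<in> disc \<Longrightarrow> f z ^ p = G z"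
    "\<And>z. z \<in> D \<inter> disc \<Longrightarrow> has_ord f z (int (N z))"
    by (rule holomorphic_root_disc[OF p isoD G(1) G_nz ordG]) (assumption+, rule that, assumption+)
  have f_nz: "f z \<noteq> 0" if "z \<in> disc - D" for z
    using f(2)[of z] G_nz[OF that] that p by (auto simp: power_0_left)
  have f_zero: "f z = 0 \<longleftrightarrow> N z > 0" if z: "z \<in> D" for z
  proof -
    have zd: "z \<in> D \<inter> disc" using z Dd by blast
    have "isCont f z" by (rule holo_isCont[OF f(1)]) (use zd in blast)
    then show ?thesis using has_ord_isCont[OF f(3)[OF zd]] by simp
  qed
  have G_inv: "G (g z) * deriv g z ^ p = G z" if g: "g \<in> \<Gamma>" and z: "z \<in> disc" for g z
  proof -
    note gc = \<Gamma>.mem_carrier[OF g]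
    have h: "(\<lambda>z. G (g z) * deriv g z ^ p - G z) holomorphic_on disc"
      by (intro holomorphic_intros G(1) DA_deriv_holo[OF gc] holomorphic_on_disc_comp[OF DA_holo[OF gc] DA_closed[OF gc] G(1)])
    have "G (g z) * deriv g z ^ p - G z = 0"
    proof (rule zero_off_isolated[OF isoD h _ z])
      fix w assume w: "w \<in> disc - D"
      have wr: "w \<in> disc - orb \<Gamma> A" using w AD by blast
      have "Q (g w) = Q w" using \<tau>_inv[OF g wr] by (simp add: Q_def)
      moreover have "(deriv \<tau> (g w) * deriv g w) ^ p = deriv \<tau> w ^ p"
        using deriv_\<tau>_equivariant[OF g wr] by simp
      ultimately show "G (g w) * deriv g w ^ p - G w = 0"
        using G(2)[OF w] G(2)[OF D_closed[OF g w]] by (simp add: G0_def power_mult_distrib)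
    qed
    then show ?thesis by simp
  qed
  \<comment> \<open>G is invariant as a differential of degree p, so each g changes its root by a
    root of unity that does not depend on the point.\<close>
  have char: "\<exists>c. c ^ p = 1 \<and> (\<forall>z\<in>disc. f (g z) * deriv g z = c * f z)" if g: "g \<in> \<Gamma>" for g
  proof -
    note gc = \<Gamma>.mem_carrier[OF g]
    have h: "(\<lambda>z. f (g z) * deriv g z) holomorphic_on disc"
      by (intro holomorphic_intros DA_deriv_holo[OF gc] holomorphic_on_disc_comp[OF DA_holo[OF gc] DA_closed[OF gc] f(1)])
    obtain c where "c ^ p = 1" "\<And>z. z \<in> disc \<Longrightarrow> f (g z) * deriv g z = c * f z"
    proof (rule root_of_unity_multiple[OF zero_less_one p h f(1)])
      fix z assume z: "z \<in> disc"
      show "(f (g z) * deriv g z) ^ p = f z ^ p"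
        using G_inv[OF g z] f(2)[OF z] f(2)[OF DA_closed[OF gc z]] by (simp add: power_mult_distrib)
    qed (rule that, assumption+)
    then show ?thesis by blast
  qed
  \<comment> \<open>The root of unity belonging to the rotation at x is found by letting w tend to
    x: the leading term contributes the power N(x) of the multiplier and the derivative one more,
    and N(x) + 1 = p - e(x).\<close>
  have rot: "f (hyp_rotation x (2 * pi / real p) z) * deriv (hyp_rotation x (2 * pi / real p)) z
         = cis (2 * pi / real p) powi (- int (e x)) * f z" if x: "x \<in> X" and z: "z \<in> disc" for x z
  proof -
    define \<zeta> where "\<zeta> = cis (2 * pi / real p)"
    define g where "g = hyp_rotation x (2 * pi / real p)"
    have xdd: "x \<in> disc" using xd[OF x] by blast
    have xx: "x \<in> orb \<Gamma> x" by (rule fuchsian_orb_refl[OF fuchsian' xdd])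
    then have xD: "x \<in> D" using br x by (auto simp: D_def)
    have gG: "g \<in> \<Gamma>" using st[of x] xD by (simp add: g_def D_def)
    note gc = \<Gamma>.mem_carrier[OF gG]
    have gx: "g x = x" by (simp add: g_def hyp_rotation_center[OF xdd])
    have dg: "deriv g x = \<zeta>" by (simp add: g_def \<zeta>_def deriv_hyp_rotation[OF xdd])
    obtain c where c: "\<And>z. z \<in> disc \<Longrightarrow> f (g z) * deriv g z = c * f z" using char[OF gG] by blast
    have Nx: "int (N x) = int p - 1 - int (e x)"
      using XA[OF x] x_of[OF x xx] e[OF x] by (simp add: N_def of_nat_diff)
    have ordf: "has_ord f x (int (N x))" by (rule f(3)) (use xD xdd in blast)
    have ne: "eventually (\<lambda>w. g w \<noteq> x) (at x)"
      by (rule eventually_mono[OF DA_eventually_neq[OF gc xdd]]) (simp add: gx)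
    have "((\<lambda>w. f (g w) / f w) \<longlongrightarrow> deriv g x powi int (N x)) (at x)"
      by (rule has_ord_compose_ratio[OF ordf DA_has_field_derivative(1)[OF gc xdd] gx DA_has_field_derivative(2)[OF gc xdd] ne])
    moreover have "(deriv g \<longlongrightarrow> \<zeta>) (at x)"
      using holo_isCont[OF DA_deriv_holo[OF gc] xdd] dg by (simp add: isCont_def)
    ultimately have "((\<lambda>w. f (g w) / f w * deriv g w) \<longlongrightarrow> \<zeta> powi int (N x) * \<zeta>) (at x)"
      unfolding dg by (rule tendsto_mult)
    moreover have "((\<lambda>w. f (g w) / f w * deriv g w) \<longlongrightarrow> c) (at x)"
    proof (rule tendsto_eventually)
      show "eventually (\<lambda>w. f (g w) / f w * deriv g w = c) (at x)"
        using has_ord_nonzero[OF ordf] eventually_at_in_open'[OF open_ball xdd]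
      proof eventually_elim
        fix w assume w: "f w \<noteq> 0" "w \<in> disc"
        have "f (g w) / f w * deriv g w = (f (g w) * deriv g w) / f w" by simp
        then show "f (g w) / f w * deriv g w = c" using c[OF w(2)] w(1) by simp
      qed
    qed
    ultimately have "c = \<zeta> powi int (N x) * \<zeta>" using tendsto_unique[of "at x"] by simp
    also have "\<dots> = \<zeta> powi (int (N x) + 1)" by (simp add: power_int_add \<zeta>_def)
    also have "\<dots> = \<zeta> powi (- int (e x))" unfolding \<zeta>_def cis_powi_eq_iff[OF p] Nx by simp
    finally show ?thesis using c[OF z] by (simp add: g_def \<zeta>_def)
  qed
  show thesis
  proof (rule that[OF f(1) _ rot])
    fix z assume z: "z \<in> disc"
    show "f z = 0 \<longleftrightarrow> (z \<in> orb \<Gamma> A \<and> p + 1 < sum e X) \<or> (\<exists>x\<in>X. z \<in> orb \<Gamma> x \<and> e x + 1 < p)"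
    proof (cases "z \<in> D")
      case False
      then have "z \<notin> orb \<Gamma> A" "\<And>x. x \<in> X \<Longrightarrow> z \<notin> orb \<Gamma> x" using br by (auto simp: D_def)
      then show ?thesis using f_nz[of z] False z by auto
    next
      case True
      show ?thesis
      proof (cases "z \<in> orb \<Gamma> A")
        case A': True
        have "\<not> z \<in> orb \<Gamma> x" if "x \<in> X" for x
          using orbits_disjoint[of A x z] A' that XA xd A by blast
        then show ?thesis using f_zero[OF True] A' by (auto simp: N_def)
      next
        case False
        then obtain x where x: "x \<in> X" "z \<in> orb \<Gamma> x" using True br by (auto simp: D_def)
        have "(\<exists>y\<in>X. z \<in> orb \<Gamma> y \<and> e y + 1 < p) \<longleftrightarrow> e x + 1 < p"
          using x x_of by metis
        moreover have "f z = 0 \<longleftrightarrow> e x + 1 < p"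
          using f_zero[OF True] False x_of[OF x] by (auto simp: N_def)
        ultimately show ?thesis using False by simp
      qed
    qed
  qed
qed

end

section \<open>The dihedral group\<close>

context group
begin

lemma int_pow_conj:
  assumes "s \<in> carrier G" "t \<in> carrier G"
  shows "s \<otimes> t [^] (k::int) \<otimes> inv s = (s \<otimes> t \<otimes> inv s) [^] k"
proof -
  have nat: "s \<otimes> t [^] (n::nat) \<otimes> inv s = (s \<otimes> t \<otimes> inv s) [^] n" for n
  proof (induction n)
    case 0
    then show ?case using assms by simp
  next
    case (Suc n)
    have "s \<otimes> t [^] Suc n \<otimes> inv s = (s \<otimes> t [^] n \<otimes> inv s) \<otimes> (s \<otimes> t \<otimes> inv s)"
    proof -
      have "inv s \<otimes> (s \<otimes> x) = x" if "x \<in> carrier G" for x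
        using assms that by (simp add: m_assoc[symmetric])
      then show ?thesis using assms by (simp add: m_assoc)
    qed
    then show ?case using Suc by simp
  qed
  show ?thesis
  proof (cases k rule: int_cases2)
    case (nonneg n)
    then show ?thesis using nat[of n] by (simp add: int_pow_int)
  next
    case (nonpos n)
    have "s \<otimes> inv (t [^] n) \<otimes> inv s = inv (s \<otimes> t [^] n \<otimes> inv s)"
      using assms by (simp add: inv_mult_group m_assoc)
    then show ?thesis using nonpos nat[of n] assms by (simp add: int_pow_neg_int)
  qed
qed

lemma int_pow_mod_ord: "t \<in> carrier G \<Longrightarrow> t [^] (k mod int (ord t)) = t [^] k"
  by (simp add: int_pow_eq minus_mod_eq_mult_div)

text \<open>The given relations let s move past a power of t by inverting it, which is the
  multiplication rule of \<open>dihedral_group\<close>. Injectivity comes from s not being a power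
  of t; the map is inverted at the end because it starts from the model group.\<close>

lemma dihedral_group_iso:
  assumes t: "t \<in> carrier G" and s: "s \<in> carrier G" "s \<notin> generate G {t}" "s \<otimes> s = \<one>" "s \<otimes> t \<otimes> inv s = inv t"
    and p: "ord t = p" "p > 0" and H: "H = generate G {t} \<union> (\<lambda>x. x \<otimes> s) ` generate G {t}"
  shows "G\<lparr>carrier := H\<rparr> \<cong> dihedral_group p"
proof -
  define \<phi> where "\<phi> u = (case u of (a, b) \<Rightarrow> t [^] (a::int) \<otimes> (if b then s else \<one>))" for u
  define D where "D = carrier (dihedral_group p)"
  have D: "D = {0..<int p} \<times> UNIV" by (simp add: D_def dihedral_group_def)
  have st: "s \<otimes> t [^] (a::int) = t [^] (- a) \<otimes> s" for a
  proof -
    have "s \<otimes> t [^] a \<otimes> inv s = t [^] (- a)"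
      using int_pow_conj[OF s(1) t, of a] s(4) t by (simp add: int_pow_inv int_pow_neg)
    moreover have "s \<otimes> t [^] a = (s \<otimes> t [^] a \<otimes> inv s) \<otimes> s" using s(1) t by (simp add: m_assoc)
    ultimately show ?thesis by simp
  qed
  have md: "t [^] (a mod int p) = t [^] a" for a using int_pow_mod_ord[OF t] p(1) by simp
  have gen: "t [^] (a::int) \<in> generate G {t}" for a unfolding generate_pow[OF t] by blast
  have hom: "\<phi> (u \<otimes>\<^bsub>dihedral_group p\<^esub> v) = \<phi> u \<otimes> \<phi> v" for u v
  proof -
    obtain a b c d where uv: "u = (a, b)" "v = (c, d)" by (cases u, cases v)
    have m1: "t [^] a \<otimes> s \<otimes> (t [^] c \<otimes> x) = t [^] (a - c) \<otimes> (s \<otimes> x)" if "x \<in> carrier G" for x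
    proof -
      have "t [^] a \<otimes> s \<otimes> (t [^] c \<otimes> x) = t [^] a \<otimes> (s \<otimes> t [^] c) \<otimes> x" using t s(1) that by (simp add: m_assoc)
      also have "\<dots> = (t [^] a \<otimes> t [^] (- c)) \<otimes> (s \<otimes> x)" unfolding st using t s(1) that by (simp add: m_assoc)
      also have "t [^] a \<otimes> t [^] (- c) = t [^] (a - c)" using int_pow_mult[OF t, of a "- c"] by simp
      finally show ?thesis .
    qed
    have m2: "t [^] a \<otimes> (t [^] c \<otimes> x) = t [^] (a + c) \<otimes> x" if "x \<in> carrier G" for x
      using t that by (simp add: int_pow_mult m_assoc)
    show ?thesis
      using m1[OF one_closed] m1[OF s(1)] m2[OF one_closed] m2[OF s(1)] t s(1)
      by (cases b; cases d) (simp_all add: uv \<phi>_def dihedral_group_def md s(3))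
  qed
  have im: "\<phi> ` D = H"
  proof (intro equalityI subsetI)
    fix x assume "x \<in> \<phi> ` D"
    then obtain u where u: "x = \<phi> u" by blast
    obtain a b where "u = (a, b)" by (cases u)
    then have "x = t [^] a \<otimes> (if b then s else \<one>)" by (simp add: u \<phi>_def)
    then show "x \<in> H" using gen[of a] t by (cases b) (auto simp: H)
  next
    fix x assume "x \<in> H"
    then obtain k b where x: "x = t [^] (k::int) \<otimes> (if b then s else \<one>)"
    proof (cases "x \<in> generate G {t}")
      case True
      then obtain k where "x = t [^] (k::int)" unfolding generate_pow[OF t] by blast
      then show thesis using that[of k False] t by simp
    next
      case False
      then obtain y where "x = y \<otimes> s" "y \<in> generate G {t}" using \<open>x \<in> H\<close> H by blast
      then show thesis using that[of _ True] unfolding generate_pow[OF t] by auto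
    qed
    have "x = \<phi> (k mod int p, b)" by (simp add: \<phi>_def x md)
    moreover have "(k mod int p, b) \<in> D" using p(2) by (simp add: D)
    ultimately show "x \<in> \<phi> ` D" by blast
  qed
  have inj: "inj_on \<phi> D"
  proof (rule inj_onI)
    fix u v assume uv: "u \<in> D" "v \<in> D" "\<phi> u = \<phi> v"
    obtain a b c d where e: "u = (a, b)" "v = (c, d)" by (cases u, cases v)
    have no: "t [^] (a::int) \<otimes> s \<noteq> t [^] (c::int)" for a c
    proof
      assume h: "t [^] a \<otimes> s = t [^] c"
      have "s = inv (t [^] a) \<otimes> (t [^] a \<otimes> s)" using t s(1) by (simp add: m_assoc[symmetric])
      also have "\<dots> = t [^] (- a) \<otimes> t [^] c" unfolding h int_pow_neg[OF t] ..
      also have "\<dots> = t [^] (- a + c)" by (rule int_pow_mult[OF t, symmetric])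
      finally show False using s(2) gen by metis
    qed
    have bd: "b = d" using uv(3) no[of a c] no[of c a] t by (cases b; cases d) (auto simp: e \<phi>_def)
    then have "t [^] a = t [^] c" using uv(3) t s(1) by (cases d) (simp_all add: e \<phi>_def)
    then have "int p dvd c - a" using int_pow_eq[OF t] p(1) by simp
    then have "c mod int p = a mod int p" by (simp add: mod_eq_dvd_iff)
    then show "u = v" using uv(1,2) bd by (simp add: e D)
  qed
  have bij: "bij_betw \<phi> D H" using inj im by (simp add: bij_betw_def)
  have cl: "u \<otimes>\<^bsub>dihedral_group p\<^esub> v \<in> D" for u v
    using p(2) by (cases u; cases v) (simp add: D dihedral_group_def)
  have "inv_into D \<phi> \<in> iso (G\<lparr>carrier := H\<rparr>) (dihedral_group p)"
  proof (rule isoI)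
    show "inv_into D \<phi> \<in> hom (G\<lparr>carrier := H\<rparr>) (dihedral_group p)"
    proof (rule homI)
      show "inv_into D \<phi> x \<in> carrier (dihedral_group p)" if "x \<in> carrier (G\<lparr>carrier := H\<rparr>)" for x
        using inv_into_into[of x \<phi> D] that im by (simp add: D_def)
      fix x y assume xy: "x \<in> carrier (G\<lparr>carrier := H\<rparr>)" "y \<in> carrier (G\<lparr>carrier := H\<rparr>)"
      then obtain u v where uv: "u \<in> D" "x = \<phi> u" "v \<in> D" "y = \<phi> v" using im by auto
      then show "inv_into D \<phi> (x \<otimes>\<^bsub>G\<lparr>carrier := H\<rparr>\<^esub> y) = inv_into D \<phi> x \<otimes>\<^bsub>dihedral_group p\<^esub> inv_into D \<phi> y"
        by (simp add: hom[symmetric] inv_into_f_f[OF inj] cl)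
    qed
    show "bij_betw (inv_into D \<phi>) (carrier (G\<lparr>carrier := H\<rparr>)) (carrier (dihedral_group p))"
      using bij_betw_inv_into[OF bij] by (simp add: D_def)
  qed
  then show ?thesis by (auto simp: is_iso_def)
qed

end

section \<open>Surfaces in normal form\<close>

text \<open>Every surface in case \<open>\<kappa>\<^sub>4\<close> has this form after a cyclic relabelling of the vertices of the tile.\<close>

locale kappa4_surface = uniformization S \<pi> \<Gamma>s
  for S :: "'a surface" and \<pi> \<Gamma>s +
  fixes p :: nat and m :: int and t T :: "'a \<Rightarrow> 'a" and A B C :: complex and \<Gamma>
  assumes prime: "prime p" and odd: "odd p"
    and tri: "angle_triangle (2 * pi / real p) A B C"
    and t: "t \<in> carrier (Aut S)" and ord_t: "group.ord (Aut S) t = p"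
    and T: "T \<in> carrier (Aut S)" "generate (Aut S) {T} = generate (Aut S) {t}"
    and sphere: "biholomorphic (quotient_surface S (generate (Aut S) {t})) riemann_sphere"
    and m: "2 \<le> m" "m \<le> int p - 2" "\<not> int p dvd m\<^sup>2 + 1"
    and covA: "covers (hyp_rotation A (2 * pi / real p)) t"
    and covB: "covers (hyp_rotation B (2 * pi / real p)) (t [^]\<^bsub>Aut S\<^esub> (-1::int))"
    and covC: "covers (hyp_rotation C (2 * pi / real p)) (t [^]\<^bsub>Aut S\<^esub> m)"
    and \<Gamma>_def: "\<Gamma> = vertex_group (2 * pi / real p) A B C" and \<Gamma>s_\<Gamma>: "\<Gamma>s \<subseteq> \<Gamma>"
    and \<Gamma>_fuchsian: "fuchsian_group \<Gamma>" and signature: "has_signature_0 \<Gamma> 4 p"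
begin

abbreviation rot :: "complex \<Rightarrow> complex \<Rightarrow> complex" where
  "rot a \<equiv> hyp_rotation a (2 * pi / real p)"

abbreviation tpow :: "int \<Rightarrow> 'a \<Rightarrow> 'a" where
  "tpow n \<equiv> t [^]\<^bsub>Aut S\<^esub> n"

sublocale \<Gamma>: subgroup \<Gamma> DA by (rule fuchsian_group_subgroup[OF \<Gamma>_fuchsian])

lemma p_pos: "p > 0" using prime prime_gt_0_nat by blast

lemma p_gt_2: "p > 2"
  using prime odd prime_ge_2_nat[OF prime] by (cases "p = 2") auto

lemma prime_int: "prime (int p)" using prime by simp

lemmas disc_ABC = angle_triangleD(1-3)[OF tri]

lemma tpow_carrier: "tpow n \<in> carrier (Aut S)" using t by simp

lemma tpow_mult: "tpow n \<otimes>\<^bsub>Aut S\<^esub> tpow l = tpow (n + l)"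
  using A.int_pow_mult[OF t] by simp

lemma tpow_inv: "inv\<^bsub>Aut S\<^esub> tpow n = tpow (- n)"
  using A.int_pow_neg[OF t] by simp

lemma tpow_eq: "tpow n = tpow l \<longleftrightarrow> int p dvd n - l"
  using A.int_pow_eq[OF t, of l n] ord_t by auto

lemma gen_tpow: "generate (Aut S) {t} = range tpow"
  using A.generate_pow[OF t] by auto

lemma covers_tpow_mult: "covers F (tpow n) \<Longrightarrow> covers H (tpow l) \<Longrightarrow> covers (F \<otimes>\<^bsub>DA\<^esub> H) (tpow (n + l))"
  using covers_mult[of F "tpow n" H "tpow l"] by (simp add: tpow_mult)

lemma covers_tpow_inv: "covers F (tpow n) \<Longrightarrow> covers (inv\<^bsub>DA\<^esub> F) (tpow (- n))"
  using covers_inv[of F "tpow n"] by (simp add: tpow_inv)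

lemma covers_tpow_unique: "covers F (tpow n) \<Longrightarrow> covers F (tpow l) \<Longrightarrow> int p dvd n - l"
  using covers_unique tpow_eq by blast

lemma vertex_group_generators: "\<Gamma> = generate DA {rot A, rot B, rot C}"
  by (simp add: \<Gamma>_def vertex_group_def)

lemma rot_mem: "rot A \<in> \<Gamma>" "rot B \<in> \<Gamma>" "rot C \<in> \<Gamma>"
  unfolding vertex_group_generators by (auto intro: generate.incl)

lemma rot_covers: "covers (rot A) (tpow 1)" "covers (rot B) (tpow (-1))" "covers (rot C) (tpow m)"
  using covA covB covC t by simp_all

text \<open>The generators lift t, its inverse and its m-th power. Conversely a lift of a power of t
  differs from a power of the rotation at A by an element of \<open>\<Gamma>s\<close>.\<close>

lemma \<Gamma>_iff: "g \<in> \<Gamma> \<longleftrightarrow> (\<exists>n. covers g (tpow n))"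
proof
  assume "g \<in> \<Gamma>"
  then have "g \<in> generate DA {rot A, rot B, rot C}" by (simp add: vertex_group_generators)
  then show "\<exists>n. covers g (tpow n)"
  proof (induction rule: generate.induct)
    case one
    have "covers \<one>\<^bsub>DA\<^esub> (tpow 0)" using covers_one[OF \<Gamma>s.one_closed] by simp
    then show ?case by blast
  next
    case (incl h)
    then show ?case using rot_covers by blast
  next
    case (inv h)
    then show ?case using rot_covers covers_tpow_inv by blast
  next
    case (eng h1 h2)
    then show ?case using covers_tpow_mult by blast
  qed
next
  assume "\<exists>n. covers g (tpow n)"
  then obtain n where n: "covers g (tpow n)" by blast
  have pw: "covers (rot A [^]\<^bsub>DA\<^esub> k) (tpow (int k))" for k :: nat
  proof (induction k)
    case 0
    have "covers \<one>\<^bsub>DA\<^esub> (tpow 0)" using covers_one[OF \<Gamma>s.one_closed] by simp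
    then show ?case by simp
  next
    case (Suc k)
    then show ?case using covers_tpow_mult[OF Suc rot_covers(1)] by (simp add: add.commute)
  qed
  define k where "k = nat (n mod int p)"
  have "tpow (int k) = tpow n" unfolding tpow_eq using p_pos by (simp add: k_def minus_mod_eq_mult_div[symmetric] mod_eq_dvd_iff[symmetric])
  then have "covers (rot A [^]\<^bsub>DA\<^esub> k) (tpow n)" using pw[of k] by simp
  then obtain h where h: "h \<in> \<Gamma>s" "g = h \<otimes>\<^bsub>DA\<^esub> (rot A [^]\<^bsub>DA\<^esub> k)" by (rule covers_same[OF n])
  have "rot A [^]\<^bsub>DA\<^esub> k \<in> \<Gamma>"
    by (induction k) (use rot_mem in auto)
  then show "g \<in> \<Gamma>" using h \<Gamma>s_\<Gamma> by blast
qed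

lemma \<Gamma>s_iff: "covers g (tpow n) \<Longrightarrow> g \<in> \<Gamma>s \<longleftrightarrow> int p dvd n"
proof
  assume g: "covers g (tpow n)"
  show "int p dvd n" if "g \<in> \<Gamma>s"
    using covers_unique[OF g covers_one[OF that]] tpow_eq[of n 0] by simp
  show "g \<in> \<Gamma>s" if "int p dvd n"
    using covers_one_imp[of g] g tpow_eq[of n 0] that by simp
qed

section \<open>The four branch orbits\<close>

definition \<sigma> :: "complex \<Rightarrow> complex" where
  "\<sigma> = (SOME c. c \<in> carrier DA \<and> c A = B \<and> c B = A)"

lemma \<sigma>: "\<sigma> \<in> carrier DA" "\<sigma> A = B" "\<sigma> B = A"
proof -
  obtain c where "c \<in> carrier DA \<and> c A = B \<and> c B = A" using swap_exists[OF disc_ABC(1,2)] by metis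
  then have "\<sigma> \<in> carrier DA \<and> \<sigma> A = B \<and> \<sigma> B = A"
    unfolding \<sigma>_def by (rule someI[of "\<lambda>c. c \<in> carrier DA \<and> c A = B \<and> c B = A"])
  then show "\<sigma> \<in> carrier DA" "\<sigma> A = B" "\<sigma> B = A" by auto
qed

lemma \<sigma>_invol: "\<sigma> \<otimes>\<^bsub>DA\<^esub> \<sigma> = \<one>\<^bsub>DA\<^esub>"
  by (rule swap_involution[OF \<sigma>(1) disc_ABC(1,2) angle_triangle_distinct(1)[OF tri] \<sigma>(2,3)])

lemma \<sigma>_inv: "inv\<^bsub>DA\<^esub> \<sigma> = \<sigma>"
  by (rule DA.inv_equality[OF \<sigma>_invol \<sigma>(1) \<sigma>(1)])

definition D :: complex where "D = \<sigma> C"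

lemma disc_D: "D \<in> disc" unfolding D_def by (rule DA_closed[OF \<sigma>(1) disc_ABC(3)])

text \<open>By \<open>swap_conj_third\<close> this rotation is the inverse of a product with
  exponents -1, m and 1.\<close>

lemma rot_D_covers: "covers (rot D) (tpow (- m))"
proof -
  have "covers (rot B \<otimes>\<^bsub>DA\<^esub> rot C \<otimes>\<^bsub>DA\<^esub> rot A) (tpow (- 1 + m + 1))"
    by (intro covers_tpow_mult rot_covers)
  from covers_tpow_inv[OF this] show ?thesis
    using swap_conj_third[OF tri \<sigma>] by (simp add: D_def)
qed

text \<open>Each vertex is paired with the exponent of the power of t that the rotation there
  induces.\<close>

definition Vs :: "(complex \<times> int) set" where
  "Vs = {(A, 1), (B, -1), (C, m), (D, - m)}"

lemma Vs_rot: "(V, n) \<in> Vs \<Longrightarrow> V \<in> disc \<and> covers (rot V) (tpow n)"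
  using disc_ABC disc_D rot_covers rot_D_covers by (auto simp: Vs_def)

lemma rot_neq_one: "V \<in> disc \<Longrightarrow> rot V \<noteq> \<one>\<^bsub>DA\<^esub>"
  using hyp_rotation_eq_one_iff[of V "2 * pi / real p"] cis_powi_eq_one[OF p_pos, of 1] p_gt_2 by auto

lemma small_dvd: "int p dvd n \<Longrightarrow> - int p < n \<Longrightarrow> n < int p \<Longrightarrow> n = 0"
  using zdvd_imp_le[of "int p" n] zdvd_imp_le[of "int p" "- n"] by (cases n "0::int" rule: linorder_cases) auto

text \<open>The range of m and the oddness of p make 1, -1, m, -m pairwise incongruent, so an
  exponent modulo p identifies its vertex.\<close>

lemma Vs_inj:
  assumes "(V, n) \<in> Vs" "(W, l) \<in> Vs" "int p dvd n - l"
  shows "V = W" "n = l"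
proof -
  have 1: "\<not> int p dvd 2" "\<not> int p dvd -2" "\<not> int p dvd m - 1" "\<not> int p dvd 1 - m" "\<not> int p dvd m + 1"
    "\<not> int p dvd 1 + m" "\<not> int p dvd - 1 - m" "\<not> int p dvd - m - 1"
    using small_dvd[of 2] small_dvd[of "-2"] small_dvd[of "m - 1"] small_dvd[of "1 - m"] small_dvd[of "m + 1"]
      small_dvd[of "1 + m"] small_dvd[of "- 1 - m"] small_dvd[of "- m - 1"] m(1,2) p_gt_2 by auto
  have nm: "\<not> int p dvd m" using small_dvd[of m] m(1,2) by auto
  have "\<not> int p dvd 2 * m" using prime_dvd_mult_iff[OF prime_int] 1(1) nm by blast
  then have 2: "\<not> int p dvd m - (- m)" "\<not> int p dvd - m - m" by (simp, metis dvd_minus_iff minus_add_distrib mult_2 diff_conv_add_uminus)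
  show "V = W" "n = l" using assms 1 2 by (auto simp: Vs_def)
qed

text \<open>Conjugation by an element of \<open>\<Gamma>\<close> does not change the exponent, as
  powers of t commute; the exponent is thus an invariant of the orbit.\<close>

lemma rot_orb:
  assumes V: "(V, n) \<in> Vs" and z: "z \<in> orb \<Gamma> V"
  shows "covers (rot z) (tpow n)"
proof -
  obtain g where g: "g \<in> \<Gamma>" "z = g V" using z unfolding mem_orb by blast
  obtain l where l: "covers g (tpow l)" using g(1) \<Gamma>_iff by blast
  have "rot z = g \<otimes>\<^bsub>DA\<^esub> rot V \<otimes>\<^bsub>DA\<^esub> inv\<^bsub>DA\<^esub> g"
    using hyp_rotation_conj[OF \<Gamma>.mem_carrier[OF g(1)]] Vs_rot[OF V] g(2) by simp
  moreover have "covers (g \<otimes>\<^bsub>DA\<^esub> rot V \<otimes>\<^bsub>DA\<^esub> inv\<^bsub>DA\<^esub> g) (tpow (l + n + (- l)))"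
    using Vs_rot[OF V] by (intro covers_tpow_mult covers_tpow_inv l) auto
  ultimately show ?thesis by simp
qed

lemma Vs_orb_unique:
  assumes "(V, n) \<in> Vs" "(W, l) \<in> Vs" "z \<in> orb \<Gamma> V" "z \<in> orb \<Gamma> W"
  shows "V = W"
  by (rule Vs_inj(1)[OF assms(1,2) covers_tpow_unique[OF rot_orb[OF assms(1,3)] rot_orb[OF assms(2,4)]]])

lemma orb_self: "z \<in> disc \<Longrightarrow> z \<in> orb \<Gamma> z"
  by (rule fuchsian_orb_refl[OF \<Gamma>_fuchsian])

lemma orb_disc: "V \<in> disc \<Longrightarrow> z \<in> orb \<Gamma> V \<Longrightarrow> z \<in> disc"
  using fuchsian_orb_subset[OF \<Gamma>_fuchsian] by blast

lemma branch_rot: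
  assumes "z \<in> disc" "rot z \<in> \<Gamma>"
  shows "z \<in> branch_points \<Gamma>"
proof -
  have "rot z \<in> stab \<Gamma> z" using assms hyp_rotation_center by (simp add: stab_def)
  then show ?thesis using rot_neq_one[OF assms(1)] assms(1) by (auto simp: branch_points_def)
qed

lemma orb_branch:
  assumes "(V, n) \<in> Vs" "z \<in> orb \<Gamma> V"
  shows "z \<in> branch_points \<Gamma>"
  using branch_rot[of z] rot_orb[OF assms] orb_disc[of V z] Vs_rot[OF assms(1)] assms(2) \<Gamma>_iff by blast

lemma stab_eq: "point_stabilizer \<Gamma> z = stab \<Gamma> z"
  by (simp add: point_stabilizer_def stab_def)

text \<open>The signature provides exactly four orbits of points with nontrivial stabilizer, and
  four inequivalent ones are known.\<close>

lemma branch_orb: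
  assumes z: "z \<in> branch_points \<Gamma>"
  obtains V n where "(V, n) \<in> Vs" "z \<in> orb \<Gamma> V"
proof -
  define O' where "O' = {orb \<Gamma> z | z. z \<in> disc \<and> point_stabilizer \<Gamma> z \<noteq> {\<one>\<^bsub>DA\<^esub>}}"
  have O': "O' = orb \<Gamma> ` branch_points \<Gamma>" by (auto simp: O'_def branch_points_def stab_eq)
  have fin: "finite O'" "card O' = 4" using signature by (simp_all add: has_signature_0_def O'_def)
  have sub: "orb \<Gamma> ` fst ` Vs \<subseteq> O'"
  proof
    fix X assume "X \<in> orb \<Gamma> ` fst ` Vs"
    then obtain V n where V: "(V, n) \<in> Vs" "X = orb \<Gamma> V" by auto
    then have "V \<in> branch_points \<Gamma>" using orb_branch[OF V(1) orb_self] Vs_rot by blast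
    then show "X \<in> O'" using V(2) O' by blast
  qed
  have "inj_on (orb \<Gamma>) (fst ` Vs)"
  proof (rule inj_onI)
    fix V W assume "V \<in> fst ` Vs" "W \<in> fst ` Vs" and eq: "orb \<Gamma> V = orb \<Gamma> W"
    then obtain n l where VW: "(V, n) \<in> Vs" "(W, l) \<in> Vs" by auto
    then have "V \<in> orb \<Gamma> V" using Vs_rot orb_self by blast
    then show "V = W" using Vs_orb_unique[OF VW] eq by simp
  qed
  then have "card (orb \<Gamma> ` fst ` Vs) = card (fst ` Vs)" by (rule card_image)
  also have "\<dots> = 4"
  proof -
    have d: "V \<noteq> W" if "(V, n) \<in> Vs" "(W, l) \<in> Vs" "n \<noteq> l" for V W n l
    proof
      assume "V = W"
      then have "int p dvd n - l" using that Vs_rot covers_tpow_unique by blast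
      then show False using Vs_inj(2)[OF that(1,2)] that(3) by blast
    qed
    have v: "(A, 1) \<in> Vs" "(B, -1) \<in> Vs" "(C, m) \<in> Vs" "(D, - m) \<in> Vs" by (simp_all add: Vs_def)
    have "A \<noteq> B" by (rule d[OF v(1,2)]) simp
    moreover have "A \<noteq> C" by (rule d[OF v(1,3)]) (use m(1) in simp)
    moreover have "A \<noteq> D" by (rule d[OF v(1,4)]) (use m(1) in simp)
    moreover have "B \<noteq> C" by (rule d[OF v(2,3)]) (use m(1) in simp)
    moreover have "B \<noteq> D" by (rule d[OF v(2,4)]) (use m(1) in simp)
    moreover have "C \<noteq> D" by (rule d[OF v(3,4)]) (use m(1) in simp)
    moreover have "fst ` Vs = {A, B, C, D}" by (simp add: Vs_def)
    ultimately show ?thesis by simp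
  qed
  finally have "card (orb \<Gamma> ` fst ` Vs) = card O'" using fin(2) by simp
  then have "orb \<Gamma> ` fst ` Vs = O'" by (rule card_subset_eq[OF fin(1) sub])
  moreover have "orb \<Gamma> z \<in> O'" unfolding O' using z by (rule imageI)
  ultimately have "orb \<Gamma> z \<in> orb \<Gamma> ` fst ` Vs" by simp
  then obtain v where v: "v \<in> Vs" "orb \<Gamma> z = orb \<Gamma> (fst v)" by blast
  have "z \<in> orb \<Gamma> z" using orb_self[of z] z by (simp add: branch_points_def)
  then have "z \<in> orb \<Gamma> (fst v)" unfolding v(2) .
  then show thesis using that[of "fst v" "snd v"] v(1) by simp
qed

lemma branch_card: "z \<in> branch_points \<Gamma> \<Longrightarrow> card (stab \<Gamma> z) = p"
  using signature by (auto simp: has_signature_0_def branch_points_def stab_eq)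

lemma branch_iff: "z \<in> branch_points \<Gamma> \<longleftrightarrow> z \<in> disc \<and> rot z \<in> \<Gamma>"
proof
  assume z: "z \<in> branch_points \<Gamma>"
  then obtain V n where "(V, n) \<in> Vs" "z \<in> orb \<Gamma> V" by (rule branch_orb)
  then have "covers (rot z) (tpow n)" by (rule rot_orb)
  then have "rot z \<in> \<Gamma>" using \<Gamma>_iff by blast
  then show "z \<in> disc \<and> rot z \<in> \<Gamma>" using z by (simp add: branch_points_def)
qed (use branch_rot in blast)

text \<open>T and t generate the same group, hence have the same fixed points. At a fixed point of t
  some lift of t fixes z; conversely the rotation at a branch point induces a power of t with
  exponent prime to p, of which t is again a power.\<close>

lemma branch_fix:
  assumes z: "z \<in> disc"
  shows "\<pi> z \<in> Fix S T \<longleftrightarrow> z \<in> branch_points \<Gamma>"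
proof -
  have pz: "\<pi> z \<in> points S" by (rule \<pi>_points[OF z])
  have pow_fix: "f [^]\<^bsub>Aut S\<^esub> k \<in> carrier (Aut S) \<and> (f [^]\<^bsub>Aut S\<^esub> k) (\<pi> z) = \<pi> z"
    if f: "f \<in> carrier (Aut S)" "f (\<pi> z) = \<pi> z" for f and k :: int
  proof -
    have nat: "(f [^]\<^bsub>Aut S\<^esub> k) (\<pi> z) = \<pi> z" for k :: nat
    proof (induction k)
      case 0
      then show ?case using pz by (simp add: one_Aut)
    next
      case (Suc k)
      then show ?case using f pz by (simp add: Aut_mult_apply)
    qed
    show ?thesis
    proof (cases k rule: int_cases2)
      case (nonneg n)
      then show ?thesis using nat[of n] f(1) by (simp add: int_pow_int)
    next
      case (nonpos n)
      have "(inv\<^bsub>Aut S\<^esub> (f [^]\<^bsub>Aut S\<^esub> n)) ((f [^]\<^bsub>Aut S\<^esub> n) (\<pi> z)) = \<pi> z"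
        by (rule Aut_inv_apply(1)[OF surface _ pz]) (use f(1) in simp)
      then show ?thesis using nonpos nat[of n] f(1) by (simp add: A.int_pow_neg_int)
    qed
  qed
  have "T \<in> generate (Aut S) {t}" using T(2) generate.incl[of T "{T}" "Aut S"] by simp
  then obtain k where k: "T = tpow k" using gen_tpow by auto
  have "t \<in> generate (Aut S) {T}" using T(2) generate.incl[of t "{t}" "Aut S"] by simp
  then obtain l where l: "t = T [^]\<^bsub>Aut S\<^esub> (l::int)" using A.generate_pow[OF T(1)] by auto
  have "T (\<pi> z) = \<pi> z" if "t (\<pi> z) = \<pi> z" unfolding k using pow_fix[OF t that] by blast
  moreover have "t (\<pi> z) = \<pi> z" if "T (\<pi> z) = \<pi> z" by (subst l) (use pow_fix[OF T(1) that] in blast)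
  ultimately have Tt: "\<pi> z \<in> Fix S T \<longleftrightarrow> t (\<pi> z) = \<pi> z"
    using pz by (auto simp: Fix_def)
  show ?thesis unfolding Tt
  proof
    assume "t (\<pi> z) = \<pi> z"
    then have "\<pi> (rot A z) = \<pi> z" using coversD(3)[OF covA z] by simp
    then obtain g where g: "g \<in> \<Gamma>s" "z = g (rot A z)"
      using \<pi>_eq_iff[OF DA_closed[OF coversD(1)[OF covA] z] z] by metis
    have "covers (g \<otimes>\<^bsub>DA\<^esub> rot A) (tpow (0 + 1))"
      by (rule covers_tpow_mult[OF _ rot_covers(1)]) (use covers_one[OF g(1)] in simp)
    then have c: "covers (g \<otimes>\<^bsub>DA\<^esub> rot A) (tpow 1)" by simp
    have "\<not> int p dvd 1" using p_gt_2 by simp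
    then have "g \<otimes>\<^bsub>DA\<^esub> rot A \<noteq> \<one>\<^bsub>DA\<^esub>" using \<Gamma>s_iff[OF c] \<Gamma>s.one_closed by metis
    moreover have "g \<otimes>\<^bsub>DA\<^esub> rot A \<in> stab \<Gamma> z"
      using g c \<Gamma>_iff z \<Gamma>s_DA[OF g(1)] coversD(1)[OF covA] by (auto simp: stab_def DA_mult)
    ultimately show "z \<in> branch_points \<Gamma>" using z by (auto simp: branch_points_def)
  next
    assume "z \<in> branch_points \<Gamma>"
    then obtain V n where V: "(V, n) \<in> Vs" "z \<in> orb \<Gamma> V" by (rule branch_orb)
    have c: "covers (rot z) (tpow n)" by (rule rot_orb[OF V])
    have fx: "tpow n (\<pi> z) = \<pi> z" using coversD(3)[OF c z] hyp_rotation_center[OF z] by simp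
    have "n = 1 \<or> n = -1 \<or> n = m \<or> n = -m" using V(1) by (auto simp: Vs_def)
    then have "\<not> int p dvd n" using small_dvd[of n] m(1,2) p_gt_2 by auto
    then have "coprime (int p) n" using prime_int by (simp add: prime_imp_coprime)
    then obtain l where l: "[n * l = 1] (mod int p)" using cong_solve_coprime_int[of n "int p"] by (auto simp: coprime_commute)
    have "tpow n [^]\<^bsub>Aut S\<^esub> l = t"
      using tpow_eq[of "n * l" 1] l t by (simp add: A.int_pow_pow cong_iff_dvd_diff)
    then show "t (\<pi> z) = \<pi> z" using pow_fix[OF tpow_carrier fx, of l] by simp
  qed
qed

end

context kappa4_surface
begin

section \<open>Automorphisms preserving the fixed points\<close>

text \<open>The lifts of the group generated by t are exactly \<open>\<Gamma>\<close>. The pole is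
  placed at A to study automorphisms and at D to construct forms.\<close>

lemma hauptmodul_\<Gamma>:
  assumes "V \<in> disc"
  obtains \<tau> where "hauptmodul \<Gamma> V \<tau>"
proof -
  interpret Q: sphere_quotient S \<pi> \<Gamma>s "generate (Aut S) {t}"
  proof (rule sphere_quotient.intro)
    show "uniformization S \<pi> \<Gamma>s" by unfold_locales
    show "sphere_quotient_axioms S (generate (Aut S) {t})"
    proof (rule sphere_quotient_axioms.intro)
      show "subgroup (generate (Aut S) {t}) (Aut S)" by (rule A.generate_is_subgroup) (use t in simp)
      show "finite (generate (Aut S) {t})"
        using A.generate_pow_card[OF t] ord_t p_pos by (intro card_ge_0_finite) simp
    qed (rule sphere)
  qed
  have "Q.\<Gamma>G = \<Gamma>" unfolding Q.\<Gamma>G_def using \<Gamma>_iff gen_tpow by auto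
  then show thesis using Q.hauptmodul_exists[OF assms] that by metis
qed

lemma conj_tpow:
  assumes "f \<in> carrier (Aut S)" "f \<otimes>\<^bsub>Aut S\<^esub> t \<otimes>\<^bsub>Aut S\<^esub> inv\<^bsub>Aut S\<^esub> f = tpow l"
  shows "f \<otimes>\<^bsub>Aut S\<^esub> tpow n \<otimes>\<^bsub>Aut S\<^esub> inv\<^bsub>Aut S\<^esub> f = tpow (l * n)"
  using A.int_pow_conj[OF assms(1) t, of n] assms(2) A.int_pow_pow[OF t] by simp

lemma rot_lift:
  assumes F: "covers F f" and V: "(V, n) \<in> Vs"
  shows "covers (rot (F V)) (f \<otimes>\<^bsub>Aut S\<^esub> tpow n \<otimes>\<^bsub>Aut S\<^esub> inv\<^bsub>Aut S\<^esub> f)"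
proof -
  have "rot (F V) = F \<otimes>\<^bsub>DA\<^esub> rot V \<otimes>\<^bsub>DA\<^esub> inv\<^bsub>DA\<^esub> F"
    using hyp_rotation_conj[OF coversD(1)[OF F]] Vs_rot[OF V] by simp
  moreover have "covers (F \<otimes>\<^bsub>DA\<^esub> rot V \<otimes>\<^bsub>DA\<^esub> inv\<^bsub>DA\<^esub> F) (f \<otimes>\<^bsub>Aut S\<^esub> tpow n \<otimes>\<^bsub>Aut S\<^esub> inv\<^bsub>Aut S\<^esub> f)"
    by (intro covers_mult covers_inv F) (use Vs_rot[OF V] in blast)
  ultimately show ?thesis by simp
qed

lemma conj_exponent:
  assumes F: "covers F f" and V: "(V, n) \<in> Vs" and br: "F V \<in> branch_points \<Gamma>"
  obtains W l where "(W, l) \<in> Vs" "F V \<in> orb \<Gamma> W" "f \<otimes>\<^bsub>Aut S\<^esub> tpow n \<otimes>\<^bsub>Aut S\<^esub> inv\<^bsub>Aut S\<^esub> f = tpow l"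
proof -
  obtain W l where W: "(W, l) \<in> Vs" "F V \<in> orb \<Gamma> W" by (rule branch_orb[OF br])
  show thesis by (rule that[OF W covers_unique[OF rot_lift[OF F V] rot_orb[OF W]]])
qed

text \<open>Commuting with t, the automorphism preserves exponents, and these tell the branch orbits
  apart; so F fixes every branch orbit, and those of A, B, C are fed to
  \<open>normalizer_fixing_orbits\<close>.\<close>

lemma centralizer:
  assumes F: "covers F f" and c: "f \<otimes>\<^bsub>Aut S\<^esub> t \<otimes>\<^bsub>Aut S\<^esub> inv\<^bsub>Aut S\<^esub> f = t"
    and br: "\<And>V n. (V, n) \<in> Vs \<Longrightarrow> F V \<in> branch_points \<Gamma>"
  shows "f \<in> generate (Aut S) {t}"
proof -
  have fc: "f \<in> carrier (Aut S)" and Fc: "F \<in> carrier DA" using coversD[OF F] by auto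
  have comm: "f \<otimes>\<^bsub>Aut S\<^esub> tpow n \<otimes>\<^bsub>Aut S\<^esub> inv\<^bsub>Aut S\<^esub> f = tpow n" for n
    using conj_tpow[OF fc, of 1 n] c t by simp
  have fix_orb: "F V \<in> orb \<Gamma> V" if V: "(V, n) \<in> Vs" for V n
  proof -
    obtain W l where W: "(W, l) \<in> Vs" "F V \<in> orb \<Gamma> W" "f \<otimes>\<^bsub>Aut S\<^esub> tpow n \<otimes>\<^bsub>Aut S\<^esub> inv\<^bsub>Aut S\<^esub> f = tpow l"
      by (rule conj_exponent[OF F V br[OF V]])
    then have "int p dvd n - l" using comm[of n] tpow_eq by simp
    then have "V = W" by (rule Vs_inj(1)[OF V W(1)])
    then show ?thesis using W(2) by simp
  qed
  have n1: "F \<otimes>\<^bsub>DA\<^esub> g \<otimes>\<^bsub>DA\<^esub> inv\<^bsub>DA\<^esub> F \<in> \<Gamma>" if g: "g \<in> \<Gamma>" for g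
  proof -
    obtain n where n: "covers g (tpow n)" using g \<Gamma>_iff by blast
    have "covers (F \<otimes>\<^bsub>DA\<^esub> g \<otimes>\<^bsub>DA\<^esub> inv\<^bsub>DA\<^esub> F) (f \<otimes>\<^bsub>Aut S\<^esub> tpow n \<otimes>\<^bsub>Aut S\<^esub> inv\<^bsub>Aut S\<^esub> f)"
      by (intro covers_mult covers_inv F n)
    then show ?thesis unfolding comm \<Gamma>_iff by blast
  qed
  have n2: "inv\<^bsub>DA\<^esub> F \<otimes>\<^bsub>DA\<^esub> g \<otimes>\<^bsub>DA\<^esub> F \<in> \<Gamma>" if g: "g \<in> \<Gamma>" for g
  proof -
    obtain n where n: "covers g (tpow n)" using g \<Gamma>_iff by blast
    have "f \<otimes>\<^bsub>Aut S\<^esub> tpow n = tpow n \<otimes>\<^bsub>Aut S\<^esub> f"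
      using comm[of n] fc tpow_carrier[of n] by (metis A.inv_solve_right' A.m_closed)
    then have "inv\<^bsub>Aut S\<^esub> f \<otimes>\<^bsub>Aut S\<^esub> tpow n \<otimes>\<^bsub>Aut S\<^esub> f = tpow n"
      using fc tpow_carrier[of n] by (metis A.inv_closed A.inv_solve_left A.m_assoc A.m_closed)
    moreover have "covers (inv\<^bsub>DA\<^esub> F \<otimes>\<^bsub>DA\<^esub> g \<otimes>\<^bsub>DA\<^esub> F) (inv\<^bsub>Aut S\<^esub> f \<otimes>\<^bsub>Aut S\<^esub> tpow n \<otimes>\<^bsub>Aut S\<^esub> f)"
      by (intro covers_mult covers_inv F n)
    ultimately show ?thesis using \<Gamma>_iff by auto
  qed
  obtain \<tau> where \<tau>: "hauptmodul \<Gamma> A \<tau>" by (rule hauptmodul_\<Gamma>[OF disc_ABC(1)])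
  have v: "(A, 1) \<in> Vs" "(B, -1) \<in> Vs" "(C, m) \<in> Vs" by (simp_all add: Vs_def)
  have d: "W \<notin> orb \<Gamma> V" if "(V, n) \<in> Vs" "(W, l) \<in> Vs" "V \<noteq> W" for V W n l
    using Vs_orb_unique[OF that(1,2), of W] orb_self[of W] Vs_rot[OF that(2)] that(3) by blast
  have "F \<in> \<Gamma>"
    by (rule normalizer_fixing_orbits[OF \<tau> \<Gamma>s_\<Gamma> Fc n1 n2 disc_ABC(2,3)
          fix_orb[OF v(1)] fix_orb[OF v(2)] fix_orb[OF v(3)] d[OF v(1,2)] d[OF v(1,3)] d[OF v(2,3)]])
      (use angle_triangle_distinct[OF tri] in auto)
  then obtain n where "covers F (tpow n)" using \<Gamma>_iff by blast
  then have "f = tpow n" by (rule covers_unique[OF F])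
  then show ?thesis unfolding gen_tpow by blast
qed

lemma Aut'_carrier: "f \<in> carrier (Aut' S T) \<longleftrightarrow> f \<in> carrier (Aut S) \<and> f ` Fix S T = Fix S T"
  by (simp add: Aut'_def)

lemma Fix_points: "Fix S T \<subseteq> points S"
  by (auto simp: Fix_def)

lemma Aut'_mult:
  assumes "f \<in> carrier (Aut' S T)" "g \<in> carrier (Aut' S T)"
  shows "f \<otimes>\<^bsub>Aut S\<^esub> g \<in> carrier (Aut' S T)"
proof -
  have c: "f \<in> carrier (Aut S)" "g \<in> carrier (Aut S)" using assms Aut'_carrier by auto
  have "(f \<otimes>\<^bsub>Aut S\<^esub> g) ` Fix S T = (\<lambda>x. f (g x)) ` Fix S T"
    by (rule image_cong) (use Fix_points Aut_mult_apply[OF c] in auto)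
  also have "\<dots> = f ` g ` Fix S T" by (simp add: image_image)
  finally show ?thesis using assms c unfolding Aut'_carrier by simp
qed

text \<open>The fixed points of T are the images of the branch points, so the condition defining
  \<open>Aut'\<close> can be tested on a lift.\<close>

lemma Aut'_branch:
  assumes F: "covers F f"
  shows "f \<in> carrier (Aut' S T) \<longleftrightarrow> (\<forall>z\<in>disc. F z \<in> branch_points \<Gamma> \<longleftrightarrow> z \<in> branch_points \<Gamma>)"
proof -
  note c = coversD[OF F]
  have mem: "F z \<in> branch_points \<Gamma> \<longleftrightarrow> f (\<pi> z) \<in> Fix S T" if z: "z \<in> disc" for z
    using branch_fix[OF DA_closed[OF c(1) z]] c(3)[OF z] by simp
  show ?thesis
  proof
    assume f: "f \<in> carrier (Aut' S T)"
    then have im: "f ` Fix S T = Fix S T" by (simp add: Aut'_carrier)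
    show "\<forall>z\<in>disc. F z \<in> branch_points \<Gamma> \<longleftrightarrow> z \<in> branch_points \<Gamma>"
    proof
      fix z assume z: "z \<in> disc"
      have "f (\<pi> z) \<in> f ` Fix S T \<longleftrightarrow> \<pi> z \<in> Fix S T"
        by (rule inj_on_image_mem_iff[OF Aut_inj[OF c(2)] \<pi>_points[OF z] Fix_points])
      then show "F z \<in> branch_points \<Gamma> \<longleftrightarrow> z \<in> branch_points \<Gamma>"
        using mem[OF z] branch_fix[OF z] im by simp
    qed
  next
    assume br: "\<forall>z\<in>disc. F z \<in> branch_points \<Gamma> \<longleftrightarrow> z \<in> branch_points \<Gamma>"
    have fx: "f (\<pi> z) \<in> Fix S T \<longleftrightarrow> \<pi> z \<in> Fix S T" if z: "z \<in> disc" for z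
      using br z mem[OF z] branch_fix[OF z] by simp
    have fx': "f x \<in> Fix S T \<longleftrightarrow> x \<in> Fix S T" if "x \<in> points S" for x
      using \<pi>_surj[OF that] fx by metis
    have "f ` Fix S T = Fix S T"
    proof (intro equalityI subsetI)
      fix y assume "y \<in> f ` Fix S T"
      then show "y \<in> Fix S T" using fx' Fix_points by blast
    next
      fix y assume y: "y \<in> Fix S T"
      then obtain x where "x \<in> points S" "y = f x" using Aut_surj[OF c(2)] Fix_points by blast
      then show "y \<in> f ` Fix S T" using fx' y by blast
    qed
    then show "f \<in> carrier (Aut' S T)" using c(2) by (simp add: Aut'_carrier)
  qed
qed

section \<open>The involution induced by the half-turn\<close>

lemma normalizer_branch:
  assumes F: "F \<in> carrier DA" and n: "\<And>g. g \<in> \<Gamma> \<Longrightarrow> F \<otimes>\<^bsub>DA\<^esub> g \<otimes>\<^bsub>DA\<^esub> inv\<^bsub>DA\<^esub> F \<in> \<Gamma>"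
    and z: "z \<in> branch_points \<Gamma>"
  shows "F z \<in> branch_points \<Gamma>"
proof -
  have zd: "z \<in> disc" "rot z \<in> \<Gamma>" using z branch_iff by auto
  have "rot (F z) \<in> \<Gamma>" using n[OF zd(2)] hyp_rotation_conj[OF F zd(1)] by simp
  then show ?thesis using branch_iff DA_closed[OF F zd(1)] by blast
qed

text \<open>On generators the exponents 1 and -1 at A and B are exchanged, and m at C becomes -m at
  D. Inversion respects products because powers of t commute, so it extends to all of
  \<open>\<Gamma>\<close>.\<close>

lemma \<sigma>_conj:
  assumes "g \<in> \<Gamma>"
  shows "\<exists>n. covers g (tpow n) \<and> covers (\<sigma> \<otimes>\<^bsub>DA\<^esub> g \<otimes>\<^bsub>DA\<^esub> inv\<^bsub>DA\<^esub> \<sigma>) (tpow (- n))"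
proof -
  note sc = \<sigma>(1)
  have ic: "inv\<^bsub>DA\<^esub> \<sigma> \<in> carrier DA" using sc by simp
  have gens: "\<exists>n. covers h (tpow n) \<and> covers (\<sigma> \<otimes>\<^bsub>DA\<^esub> h \<otimes>\<^bsub>DA\<^esub> inv\<^bsub>DA\<^esub> \<sigma>) (tpow (- n))"
    if h: "h \<in> {rot A, rot B, rot C}" for h
  proof -
    have 1: "\<sigma> \<otimes>\<^bsub>DA\<^esub> rot V \<otimes>\<^bsub>DA\<^esub> inv\<^bsub>DA\<^esub> \<sigma> = rot (\<sigma> V)" if "V \<in> disc" for V
      by (rule hyp_rotation_conj[OF sc that])
    have "covers (\<sigma> \<otimes>\<^bsub>DA\<^esub> rot A \<otimes>\<^bsub>DA\<^esub> inv\<^bsub>DA\<^esub> \<sigma>) (tpow (- 1))"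
      using 1[OF disc_ABC(1)] rot_covers(2) \<sigma>(2) by simp
    moreover have "covers (\<sigma> \<otimes>\<^bsub>DA\<^esub> rot B \<otimes>\<^bsub>DA\<^esub> inv\<^bsub>DA\<^esub> \<sigma>) (tpow (- (- 1)))"
      using 1[OF disc_ABC(2)] rot_covers(1) \<sigma>(3) by simp
    moreover have "covers (\<sigma> \<otimes>\<^bsub>DA\<^esub> rot C \<otimes>\<^bsub>DA\<^esub> inv\<^bsub>DA\<^esub> \<sigma>) (tpow (- m))"
      using 1[OF disc_ABC(3)] rot_D_covers by (simp add: D_def)
    ultimately show ?thesis using h rot_covers by blast
  qed
  from assms have "g \<in> generate DA {rot A, rot B, rot C}" by (simp add: vertex_group_generators)
  then show ?thesis
  proof (induction rule: generate.induct)
    case one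
    have "covers \<one>\<^bsub>DA\<^esub> (tpow 0)" using covers_one[OF \<Gamma>s.one_closed] by simp
    then show ?case using sc by (intro exI[of _ 0]) simp
  next
    case (incl h)
    then show ?case by (rule gens)
  next
    case (inv h)
    then obtain n where n: "covers h (tpow n)" "covers (\<sigma> \<otimes>\<^bsub>DA\<^esub> h \<otimes>\<^bsub>DA\<^esub> inv\<^bsub>DA\<^esub> \<sigma>) (tpow (- n))" using gens by blast
    note hc = coversD(1)[OF n(1)]
    have "inv\<^bsub>DA\<^esub> (\<sigma> \<otimes>\<^bsub>DA\<^esub> h \<otimes>\<^bsub>DA\<^esub> inv\<^bsub>DA\<^esub> \<sigma>) = \<sigma> \<otimes>\<^bsub>DA\<^esub> inv\<^bsub>DA\<^esub> h \<otimes>\<^bsub>DA\<^esub> inv\<^bsub>DA\<^esub> \<sigma>"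
      using sc hc by (simp add: DA.inv_mult_group DA.m_assoc)
    then show ?case using covers_tpow_inv[OF n(1)] covers_tpow_inv[OF n(2)] by (intro exI[of _ "- n"]) simp
  next
    case (eng h1 h2)
    then obtain n l where n: "covers h1 (tpow n)" "covers (\<sigma> \<otimes>\<^bsub>DA\<^esub> h1 \<otimes>\<^bsub>DA\<^esub> inv\<^bsub>DA\<^esub> \<sigma>) (tpow (- n))"
      and l: "covers h2 (tpow l)" "covers (\<sigma> \<otimes>\<^bsub>DA\<^esub> h2 \<otimes>\<^bsub>DA\<^esub> inv\<^bsub>DA\<^esub> \<sigma>) (tpow (- l))" by blast
    note hc = coversD(1)[OF n(1)] coversD(1)[OF l(1)]
    have canc: "inv\<^bsub>DA\<^esub> \<sigma> \<otimes>\<^bsub>DA\<^esub> (\<sigma> \<otimes>\<^bsub>DA\<^esub> x) = x" if "x \<in> carrier DA" for x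
      using sc that by (simp add: DA.m_assoc[symmetric])
    have "(\<sigma> \<otimes>\<^bsub>DA\<^esub> h1 \<otimes>\<^bsub>DA\<^esub> inv\<^bsub>DA\<^esub> \<sigma>) \<otimes>\<^bsub>DA\<^esub> (\<sigma> \<otimes>\<^bsub>DA\<^esub> h2 \<otimes>\<^bsub>DA\<^esub> inv\<^bsub>DA\<^esub> \<sigma>) = \<sigma> \<otimes>\<^bsub>DA\<^esub> (h1 \<otimes>\<^bsub>DA\<^esub> h2) \<otimes>\<^bsub>DA\<^esub> inv\<^bsub>DA\<^esub> \<sigma>"
      using sc hc by (simp add: DA.m_assoc canc)
    then show ?case using covers_tpow_mult[OF n(1) l(1)] covers_tpow_mult[OF n(2) l(2)] by (intro exI[of _ "n + l"]) simp
  qed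
qed

text \<open>An exponent is divisible by p exactly when its negative is, so \<open>\<sigma>\<close>
  normalizes \<open>\<Gamma>s\<close> and descends. It inverts t, which a power of t cannot do since
  p is odd.\<close>

lemma involution_exists:
  obtains s where "covers \<sigma> s" "s \<in> carrier (Aut' S T)" "s \<otimes>\<^bsub>Aut S\<^esub> s = \<one>\<^bsub>Aut S\<^esub>"
    "s \<otimes>\<^bsub>Aut S\<^esub> t \<otimes>\<^bsub>Aut S\<^esub> inv\<^bsub>Aut S\<^esub> s = inv\<^bsub>Aut S\<^esub> t" "s \<notin> generate (Aut S) {t}"
proof -
  have n1: "\<sigma> \<otimes>\<^bsub>DA\<^esub> g \<otimes>\<^bsub>DA\<^esub> inv\<^bsub>DA\<^esub> \<sigma> \<in> \<Gamma>s" if g: "g \<in> \<Gamma>s" for g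
  proof -
    obtain n where n: "covers g (tpow n)" "covers (\<sigma> \<otimes>\<^bsub>DA\<^esub> g \<otimes>\<^bsub>DA\<^esub> inv\<^bsub>DA\<^esub> \<sigma>) (tpow (- n))"
      using \<sigma>_conj g \<Gamma>s_\<Gamma> by blast
    then show ?thesis using \<Gamma>s_iff[OF n(1)] \<Gamma>s_iff[OF n(2)] g by simp
  qed
  obtain s where s: "covers \<sigma> s" by (rule descend[OF \<sigma>(1) n1]) (assumption, use n1 \<sigma>_inv in simp, rule that)
  note sc = coversD(2)[OF s]
  have inv: "s \<otimes>\<^bsub>Aut S\<^esub> s = \<one>\<^bsub>Aut S\<^esub>"
    using covers_unique[OF covers_mult[OF s s], of "\<one>\<^bsub>Aut S\<^esub>"] covers_one[OF \<Gamma>s.one_closed] \<sigma>_invol by simp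
  have conj: "s \<otimes>\<^bsub>Aut S\<^esub> t \<otimes>\<^bsub>Aut S\<^esub> inv\<^bsub>Aut S\<^esub> s = inv\<^bsub>Aut S\<^esub> t"
  proof (rule covers_unique)
    show "covers (rot (\<sigma> A)) (s \<otimes>\<^bsub>Aut S\<^esub> t \<otimes>\<^bsub>Aut S\<^esub> inv\<^bsub>Aut S\<^esub> s)"
      using rot_lift[OF s, of A 1] t by (simp add: Vs_def)
    show "covers (rot (\<sigma> A)) (inv\<^bsub>Aut S\<^esub> t)"
      using rot_covers(2) t \<sigma>(2) by (simp add: A.int_pow_neg)
  qed
  have nb: "\<sigma> z \<in> branch_points \<Gamma>" if "z \<in> branch_points \<Gamma>" for z
    by (rule normalizer_branch[OF \<sigma>(1) _ that]) (use \<sigma>_conj \<Gamma>_iff in blast)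
  have "s \<in> carrier (Aut' S T)"
    unfolding Aut'_branch[OF s]
  proof
    fix z assume z: "z \<in> disc"
    have "\<sigma> (\<sigma> z) = z" using DA_mult[OF \<sigma>(1,1) z] \<sigma>_invol DA_one[OF z] by simp
    then show "\<sigma> z \<in> branch_points \<Gamma> \<longleftrightarrow> z \<in> branch_points \<Gamma>" using nb[of z] nb[of "\<sigma> z"] by auto
  qed
  moreover have "s \<notin> generate (Aut S) {t}"
  proof
    assume "s \<in> generate (Aut S) {t}"
    then obtain n where n: "s = tpow n" using gen_tpow by blast
    have "tpow n \<otimes>\<^bsub>Aut S\<^esub> tpow 1 \<otimes>\<^bsub>Aut S\<^esub> inv\<^bsub>Aut S\<^esub> tpow n = tpow 1"
      unfolding tpow_inv tpow_mult by simp
    then have "t = inv\<^bsub>Aut S\<^esub> t" using conj n t by simp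
    then have "tpow 1 = tpow (- 1)" using t by (simp add: A.int_pow_neg)
    then have "int p dvd 2" unfolding tpow_eq by simp
    then show False using small_dvd[of 2] p_gt_2 by simp
  qed
  ultimately show thesis using s inv conj that by blast
qed

lemma tpow_Aut': "tpow n \<in> carrier (Aut' S T)"
proof -
  obtain F where F: "covers F (tpow n)" by (rule lift_exists[OF tpow_carrier])
  have FG: "F \<in> \<Gamma>" using F \<Gamma>_iff by blast
  note Fc = \<Gamma>.mem_carrier[OF FG]
  have nb: "g z \<in> branch_points \<Gamma>" if "g \<in> \<Gamma>" "z \<in> branch_points \<Gamma>" for g z
    by (rule normalizer_branch[OF \<Gamma>.mem_carrier[OF that(1)] _ that(2)]) (intro \<Gamma>.m_closed \<Gamma>.m_inv_closed that)
  show ?thesis unfolding Aut'_branch[OF F]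
  proof
    fix z assume z: "z \<in> disc"
    show "F z \<in> branch_points \<Gamma> \<longleftrightarrow> z \<in> branch_points \<Gamma>"
      using nb[OF FG, of z] nb[OF \<Gamma>.m_inv_closed[OF FG], of "F z"] DA_inv_apply(1)[OF Fc z] by auto
  qed
qed

text \<open>Conjugation by an element of \<open>Aut'\<close> multiplies the set \<open>{\<plusminus>1, \<plusminus>m}\<close> of exponents at the fixed points by
  a unit; the assumptions on \<open>m\<close> leave only the units \<open>\<plusminus>1\<close>.\<close>

lemma Aut'_conj:
  assumes f: "f \<in> carrier (Aut' S T)"
  shows "f \<otimes>\<^bsub>Aut S\<^esub> t \<otimes>\<^bsub>Aut S\<^esub> inv\<^bsub>Aut S\<^esub> f = t \<or> f \<otimes>\<^bsub>Aut S\<^esub> t \<otimes>\<^bsub>Aut S\<^esub> inv\<^bsub>Aut S\<^esub> f = inv\<^bsub>Aut S\<^esub> t"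
proof -
  have fc: "f \<in> carrier (Aut S)" using f Aut'_carrier by blast
  obtain F where F: "covers F f" by (rule lift_exists[OF fc])
  have br: "F V \<in> branch_points \<Gamma>" if "(V, n) \<in> Vs" for V n
    using f Aut'_branch[OF F] orb_branch[OF that orb_self] Vs_rot[OF that] by blast
  have v: "(A, 1) \<in> Vs" "(C, m) \<in> Vs" by (simp_all add: Vs_def)
  obtain W l where W: "(W, l) \<in> Vs" "F A \<in> orb \<Gamma> W" "f \<otimes>\<^bsub>Aut S\<^esub> tpow 1 \<otimes>\<^bsub>Aut S\<^esub> inv\<^bsub>Aut S\<^esub> f = tpow l"
    by (rule conj_exponent[OF F v(1) br[OF v(1)]])
  obtain X k where X: "(X, k) \<in> Vs" "F C \<in> orb \<Gamma> X" "f \<otimes>\<^bsub>Aut S\<^esub> tpow m \<otimes>\<^bsub>Aut S\<^esub> inv\<^bsub>Aut S\<^esub> f = tpow k"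
    by (rule conj_exponent[OF F v(2) br[OF v(2)]])
  have fl: "f \<otimes>\<^bsub>Aut S\<^esub> t \<otimes>\<^bsub>Aut S\<^esub> inv\<^bsub>Aut S\<^esub> f = tpow l" using W(3) t by simp
  have "tpow (l * m) = tpow k" using conj_tpow[OF fc fl, of m] X(3) by simp
  then have dv: "int p dvd l * m - k" unfolding tpow_eq .
  have l: "l = 1 \<or> l = -1 \<or> l = m \<or> l = - m" and k: "k = 1 \<or> k = -1 \<or> k = m \<or> k = - m"
    using W(1) X(1) by (auto simp: Vs_def)
  have no: "\<not> int p dvd m" "\<not> int p dvd m - 1" "\<not> int p dvd m + 1"
    using small_dvd[of m] small_dvd[of "m - 1"] small_dvd[of "m + 1"] m(1,2) by auto
  \<comment> \<open>If l were m or -m, then k would be congruent to m^2 or -m^2 modulo p. For k = 1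
    or -1 this contradicts m^2 being different from 1 and -1; for k = m or -m it contradicts m being
    different from 0, 1 and -1.\<close>
  have "l = 1 \<or> l = - 1"
  proof (rule ccontr)
    assume "\<not> ?thesis"
    then have "int p dvd m * m - k \<or> int p dvd - (m * m) - k" using l dv by auto
    then have "int p dvd m * m - k \<or> int p dvd m * m + k"
      by (metis dvd_minus_iff minus_add_distrib diff_conv_add_uminus minus_minus)
    then have "int p dvd (m - 1) * (m + 1) \<or> int p dvd m\<^sup>2 + 1 \<or> int p dvd m * (m - 1) \<or> int p dvd m * (m + 1)"
      using k by (auto simp: algebra_simps power2_eq_square)
    then show False using m(3) no by (simp add: prime_dvd_mult_iff[OF prime_int])
  qed
  then show ?thesis using fl t by (auto simp: A.int_pow_neg)
qed

theorem Aut'_dihedral: "Aut' S T \<cong> dihedral_group p"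
proof -
  obtain s where s: "covers \<sigma> s" "s \<in> carrier (Aut' S T)" "s \<otimes>\<^bsub>Aut S\<^esub> s = \<one>\<^bsub>Aut S\<^esub>"
    "s \<otimes>\<^bsub>Aut S\<^esub> t \<otimes>\<^bsub>Aut S\<^esub> inv\<^bsub>Aut S\<^esub> s = inv\<^bsub>Aut S\<^esub> t" "s \<notin> generate (Aut S) {t}" by (rule involution_exists)
  note sc = coversD(2)[OF s(1)]
  have cent: "f \<in> generate (Aut S) {t}"
    if f: "f \<in> carrier (Aut' S T)" "f \<otimes>\<^bsub>Aut S\<^esub> t \<otimes>\<^bsub>Aut S\<^esub> inv\<^bsub>Aut S\<^esub> f = t" for f
  proof -
    have fc: "f \<in> carrier (Aut S)" using f Aut'_carrier by blast
    obtain F where F: "covers F f" by (rule lift_exists[OF fc])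
    show ?thesis
    proof (rule centralizer[OF F f(2)])
      show "F V \<in> branch_points \<Gamma>" if "(V, n) \<in> Vs" for V n
        using f(1) Aut'_branch[OF F] orb_branch[OF that orb_self] Vs_rot[OF that] by blast
    qed
  qed
  have "carrier (Aut' S T) = generate (Aut S) {t} \<union> (\<lambda>x. x \<otimes>\<^bsub>Aut S\<^esub> s) ` generate (Aut S) {t}"
  proof (intro equalityI subsetI)
    fix f assume f: "f \<in> carrier (Aut' S T)"
    have fc: "f \<in> carrier (Aut S)" using f Aut'_carrier by blast
    from Aut'_conj[OF f] show "f \<in> generate (Aut S) {t} \<union> (\<lambda>x. x \<otimes>\<^bsub>Aut S\<^esub> s) ` generate (Aut S) {t}"
    proof
      assume "f \<otimes>\<^bsub>Aut S\<^esub> t \<otimes>\<^bsub>Aut S\<^esub> inv\<^bsub>Aut S\<^esub> f = t"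
      then show ?thesis using cent[OF f] by blast
    next
      \<comment> \<open>An element inverting t becomes one commuting with t after multiplication by
        s.\<close>
      assume c: "f \<otimes>\<^bsub>Aut S\<^esub> t \<otimes>\<^bsub>Aut S\<^esub> inv\<^bsub>Aut S\<^esub> f = inv\<^bsub>Aut S\<^esub> t"
      have "f \<otimes>\<^bsub>Aut S\<^esub> s \<otimes>\<^bsub>Aut S\<^esub> t \<otimes>\<^bsub>Aut S\<^esub> inv\<^bsub>Aut S\<^esub> (f \<otimes>\<^bsub>Aut S\<^esub> s)
          = f \<otimes>\<^bsub>Aut S\<^esub> (s \<otimes>\<^bsub>Aut S\<^esub> t \<otimes>\<^bsub>Aut S\<^esub> inv\<^bsub>Aut S\<^esub> s) \<otimes>\<^bsub>Aut S\<^esub> inv\<^bsub>Aut S\<^esub> f"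
        using fc sc t by (simp add: A.inv_mult_group A.m_assoc)
      also have "\<dots> = inv\<^bsub>Aut S\<^esub> (f \<otimes>\<^bsub>Aut S\<^esub> t \<otimes>\<^bsub>Aut S\<^esub> inv\<^bsub>Aut S\<^esub> f)"
        unfolding s(4) using fc t by (simp add: A.inv_mult_group A.m_assoc)
      also have "\<dots> = t" unfolding c using t by simp
      finally have "f \<otimes>\<^bsub>Aut S\<^esub> s \<in> generate (Aut S) {t}" by (rule cent[OF Aut'_mult[OF f s(2)]])
      moreover have "f = f \<otimes>\<^bsub>Aut S\<^esub> s \<otimes>\<^bsub>Aut S\<^esub> s" using fc sc s(3) by (simp add: A.m_assoc)
      ultimately show ?thesis by blast
    qed
  next
    fix f assume "f \<in> generate (Aut S) {t} \<union> (\<lambda>x. x \<otimes>\<^bsub>Aut S\<^esub> s) ` generate (Aut S) {t}"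
    then show "f \<in> carrier (Aut' S T)" unfolding gen_tpow using tpow_Aut' Aut'_mult[OF tpow_Aut' s(2)] by blast
  qed
  then have "(Aut S)\<lparr>carrier := carrier (Aut' S T)\<rparr> \<cong> dihedral_group p"
    by (rule A.dihedral_group_iso[OF t sc s(5,3,4) ord_t p_pos])
  then show ?thesis by (simp add: Aut'_def)
qed

section \<open>No hyperelliptic involution\<close>

text \<open>The generators multiply the form by roots of unity with exponents -e; the congruences
  make these the values of one character at the exponents 1, -1, m, and it is trivial on
  \<open>\<Gamma>s\<close>. The pole of the coordinate is put at D, and the strict bound on the sum
  produces a zero there.\<close>

lemma weight2_form:
  fixes e :: "complex \<Rightarrow> nat" and u :: int
  assumes e: "\<And>x. x \<in> {A, B, C} \<Longrightarrow> e x < p" and sum_e: "p + 1 < sum e {A, B, C}"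
    and cong: "int p dvd int (e A) - u" "int p dvd int (e B) + u" "int p dvd int (e C) - u * m"
  obtains f where "f holomorphic_on disc"
    "\<And>z. z \<in> disc \<Longrightarrow> f z = 0 \<longleftrightarrow> z \<in> orb \<Gamma> D \<or> (\<exists>x\<in>{A, B, C}. z \<in> orb \<Gamma> x \<and> e x + 1 < p)"
    "\<And>g z. g \<in> \<Gamma>s \<Longrightarrow> z \<in> disc \<Longrightarrow> f (g z) * deriv g z = f z"
proof -
  obtain \<tau> where "hauptmodul \<Gamma> D \<tau>" by (rule hauptmodul_\<Gamma>[OF disc_D])
  then interpret H: hauptmodul \<Gamma> D \<tau> .
  define \<zeta> where "\<zeta> = cis (2 * pi / real p)"
  have \<zeta>_nz: "\<zeta> \<noteq> 0" by (simp add: \<zeta>_def)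
  have v: "(A, 1) \<in> Vs" "(B, -1) \<in> Vs" "(C, m) \<in> Vs" "(D, - m) \<in> Vs" by (simp_all add: Vs_def)
  have XV: "\<exists>n. (x, n) \<in> Vs" if "x \<in> {A, B, C}" for x using that v by blast
  have self: "x \<in> orb \<Gamma> x" if "(x, n) \<in> Vs" for x n using Vs_rot[OF that] orb_self by blast
  have DABC: "x \<noteq> D" if x: "x \<in> {A, B, C}" for x
  proof
    assume xD: "x = D"
    have a: "(A, 1) \<in> Vs \<and> 1 \<noteq> - m" "(B, -1) \<in> Vs \<and> -1 \<noteq> - m" "(C, m) \<in> Vs \<and> m \<noteq> - m"
      using v m(1) by auto
    from x consider "x = A" | "x = B" | "x = C" by blast
    then have "\<exists>n. (x, n) \<in> Vs \<and> n \<noteq> - m" by cases (use a in metis)+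
    then obtain n where n: "(D, n) \<in> Vs" "n \<noteq> - m" unfolding xD by blast
    then have "int p dvd n - (- m)" using covers_tpow_unique Vs_rot[OF n(1)] Vs_rot[OF v(4)] by blast
    then show False using Vs_inj(2)[OF n(1) v(4)] n(2) by blast
  qed
  obtain f where f: "f holomorphic_on disc"
    "\<And>z. z \<in> disc \<Longrightarrow> f z = 0 \<longleftrightarrow> (z \<in> orb \<Gamma> D \<and> p + 1 < sum e {A, B, C}) \<or> (\<exists>x\<in>{A, B, C}. z \<in> orb \<Gamma> x \<and> e x + 1 < p)"
    "\<And>x z. x \<in> {A, B, C} \<Longrightarrow> z \<in> disc \<Longrightarrow> f (rot x z) * deriv (rot x) z = \<zeta> powi (- int (e x)) * f z"
  proof (rule H.form_exists[OF p_pos, of "{A, B, C}" e])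
    show "{A, B, C} \<subseteq> disc" using disc_ABC by simp
    show "x \<notin> orb \<Gamma> D" if x: "x \<in> {A, B, C}" for x
    proof
      assume "x \<in> orb \<Gamma> D"
      moreover obtain n where n: "(x, n) \<in> Vs" using XV[OF x] by blast
      ultimately have "x = D" using Vs_orb_unique[OF n v(4) self[OF n]] by blast
      then show False using DABC[OF x] by blast
    qed
    show "y = x" if xy: "x \<in> {A, B, C}" "y \<in> {A, B, C}" "y \<in> orb \<Gamma> x" for x y
    proof -
      obtain n l where n: "(x, n) \<in> Vs" "(y, l) \<in> Vs" using XV xy by blast
      show ?thesis by (rule Vs_orb_unique[OF n(2,1) self[OF n(2)] xy(3)])
    qed
    show "branch_points \<Gamma> = orb \<Gamma> D \<union> (\<Union>x\<in>{A, B, C}. orb \<Gamma> x)"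
    proof (intro equalityI subsetI)
      fix z assume "z \<in> branch_points \<Gamma>"
      then obtain V n where "(V, n) \<in> Vs" "z \<in> orb \<Gamma> V" by (rule branch_orb)
      then show "z \<in> orb \<Gamma> D \<union> (\<Union>x\<in>{A, B, C}. orb \<Gamma> x)" by (auto simp: Vs_def)
    next
      fix z assume "z \<in> orb \<Gamma> D \<union> (\<Union>x\<in>{A, B, C}. orb \<Gamma> x)"
      then obtain V n where "(V, n) \<in> Vs" "z \<in> orb \<Gamma> V" using v by blast
      then show "z \<in> branch_points \<Gamma>" by (rule orb_branch)
    qed
    show "card (stab \<Gamma> z) = p \<and> rot z \<in> \<Gamma>" if "z \<in> branch_points \<Gamma>" for z
      using branch_card[OF that] branch_iff that by blast
  qed (use e sum_e \<zeta>_def in auto)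
  \<comment> \<open>The character of the group generated by t that sends t to the power -u of
    \<open>\<zeta>\<close>.\<close>
  define \<chi>' where "\<chi>' n = \<zeta> powi (- (u * n))" for n
  have \<chi>'_add: "\<chi>' (n + l) = \<chi>' n * \<chi>' l" for n l
    using \<zeta>_nz by (simp add: \<chi>'_def power_int_add[symmetric] distrib_left)
  have \<chi>'_nz: "\<chi>' n \<noteq> 0" for n using \<zeta>_nz by (simp add: \<chi>'_def)
  have gens: "\<exists>n. covers h (tpow n) \<and> (\<forall>z\<in>disc. f (h z) * deriv h z = \<chi>' n * f z)"
    if h: "h \<in> {rot A, rot B, rot C}" for h
  proof -
    have "\<zeta> powi (- int (e A)) = \<chi>' 1" unfolding \<chi>'_def \<zeta>_def cis_powi_eq_iff[OF p_pos]
      using cong(1) dvd_minus_iff[of "int p" "int (e A) - u"] by simp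
    moreover have "\<zeta> powi (- int (e B)) = \<chi>' (-1)" unfolding \<chi>'_def \<zeta>_def cis_powi_eq_iff[OF p_pos]
      using cong(2) dvd_minus_iff[of "int p" "int (e B) + u"] by simp
    moreover have "\<zeta> powi (- int (e C)) = \<chi>' m" unfolding \<chi>'_def \<zeta>_def cis_powi_eq_iff[OF p_pos]
      using cong(3) dvd_minus_iff[of "int p" "int (e C) - u * m"] by simp
    ultimately show ?thesis using h rot_covers f(3)[of A] f(3)[of B] f(3)[of C] by auto
  qed
  have char: "\<exists>n. covers g (tpow n) \<and> (\<forall>z\<in>disc. f (g z) * deriv g z = \<chi>' n * f z)" if "g \<in> \<Gamma>" for g
  proof -
    from that have "g \<in> generate DA {rot A, rot B, rot C}" by (simp add: vertex_group_generators)
    then show ?thesis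
    proof (induction rule: generate.induct)
      case one
      have "covers \<one>\<^bsub>DA\<^esub> (tpow 0)" using covers_one[OF \<Gamma>s.one_closed] by simp
      then show ?case by (intro exI[of _ 0]) (simp add: \<chi>'_def DA_deriv_one DA_one)
    next
      case (incl h)
      then show ?case by (rule gens)
    next
      case (inv h)
      then obtain n where n: "covers h (tpow n)" "\<And>z. z \<in> disc \<Longrightarrow> f (h z) * deriv h z = \<chi>' n * f z" using gens by blast
      note hc = coversD(1)[OF n(1)]
      have ic: "inv\<^bsub>DA\<^esub> h \<in> carrier DA" using hc by simp
      have "f ((inv\<^bsub>DA\<^esub> h) z) * deriv (inv\<^bsub>DA\<^esub> h) z = \<chi>' (- n) * f z" if z: "z \<in> disc" for z
      proof -
        define w where "w = (inv\<^bsub>DA\<^esub> h) z"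
        have w: "w \<in> disc" "h w = z" using DA_closed[OF ic z] DA_inv_apply(2)[OF hc z] by (simp_all add: w_def)
        have d: "deriv h w * deriv (inv\<^bsub>DA\<^esub> h) z = 1"
          using DA_deriv_mult[OF hc ic z] DA.r_inv[OF hc] DA_deriv_one[OF z] by (simp add: w_def)
        have "\<chi>' (- n) * f z = \<chi>' (- n) * (f (h w) * deriv h w) * deriv (inv\<^bsub>DA\<^esub> h) z"
          using d w(2) by (simp add: mult.assoc)
        also have "\<dots> = (\<chi>' (- n) * \<chi>' n) * (f w * deriv (inv\<^bsub>DA\<^esub> h) z)" unfolding n(2)[OF w(1)] by simp
        also have "\<chi>' (- n) * \<chi>' n = 1" using \<chi>'_add[of "- n" n] by (simp add: \<chi>'_def)
        finally show ?thesis by (simp add: w_def)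
      qed
      then show ?case using covers_tpow_inv[OF n(1)] by blast
    next
      case (eng h1 h2)
      then obtain n l where n: "covers h1 (tpow n)" "\<And>z. z \<in> disc \<Longrightarrow> f (h1 z) * deriv h1 z = \<chi>' n * f z"
        and l: "covers h2 (tpow l)" "\<And>z. z \<in> disc \<Longrightarrow> f (h2 z) * deriv h2 z = \<chi>' l * f z" by blast
      note hc = coversD(1)[OF n(1)] coversD(1)[OF l(1)]
      have "f ((h1 \<otimes>\<^bsub>DA\<^esub> h2) z) * deriv (h1 \<otimes>\<^bsub>DA\<^esub> h2) z = \<chi>' (n + l) * f z" if z: "z \<in> disc" for z
      proof -
        have "f ((h1 \<otimes>\<^bsub>DA\<^esub> h2) z) * deriv (h1 \<otimes>\<^bsub>DA\<^esub> h2) z = (f (h1 (h2 z)) * deriv h1 (h2 z)) * deriv h2 z"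
          using DA_mult[OF hc z] DA_deriv_mult[OF hc z] by simp
        also have "\<dots> = \<chi>' n * (f (h2 z) * deriv h2 z)" unfolding n(2)[OF DA_closed[OF hc(2) z]] by simp
        also have "\<dots> = \<chi>' (n + l) * f z" unfolding l(2)[OF z] \<chi>'_add by simp
        finally show ?thesis .
      qed
      then show ?case using covers_tpow_mult[OF n(1) l(1)] by blast
    qed
  qed
  show thesis
  proof (rule that[OF f(1)])
    show "f z = 0 \<longleftrightarrow> z \<in> orb \<Gamma> D \<or> (\<exists>x\<in>{A, B, C}. z \<in> orb \<Gamma> x \<and> e x + 1 < p)" if "z \<in> disc" for z
      using f(2)[OF that] sum_e by blast
    fix g z assume g: "g \<in> \<Gamma>s" and z: "z \<in> disc"
    obtain n where n: "covers g (tpow n)" "\<forall>z\<in>disc. f (g z) * deriv g z = \<chi>' n * f z"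
      using char g \<Gamma>s_\<Gamma> by blast
    have "int p dvd n" using \<Gamma>s_iff[OF n(1)] g by blast
    then have "\<chi>' n = 1" unfolding \<chi>'_def \<zeta>_def cis_powi_eq_one[OF p_pos] by simp
    then show "f (g z) * deriv g z = f z" using n(2) z by simp
  qed
qed

theorem not_hyperelliptic: "\<not> hyperelliptic S"
proof
  assume "hyperelliptic S"
  then obtain J where J: "J \<in> carrier (Aut S)" "A.ord J = 2"
    and sph: "biholomorphic (quotient_surface S (generate (Aut S) {J})) riemann_sphere"
    unfolding hyperelliptic_def by blast
  have JJ: "J \<otimes>\<^bsub>Aut S\<^esub> J = \<one>\<^bsub>Aut S\<^esub>"
    using A.pow_ord_eq_1[OF J(1)] J by (simp add: numeral_2_eq_2)
  have "generate (Aut S) {J} = {\<one>\<^bsub>Aut S\<^esub>, J}"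
  proof (intro equalityI subsetI)
    fix x assume "x \<in> generate (Aut S) {J}"
    then obtain k where k: "x = J [^]\<^bsub>Aut S\<^esub> (k::int)" using A.generate_pow[OF J(1)] by auto
    then have "x = J [^]\<^bsub>Aut S\<^esub> (k mod 2)" using A.int_pow_mod_ord[OF J(1), of k] J(2) by simp
    moreover have "k mod 2 = 0 \<or> k mod 2 = 1" by presburger
    ultimately show "x \<in> {\<one>\<^bsub>Aut S\<^esub>, J}" using J(1) by auto
  qed (auto intro: generate.intros)
  then have sph': "biholomorphic (quotient_surface S {\<one>\<^bsub>Aut S\<^esub>, J}) riemann_sphere" using sph by simp
  obtain K where K: "covers K J" by (rule lift_exists[OF J(1)])
  note Kc = coversD(1)[OF K]
  have zero: "f (K z) = 0 \<longleftrightarrow> f z = 0"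
    if "f holomorphic_on disc" "\<And>g z. g \<in> \<Gamma>s \<Longrightarrow> z \<in> disc \<Longrightarrow> f (g z) * deriv g z = f z" "z \<in> disc" for f z
  proof -
    have "f (K z) * deriv K z = - f z" by (rule involution_negates_forms[OF J(1) JJ sph' K that])
    then show ?thesis using DA_has_field_derivative(2)[OF Kc that(3)] by auto
  qed
  define mn where "mn = nat m"
  have mn: "int mn = m" "2 \<le> mn" "mn + 2 \<le> p" using m(1,2) by (auto simp: mn_def)
  note dABC = angle_triangle_distinct[OF tri]
  \<comment> \<open>Residues of the exponents 1, -1, m. The entry p - 1 is the one that produces no
    zero, here over B, and the sum p + m exceeds p + 1.\<close>
  define e1 where "e1 x = (if x = A then 1 else if x = B then p - 1 else mn)" for x
  have e1v: "e1 A = 1" "e1 B = p - 1" "e1 C = mn" using dABC by (auto simp: e1_def)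
  obtain f1 where f1: "f1 holomorphic_on disc"
    "\<And>z. z \<in> disc \<Longrightarrow> f1 z = 0 \<longleftrightarrow> z \<in> orb \<Gamma> D \<or> (\<exists>x\<in>{A, B, C}. z \<in> orb \<Gamma> x \<and> e1 x + 1 < p)"
    "\<And>g z. g \<in> \<Gamma>s \<Longrightarrow> z \<in> disc \<Longrightarrow> f1 (g z) * deriv g z = f1 z"
  proof (rule weight2_form[of e1 1])
    show "e1 x < p" if "x \<in> {A, B, C}" for x using that e1v mn p_gt_2 by auto
    have "sum e1 {A, B, C} = e1 A + e1 B + e1 C" using dABC by auto
    then show "p + 1 < sum e1 {A, B, C}" using e1v mn p_gt_2 by simp
    show "int p dvd int (e1 A) - 1" "int p dvd int (e1 B) + 1" "int p dvd int (e1 C) - 1 * m"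
      using e1v mn p_gt_2 by (simp_all add: of_nat_diff)
  qed (rule that)
  \<comment> \<open>The negated exponents: now A carries p - 1, and the sum 2 p - m exceeds p + 1
    because m is at most p - 2.\<close>
  define e2 where "e2 x = (if x = A then p - 1 else if x = B then 1 else p - mn)" for x
  have e2v: "e2 A = p - 1" "e2 B = 1" "e2 C = p - mn" using dABC by (auto simp: e2_def)
  obtain f2 where f2: "f2 holomorphic_on disc"
    "\<And>z. z \<in> disc \<Longrightarrow> f2 z = 0 \<longleftrightarrow> z \<in> orb \<Gamma> D \<or> (\<exists>x\<in>{A, B, C}. z \<in> orb \<Gamma> x \<and> e2 x + 1 < p)"
    "\<And>g z. g \<in> \<Gamma>s \<Longrightarrow> z \<in> disc \<Longrightarrow> f2 (g z) * deriv g z = f2 z"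
  proof (rule weight2_form[of e2 "-1"])
    show "e2 x < p" if "x \<in> {A, B, C}" for x using that e2v mn p_gt_2 by auto
    have "sum e2 {A, B, C} = e2 A + e2 B + e2 C" using dABC by auto
    then show "p + 1 < sum e2 {A, B, C}" using e2v mn p_gt_2 by simp
    show "int p dvd int (e2 A) - (-1)" "int p dvd int (e2 B) + (-1)" "int p dvd int (e2 C) - (-1) * m"
      using e2v mn p_gt_2 by (simp_all add: of_nat_diff)
  qed (rule that)
  have z1: "f1 z = 0 \<longleftrightarrow> z \<in> orb \<Gamma> A \<or> z \<in> orb \<Gamma> C \<or> z \<in> orb \<Gamma> D" if "z \<in> disc" for z
    using f1(2)[OF that] e1v mn p_gt_2 by auto
  have z2: "f2 z = 0 \<longleftrightarrow> z \<in> orb \<Gamma> B \<or> z \<in> orb \<Gamma> C \<or> z \<in> orb \<Gamma> D" if "z \<in> disc" for z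
    using f2(2)[OF that] e2v mn p_gt_2 by auto
  have v: "(A, 1) \<in> Vs" "(B, -1) \<in> Vs" "(C, m) \<in> Vs" "(D, - m) \<in> Vs" by (simp_all add: Vs_def)
  have br: "z \<in> branch_points \<Gamma> \<longleftrightarrow> f1 z = 0 \<or> f2 z = 0" if z: "z \<in> disc" for z
  proof
    assume "z \<in> branch_points \<Gamma>"
    then obtain V n where "(V, n) \<in> Vs" "z \<in> orb \<Gamma> V" by (rule branch_orb)
    then show "f1 z = 0 \<or> f2 z = 0" using z1[OF z] z2[OF z] by (auto simp: Vs_def)
  next
    assume "f1 z = 0 \<or> f2 z = 0"
    then show "z \<in> branch_points \<Gamma>" using z1[OF z] z2[OF z] orb_branch[OF v(1)] orb_branch[OF v(2)] orb_branch[OF v(3)] orb_branch[OF v(4)] by blast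
  qed
  have Kbr: "K V \<in> branch_points \<Gamma>" if V: "(V, n) \<in> Vs" for V n
  proof -
    have d: "V \<in> disc" using Vs_rot[OF V] by blast
    have "V \<in> branch_points \<Gamma>" by (rule orb_branch[OF V orb_self[OF d]])
    then show ?thesis
      using br[OF d] br[OF DA_closed[OF Kc d]] zero[OF f1(1,3) d] zero[OF f2(1,3) d] by blast
  qed
  \<comment> \<open>The orbit of A is the only one over which the first form vanishes and the second
    does not, and J preserves both zero sets.\<close>
  have "K A \<in> orb \<Gamma> A"
  proof -
    note dA = disc_ABC(1)
    have KA: "K A \<in> disc" by (rule DA_closed[OF Kc dA])
    have self: "A \<in> orb \<Gamma> A" by (rule orb_self[OF dA])
    have "A \<notin> orb \<Gamma> B" using Vs_orb_unique[OF v(1,2) self] dABC by blast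
    moreover have "A \<notin> orb \<Gamma> C" using Vs_orb_unique[OF v(1,3) self] dABC by blast
    moreover have "A \<notin> orb \<Gamma> D"
    proof
      assume "A \<in> orb \<Gamma> D"
      from covers_tpow_unique[OF rot_orb[OF v(1) self] rot_orb[OF v(4) this]]
      have "1 = - m" by (rule Vs_inj(2)[OF v(1,4)])
      then show False using m(1) by simp
    qed
    ultimately have "f1 A = 0" "f2 A \<noteq> 0" using z1[OF dA] z2[OF dA] self by auto
    then have "f1 (K A) = 0" "f2 (K A) \<noteq> 0" using zero[OF f1(1,3) dA] zero[OF f2(1,3) dA] by auto
    then show ?thesis using z1[OF KA] z2[OF KA] by blast
  qed
  then have "J \<otimes>\<^bsub>Aut S\<^esub> t \<otimes>\<^bsub>Aut S\<^esub> inv\<^bsub>Aut S\<^esub> J = t"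
    using covers_unique[OF rot_lift[OF K v(1)] rot_orb[OF v(1)]] t by simp
  then have "J \<in> generate (Aut S) {t}" by (rule centralizer[OF K _ Kbr])
  then obtain n where n: "J = tpow n" using gen_tpow by blast
  have "tpow (n + n) = tpow 0" using JJ unfolding n tpow_mult by simp
  then have "int p dvd (n + n) - 0" unfolding tpow_eq .
  then have "int p dvd 2 * n" by simp
  moreover have "\<not> int p dvd 2" using small_dvd[of 2] p_gt_2 by auto
  ultimately have "int p dvd n" using prime_dvd_mult_iff[OF prime_int] by blast
  then have "J = \<one>\<^bsub>Aut S\<^esub>" using n tpow_eq[of n 0] by simp
  then show False using J(2) A.ord_eq_1[OF J(1)] by simp
qed

end

section \<open>Arithmetic of the exponents\<close>

text \<open>For prime p: a is neither 0 nor a fourth root of unity modulo p, a condition shared by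
  a, -a and their inverses.\<close>

definition generic_exponent :: "int \<Rightarrow> int \<Rightarrow> bool" where
  "generic_exponent p a \<longleftrightarrow> \<not> p dvd a \<and> \<not> p dvd a\<^sup>2 - 1 \<and> \<not> p dvd a\<^sup>2 + 1"

text \<open>Format of the certificates for the divisibilities below: each is an explicit combination
  of at most three known ones.\<close>

lemma dvd_combination:
  fixes p :: int
  assumes "p dvd x" "p dvd y" "p dvd z" "w = a * x + b * y + c * z"
  shows "p dvd w"
  unfolding assms(4) by (intro dvd_add dvd_mult assms)

text \<open>The condition concerns only a^2, which is congruent to m^2 or inverse to it.\<close>

lemma generic_exponent_transfer:
  assumes p: "prime p" and m: "generic_exponent p m"
    and am: "p dvd a - m \<or> p dvd a + m \<or> p dvd a * m - 1 \<or> p dvd a * m + 1"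
  shows "generic_exponent p a"
proof -
  have sq: "p dvd a\<^sup>2 - m\<^sup>2 \<or> p dvd a\<^sup>2 * m\<^sup>2 - 1"
  proof -
    have "a\<^sup>2 - m\<^sup>2 = (a - m) * (a + m)" "a\<^sup>2 * m\<^sup>2 - 1 = (a * m - 1) * (a * m + 1)"
      by (simp_all add: power2_eq_square algebra_simps)
    then show ?thesis using am by auto
  qed
  have np: "\<not> p dvd 1" using p not_prime_unit by blast
  have "\<not> p dvd a\<^sup>2 - s" if s: "s = 0 \<or> s = 1 \<or> s = -1" for s
  proof
    assume d: "p dvd a\<^sup>2 - s"
    from sq show False
    proof
      assume e: "p dvd a\<^sup>2 - m\<^sup>2"
      have "p dvd m\<^sup>2 - s" by (rule dvd_combination[OF d e dvd_0_right, of _ 1 "-1" 0]) simp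
      then show False using m s prime_dvd_power[OF p, of m 2] by (auto simp: generic_exponent_def)
    next
      assume e: "p dvd a\<^sup>2 * m\<^sup>2 - 1"
      have "p dvd s * m\<^sup>2 - 1"
        by (rule dvd_combination[OF d e dvd_0_right, of _ "- m\<^sup>2" 1 0]) (simp add: algebra_simps)
      moreover have "p dvd 1 + m\<^sup>2 \<Longrightarrow> False" using m by (simp add: generic_exponent_def add.commute)
      moreover have "p dvd - m\<^sup>2 - 1 \<Longrightarrow> False"
      proof -
        assume "p dvd - m\<^sup>2 - 1"
        then have "p dvd m\<^sup>2 + 1"
          by (rule dvd_combination[OF _ dvd_0_right dvd_0_right, where a = "-1" and b = 0 and c = 0]) simp
        then show False using m by (simp add: generic_exponent_def)
      qed
      ultimately show False using m s np by (auto simp: generic_exponent_def)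
    qed
  qed
  from this[of 0] this[of 1] this[of "-1"] show ?thesis
    using p by (auto simp: generic_exponent_def power2_eq_square)
qed

text \<open>The pair \<open>(-1, m)\<close> in the orbit forces two of the four exponents \<open>1, i, j, k\<close> to cancel.\<close>

lemma eLambda_cases:
  assumes p: "prime p" and i: "i \<in> {1..p - 1}" and j: "j \<in> {1..p - 1}" and ij: "\<not> p dvd i + j + 1"
    and m: "m \<in> {2..int p - 2}" "\<not> int p dvd m\<^sup>2 + 1" and mem: "((- 1) mod int p, m) \<in> eLambda p i j"
  shows "(int p dvd int i + 1 \<and> generic_exponent (int p) (int j)) \<or>
    (int p dvd int j + 1 \<and> generic_exponent (int p) (int i)) \<or>
    (int p dvd int i + int j \<and> generic_exponent (int p) (int i))"
proof -
  define P I J K I' J' K' where "P = int p" and "I = int i" and "J = int j" and "K = - (I + J + 1)"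
    and "I' = modular_inverse P I" and "J' = modular_inverse P J" and "K' = modular_inverse P K"
  have P: "prime P" using p by (simp add: P_def)
  have p2: "2 \<le> p" by (rule prime_ge_2_nat[OF p])
  have small: "\<not> P dvd n" if "0 < n" "n < P" for n using zdvd_imp_le[of P n] that by auto
  have inv: "P dvd n * modular_inverse P n - 1" if "\<not> P dvd n" for n
  proof -
    have "coprime n P" using prime_imp_coprime[OF P that] by (simp add: coprime_commute)
    then show ?thesis using cong_modular_inverse1 cong_iff_dvd_diff by blast
  qed
  have IJ: "0 < I" "I < P" "0 < J" "J < P" using i j p2 by (auto simp: I_def J_def P_def)
  have ii: "P dvd I * I' - 1" unfolding I'_def using IJ by (intro inv small) auto
  have jj: "P dvd J * J' - 1" unfolding J'_def using IJ by (intro inv small) auto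
  have "\<not> P dvd I + J + 1" using ij int_dvd_int_iff[of p "i + j + 1"] by (simp add: P_def I_def J_def ac_simps)
  then have kk: "P dvd K * K' - 1" unfolding K'_def by (intro inv) (simp only: K_def dvd_minus_iff not_False_eq_True)
  have "m\<^sup>2 - 1 = (m - 1) * (m + 1)" by (simp add: power2_eq_square algebra_simps)
  then have gm: "generic_exponent P m"
    using small[of m] small[of "m - 1"] small[of "m + 1"] m
    by (simp add: generic_exponent_def prime_dvd_mult_iff[OF P] flip: P_def)
  let ?C = "\<lambda>a. P dvd a - m \<or> P dvd a + m \<or> P dvd a * m - 1 \<or> P dvd a * m + 1"
  have "(P dvd I + 1 \<and> ?C J) \<or> (P dvd J + 1 \<and> ?C I) \<or> (P dvd I + J \<and> ?C I)"
  proof -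
    define L where "L = {(I, J), (J, K), (K, I), (I' * J, I'), (I', I' * K), (I' * K, I' * J),
          (J', I * J'), (I * J', J' * K), (J' * K, J'), (J * K', I * K'), (I * K', K'), (K', J * K')}"
    have "((- 1) mod P, m) \<in> (\<lambda>(a, b). (a mod P, b mod P)) ` L"
      using mem unfolding eLambda_def Let_def L_def P_def I_def J_def K_def I'_def J'_def K'_def .
    then obtain q where q: "q \<in> L" "((- 1) mod P, m) = (\<lambda>(a, b). (a mod P, b mod P)) q" by (rule imageE)
    obtain a b where "q = (a, b)" by (cases q)
    with q have ab: "(a, b) \<in> L" "(- 1) mod P = a mod P" "m = b mod P" by simp_all
    have h1: "P dvd a + 1" using ab(2)[symmetric] unfolding mod_eq_dvd_iff by simp
    have h2: "P dvd b - m" unfolding ab(3) by (rule dvd_minus_mod)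
    note c = dvd_combination
    \<comment> \<open>In every case the congruences a = -1 and b = m and, where inverses occur, the
      relation defining the inverse are combined linearly so that the inverse disappears.\<close>
    from ab(1)[unfolded L_def insert_iff empty_iff prod.inject simp_thms] show ?thesis
    proof (elim disjE)
      assume "a = I \<and> b = J"
      then show ?thesis using h1 h2 by blast
    next
      assume 2: "a = J \<and> b = K"
      have "P dvd I + m" by (rule c[OF h1 h2 dvd_0_right, of _ "-1" "-1" 0]) (simp add: 2 K_def)
      then show ?thesis using h1 2 by blast
    next
      assume 3: "a = K \<and> b = I"
      have "P dvd I + J" by (rule c[OF h1 h2 dvd_0_right, of _ "-1" 0 0]) (simp add: 3 K_def)
      then show ?thesis using h2 3 by blast
    next
      assume 4: "a = I' * J \<and> b = I'"
      have "P dvd I + J" by (rule c[OF h1 h2 ii, of _ I 0 "- J"]) (simp add: 4 algebra_simps)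
      moreover have "P dvd I * m - 1" by (rule c[OF h1 h2 ii, of _ 0 "- I" 1]) (simp add: 4 algebra_simps)
      ultimately show ?thesis by blast
    next
      assume 5: "a = I' \<and> b = I' * K"
      have 1: "P dvd I + 1" by (rule c[OF h1 h2 ii, of _ I 0 "- 1"]) (simp add: 5 algebra_simps)
      moreover have "P dvd J - m" by (rule c[OF h1 h2 1, of _ "- K" 1 "-1"]) (simp add: 5 K_def algebra_simps)
      ultimately show ?thesis by blast
    next
      assume 6: "a = I' * K \<and> b = I' * J"
      have 1: "P dvd J + 1" by (rule c[OF h1 h2 ii, of _ "- I" 0 K]) (simp add: 6 K_def algebra_simps)
      moreover have "P dvd I * m + 1" by (rule c[OF h2 ii 1, of _ "- I" J 1]) (simp add: 6 algebra_simps)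
      ultimately show ?thesis by blast
    next
      assume 7: "a = J' \<and> b = I * J'"
      have "P dvd J + 1" by (rule c[OF h1 h2 jj, of _ J 0 "- 1"]) (simp add: 7 algebra_simps)
      moreover have "P dvd I + m" by (rule c[OF h1 h2 jj, of _ I "- 1" 0]) (simp add: 7 algebra_simps)
      ultimately show ?thesis by blast
    next
      assume 8: "a = I * J' \<and> b = J' * K"
      have 1: "P dvd I + J" by (rule c[OF h1 h2 jj, of _ J 0 "- I"]) (simp add: 8 algebra_simps)
      moreover have "P dvd I * m - 1" by (rule c[OF h1 h2 1, of _ K "- I" 1]) (simp add: 8 K_def algebra_simps)
      ultimately show ?thesis by blast
    next
      assume 9: "a = J' * K \<and> b = J'"
      have "P dvd I + 1" by (rule c[OF h1 h2 jj, of _ "- J" 0 K]) (simp add: 9 K_def algebra_simps)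
      moreover have "P dvd J * m - 1" by (rule c[OF h1 h2 jj, of _ 0 "- J" 1]) (simp add: 9 algebra_simps)
      ultimately show ?thesis by blast
    next
      assume 10: "a = J * K' \<and> b = I * K'"
      have 1: "P dvd I + 1" by (rule c[OF h1 h2 kk, of _ "- K" 0 J]) (simp add: 10 K_def algebra_simps)
      moreover have "P dvd J * m - 1" by (rule c[OF h2 kk 1, of _ K "- I" "- (m + 1)"]) (simp add: 10 K_def algebra_simps)
      ultimately show ?thesis by blast
    next
      assume 11: "a = I * K' \<and> b = K'"
      have 1: "P dvd J + 1" by (rule c[OF h1 h2 kk, of _ "- K" 0 I]) (simp add: 11 K_def algebra_simps)
      moreover have "P dvd I * m + 1" by (rule c[OF h2 kk 1, of _ K "- 1" "- m"]) (simp add: 11 K_def algebra_simps)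
      ultimately show ?thesis by blast
    next
      assume 12: "a = K' \<and> b = J * K'"
      have 1: "P dvd I + J" by (rule c[OF h1 h2 kk, of _ "- K" 0 1]) (simp add: 12 K_def algebra_simps)
      moreover have "P dvd I - m" by (rule c[OF h1 h2 1, of _ "- J" 1 1]) (simp add: 12 algebra_simps)
      ultimately show ?thesis by blast
    qed
  qed
  then show ?thesis using generic_exponent_transfer[OF P gm] unfolding P_def I_def J_def by blast
qed

section \<open>Reduction to normal form\<close>

text \<open>In a group of prime order every element but the identity generates. It is applied to the
  automorphism induced by the rotation at a vertex.\<close>

lemma (in group) prime_order_generator:
  assumes T: "T \<in> carrier G" "ord T = p" and p: "prime p" and t: "t \<in> generate G {T}" "t \<noteq> \<one>"
  shows "t \<in> carrier G" "generate G {T} = generate G {t}" "ord t = p"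
proof -
  obtain k where k: "t = T [^] (k::int)" using t(1) generate_pow[OF T(1)] by auto
  show tc: "t \<in> carrier G" using k T(1) by simp
  have pI: "prime (int p)" using p by simp
  have "\<not> int p dvd k" using t(2) k int_pow_eq_id[OF T(1), of k] T(2) by simp
  then have "coprime k (int p)" using prime_imp_coprime[OF pI] by (simp add: coprime_commute)
  then obtain l where "[k * l = 1] (mod int p)" using cong_solve_coprime_int by blast
  then have "T [^] (1::int) = T [^] (k * l)"
    using int_pow_eq[OF T(1), of 1 "k * l"] T(2) by (simp add: cong_iff_dvd_diff)
  then have "t [^] l = T" using T(1) k by (simp add: int_pow_pow)
  then have Tt: "T \<in> generate G {t}" using generate_pow[OF tc] by auto
  show e: "generate G {T} = generate G {t}"
  proof
    show "generate G {T} \<subseteq> generate G {t}"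
      by (rule generate_subgroup_incl) (use Tt generate_is_subgroup[of "{t}"] tc in auto)
    show "generate G {t} \<subseteq> generate G {T}"
      by (rule generate_subgroup_incl) (use t(1) generate_is_subgroup[of "{T}"] T(1) in auto)
  qed
  show "ord t = p" using generate_pow_card[OF tc] generate_pow_card[OF T(1)] e T(2) by simp
qed

section \<open>From two opposite exponents to the conclusion\<close>

context uniformization
begin

lemma covers_nat_pow:
  assumes "covers F f"
  shows "covers (F [^]\<^bsub>DA\<^esub> (n::nat)) (f [^]\<^bsub>Aut S\<^esub> n)"
proof (induction n)
  case 0
  then show ?case using covers_one[OF \<Gamma>s.one_closed] by simp
next
  case (Suc n)
  then show ?case using covers_mult[OF Suc assms] by simp
qed

text \<open>Reduction of n modulo p lands between 2 and p - 2, because a generic exponent is none of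
  0, 1, -1. And t is nontrivial, since otherwise the rotation at P would lie in the freely acting
  group.\<close>

lemma normal_form_conclusion:
  assumes p: "prime p" "odd p" and tri: "angle_triangle (2 * pi / real p) P Q R"
    and T: "T \<in> carrier (Aut S)" "A.ord T = p" and t: "t \<in> generate (Aut S) {T}"
    and sph: "biholomorphic (quotient_surface S (generate (Aut S) {T})) riemann_sphere"
    and n: "generic_exponent (int p) n"
    and cov: "covers (hyp_rotation P (2 * pi / real p)) t"
      "covers (hyp_rotation Q (2 * pi / real p)) (t [^]\<^bsub>Aut S\<^esub> (-1::int))"
      "covers (hyp_rotation R (2 * pi / real p)) (t [^]\<^bsub>Aut S\<^esub> n)"
    and \<Gamma>: "\<Gamma> = vertex_group (2 * pi / real p) P Q R" "\<Gamma>s \<subseteq> \<Gamma>" "fuchsian_group \<Gamma>" "has_signature_0 \<Gamma> 4 p"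
  shows "Aut' S T \<cong> dihedral_group p \<and> \<not> hyperelliptic S"
proof -
  have p0: "p > 0" using p(1) prime_gt_0_nat by blast
  have p2: "p > 2" using p prime_ge_2_nat[OF p(1)] by (cases "p = 2") auto
  have P: "P \<in> disc" by (rule angle_triangleD(1)[OF tri])
  have "t \<noteq> \<one>\<^bsub>Aut S\<^esub>"
  proof
    assume "t = \<one>\<^bsub>Aut S\<^esub>"
    then have "hyp_rotation P (2 * pi / real p) \<in> \<Gamma>s" using covers_one_imp cov(1) by simp
    then have "hyp_rotation P (2 * pi / real p) = \<one>\<^bsub>DA\<^esub>" using free_fixed P hyp_rotation_center by blast
    then show False
      using hyp_rotation_eq_one_iff[OF P, of "2 * pi / real p"] cis_powi_eq_one[OF p0, of 1] p2 by simp
  qed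
  note g = A.prime_order_generator[OF T p(1) t this]
  define m where "m = n mod int p"
  have mn: "int p dvd m - n" by (simp add: m_def mod_eq_dvd_iff[symmetric])
  have gm: "generic_exponent (int p) m"
    by (rule generic_exponent_transfer[OF _ n]) (use p(1) mn in auto)
  have "0 \<le> m" "m < int p" using p0 by (simp_all add: m_def)
  moreover have "m \<noteq> 0" "m \<noteq> 1" "m \<noteq> int p - 1"
  proof -
    have "int p dvd (int p - 1)\<^sup>2 - 1" by (simp add: power2_eq_square algebra_simps)
    then show "m \<noteq> 0" "m \<noteq> 1" "m \<noteq> int p - 1" using gm by (auto simp: generic_exponent_def)
  qed
  ultimately have m: "2 \<le> m" "m \<le> int p - 2" by auto
  have tm: "t [^]\<^bsub>Aut S\<^esub> m = t [^]\<^bsub>Aut S\<^esub> n"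
    using A.int_pow_mod_ord[OF g(1), of n] g(3) by (simp add: m_def)
  interpret k: kappa4_surface S \<pi> \<Gamma>s p m t T P Q R \<Gamma>
  proof (rule kappa4_surface.intro)
    show "uniformization S \<pi> \<Gamma>s" by unfold_locales
    show "kappa4_surface_axioms S \<pi> \<Gamma>s p m t T P Q R \<Gamma>"
    proof (rule kappa4_surface_axioms.intro)
      show "\<not> int p dvd m\<^sup>2 + 1" using gm by (simp add: generic_exponent_def)
      show "covers (hyp_rotation R (2 * pi / real p)) (t [^]\<^bsub>Aut S\<^esub> m)" unfolding tm by (rule cov(3))
      show "biholomorphic (quotient_surface S (generate (Aut S) {t})) riemann_sphere" using sph g(2) by simp
    qed (fact p tri g T m cov \<Gamma>)+
  qed
  show ?thesis using k.Aut'_dihedral k.not_hyperelliptic by blast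
qed

end

theorem proposition9p4:
  fixes p :: nat and S :: "'a surface" and T :: "'a \<Rightarrow> 'a"
  assumes "prime p" and "odd p"
    and "gimel_surface p S T"
    and "case_kappa4 p S T"
  shows "Aut' S T \<cong> dihedral_group p \<and> \<not> hyperelliptic S"
proof -
  have S: "compact_riemann_surface S" and T: "T \<in> carrier (Aut S)" "group.ord (Aut S) T = p"
    and sph: "biholomorphic (quotient_surface S (generate (Aut S) {T})) riemann_sphere"
    using assms(3) by (auto simp: gimel_surface_def)
  obtain i j m where ij: "is_pair p S T i j" and m: "m \<in> {2..int p - 2}" "\<not> int p dvd m\<^sup>2 + 1"
    and mem: "((- 1) mod int p, m) \<in> eLambda p i j"
    using assms(4) unfolding case_kappa4_def by blast
  define \<rho> where "\<rho> a = hyp_rotation a (2 * pi / real p)" for a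
  obtain \<Gamma> \<Gamma>s \<T> \<alpha> \<beta> \<gamma> A B C where u: "uniformized_by p S T \<Gamma> \<Gamma>s"
    and ct: "canonical_tiling p \<Gamma> \<T> \<alpha> \<beta> \<gamma>" "ccw_triangle A B C \<alpha> \<beta> \<gamma>" "hyp_triangle A B C \<in> \<T>"
    and rG: "\<rho> A \<in> \<Gamma>" "\<rho> B \<in> \<Gamma>" "\<rho> C \<in> \<Gamma>"
    and cB: "\<Gamma>s #>\<^bsub>DA\<^esub> \<rho> B = \<Gamma>s #>\<^bsub>DA\<^esub> (\<rho> A [^]\<^bsub>DA\<^esub> i)"
    and cC: "\<Gamma>s #>\<^bsub>DA\<^esub> \<rho> C = \<Gamma>s #>\<^bsub>DA\<^esub> (\<rho> A [^]\<^bsub>DA\<^esub> j)"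
    and i: "i \<in> {1..p - 1}" and j: "j \<in> {1..p - 1}" and nd: "\<not> p dvd i + j + 1"
    using ij unfolding is_pair_def Let_def \<rho>_def by blast
  have fu: "fuchsian_group \<Gamma>" and sig: "has_signature_0 \<Gamma> 4 p" and nrm: "\<Gamma>s \<lhd> DA\<lparr>carrier := \<Gamma>\<rparr>"
    using u by (auto simp: uniformized_by_def)
  interpret \<Gamma>: subgroup \<Gamma> DA by (rule fuchsian_group_subgroup[OF fu])
  have sub: "\<Gamma>s \<subseteq> \<Gamma>" using subgroup.subset[of \<Gamma>s "DA\<lparr>carrier := \<Gamma>\<rparr>"] nrm by (simp add: normal_def)
  have tri: "angle_triangle (2 * pi / real p) A B C" and \<Gamma>v: "\<Gamma> = vertex_group (2 * pi / real p) A B C"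
    using canonical_tiling_vertex_group[OF ct] by auto
  obtain \<pi> \<theta> where U: "uniformization S \<pi> \<Gamma>s"
    and \<theta>: "\<theta> \<in> iso (DA\<lparr>carrier := \<Gamma>\<rparr> Mod \<Gamma>s) ((Aut S)\<lparr>carrier := generate (Aut S) {T}\<rparr>)"
    and \<theta>\<pi>: "\<And>g z. g \<in> \<Gamma> \<Longrightarrow> z \<in> disc \<Longrightarrow> \<theta> (\<Gamma>s #>\<^bsub>DA\<^esub> g) (\<pi> z) = \<pi> (g z)"
    by (rule uniformized_by_uniformization[OF S u]) (rule that, assumption+)
  interpret uniformization S \<pi> \<Gamma>s by (rule U)
  have pI: "prime (int p)" using assms(1) by simp
  have gen_sub: "subgroup (generate (Aut S) {T}) (Aut S)" by (rule A.generate_is_subgroup) (use T in simp)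
  have \<theta>_gen: "\<theta> (\<Gamma>s #>\<^bsub>DA\<^esub> g) \<in> generate (Aut S) {T}" if g: "g \<in> \<Gamma>" for g
  proof -
    have "\<Gamma>s #>\<^bsub>DA\<^esub> g \<in> carrier (DA\<lparr>carrier := \<Gamma>\<rparr> Mod \<Gamma>s)"
      using g by (auto simp: FactGroup_def RCOSETS_def r_coset_def)
    then show ?thesis using \<theta> by (auto simp: iso_def hom_def)
  qed
  have \<theta>_covers: "covers g (\<theta> (\<Gamma>s #>\<^bsub>DA\<^esub> g))" if g: "g \<in> \<Gamma>" for g
    unfolding covers_def
    using \<Gamma>.mem_carrier[OF g] subgroup.mem_carrier[OF gen_sub \<theta>_gen[OF g]] \<theta>\<pi>[OF g] by simp
  \<comment> \<open>The automorphism induced by x; it generates the same group as T but need not be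
    T itself.\<close>
  define t where "t = \<theta> (\<Gamma>s #>\<^bsub>DA\<^esub> \<rho> A)"
  have tg: "t \<in> generate (Aut S) {T}" unfolding t_def by (rule \<theta>_gen[OF rG(1)])
  have tc: "t \<in> carrier (Aut S)" by (rule subgroup.mem_carrier[OF gen_sub tg])
  have covA: "covers (\<rho> A) t" unfolding t_def by (rule \<theta>_covers[OF rG(1)])
  have cov_pow: "covers g (t [^]\<^bsub>Aut S\<^esub> int n)" if g: "g \<in> \<Gamma>" "\<Gamma>s #>\<^bsub>DA\<^esub> g = \<Gamma>s #>\<^bsub>DA\<^esub> (\<rho> A [^]\<^bsub>DA\<^esub> n)" for g n
  proof -
    have "\<rho> A [^]\<^bsub>DA\<^esub> n \<in> \<Gamma>" by (induction n) (use rG(1) in auto)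
    then have "\<theta> (\<Gamma>s #>\<^bsub>DA\<^esub> (\<rho> A [^]\<^bsub>DA\<^esub> n)) = t [^]\<^bsub>Aut S\<^esub> n"
      by (intro covers_unique[OF \<theta>_covers covers_nat_pow[OF covA]])
    then show ?thesis using \<theta>_covers[OF g(1)] g(2) by (simp add: int_pow_int)
  qed
  have covB: "covers (\<rho> B) (t [^]\<^bsub>Aut S\<^esub> int i)" by (rule cov_pow[OF rG(2) cB])
  have covC: "covers (\<rho> C) (t [^]\<^bsub>Aut S\<^esub> int j)" by (rule cov_pow[OF rG(3) cC])
  have tp: "t [^]\<^bsub>Aut S\<^esub> a = t [^]\<^bsub>Aut S\<^esub> b" if "int p dvd b - a" for a b :: int
  proof -
    obtain k where k: "t = T [^]\<^bsub>Aut S\<^esub> (k::int)" using tg A.generate_pow[OF T(1)] by auto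
    have "int p dvd k * b - k * a" using that by (simp add: right_diff_distrib[symmetric])
    then show ?thesis using A.int_pow_eq[OF T(1), of "k * a" "k * b"] T by (simp add: k A.int_pow_pow)
  qed
  have gp: "t [^]\<^bsub>Aut S\<^esub> (a::int) \<in> generate (Aut S) {T}" for a
    using A.subgroup_int_pow_closed[OF gen_sub tg] .
  note concl = normal_form_conclusion[OF assms(1,2) _ T _ sph]
  note tri2 = angle_triangle_cyclic[OF tri]
  note tri3 = angle_triangle_cyclic[OF tri2]
  \<comment> \<open>The vertices are cyclically relabelled so that the two cancelling exponents come
    first; the base is the power of t induced at the new first vertex.\<close>
  from eLambda_cases[OF assms(1) i j nd m mem] consider
    "int p dvd int i + 1" "generic_exponent (int p) (int j)"
    | "int p dvd int j + 1" "generic_exponent (int p) (int i)"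
    | "int p dvd int i + int j" "generic_exponent (int p) (int i)" by blast
  then show ?thesis
  proof cases
    case 1
    show ?thesis
    proof (rule concl[OF tri tg 1(2) _ _ _ \<Gamma>v sub fu sig])
      show "covers (hyp_rotation B (2 * pi / real p)) (t [^]\<^bsub>Aut S\<^esub> (-1::int))"
        using covB tp[of "int i" "-1"] 1(1) by (simp add: \<rho>_def)
    qed (use covA covC in \<open>simp_all add: \<rho>_def\<close>)
  next
    case 2
    \<comment> \<open>Relative to this base, C and A have exponents 1 and -1, and B has exponent i /
      j = -i modulo p.\<close>
    define s where "s = t [^]\<^bsub>Aut S\<^esub> int j"
    have sp: "s [^]\<^bsub>Aut S\<^esub> a = t [^]\<^bsub>Aut S\<^esub> (int j * a)" for a :: int by (simp add: s_def A.int_pow_pow tc)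
    have \<Gamma>v': "\<Gamma> = vertex_group (2 * pi / real p) C A B" using \<Gamma>v vertex_group_cyclic by metis
    have n: "generic_exponent (int p) (- int i)" using 2(2) by (simp add: generic_exponent_def)
    show ?thesis
    proof (rule concl[OF tri3 _ n _ _ _ \<Gamma>v' sub fu sig])
      show "s \<in> generate (Aut S) {T}" unfolding s_def by (rule gp)
      show "covers (hyp_rotation C (2 * pi / real p)) s" using covC by (simp add: s_def \<rho>_def)
      have "t [^]\<^bsub>Aut S\<^esub> (int j * (-1)) = t [^]\<^bsub>Aut S\<^esub> (1::int)" by (rule tp) (use 2(1) in \<open>simp add: add.commute\<close>)
      then show "covers (hyp_rotation A (2 * pi / real p)) (s [^]\<^bsub>Aut S\<^esub> (-1::int))"
        unfolding sp using covA tc by (simp add: \<rho>_def)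
      have "int i - int j * - int i = int i * (int j + 1)" by (simp add: algebra_simps)
      then have "t [^]\<^bsub>Aut S\<^esub> (int j * - int i) = t [^]\<^bsub>Aut S\<^esub> int i" by (intro tp) (simp only: dvd_mult[OF 2(1)])
      then show "covers (hyp_rotation B (2 * pi / real p)) (s [^]\<^bsub>Aut S\<^esub> (- int i))"
        unfolding sp using covB by (simp add: \<rho>_def)
    qed
  next
    case 3
    \<comment> \<open>Relative to this base, B and C have exponents 1 and -1, and A has the inverse
      of i modulo p.\<close>
    define s where "s = t [^]\<^bsub>Aut S\<^esub> int i"
    have sp: "s [^]\<^bsub>Aut S\<^esub> a = t [^]\<^bsub>Aut S\<^esub> (int i * a)" for a :: int by (simp add: s_def A.int_pow_pow tc)
    have \<Gamma>v': "\<Gamma> = vertex_group (2 * pi / real p) B C A" using \<Gamma>v vertex_group_cyclic by metis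
    have "coprime (int i) (int p)"
      using prime_imp_coprime[OF pI, of "int i"] 3(2) by (simp add: generic_exponent_def coprime_commute)
    then obtain l where "[int i * l = 1] (mod int p)" using cong_solve_coprime_int by blast
    then have l: "int p dvd int i * l - 1" by (simp add: cong_iff_dvd_diff)
    have n: "generic_exponent (int p) l"
      by (rule generic_exponent_transfer[OF pI 3(2)]) (use l in \<open>simp add: mult.commute\<close>)
    show ?thesis
    proof (rule concl[OF tri2 _ n _ _ _ \<Gamma>v' sub fu sig])
      show "s \<in> generate (Aut S) {T}" unfolding s_def by (rule gp)
      show "covers (hyp_rotation B (2 * pi / real p)) s" using covB by (simp add: s_def \<rho>_def)
      have "t [^]\<^bsub>Aut S\<^esub> (int i * (-1)) = t [^]\<^bsub>Aut S\<^esub> int j" by (rule tp) (use 3(1) in \<open>simp add: add.commute\<close>)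
      then show "covers (hyp_rotation C (2 * pi / real p)) (s [^]\<^bsub>Aut S\<^esub> (-1::int))"
        unfolding sp using covC by (simp add: \<rho>_def)
      have "int p dvd 1 - int i * l" using l dvd_minus_iff[of "int p" "1 - int i * l"] by simp
      then have "t [^]\<^bsub>Aut S\<^esub> (int i * l) = t [^]\<^bsub>Aut S\<^esub> (1::int)" by (rule tp)
      then show "covers (hyp_rotation A (2 * pi / real p)) (s [^]\<^bsub>Aut S\<^esub> l)"
        unfolding sp using covA tc by (simp add: \<rho>_def)
    qed
  qed
qed

end
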